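(* At least one of the following statements is true: (1) there is no p-optimal proof system for $\mathsf{SAT}$; (2) there is no p-optimal proof system for $\mathsf{TAUT}$; (3) there exists $T\in\mathcal{T}$ such that for every $S\in\mathcal{T}$ the $T$-proofs of $\Sigma^b_1\mathsf{RFN}_S(\bar n)$ can be constructed in polynomial time, i.e. there is a function $h$ computable in time polynomial in $n$ such that $h(n)$ is a $T$-proof of $\Sigma^b_1\mathsf{RFN}_S(\bar n)$ for every $n$.
   Context: $\mathcal{L}_{BA}=\{0,S,+,\cdot,|x|,\lfloor x/2\rfloor,x\#y\}$ ($|x|=\lceil\log_2(x+1)\rceil$, $x\#y=2^{|x||y|}$); $\mathsf{S^1_2}$ is Buss's theory with $\Sigma^b_1$ length induction. $\mathcal{T}$ is the set of all consistent first-order theories $T\supseteq\mathsf{S^1_2}$ in $\mathcal{L}_{BA}$ with polynomial-time decidable axiom set. $Pr_T(u,y)$ is the polynomial-time relation "$u$ codes a Hilbert-style $T$-proof of the formula with code $y$". Numerals: $\bar 0=0$, $\overline{2k}=SS0\cdot\bar k$, $\overline{2k+1}=S(SS0\cdot\bar k)$; $\ulcorner\phi(\dot n)\urcorner$ is the code of $\phi(\bar n)$. Fix a $\Sigma^b_1$ formula $\mu_1(e,x,z)$ such that for every $\Sigma^b_1$ formula $\phi(x)$ there are $e$ and a polynomial $p$ with $\mathsf{S^1_2}\vdash\forall x,z(|z|\ge p(|x|)\to(\mu_1(\bar e,x,z)\leftrightarrow\phi(x)))$. $\Sigma^b_1\mathsf{RFN}_S(\bar n)$ is the sentence $\forall e,u,x,z(|e|,|u|,|x|,|z|\le\bar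 n\land Pr_S(u,\ulcorner\mu_1(\dot e,\dot x,\dot z)\urcorner)\to\mu_1(e,x,z))$. A proof system for $C\subseteq\mathbb{N}$ is a polynomial-time function with range $C$; it is p-optimal if for every proof system $Q$ for $C$ there is a polynomial-time $f$ with $P(f(\pi))=Q(\pi)$ for all $\pi$. $\mathsf{TAUT}$ and $\mathsf{SAT}$ are the sets of propositional tautologies and satisfiable propositional formulas. *)

theory Defs
  imports Complex_Main "HOL-Computational_Algebra.Polynomial"
begin

section \<open>Binary notation\<close>

definition blen :: "nat \<Rightarrow> nat" where
  "blen x = nat \<lceil>log 2 (real x + 1)\<rceil>"

text \<open>Binary digits, least significant digit first; \<open>0\<close> is the empty word.\<close>

definition bits :: "nat \<Rightarrow> bool list" where
  "bits n = map (bit n) [0..<blen n]"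

section \<open>Polynomial time\<close>

text \<open>
  Deterministic Turing machines with finitely many two-way infinite tapes. Control states are the
  numbers below \<open>nstates\<close>, with \<open>0\<close> initial and \<open>1\<close> halting; tape symbols are the
  numbers below \<open>nsyms\<close>, with \<open>0\<close> the blank and \<open>1\<close>, \<open>2\<close> the binary digits zero and one.
\<close>

datatype move = Lft | Stay | Rgt

fun shift :: "move \<Rightarrow> int" where
  "shift Lft = -1" | "shift Stay = 0" | "shift Rgt = 1"

record machine =
  ntapes :: nat
  nstates :: nat
  nsyms :: nat
  delta :: "nat \<Rightarrow> nat list \<Rightarrow> nat \<times> (nat \<times> move) list"

definition turing_machine :: "machine \<Rightarrow> bool" where
  "turing_machine M \<longleftrightarrow> 1 \<le> ntapes M \<and> 2 \<le> nstates M \<and> 3 \<le> nsyms M \<and>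
     (\<forall>q < nstates M. \<forall>as. length as = ntapes M \<and> (\<forall>a \<in> set as. a < nsyms M) \<longrightarrow>
        fst (delta M q as) < nstates M \<and>
        length (snd (delta M q as)) = ntapes M \<and>
        (\<forall>(b, d) \<in> set (snd (delta M q as)). b < nsyms M))"

type_synonym tape = "(int \<Rightarrow> nat) \<times> int"  \<comment> \<open>contents and head position\<close>
type_synonym config = "nat \<times> tape list"

fun act :: "nat \<times> move \<Rightarrow> tape \<Rightarrow> tape" where
  "act (b, d) (c, i) = (c(i := b), i + shift d)"

fun step :: "machine \<Rightarrow> config \<Rightarrow> config" where
  "step M (q, ts) =
     (if q = 1 then (q, ts)
      else (let (q', as) = delta M q (map (\<lambda>(c, i). c i) ts) in (q', map2 act as ts)))"

definition word_tape :: "bool list \<Rightarrow> tape" where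
  "word_tape w = (\<lambda>i. if 0 \<le> i \<and> i < int (length w) then (if w ! nat i then 2 else 1) else 0, 0)"

definition init_config :: "machine \<Rightarrow> bool list \<Rightarrow> config" where
  "init_config M w = (0, word_tape w # replicate (ntapes M - 1) (word_tape []))"

text \<open>The output is the word on the first tape from cell \<open>0\<close> up to the next blank.\<close>

definition halts_with :: "config \<Rightarrow> bool list \<Rightarrow> bool" where
  "halts_with cf w \<longleftrightarrow> fst cf = 1 \<and>
     (\<forall>i. 0 \<le> i \<and> i \<le> int (length w) \<longrightarrow> fst (hd (snd cf)) i = fst (word_tape w) i)"

text \<open>The halting state is never left, so this says that \<open>f n\<close> is output after at most \<open>t n\<close> steps.\<close>

definition computes_within :: "machine \<Rightarrow> (nat \<Rightarrow> nat) \<Rightarrow> (nat \<Rightarrow> nat) \<Rightarrow> bool" where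
  "computes_within M f t \<longleftrightarrow>
     (\<forall>n. halts_with ((step M ^^ t n) (init_config M (bits n))) (bits (f n)))"

definition poly_time :: "(nat \<Rightarrow> nat) \<Rightarrow> bool" where
  "poly_time f \<longleftrightarrow>
     (\<exists>M p. turing_machine M \<and> computes_within M f (\<lambda>n. poly (p :: nat poly) (blen n)))"

text \<open>Time polynomial in the value of the argument rather than in its length.\<close>

definition poly_time_in_value :: "(nat \<Rightarrow> nat) \<Rightarrow> bool" where
  "poly_time_in_value f \<longleftrightarrow>
     (\<exists>M p. turing_machine M \<and> computes_within M f (\<lambda>n. poly (p :: nat poly) n))"

definition poly_time_decidable :: "nat set \<Rightarrow> bool" where
  "poly_time_decidable A \<longleftrightarrow> poly_time (\<lambda>n. if n \<in> A then 1 else 0)"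

section \<open>Coding of strings of tokens\<close>

text \<open>
  Expressions are written in Polish notation as lists of numbers. Each number is turned into a
  self-delimiting bit string, and a bit string is read as a number by means of a leading one. The
  length of a code is thus linear in the length of the expression, indices being written in binary.
\<close>

definition token_bits :: "nat \<Rightarrow> bool list" where
  "token_bits n = concat (map (\<lambda>b. [True, b]) (bits n)) @ [False]"

definition tokens_code :: "nat list \<Rightarrow> nat" where
  "tokens_code ks = horner_sum of_bool 2 (concat (map token_bits ks) @ [True])"

section \<open>Propositional formulas and proof systems\<close>

datatype pform = PVar nat | PNot pform | PAnd pform pform | POr pform pform

fun ptokens :: "pform \<Rightarrow> nat list" where
  "ptokens (PVar i) = [0, i]"
| "ptokens (PNot A) = 1 # ptokens A"
| "ptokens (PAnd A B) = 2 # ptokens A @ ptokens B"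
| "ptokens (POr A B) = 3 # ptokens A @ ptokens B"

fun psat :: "(nat \<Rightarrow> bool) \<Rightarrow> pform \<Rightarrow> bool" where
  "psat v (PVar i) = v i"
| "psat v (PNot A) = (\<not> psat v A)"
| "psat v (PAnd A B) = (psat v A \<and> psat v B)"
| "psat v (POr A B) = (psat v A \<or> psat v B)"

definition TAUT :: "nat set" where
  "TAUT = {tokens_code (ptokens A) | A. \<forall>v. psat v A}"

definition SAT :: "nat set" where
  "SAT = {tokens_code (ptokens A) | A. \<exists>v. psat v A}"

definition proof_system :: "nat set \<Rightarrow> (nat \<Rightarrow> nat) \<Rightarrow> bool" where
  "proof_system C P \<longleftrightarrow> poly_time P \<and> range P = C"

definition p_optimal :: "nat set \<Rightarrow> (nat \<Rightarrow> nat) \<Rightarrow> bool" where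
  "p_optimal C P \<longleftrightarrow> proof_system C P \<and>
     (\<forall>Q. proof_system C Q \<longrightarrow> (\<exists>f. poly_time f \<and> (\<forall>w. P (f w) = Q w)))"

section \<open>The language of bounded arithmetic\<close>

text \<open>As in Buss's presentation, \<open>\<le>\<close> is a primitive relation symbol.\<close>

datatype trm = Var nat | Zero | Sc trm | Add trm trm | Mul trm trm
  | Len trm | Half trm | Smash trm trm

datatype fm = Eq trm trm | Le trm trm | Neg fm | And fm fm | Or fm fm | Imp fm fm
  | All nat fm | Ex nat fm

abbreviation Iff :: "fm \<Rightarrow> fm \<Rightarrow> fm" where
  "Iff A B \<equiv> And (Imp A B) (Imp B A)"

abbreviation AllLe :: "nat \<Rightarrow> trm \<Rightarrow> fm \<Rightarrow> fm" where
  "AllLe x t A \<equiv> All x (Imp (Le (Var x) t) A)"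

abbreviation ExLe :: "nat \<Rightarrow> trm \<Rightarrow> fm \<Rightarrow> fm" where
  "ExLe x t A \<equiv> Ex x (And (Le (Var x) t) A)"

abbreviation One :: trm where "One \<equiv> Sc Zero"
abbreviation Two :: trm where "Two \<equiv> Sc (Sc Zero)"

fun tm_tokens :: "trm \<Rightarrow> nat list" where
  "tm_tokens (Var i) = [0, i]"
| "tm_tokens Zero = [1]"
| "tm_tokens (Sc s) = 2 # tm_tokens s"
| "tm_tokens (Add s t) = 3 # tm_tokens s @ tm_tokens t"
| "tm_tokens (Mul s t) = 4 # tm_tokens s @ tm_tokens t"
| "tm_tokens (Len s) = 5 # tm_tokens s"
| "tm_tokens (Half s) = 6 # tm_tokens s"
| "tm_tokens (Smash s t) = 7 # tm_tokens s @ tm_tokens t"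

fun fm_tokens :: "fm \<Rightarrow> nat list" where
  "fm_tokens (Eq s t) = 8 # tm_tokens s @ tm_tokens t"
| "fm_tokens (Le s t) = 9 # tm_tokens s @ tm_tokens t"
| "fm_tokens (Neg A) = 10 # fm_tokens A"
| "fm_tokens (And A B) = 11 # fm_tokens A @ fm_tokens B"
| "fm_tokens (Or A B) = 12 # fm_tokens A @ fm_tokens B"
| "fm_tokens (Imp A B) = 13 # fm_tokens A @ fm_tokens B"
| "fm_tokens (All x A) = 14 # x # fm_tokens A"
| "fm_tokens (Ex x A) = 15 # x # fm_tokens A"

definition fm_code :: "fm \<Rightarrow> nat" where
  "fm_code A = tokens_code (fm_tokens A)"

definition proof_code :: "fm list \<Rightarrow> nat" where
  "proof_code As = tokens_code (concat (map fm_tokens As))"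

fun tm_vars :: "trm \<Rightarrow> nat set" where
  "tm_vars (Var i) = {i}"
| "tm_vars Zero = {}"
| "tm_vars (Sc s) = tm_vars s"
| "tm_vars (Add s t) = tm_vars s \<union> tm_vars t"
| "tm_vars (Mul s t) = tm_vars s \<union> tm_vars t"
| "tm_vars (Len s) = tm_vars s"
| "tm_vars (Half s) = tm_vars s"
| "tm_vars (Smash s t) = tm_vars s \<union> tm_vars t"

fun free_vars :: "fm \<Rightarrow> nat set" where
  "free_vars (Eq s t) = tm_vars s \<union> tm_vars t"
| "free_vars (Le s t) = tm_vars s \<union> tm_vars t"
| "free_vars (Neg A) = free_vars A"
| "free_vars (And A B) = free_vars A \<union> free_vars B"
| "free_vars (Or A B) = free_vars A \<union> free_vars B"
| "free_vars (Imp A B) = free_vars A \<union> free_vars B"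
| "free_vars (All x A) = free_vars A - {x}"
| "free_vars (Ex x A) = free_vars A - {x}"

fun tm_subst :: "nat \<Rightarrow> trm \<Rightarrow> trm \<Rightarrow> trm" where
  "tm_subst x r (Var i) = (if i = x then r else Var i)"
| "tm_subst x r Zero = Zero"
| "tm_subst x r (Sc s) = Sc (tm_subst x r s)"
| "tm_subst x r (Add s t) = Add (tm_subst x r s) (tm_subst x r t)"
| "tm_subst x r (Mul s t) = Mul (tm_subst x r s) (tm_subst x r t)"
| "tm_subst x r (Len s) = Len (tm_subst x r s)"
| "tm_subst x r (Half s) = Half (tm_subst x r s)"
| "tm_subst x r (Smash s t) = Smash (tm_subst x r s) (tm_subst x r t)"

text \<open>
  Substitution for free occurrences, without renaming of bound variables: it is only meaningful
  under \<open>free_for\<close>, which holds whenever the substituted term has no variable other than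
  the one it replaces.
\<close>

fun subst :: "nat \<Rightarrow> trm \<Rightarrow> fm \<Rightarrow> fm" where
  "subst x r (Eq s t) = Eq (tm_subst x r s) (tm_subst x r t)"
| "subst x r (Le s t) = Le (tm_subst x r s) (tm_subst x r t)"
| "subst x r (Neg A) = Neg (subst x r A)"
| "subst x r (And A B) = And (subst x r A) (subst x r B)"
| "subst x r (Or A B) = Or (subst x r A) (subst x r B)"
| "subst x r (Imp A B) = Imp (subst x r A) (subst x r B)"
| "subst x r (All y A) = All y (if y = x then A else subst x r A)"
| "subst x r (Ex y A) = Ex y (if y = x then A else subst x r A)"

fun free_for :: "trm \<Rightarrow> nat \<Rightarrow> fm \<Rightarrow> bool" where
  "free_for r x (Eq s t) = True"
| "free_for r x (Le s t) = True"
| "free_for r x (Neg A) = free_for r x A"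
| "free_for r x (And A B) = (free_for r x A \<and> free_for r x B)"
| "free_for r x (Or A B) = (free_for r x A \<and> free_for r x B)"
| "free_for r x (Imp A B) = (free_for r x A \<and> free_for r x B)"
| "free_for r x (All y A) = (x \<notin> free_vars (All y A) \<or> y \<notin> tm_vars r \<and> free_for r x A)"
| "free_for r x (Ex y A) = (x \<notin> free_vars (Ex y A) \<or> y \<notin> tm_vars r \<and> free_for r x A)"

fun tm_val :: "(nat \<Rightarrow> nat) \<Rightarrow> trm \<Rightarrow> nat" where
  "tm_val v (Var i) = v i"
| "tm_val v Zero = 0"
| "tm_val v (Sc s) = Suc (tm_val v s)"
| "tm_val v (Add s t) = tm_val v s + tm_val v t"
| "tm_val v (Mul s t) = tm_val v s * tm_val v t"
| "tm_val v (Len s) = blen (tm_val v s)"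
| "tm_val v (Half s) = tm_val v s div 2"
| "tm_val v (Smash s t) = 2 ^ (blen (tm_val v s) * blen (tm_val v t))"

text \<open>Truth in the standard model.\<close>

fun holds :: "(nat \<Rightarrow> nat) \<Rightarrow> fm \<Rightarrow> bool" where
  "holds v (Eq s t) = (tm_val v s = tm_val v t)"
| "holds v (Le s t) = (tm_val v s \<le> tm_val v t)"
| "holds v (Neg A) = (\<not> holds v A)"
| "holds v (And A B) = (holds v A \<and> holds v B)"
| "holds v (Or A B) = (holds v A \<or> holds v B)"
| "holds v (Imp A B) = (holds v A \<longrightarrow> holds v B)"
| "holds v (All x A) = (\<forall>a. holds (v(x := a)) A)"
| "holds v (Ex x A) = (\<exists>a. holds (v(x := a)) A)"

fun numeral_tm :: "nat \<Rightarrow> trm" where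
  "numeral_tm n =
     (if n = 0 then Zero
      else if even n then Mul Two (numeral_tm (n div 2))
      else Sc (Mul Two (numeral_tm (n div 2))))"

declare numeral_tm.simps [simp del]

definition poly_tm :: "nat poly \<Rightarrow> trm \<Rightarrow> trm" where
  "poly_tm p t = foldr (\<lambda>c s. Add (numeral_tm c) (Mul t s)) (coeffs p) Zero"

section \<open>Hilbert-style proofs\<close>

inductive logical_axiom :: "fm \<Rightarrow> bool" where
  "logical_axiom (Imp A (Imp B A))"
| "logical_axiom (Imp (Imp A (Imp B C)) (Imp (Imp A B) (Imp A C)))"
| "logical_axiom (Imp (And A B) A)"
| "logical_axiom (Imp (And A B) B)"
| "logical_axiom (Imp A (Imp B (And A B)))"
| "logical_axiom (Imp A (Or A B))"
| "logical_axiom (Imp B (Or A B))"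
| "logical_axiom (Imp (Imp A C) (Imp (Imp B C) (Imp (Or A B) C)))"
| "logical_axiom (Imp (Imp A B) (Imp (Imp A (Neg B)) (Neg A)))"
| "logical_axiom (Imp (Neg (Neg A)) A)"
| "free_for t x A \<Longrightarrow> logical_axiom (Imp (All x A) (subst x t A))"
| "free_for t x A \<Longrightarrow> logical_axiom (Imp (subst x t A) (Ex x A))"
| "x \<notin> free_vars C \<Longrightarrow> logical_axiom (Imp (All x (Imp C A)) (Imp C (All x A)))"
| "x \<notin> free_vars C \<Longrightarrow> logical_axiom (Imp (All x (Imp A C)) (Imp (Ex x A) C))"
| "logical_axiom (Eq t t)"
| "logical_axiom (Imp (Eq s t) (Eq (Sc s) (Sc t)))"
| "logical_axiom (Imp (Eq s t) (Eq (Len s) (Len t)))"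
| "logical_axiom (Imp (Eq s t) (Eq (Half s) (Half t)))"
| "logical_axiom (Imp (Eq s t) (Imp (Eq s' t') (Eq (Add s s') (Add t t'))))"
| "logical_axiom (Imp (Eq s t) (Imp (Eq s' t') (Eq (Mul s s') (Mul t t'))))"
| "logical_axiom (Imp (Eq s t) (Imp (Eq s' t') (Eq (Smash s s') (Smash t t'))))"
| "logical_axiom (Imp (Eq s t) (Imp (Eq s' t') (Imp (Eq s s') (Eq t t'))))"
| "logical_axiom (Imp (Eq s t) (Imp (Eq s' t') (Imp (Le s s') (Le t t'))))"

text \<open>
  A theory is given by its set of non-logical axioms. These need not be sentences: by the
  generalization rule an open axiom amounts to its universal closure.
\<close>

definition is_proof :: "fm set \<Rightarrow> fm list \<Rightarrow> fm \<Rightarrow> bool" where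
  "is_proof T As A \<longleftrightarrow> As \<noteq> [] \<and> last As = A \<and>
     (\<forall>i < length As. logical_axiom (As ! i) \<or> As ! i \<in> T \<or>
        (\<exists>j < i. \<exists>k < i. As ! k = Imp (As ! j) (As ! i)) \<or>
        (\<exists>j < i. \<exists>x. As ! i = All x (As ! j)))"

definition provable :: "fm set \<Rightarrow> fm \<Rightarrow> bool"  (infix \<open>\<turnstile>\<close> 50) where
  "T \<turnstile> A \<longleftrightarrow> (\<exists>As. is_proof T As A)"

definition consistent :: "fm set \<Rightarrow> bool" where
  "consistent T \<longleftrightarrow> \<not> (\<exists>A. T \<turnstile> A \<and> T \<turnstile> Neg A)"

definition Pr :: "fm set \<Rightarrow> nat \<Rightarrow> nat \<Rightarrow> bool" where
  "Pr T u y \<longleftrightarrow> (\<exists>As A. u = proof_code As \<and> y = fm_code A \<and> is_proof T As A)"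

section \<open>Bounded formulas\<close>

inductive sharply_bounded :: "fm \<Rightarrow> bool" where
  "sharply_bounded (Eq s t)"
| "sharply_bounded (Le s t)"
| "sharply_bounded A \<Longrightarrow> sharply_bounded (Neg A)"
| "sharply_bounded A \<Longrightarrow> sharply_bounded B \<Longrightarrow> sharply_bounded (And A B)"
| "sharply_bounded A \<Longrightarrow> sharply_bounded B \<Longrightarrow> sharply_bounded (Or A B)"
| "sharply_bounded A \<Longrightarrow> sharply_bounded B \<Longrightarrow> sharply_bounded (Imp A B)"
| "sharply_bounded A \<Longrightarrow> x \<notin> tm_vars t \<Longrightarrow> sharply_bounded (AllLe x (Len t) A)"
| "sharply_bounded A \<Longrightarrow> x \<notin> tm_vars t \<Longrightarrow> sharply_bounded (ExLe x (Len t) A)"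

text \<open>Buss's classes \<open>\<Sigma>\<^sup>b\<^sub>1\<close> and \<open>\<Pi>\<^sup>b\<^sub>1\<close>.\<close>

inductive Sigma1b :: "fm \<Rightarrow> bool" and Pi1b :: "fm \<Rightarrow> bool" where
  "sharply_bounded A \<Longrightarrow> Sigma1b A"
| "Sigma1b A \<Longrightarrow> x \<notin> tm_vars t \<Longrightarrow> Sigma1b (ExLe x t A)"
| "Sigma1b A \<Longrightarrow> x \<notin> tm_vars t \<Longrightarrow> Sigma1b (AllLe x (Len t) A)"
| "Sigma1b A \<Longrightarrow> Sigma1b B \<Longrightarrow> Sigma1b (And A B)"
| "Sigma1b A \<Longrightarrow> Sigma1b B \<Longrightarrow> Sigma1b (Or A B)"
| "Pi1b A \<Longrightarrow> Sigma1b (Neg A)"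
| "Pi1b A \<Longrightarrow> Sigma1b B \<Longrightarrow> Sigma1b (Imp A B)"
| "sharply_bounded A \<Longrightarrow> Pi1b A"
| "Pi1b A \<Longrightarrow> x \<notin> tm_vars t \<Longrightarrow> Pi1b (AllLe x t A)"
| "Pi1b A \<Longrightarrow> x \<notin> tm_vars t \<Longrightarrow> Pi1b (ExLe x (Len t) A)"
| "Pi1b A \<Longrightarrow> Pi1b B \<Longrightarrow> Pi1b (And A B)"
| "Pi1b A \<Longrightarrow> Pi1b B \<Longrightarrow> Pi1b (Or A B)"
| "Sigma1b A \<Longrightarrow> Pi1b (Neg A)"
| "Sigma1b A \<Longrightarrow> Pi1b B \<Longrightarrow> Pi1b (Imp A B)"

section \<open>The theory \<open>S\<^sup>1\<^sub>2\<close>\<close>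

text \<open>Buss's 32 open axioms, in his order.\<close>

definition BASIC :: "fm set" where
  "BASIC = (let a = Var 0; b = Var 1; c = Var 2; d = Var 3 in
   {Imp (Le a b) (Le a (Sc b)),
    Neg (Eq a (Sc a)),
    Le Zero a,
    Iff (And (Le a b) (Neg (Eq a b))) (Le (Sc a) b),
    Imp (Neg (Eq a Zero)) (Neg (Eq (Mul Two a) Zero)),
    Or (Le a b) (Le b a),
    Imp (And (Le a b) (Le b a)) (Eq a b),
    Imp (And (Le a b) (Le b c)) (Le a c),
    Eq (Len Zero) Zero,
    Imp (Neg (Eq a Zero))
      (And (Eq (Len (Mul Two a)) (Sc (Len a))) (Eq (Len (Sc (Mul Two a))) (Sc (Len a)))),
    Eq (Len One) One,
    Imp (Le a b) (Le (Len a) (Len b)),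
    Eq (Len (Smash a b)) (Sc (Mul (Len a) (Len b))),
    Eq (Smash Zero a) One,
    Imp (Neg (Eq a Zero))
      (And (Eq (Smash One (Mul Two a)) (Mul Two (Smash One a)))
           (Eq (Smash One (Sc (Mul Two a))) (Mul Two (Smash One a)))),
    Eq (Smash a b) (Smash b a),
    Imp (Eq (Len a) (Len b)) (Eq (Smash a c) (Smash b c)),
    Imp (Eq (Len a) (Add (Len b) (Len c))) (Eq (Smash a d) (Mul (Smash b d) (Smash c d))),
    Le a (Add a b),
    Imp (And (Le a b) (Neg (Eq a b)))
      (And (Le (Sc (Mul Two a)) (Mul Two b)) (Neg (Eq (Sc (Mul Two a)) (Mul Two b)))),
    Eq (Add a b) (Add b a),
    Eq (Add a Zero) a,
    Eq (Add a (Sc b)) (Sc (Add a b)),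
    Eq (Add (Add a b) c) (Add a (Add b c)),
    Iff (Le (Add a b) (Add a c)) (Le b c),
    Eq (Mul a Zero) Zero,
    Eq (Mul a (Sc b)) (Add (Mul a b) a),
    Eq (Mul a b) (Mul b a),
    Eq (Mul a (Add b c)) (Add (Mul a b) (Mul a c)),
    Imp (Le One a) (Iff (Le (Mul a b) (Mul a c)) (Le b c)),
    Imp (Neg (Eq a Zero)) (Eq (Len a) (Sc (Len (Half a)))),
    Iff (Eq a (Half b)) (Or (Eq (Mul Two a) b) (Eq (Sc (Mul Two a)) b))})"

definition LIND :: "nat \<Rightarrow> fm \<Rightarrow> fm" where
  "LIND x A = Imp (And (subst x Zero A) (All x (Imp A (subst x (Sc (Var x)) A))))
                  (All x (subst x (Len (Var x)) A))"

definition S12 :: "fm set" where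
  "S12 = BASIC \<union> {LIND x A | x A. Sigma1b A}"

text \<open>Inclusion of theories is inclusion of their sets of theorems.\<close>

definition theories :: "fm set set" where
  "theories = {T. consistent T \<and> (\<forall>A. S12 \<turnstile> A \<longrightarrow> T \<turnstile> A) \<and> poly_time_decidable (fm_code ` T)}"

section \<open>Reflection for \<open>\<Sigma>\<^sup>b\<^sub>1\<close> formulas\<close>

text \<open>
  Formulas of several arguments are written in the following fixed, pairwise distinct variables,
  so that combining them needs no renaming.
\<close>

abbreviation (input) vE :: nat where "vE \<equiv> 0"
abbreviation (input) vX :: nat where "vX \<equiv> 1"
abbreviation (input) vZ :: nat where "vZ \<equiv> 2"
abbreviation (input) vU :: nat where "vU \<equiv> 3"
abbreviation (input) vY :: nat where "vY \<equiv> 4"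
abbreviation (input) vW :: nat where "vW \<equiv> 5"

definition universal_Sigma1b :: "fm \<Rightarrow> bool" where
  "universal_Sigma1b \<mu> \<longleftrightarrow> Sigma1b \<mu> \<and> free_vars \<mu> \<subseteq> {vE, vX, vZ} \<and>
     (\<forall>\<phi>. Sigma1b \<phi> \<and> free_vars \<phi> \<subseteq> {vX} \<longrightarrow>
        (\<exists>e p. S12 \<turnstile> All vX (All vZ
           (Imp (Le (poly_tm p (Len (Var vX))) (Len (Var vZ)))
                (Iff (subst vE (numeral_tm e) \<mu>) \<phi>)))))"

definition numeral_inst :: "fm \<Rightarrow> nat \<Rightarrow> nat \<Rightarrow> nat \<Rightarrow> fm" where
  "numeral_inst \<mu> e x z =
     subst vE (numeral_tm e) (subst vX (numeral_tm x) (subst vZ (numeral_tm z) \<mu>))"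

text \<open>
  The arithmetization follows Buss: polynomial-time functions and relations enter the language
  through \<open>\<Sigma>\<^sup>b\<^sub>1\<close>-definitions of functions and \<open>\<Delta>\<^sup>b\<^sub>1\<close>-definitions of relations in
  \<open>S\<^sup>1\<^sub>2\<close>. The formula \<open>D\<close> defines the function taking \<open>e, x, z\<close> to the code of
  \<open>\<mu>\<close> at their numerals; existence (below a term) and uniqueness of the value are provable.
\<close>

definition defines_dot_code :: "fm \<Rightarrow> fm \<Rightarrow> bool" where
  "defines_dot_code \<mu> D \<longleftrightarrow> Sigma1b D \<and> free_vars D \<subseteq> {vE, vX, vZ, vY} \<and>
     (\<exists>t. tm_vars t \<subseteq> {vE, vX, vZ} \<and>
        S12 \<turnstile> ExLe vW t (All vY (Iff D (Eq (Var vY) (Var vW))))) \<and>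
     (\<forall>v. holds v D \<longleftrightarrow> v vY = fm_code (numeral_inst \<mu> (v vE) (v vX) (v vZ)))"

definition defines_Pr :: "fm set \<Rightarrow> fm \<Rightarrow> bool" where
  "defines_Pr S B \<longleftrightarrow> Sigma1b B \<and> free_vars B \<subseteq> {vU, vY} \<and>
     (\<exists>B'. Pi1b B' \<and> free_vars B' \<subseteq> {vU, vY} \<and> S12 \<turnstile> Iff B B') \<and>
     (\<forall>v. holds v B \<longleftrightarrow> Pr S (v vU) (v vY))"

definition RFN :: "fm \<Rightarrow> fm \<Rightarrow> fm \<Rightarrow> nat \<Rightarrow> fm" where
  "RFN \<mu> D B n = (let small = (\<lambda>x. Le (Len (Var x)) (numeral_tm n)) in
     All vE (All vU (All vX (All vZ
       (Imp (And (small vE) (And (small vU) (And (small vX) (And (small vZ)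
               (Ex vY (And D B))))))
            \<mu>)))))"

end

theory Submission
  imports Defs
begin

text \<open>
  Let \<open>P\<close> and \<open>P'\<close> be p-optimal for \<open>SAT\<close> and \<open>TAUT\<close>. If all values of a polynomial-time function
  \<open>G(a, \<cdot>)\<close> are satisfiable formulas, then \<open>G(a, \<cdot>)\<close> extends to a proof system for \<open>SAT\<close>, which \<open>P\<close>
  simulates by some machine; that this machine works on all inputs of a given length is a propositional
  tautology, and \<open>P'\<close> simulates a proof system in which these tautologies have trivial proofs. Hence
  ``all values of \<open>G(a, \<cdot>)\<close> on words of length \<open>l\<close> are satisfiable'' has certificates that are sound,
  checkable in polynomial time, and constructible in polynomial time whenever the claim holds for all
  \<open>l\<close>.

  Given a theory \<open>S\<close>, universality provides a theorem of \<open>S\<^sup>1\<^sub>2\<close> stating that an instance of \<open>\<mu>\<close> is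
  equivalent to ``\<open>u\<close> is an \<open>S\<close>-proof of \<open>\<mu>(e, x, z)\<close>''. Let \<open>G\<close> map a number and a witness of that
  instance to the propositional translation of \<open>\<mu>(e, x, z)\<close>. As \<open>S\<close> is consistent and refutes false closed
  bounded formulas, all values of \<open>G\<close> are satisfiable, and certificates for this entail the reflection
  principle. The theory \<open>T\<close> consists of BASIC, of induction axioms and of the implications from the
  theorem of universality to the reflection principle for which a certificate exists. The certificates,
  as well as all other side conditions, are part of the index of an axiom, so the axioms are decidable in
  polynomial time; they are true, so \<open>T\<close> is consistent.
\<close>

section \<open>Machine model: a stack language and its compilation to Turing machines\<close>

section \<open>A structured language on stacks\<close>

text \<open>An axiom of \<open>T\<close> mentions no theory \<open>S\<close>, only an index
  \<open>e\<close>, the coefficients of a polynomial and an arbitrary formula \<open>B\<close>. Its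
  certificate concerns \<open>e\<close> and the polynomial alone: a witness of the instance of
  \<open>\<mu>\<close> with index \<open>e\<close> at a tuple leads to a true instance of
  \<open>\<mu>\<close>. This makes the implication true for every formula \<open>B\<close>, because
  under the premise a tuple satisfying \<open>B\<close> has such a witness. So the truth of
  \<open>T\<close> is checked once, without reference to the theories it will serve. For a given
  \<open>S\<close> the premise is one theorem with one proof, independent of \<open>n\<close>; only
  the certificate and the conclusion vary with \<open>n\<close>. Hence the proofs constructed in
  \<open>T\<close> are a constant list of formulas followed by four lines. Polynomial time in the
  statement refers to concrete Turing machines. Therefore a class \<open>fp\<close> on encoded data
  types is introduced, closed under bounded recursion, and shown to agree with
  \<open>poly_time\<close> on numbers. A universal simulation gives one inclusion and turns machines
  into data that certificates can contain.\<close>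

datatype com = Skip | Push nat bool | Seq com com | Case nat com com com | Loop nat com com

type_synonym store = "nat \<Rightarrow> bool list"

text \<open>Reading is destructive: \<open>Case\<close> and \<open>Loop\<close> pop the symbol on
  which they branch, as a head does that blanks the top cell before moving on. Divergence is the
  absence of a derivation.\<close>

inductive exec :: "com \<Rightarrow> store \<Rightarrow> nat \<Rightarrow> store \<Rightarrow> bool" where
  Skip: "exec Skip s (Suc 0) s"
| Push: "exec (Push r b) s (Suc 0) (s(r := b # s r))"
| Seq: "exec c1 s t1 s1 \<Longrightarrow> exec c2 s1 t2 s2 \<Longrightarrow> exec (Seq c1 c2) s (Suc (t1 + t2)) s2"
| CaseE: "s r = [] \<Longrightarrow> exec c0 s t s' \<Longrightarrow> exec (Case r c0 c1 c2) s (Suc t) s'"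
| CaseF: "s r = False # w \<Longrightarrow> exec c1 (s(r := w)) t s' \<Longrightarrow> exec (Case r c0 c1 c2) s (Suc t) s'"
| CaseT: "s r = True # w \<Longrightarrow> exec c2 (s(r := w)) t s' \<Longrightarrow> exec (Case r c0 c1 c2) s (Suc t) s'"
| LoopE: "s r = [] \<Longrightarrow> exec (Loop r c1 c2) s (Suc 0) s"
| LoopF: "s r = False # w \<Longrightarrow> exec c1 (s(r := w)) t s1 \<Longrightarrow> exec (Loop r c1 c2) s1 t' s' \<Longrightarrow>
    exec (Loop r c1 c2) s (Suc (t + t')) s'"
| LoopT: "s r = True # w \<Longrightarrow> exec c2 (s(r := w)) t s1 \<Longrightarrow> exec (Loop r c1 c2) s1 t' s' \<Longrightarrow>
    exec (Loop r c1 c2) s (Suc (t + t')) s'"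

fun regs :: "com \<Rightarrow> nat" where
  "regs Skip = 0"
| "regs (Push r b) = Suc r"
| "regs (Seq c1 c2) = max (regs c1) (regs c2)"
| "regs (Case r c0 c1 c2) = max (Suc r) (max (regs c0) (max (regs c1) (regs c2)))"
| "regs (Loop r c1 c2) = max (Suc r) (max (regs c1) (regs c2))"

text \<open>Lets a subprogram run while other data wait on the stacks from \<open>m\<close> on; the
  program combinators below are built on this.\<close>

lemma exec_frame:
  assumes "exec c s t s'" "regs c \<le> m"
  shows "exec c (\<lambda>r. if r < m then s r else u r) t (\<lambda>r. if r < m then s' r else u r)"
  using assms
proof (induction rule: exec.induct)
  case (Push r b s)
  then have *: "(\<lambda>r'. if r' < m then (s(r := b # s r)) r' else u r') =
    (\<lambda>r. if r < m then s r else u r)(r := b # (\<lambda>r. if r < m then s r else u r) r)"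
    by auto
  show ?case unfolding * by (rule exec.Push)
next
  case (CaseF s r w c1 t s' c0 c2)
  have "(\<lambda>r'. if r' < m then (s(r := w)) r' else u r') = (\<lambda>r. if r < m then s r else u r)(r := w)"
    using CaseF by auto
  then show ?case using CaseF by (intro exec.CaseF[where w=w]) auto
next
  case (CaseT s r w c2 t s' c0 c1)
  have "(\<lambda>r'. if r' < m then (s(r := w)) r' else u r') = (\<lambda>r. if r < m then s r else u r)(r := w)"
    using CaseT by auto
  then show ?case using CaseT by (intro exec.CaseT[where w=w]) auto
next
  case (LoopF s r w c1 t s1 c2 t' s')
  have "(\<lambda>r'. if r' < m then (s(r := w)) r' else u r') = (\<lambda>r. if r < m then s r else u r)(r := w)"
    using LoopF by auto
  then show ?case using LoopF by (intro exec.LoopF[where w=w]) auto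
next
  case (LoopT s r w c2 t s1 c1 t' s')
  have "(\<lambda>r'. if r' < m then (s(r := w)) r' else u r') = (\<lambda>r. if r < m then s r else u r)(r := w)"
    using LoopT by auto
  then show ?case using LoopT by (intro exec.LoopT[where w=w]) auto
qed (auto intro: exec.intros)

subsection \<open>Small steps on a continuation\<close>

fun ctl_step :: "com list \<Rightarrow> store \<Rightarrow> com list" where
  "ctl_step [] s = []"
| "ctl_step (Skip # k) s = k"
| "ctl_step (Push r b # k) s = k"
| "ctl_step (Seq c1 c2 # k) s = c1 # c2 # k"
| "ctl_step (Case r c0 c1 c2 # k) s =
     (case s r of [] \<Rightarrow> c0 # k | b # w \<Rightarrow> (if b then c2 else c1) # k)"
| "ctl_step (Loop r c1 c2 # k) s =
     (case s r of [] \<Rightarrow> k | b # w \<Rightarrow> (if b then c2 else c1) # Loop r c1 c2 # k)"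

fun store_step :: "com list \<Rightarrow> store \<Rightarrow> store" where
  "store_step (Push r b # k) s = s(r := b # s r)"
| "store_step (Case r c0 c1 c2 # k) s = s(r := tl (s r))"
| "store_step (Loop r c1 c2 # k) s = s(r := tl (s r))"
| "store_step k s = s"

definition small :: "com list \<times> store \<Rightarrow> com list \<times> store" where
  "small = (\<lambda>(k, s). (ctl_step k s, store_step k s))"

text \<open>The step counts agree exactly, because the \<open>Suc\<close> in each rule of
  \<open>exec\<close> pays for unfolding one constructor.\<close>

lemma exec_small: "exec c s t s' \<Longrightarrow> (small ^^ t) (c # k, s) = (k, s')"
proof (induction arbitrary: k rule: exec.induct)
  case (Seq c1 s t1 s1 c2 t2 s2)
  have "(small ^^ Suc (t1 + t2)) (Seq c1 c2 # k, s) = (small ^^ (t2 + t1)) (c1 # c2 # k, s)"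
    by (simp only: funpow_Suc_right o_apply add.commute) (simp add: small_def)
  then show ?case by (simp only: funpow_add o_apply Seq)
next
  case (LoopF s r w c1 t s1 c2 t' s')
  have "(small ^^ Suc (t + t')) (Loop r c1 c2 # k, s) =
      (small ^^ (t' + t)) (c1 # Loop r c1 c2 # k, s(r := w))"
    by (simp only: funpow_Suc_right o_apply add.commute) (simp add: small_def LoopF)
  then show ?case by (simp only: funpow_add o_apply LoopF)
next
  case (LoopT s r w c2 t s1 c1 t' s')
  have "(small ^^ Suc (t + t')) (Loop r c1 c2 # k, s) =
      (small ^^ (t' + t)) (c2 # Loop r c1 c2 # k, s(r := w))"
    by (simp only: funpow_Suc_right o_apply add.commute) (simp add: small_def LoopT)
  then show ?case by (simp only: funpow_add o_apply LoopT)
next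
  case (LoopE s r c1 c2)
  then show ?case by (simp add: small_def) (metis fun_upd_triv)
next
  case (CaseE s r c0 t s' c1 c2)
  have "s(r := []) = s" using CaseE by (metis fun_upd_triv)
  then show ?case using CaseE by (simp add: funpow_Suc_right small_def del: funpow.simps)
qed (auto simp: funpow_Suc_right small_def simp del: funpow.simps)

text \<open>A finite superset of the continuations that can arise before control returns to
  \<open>k\<close>. These continuations become control states of the machine, so finiteness is the
  point.\<close>

fun reach :: "com \<Rightarrow> com list \<Rightarrow> com list set" where
  "reach Skip k = {Skip # k}"
| "reach (Push r b) k = {Push r b # k}"
| "reach (Seq c1 c2) k = {Seq c1 c2 # k} \<union> reach c1 (c2 # k) \<union> reach c2 k"
| "reach (Case r c0 c1 c2) k = {Case r c0 c1 c2 # k} \<union> reach c0 k \<union> reach c1 k \<union> reach c2 k"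
| "reach (Loop r c1 c2) k =
     {Loop r c1 c2 # k} \<union> reach c1 (Loop r c1 c2 # k) \<union> reach c2 (Loop r c1 c2 # k)"

lemma finite_reach: "finite (reach c k)"
  by (induction c arbitrary: k) auto

lemma reach_self: "c # k \<in> reach c k"
  by (cases c) auto

lemma reach_step: "q \<in> reach c k \<Longrightarrow> ctl_step q s \<in> insert k (reach c k)"
proof (induction c arbitrary: k q)
  case (Seq c1 c2)
  then consider "q = Seq c1 c2 # k" | "q \<in> reach c1 (c2 # k)" | "q \<in> reach c2 k" by auto
  then show ?case
  proof cases
    case 2 then show ?thesis using Seq.IH(1)[OF 2] reach_self[of c2 k] by auto
  qed (use Seq.IH reach_self in auto)
next
  case (Case r c0 c1 c2)
  then consider "q = Case r c0 c1 c2 # k" | "q \<in> reach c0 k" | "q \<in> reach c1 k" | "q \<in> reach c2 k" by auto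
  then show ?case
  proof cases
    case 1 then show ?thesis by (auto split: list.splits simp: reach_self)
  next
    case 2 then show ?thesis using Case.IH(1)[OF 2] by auto
  next
    case 3 then show ?thesis using Case.IH(2)[OF 3] by auto
  next
    case 4 then show ?thesis using Case.IH(3)[OF 4] by auto
  qed
next
  case (Loop r c1 c2)
  let ?k = "Loop r c1 c2 # k"
  from Loop consider "q = ?k" | "q \<in> reach c1 ?k" | "q \<in> reach c2 ?k" by auto
  then show ?case
  proof cases
    case 1 then show ?thesis by (auto split: list.splits simp: reach_self)
  next
    case 2 then show ?thesis using Loop.IH(1)[OF 2] by auto
  next
    case 3 then show ?thesis using Loop.IH(2)[OF 3] by auto
  qed
qed auto

lemma reach_regs: "q \<in> reach c k \<Longrightarrow> q \<noteq> [] \<and> (\<forall>d\<in>set q. regs d \<le> regs c \<or> d \<in> set k)"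
  by (induction c arbitrary: k q) (auto, (fastforce simp: le_max_iff_disj)+)

subsection \<open>Compilation to Turing machines\<close>

text \<open>Tape \<open>0\<close> serves for input and output; stack \<open>r\<close> is kept on tape \<open>r + 1\<close>, the head standing on
  the top. An instruction takes two steps, since pushing needs a move before writing.\<close>

datatype ctl = In0 | In1 | In2 | Run "com list" bool | Out | Halt

definition sym :: "bool \<Rightarrow> nat" where "sym b = (if b then 2 else 1)"

definition keep :: "nat list \<Rightarrow> (nat \<times> move) list" where
  "keep as = map (\<lambda>a. (a, Stay)) as"

fun top_reg :: "com list \<Rightarrow> nat option" where
  "top_reg (Case r c0 c1 c2 # k) = Some r"
| "top_reg (Loop r c1 c2 # k) = Some r"
| "top_reg k = None"

text \<open>\<open>In0\<close> and \<open>In1\<close> push the input symbol by symbol, which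
  reverses it; \<open>In2\<close> walks back over tape \<open>0\<close> and erases it;
  \<open>Out\<close> pops stack \<open>0\<close> onto tape \<open>0\<close>. Since
  \<open>ctl_step\<close> looks at most at one top symbol, it can be applied to a dummy store
  holding that symbol only.\<close>

fun ctrans :: "com \<Rightarrow> ctl \<Rightarrow> nat list \<Rightarrow> ctl \<times> (nat \<times> move) list" where
  "ctrans c In0 as = (if as ! 0 = 0 then (In2, (keep as)[0 := (0, Lft)])
     else (In1, (keep as)[1 := (as ! 1, Lft)]))"
| "ctrans c In1 as = (In0, (keep as)[0 := (as ! 0, Rgt), 1 := (as ! 0, Stay)])"
| "ctrans c In2 as = (if as ! 0 = 0 then (Run [c] False, (keep as)[0 := (0, Rgt)])
     else (In2, (keep as)[0 := (0, Lft)]))"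
| "ctrans c (Run [] p) as = (Out, keep as)"
| "ctrans c (Run (Push r b # k) False) as =
     (Run (Push r b # k) True, (keep as)[Suc r := (as ! Suc r, Lft)])"
| "ctrans c (Run (Push r b # k) True) as = (Run k False, (keep as)[Suc r := (sym b, Stay)])"
| "ctrans c (Run k False) as = (Run k True, keep as)"
| "ctrans c (Run k True) as = (case top_reg k of None \<Rightarrow> (Run (ctl_step k (\<lambda>_. [])) False, keep as)
     | Some r \<Rightarrow> if as ! Suc r = 0 then (Run (ctl_step k (\<lambda>_. [])) False, keep as)
        else (Run (ctl_step k (\<lambda>_. [as ! Suc r = 2])) False, (keep as)[Suc r := (0, Rgt)]))"
| "ctrans c Out as = (if as ! 1 = 0 then (Halt, keep as)
     else (Out, (keep as)[0 := (as ! 1, Rgt), 1 := (0, Rgt)]))"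
| "ctrans c Halt as = (Halt, keep as)"

definition read :: "tape \<Rightarrow> nat" where "read = (\<lambda>(c, i). c i)"

definition cstep :: "com \<Rightarrow> ctl \<times> tape list \<Rightarrow> ctl \<times> tape list" where
  "cstep c = (\<lambda>(q, ts). (fst (ctrans c q (map read ts)), map2 act (snd (ctrans c q (map read ts))) ts))"

lemma map2_act_keep: "map2 act (keep (map read ts)) ts = ts"
  by (rule nth_equalityI) (auto simp: keep_def read_def split: prod.splits)

lemma map2_act_update:
  "length xs = length ts \<Longrightarrow> j < length ts \<Longrightarrow>
   map2 act (xs[j := x]) ts = (map2 act xs ts)[j := act x (ts ! j)]"
  by (rule nth_equalityI) (auto simp: nth_list_update)

lemma length_keep [simp]: "length (keep as) = length as"
  by (simp add: keep_def)

text \<open>Stacks grow to the left with the head on the top, so the scanned cell is blank exactly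
  if the stack is empty. The offset \<open>h\<close> drifts as symbols are pushed and
  popped.\<close>

definition rep :: "int \<Rightarrow> bool list \<Rightarrow> tape" where
  "rep h w = (\<lambda>i. if h \<le> i \<and> i < h + int (length w) then sym (w ! nat (i - h)) else 0, h)"

lemma word_tape_rep: "word_tape w = rep 0 w"
  by (auto simp: word_tape_def rep_def sym_def)

lemma sym_neq_0 [simp]: "sym b \<noteq> 0" "(sym b = 2) = b"
  by (auto simp: sym_def)

lemma read_rep [simp]: "read (rep h []) = 0" "read (rep h (b # w)) = sym b"
  by (auto simp: read_def rep_def)

lemma act_pop: "act (0, Rgt) (rep h (b # w)) = rep (h + 1) w"
  by (auto simp: rep_def fun_eq_iff nth_Cons' nat_diff_distrib) (auto simp: algebra_simps nat_diff_distrib' intro!: arg_cong[where f=sym] arg_cong[where f="(!) w"])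

lemma act_push: "act (sym b, Stay) (act (read (rep h w), Lft) (rep h w)) = rep (h - 1) (b # w)"
proof -
  have [simp]: "nat (x + 1 - h) - Suc 0 = nat (x - h)" if "h \<le> x" for x
    using that by linarith
  show ?thesis
    by (auto simp: rep_def read_def fun_eq_iff nth_Cons' sym_def) (auto simp: algebra_simps)
qed

definition repr :: "nat \<Rightarrow> tape \<Rightarrow> store \<Rightarrow> tape list \<Rightarrow> bool" where
  "repr K T s ts \<longleftrightarrow> length ts = Suc K \<and> ts ! 0 = T \<and> (\<forall>r<K. \<exists>h. ts ! Suc r = rep h (s r))"

lemma repr_read:
  "repr K T s ts \<Longrightarrow> r < K \<Longrightarrow> map read ts ! Suc r = (case s r of [] \<Rightarrow> 0 | b # w \<Rightarrow> sym b)"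
  by (force simp: repr_def split: list.splits)

lemma repr_update:
  "repr K T s ts \<Longrightarrow> r < K \<Longrightarrow> x = rep h w \<Longrightarrow> repr K T (s(r := w)) (ts[Suc r := x])"
  unfolding repr_def by (auto simp: nth_list_update)

lemma repr_push:
  assumes "repr K T s ts" "r < K"
  shows "repr K T (s(r := b # s r))
    (ts[Suc r := act (sym b, Stay) (act (map read ts ! Suc r, Lft) (ts ! Suc r))])"
proof -
  obtain h where "ts ! Suc r = rep h (s r)" "Suc r < length ts" using assms by (auto simp: repr_def)
  then show ?thesis by (intro repr_update[OF assms, where h="h - 1"]) (simp add: act_push del: act.simps)
qed

lemma repr_pop:
  assumes "repr K T s ts" "r < K" "s r = b # w"
  shows "repr K T (s(r := w)) (ts[Suc r := act (0, Rgt) (ts ! Suc r)])"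
proof -
  obtain h where "ts ! Suc r = rep h (s r)" using assms by (auto simp: repr_def)
  then show ?thesis using assms(3)
    by (intro repr_update[OF assms(1,2), where h="h + 1"]) (simp add: act_pop del: act.simps)
qed

lemma repr_T: "repr K T s ts \<Longrightarrow> repr K T' s (ts[0 := T'])"
  by (auto simp: repr_def)

lemma repr_length: "repr K T s ts \<Longrightarrow> length ts = Suc K"
  by (simp add: repr_def)

lemma cstep_keep: "ctrans c q (map read ts) = (q', keep (map read ts)) \<Longrightarrow> cstep c (q, ts) = (q', ts)"
  by (simp add: cstep_def map2_act_keep)

lemma cstep_update: "ctrans c q (map read ts) = (q', (keep (map read ts))[j := x]) \<Longrightarrow> j < length ts \<Longrightarrow>
  cstep c (q, ts) = (q', ts[j := act x (ts ! j)])"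
  by (simp add: cstep_def map2_act_keep map2_act_update)

lemma cstep_update2: "ctrans c q (map read ts) = (q', (keep (map read ts))[j := x, i := y]) \<Longrightarrow>
  j < length ts \<Longrightarrow> i < length ts \<Longrightarrow> i \<noteq> j \<Longrightarrow>
  cstep c (q, ts) = (q', ts[j := act x (ts ! j), i := act y (ts ! i)])"
  by (simp add: cstep_def map2_act_keep map2_act_update)

lemma cstep_small:
  assumes "repr K T s ts" "\<forall>d\<in>set q. regs d \<le> K" "q \<noteq> []"
  shows "\<exists>ts'. (cstep c ^^ 2) (Run q False, ts) = (Run (ctl_step q s) False, ts') \<and>
    repr K T (store_step q s) ts'"
proof -
  note len = repr_length[OF assms(1)]
  obtain d k where q: "q = d # k" using assms(3) by (cases q) auto
  have two: "(cstep c ^^ 2) x = cstep c (cstep c x)" for x by (simp add: numeral_2_eq_2)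
  \<comment> \<open>One argument for \<open>Case\<close> and \<open>Loop\<close>: the last
    assumption says that only emptiness and the top symbol of stack \<open>r\<close> matter, which
    is what the machine sees.\<close>
  have pop: ?thesis if "top_reg q = Some r" "r < K"
      "\<And>p. ctrans c (Run q False) p = (Run q True, keep p)"
      "\<And>p. ctrans c (Run q True) p = (if p ! Suc r = 0 then (Run (ctl_step q (\<lambda>_. [])) False, keep p)
        else (Run (ctl_step q (\<lambda>_. [p ! Suc r = 2])) False, (keep p)[Suc r := (0, Rgt)]))"
      "store_step q s = s(r := tl (s r))"
      "\<And>s' s''. (s' r = [] \<longleftrightarrow> s'' r = []) \<Longrightarrow> (s' r \<noteq> [] \<Longrightarrow> hd (s' r) = hd (s'' r)) \<Longrightarrow> ctl_step q s' = ctl_step q s''" for r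
  proof -
    have 1: "cstep c (Run q False, ts) = (Run q True, ts)" by (rule cstep_keep) (rule that(3))
    show ?thesis
    proof (cases "s r")
      case Nil
      then have "map read ts ! Suc r = 0" using repr_read[OF assms(1) that(2)] by simp
      then have "cstep c (Run q True, ts) = (Run (ctl_step q (\<lambda>_. [])) False, ts)"
        by (intro cstep_keep) (simp only: that(4) if_True simp_thms)
      moreover have "ctl_step q (\<lambda>_. []) = ctl_step q s" by (rule that(6)) (auto simp: Nil)
      moreover have "store_step q s = s" using Nil by (auto simp: that(5) fun_eq_iff)
      ultimately show ?thesis by (simp add: two 1 assms(1))
    next
      case (Cons b w)
      then have r: "map read ts ! Suc r = sym b" using repr_read[OF assms(1) that(2)] by simp
      then have "cstep c (Run q True, ts) =
          (Run (ctl_step q (\<lambda>_. [b])) False, ts[Suc r := act (0, Rgt) (ts ! Suc r)])"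
        by (intro cstep_update) (use len that(2) in \<open>simp_all only: that(4) sym_neq_0 if_False len Suc_less_eq\<close>)
      moreover have "ctl_step q (\<lambda>_. [b]) = ctl_step q s" by (rule that(6)) (auto simp: Cons)
      ultimately show ?thesis using repr_pop[OF assms(1) that(2) Cons]
        by (simp add: two 1 that(5) Cons del: act.simps)
    qed
  qed
  show ?thesis
  proof (cases d)
    case Skip
    have "cstep c (Run q False, ts) = (Run q True, ts)" "cstep c (Run q True, ts) = (Run k False, ts)"
      by (rule cstep_keep; simp add: q Skip)+
    then show ?thesis using assms(1) by (simp add: two q Skip)
  next
    case (Seq c1 c2)
    have "cstep c (Run q False, ts) = (Run q True, ts)"
      "cstep c (Run q True, ts) = (Run (c1 # c2 # k) False, ts)"
      by (rule cstep_keep; simp add: q Seq)+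
    then show ?thesis using assms(1) by (simp add: two q Seq)
  next
    case (Push r b)
    then have r: "r < K" using assms(2) q by auto
    let ?ts = "ts[Suc r := act (map read ts ! Suc r, Lft) (ts ! Suc r)]"
    have 1: "cstep c (Run q False, ts) = (Run q True, ?ts)"
      by (rule cstep_update) (use r len in \<open>simp_all add: q Push\<close>)
    have 2: "cstep c (Run q True, ?ts) = (Run k False, ?ts[Suc r := act (sym b, Stay) (?ts ! Suc r)])"
      by (rule cstep_update) (use r len in \<open>simp_all add: q Push\<close>)
    show ?thesis unfolding two 1 2 using repr_push[OF assms(1) r, of b] r len
      by (auto simp add: q Push simp del: act.simps)
  next
    case (Case r c0 c1 c2)
    show ?thesis
      by (rule pop[of r]) (use assms(2) in \<open>auto simp: q Case split: list.splits\<close>)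
  next
    case (Loop r c1 c2)
    show ?thesis
      by (rule pop[of r]) (use assms(2) in \<open>auto simp: q Loop split: list.splits\<close>)
  qed
qed

lemma cstep_run:
  assumes "(small ^^ t) (q, s) = ([], s')" "repr K T s ts"
    "q \<in> insert [] (reach c [])" "regs c \<le> K"
  shows "\<exists>t' ts'. t' \<le> 2 * t \<and> (cstep c ^^ t') (Run q False, ts) = (Run [] False, ts') \<and> repr K T s' ts'"
  using assms(1-3)
proof (induction t arbitrary: q s ts)
  case 0
  then show ?case by (auto intro!: exI[of _ ts])
next
  case (Suc t)
  show ?case
  proof (cases "q = []")
    case True
    have "(small ^^ n) ([], s) = ([], s)" for n by (induction n) (auto simp: small_def)
    then show ?thesis using Suc.prems True by (intro exI[of _ 0] exI[of _ ts]) (auto simp del: funpow.simps)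
  next
    case False
    then have "q \<in> reach c []" using Suc.prems by auto
    then have k: "\<forall>d\<in>set q. regs d \<le> K" and r: "ctl_step q s \<in> insert [] (reach c [])"
      using reach_regs[of q c "[]"] reach_step[of q c "[]" s] assms(4) by fastforce+
    obtain ts1 where 1: "(cstep c ^^ 2) (Run q False, ts) = (Run (ctl_step q s) False, ts1)"
      "repr K T (store_step q s) ts1"
      using cstep_small[OF Suc.prems(2) k False] by blast
    have "(small ^^ t) (ctl_step q s, store_step q s) = ([], s')"
      using Suc.prems(1) by (simp add: funpow_Suc_right small_def del: funpow.simps)
    from Suc.IH[OF this 1(2) r] obtain t' ts' where
      "t' \<le> 2 * t" "(cstep c ^^ t') (Run (ctl_step q s) False, ts1) = (Run [] False, ts')" "repr K T s' ts'"
      by blast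
    moreover have "(cstep c ^^ (t' + 2)) (Run q False, ts) = (Run [] False, ts')"
      by (simp only: funpow_add o_apply 1(1)) fact
    ultimately show ?thesis by (intro exI[of _ "t' + 2"] exI[of _ ts']) simp
  qed
qed

lemma word_tape_at: "int i = j \<Longrightarrow> fst (word_tape w) j = (if i < length w then sym (w ! i) else 0)"
  by (auto simp: word_tape_def sym_def)

lemma word_tape_neg: "j < 0 \<Longrightarrow> fst (word_tape w) j = 0"
  by (auto simp: word_tape_def)

lemma input_copy:
  assumes "repr K (word_tape w) (\<lambda>_. []) ts" "0 < K" "i \<le> length w"
  shows "\<exists>ts'. (cstep c ^^ (2 * i)) (In0, ts) = (In0, ts') \<and>
    repr K (fst (word_tape w), int i) (\<lambda>r. if r = 0 then rev (take i w) else []) ts'"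
  using assms(3)
proof (induction i)
  case 0
  have "word_tape w = (fst (word_tape w), 0)" by (simp add: word_tape_def)
  then show ?case using assms by (auto simp: if_distrib cong: if_cong)
next
  case (Suc i)
  let ?T = "(fst (word_tape w), int i)" and ?s = "\<lambda>r. if r = 0 then rev (take i w) else []"
  from Suc obtain ts' where 1: "(cstep c ^^ (2 * i)) (In0, ts) = (In0, ts')" "repr K ?T ?s ts'" by auto
  note len = repr_length[OF 1(2)]
  have t0: "ts' ! 0 = ?T" using 1 by (simp add: repr_def)
  have i: "fst (word_tape w) (int i) = sym (w ! i)" using Suc.prems by (simp add: word_tape_at)
  have r0: "map read ts' ! 0 = sym (w ! i)" using len t0 i by (simp add: read_def)
  let ?ts = "ts'[1 := act (map read ts' ! 1, Lft) (ts' ! 1)]"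
  have s1: "cstep c (In0, ts') = (In1, ?ts)"
    by (rule cstep_update) (use r0 len assms(2) in simp_all)
  have r1: "map read ?ts ! 0 = sym (w ! i)" using r0 len by simp
  have s2: "cstep c (In1, ?ts) = (In0, ?ts[0 := act (sym (w ! i), Rgt) (?ts ! 0), 1 := act (sym (w ! i), Stay) (?ts ! 1)])"
    using r1 by (intro cstep_update2) (use len assms(2) in \<open>simp_all del: length_map nth_map list_update.simps\<close>)
  have "?ts ! 0 = ?T" using t0 len by simp
  then have "act (sym (w ! i), Rgt) (?ts ! 0) = (fst (word_tape w), int (Suc i))"
    using i by (simp add: fun_eq_iff)
  moreover have "?ts ! 1 = act (map read ts' ! 1, Lft) (ts' ! 1)" using len assms(2) by simp
  ultimately have A: "repr K (fst (word_tape w), int (Suc i)) (?s(0 := w ! i # ?s 0))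
     (?ts[0 := act (sym (w ! i), Rgt) (?ts ! 0), 1 := act (sym (w ! i), Stay) (?ts ! 1)])"
    using repr_T[OF repr_push[OF 1(2) assms(2), of "w ! i"], of "(fst (word_tape w), int (Suc i))"]
    using len assms(2) by (simp add: list_update_swap)
  have B: "?s(0 := w ! i # ?s 0) = (\<lambda>r. if r = 0 then rev (take (Suc i) w) else [])"
    using Suc.prems by (auto simp: fun_eq_iff take_Suc_conv_app_nth)
  have "(cstep c ^^ (2 * Suc i)) (In0, ts) = cstep c (cstep c (In0, ts'))"
    using 1(1) by simp
  then show ?case unfolding s1 s2 using A[unfolded B] by blast
qed

lemma input_erase:
  assumes "repr K (fst (word_tape (take j w)), int j - 1) s ts" "j \<le> length w"
  shows "\<exists>ts'. (cstep c ^^ j) (In2, ts) = (In2, ts') \<and> repr K (fst (word_tape []), -1) s ts'"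
  using assms
proof (induction j arbitrary: ts)
  case 0
  then show ?case by auto
next
  case (Suc j)
  let ?T = "(fst (word_tape (take (Suc j) w)), int j)"
  note len = repr_length[OF Suc.prems(1)]
  have t0: "ts ! 0 = ?T" using Suc.prems by (simp add: repr_def)
  have r0: "map read ts ! 0 = sym (w ! j)"
    using len t0 Suc.prems by (simp add: read_def word_tape_at[of j])
  let ?ts = "ts[0 := act (0, Lft) (ts ! 0)]"
  have s1: "cstep c (In2, ts) = (In2, ?ts)"
    by (rule cstep_update) (use r0 len in simp_all)
  have "act (0, Lft) (ts ! 0) = (fst (word_tape (take j w)), int j - 1)"
  proof -
    have "nat x < j" if "0 \<le> x" "x < 1 + int j" "x \<noteq> int j" for x using that by linarith
    then show ?thesis
      unfolding t0 using Suc.prems by (auto simp: word_tape_def fun_eq_iff)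
  qed
  then have "repr K (fst (word_tape (take j w)), int j - 1) s ?ts" using repr_T[OF Suc.prems(1)] by simp
  from Suc.IH[OF this] Suc.prems show ?case by (simp add: funpow_Suc_right s1 del: funpow.simps)
qed

lemma output_copy:
  assumes "repr K (word_tape []) s ts" "0 < K" "s 0 = w" "i \<le> length w"
  shows "\<exists>ts'. (cstep c ^^ i) (Out, ts) = (Out, ts') \<and>
    repr K (fst (word_tape (take i w)), int i) (s(0 := drop i w)) ts'"
  using assms(4)
proof (induction i)
  case 0
  have "word_tape [] = (fst (word_tape []), 0)" by (simp add: word_tape_def)
  moreover have "s(0 := w) = s" using assms(3) by auto
  ultimately show ?case using assms by auto
next
  case (Suc i)
  let ?T = "(fst (word_tape (take i w)), int i)" and ?s = "s(0 := drop i w)"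
  from Suc.IH[OF Suc_leD[OF Suc.prems]]
  obtain ts' where 1: "(cstep c ^^ i) (Out, ts) = (Out, ts')" "repr K ?T ?s ts'" by blast
  note len = repr_length[OF 1(2)]
  have t0: "ts' ! 0 = ?T" using 1 by (simp add: repr_def)
  have sw: "?s 0 = w ! i # drop (Suc i) w" using Suc.prems by (simp add: Cons_nth_drop_Suc)
  have r1: "map read ts' ! 1 = sym (w ! i)"
    using repr_read[OF 1(2) assms(2)] sw by simp
  have s1: "cstep c (Out, ts') = (Out, ts'[0 := act (sym (w ! i), Rgt) (ts' ! 0), 1 := act (0, Rgt) (ts' ! 1)])"
    by (rule cstep_update2) (use r1 len assms(2) in simp_all)
  have "act (sym (w ! i), Rgt) (ts' ! 0) = (fst (word_tape (take (Suc i) w)), int (Suc i))"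
    unfolding t0 using Suc.prems by (auto simp: word_tape_def fun_eq_iff sym_def)
  then show ?case
    using repr_T[OF repr_pop[OF 1(2) assms(2) sw], of "(fst (word_tape (take (Suc i) w)), int (Suc i))"] 1(1) s1
    by (auto simp: list_update_swap fun_upd_def cong: if_cong)
qed

text \<open>The count: three steps per input symbol (two for copying, one for erasing), two per
  instruction, one per output symbol, and four changes of phase.\<close>

lemma cstep_full:
  assumes "exec c (\<lambda>r. if r = 0 then rev w else []) t s'" "regs c \<le> K" "0 < K"
  shows "\<exists>t' ts'. t' \<le> 3 * length w + 2 * t + length (s' 0) + 4 \<and>
     (cstep c ^^ t') (In0, word_tape w # replicate K (word_tape [])) = (Halt, ts') \<and>
     fst (hd ts') = fst (word_tape (s' 0))"
proof -
  let ?ts = "word_tape w # replicate K (word_tape [])"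
  have "repr K (word_tape w) (\<lambda>_. []) ?ts" by (auto simp: repr_def word_tape_rep)
  from input_copy[OF this assms(3) order_refl, of c] obtain ts1 where
    1: "(cstep c ^^ (2 * length w)) (In0, ?ts) = (In0, ts1)"
      "repr K (fst (word_tape w), int (length w)) (\<lambda>r. if r = 0 then rev w else []) ts1" by (auto cong: if_cong)
  let ?s = "\<lambda>r::nat. if r = 0 then rev w else []"
  have 2: "cstep c (In0, ts1) = (In2, ts1[0 := act (0, Lft) (ts1 ! 0)])"
    by (rule cstep_update) (use 1(2) in \<open>simp_all add: repr_def read_def word_tape_at\<close>)
  have "act (0, Lft) (ts1 ! 0) = (fst (word_tape (take (length w) w)), int (length w) - 1)"
    using 1(2) by (auto simp: repr_def word_tape_at word_tape_def)
  then have "repr K (fst (word_tape (take (length w) w)), int (length w) - 1) ?s (ts1[0 := act (0, Lft) (ts1 ! 0)])"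
    using repr_T[OF 1(2)] by simp
  from input_erase[OF this order_refl, of c] obtain ts3 where
    3: "(cstep c ^^ length w) (In2, ts1[0 := act (0, Lft) (ts1 ! 0)]) = (In2, ts3)"
       "repr K (fst (word_tape []), -1) ?s ts3" by auto
  have 4: "cstep c (In2, ts3) = (Run [c] False, ts3[0 := act (0, Rgt) (ts3 ! 0)])"
    by (rule cstep_update) (use 3(2) in \<open>simp_all add: repr_def read_def word_tape_neg\<close>)
  have "act (0, Rgt) (ts3 ! 0) = word_tape []"
    using 3(2) by (auto simp: repr_def word_tape_def)
  then have 5: "repr K (word_tape []) ?s (ts3[0 := act (0, Rgt) (ts3 ! 0)])"
    using repr_T[OF 3(2)] by simp
  obtain t6 ts6 where 6: "t6 \<le> 2 * t" 
    "(cstep c ^^ t6) (Run [c] False, ts3[0 := act (0, Rgt) (ts3 ! 0)]) = (Run [] False, ts6)"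
    "repr K (word_tape []) s' ts6"
    using cstep_run[OF exec_small[OF assms(1)] 5, of c] reach_self[of c "[]"] assms(2) by auto
  have 7: "cstep c (Run [] False, ts6) = (Out, ts6)" by (rule cstep_keep) simp
  obtain ts8 where 8: "(cstep c ^^ length (s' 0)) (Out, ts6) = (Out, ts8)"
     "repr K (fst (word_tape (s' 0)), int (length (s' 0))) (s'(0 := [])) ts8"
    using output_copy[OF 6(3) assms(3) refl order_refl, of c] by auto
  have 9: "cstep c (Out, ts8) = (Halt, ts8)"
    by (rule cstep_keep) (use repr_read[OF 8(2) assms(3)] in simp)
  have one: "(cstep c ^^ 1) x = cstep c x" for x by simp
  let ?t = "1 + (length (s' 0) + (1 + (t6 + (1 + (length w + (1 + 2 * length w))))))"
  have "(cstep c ^^ ?t) (In0, ?ts) = (Halt, ts8)"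
    by (simp only: funpow_add o_apply one 1 2 3 4 6 7 8 9)
  moreover have "hd ts8 = ts8 ! 0" using 8(2) by (cases ts8) (auto simp: repr_def)
  then have "fst (hd ts8) = fst (word_tape (s' 0))" using 8(2) by (simp add: repr_def)
  ultimately show ?thesis using 6(1) by (intro exI[of _ ?t] exI[of _ ts8]) simp
qed

definition ctls :: "com \<Rightarrow> ctl set" where
  "ctls c = {In0, In1, In2, Out, Halt} \<union> (\<lambda>(q, p). Run q p) ` (insert [] (reach c []) \<times> UNIV)"

lemma finite_ctls: "finite (ctls c)"
  by (simp add: ctls_def finite_reach)

lemma Run_ctls: "Run q p \<in> ctls c \<longleftrightarrow> q \<in> insert [] (reach c [])"
  by (auto simp: ctls_def)

lemma ctrans_ctls:
  assumes "q \<in> ctls c"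
  shows "fst (ctrans c q as) \<in> ctls c"
proof -
  have s: "ctl_step k s \<in> insert [] (reach c [])" if "k \<in> insert [] (reach c [])" for k s
    using reach_step[of k c "[]" s] that by auto
  have In: "{In0, In1, In2, Out, Halt} \<subseteq> ctls c" by (auto simp: ctls_def)
  show ?thesis
  proof (cases "(c, q, as)" rule: ctrans.cases)
    case (6 c' r b k as')
    then show ?thesis using s[of "Push r b # k" "\<lambda>_. []"] assms by (auto simp: Run_ctls)
  qed (use assms In s reach_self in \<open>auto simp: Run_ctls simp del: ctl_step.simps split: option.splits\<close>)
qed

lemma length_ctrans: "length (snd (ctrans c q as)) = length as"
  by (induction c q as rule: ctrans.induct) (auto split: option.splits)

lemma keep_syms: "x \<in> set (keep as) \<Longrightarrow> fst x \<in> set as"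
  by (auto simp: keep_def)

lemma update_syms: "x \<in> set (xs[j := y]) \<Longrightarrow> x = y \<or> x \<in> set xs"
  using set_update_subset_insert by fastforce

lemma ctrans_syms:
  assumes "\<forall>a\<in>set as. a < 3" "x \<in> set (snd (ctrans c q as))" "regs c \<le> K" "length as = Suc K" "0 < K"
    "q \<in> ctls c"
  shows "fst x < 3"
proof -
  have nth: "as ! i < 3" if "i < Suc K" for i using assms(1,4) that by auto
  have r: "r < K" if "q = Run (Push r b # k) p" for r b k p
    using assms(6,3) that reach_regs[of "Push r b # k" c "[]"] by (auto simp: Run_ctls)
  show ?thesis
    using assms(2)
    by (cases "(c, q, as)" rule: ctrans.cases)
      (use assms(1,5) nth r in \<open>auto split: option.splits if_splits dest!: update_syms keep_syms simp: sym_def\<close>)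
qed

lemma machine_exists:
  "\<exists>M. turing_machine M \<and> (\<forall>w t s'. exec c (\<lambda>r. if r = 0 then rev w else []) t s' \<longrightarrow>
     (\<forall>t' \<ge> 3 * length w + 2 * t + length (s' 0) + 4.
        halts_with ((step M ^^ t') (init_config M w)) (s' 0)))"
proof -
  define K where "K = max 1 (regs c)"
  have K: "0 < K" "regs c \<le> K" by (auto simp: K_def)
  obtain xs where xs: "set xs = ctls c" using finite_ctls finite_list by blast
  \<comment> \<open>States \<open>0\<close> and \<open>1\<close> have to be the initial and the
    halting one, so these two are put in front. They occur again in \<open>xs\<close>, hence the
    least index in \<open>num\<close>.\<close>
  define cs where "cs = In0 # Halt # xs"
  have cs: "set cs = ctls c" using xs by (auto simp: cs_def ctls_def)
  define num where "num q = (LEAST i. i < length cs \<and> cs ! i = q)" for q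
  have num: "num q < length cs \<and> cs ! num q = q" if "q \<in> ctls c" for q
    unfolding num_def by (rule LeastI_ex) (use that cs in \<open>auto simp: in_set_conv_nth\<close>)
  have num0: "num In0 = 0" unfolding num_def by (rule Least_equality) (auto simp: cs_def)
  have num1: "num Halt = 1" unfolding num_def
  proof (rule Least_equality)
    show "1 \<le> y" if "y < length cs \<and> cs ! y = Halt" for y using that by (cases y) (auto simp: cs_def)
  qed (auto simp: cs_def)
  have num1': "q = Halt" if "q \<in> ctls c" "num q = 1" for q
    using num[OF that(1)] that(2) by (simp add: cs_def)
  define M where "M = \<lparr>ntapes = Suc K, nstates = length cs, nsyms = 3,
    delta = (\<lambda>q as. (num (fst (ctrans c (cs ! q) as)), snd (ctrans c (cs ! q) as)))\<rparr>"
  have csq: "cs ! q \<in> ctls c" if "q < length cs" for q using that cs nth_mem by blast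
  have tm: "turing_machine M"
    unfolding turing_machine_def
    using csq num[OF ctrans_ctls[OF csq]] ctrans_syms[OF _ _ K(2) _ K(1) csq]
    by (fastforce simp: M_def length_ctrans cs_def)
  have step: "step M (num q, ts) = (num (fst (cstep c (q, ts))), snd (cstep c (q, ts)))"
    if "q \<in> ctls c" for q ts
  proof (cases "q = Halt")
    case True
    then show ?thesis by (simp add: num1 cstep_def map2_act_keep)
  next
    case False
    then have "num q \<noteq> 1" using num1' that by auto
    then show ?thesis using num[OF that] by (simp add: M_def cstep_def read_def Let_def)
  qed
  have cl: "fst (cstep c (q, ts)) \<in> ctls c" if "q \<in> ctls c" for q ts
    using ctrans_ctls[OF that] by (simp add: cstep_def)
  have steps: "fst ((cstep c ^^ t) (q, ts)) \<in> ctls c \<and> (step M ^^ t) (num q, ts) =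
     (num (fst ((cstep c ^^ t) (q, ts))), snd ((cstep c ^^ t) (q, ts)))" if "q \<in> ctls c" for q ts t
    using that
  proof (induction t)
    case (Suc t)
    then show ?case using step[of "fst ((cstep c ^^ t) (q, ts))" "snd ((cstep c ^^ t) (q, ts))"]
        cl[of "fst ((cstep c ^^ t) (q, ts))" "snd ((cstep c ^^ t) (q, ts))"] by simp
  qed simp
  show ?thesis
  proof (intro exI[of _ M] conjI tm allI impI)
    fix w t s' t'
    assume ex: "exec c (\<lambda>r. if r = 0 then rev w else []) t s'"
      and t': "3 * length w + 2 * t + length (s' 0) + 4 \<le> t'"
    obtain t1 ts' where 1: "t1 \<le> 3 * length w + 2 * t + length (s' 0) + 4"
      "(cstep c ^^ t1) (In0, word_tape w # replicate K (word_tape [])) = (Halt, ts')"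
      "fst (hd ts') = fst (word_tape (s' 0))"
      using cstep_full[OF ex K(2,1)] by blast
    have "In0 \<in> ctls c" by (simp add: ctls_def)
    then have 2: "(step M ^^ t1) (init_config M w) = (1, ts')"
      using steps[of In0 t1 "word_tape w # replicate K (word_tape [])"] 1(2)
      by (simp add: init_config_def M_def num0 num1)
    have "(step M ^^ n) (1, ts') = (1, ts')" for n by (induction n) auto
    moreover have "(step M ^^ t') (init_config M w) = (step M ^^ (t' - t1)) ((step M ^^ t1) (init_config M w))"
      using 1(1) t' by (simp flip: funpow_add[THEN fun_cong, simplified])
    ultimately show "halts_with ((step M ^^ t') (init_config M w)) (s' 0)"
      using 2 1(3) by (simp add: halts_with_def)
  qed
qed

section \<open>A class of polynomial-time functions closed under bounded recursion\<close>

section \<open>Polynomial-time functions on trees\<close>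

subsection \<open>Polynomial bounds\<close>

text \<open>A power of \<open>n + 2\<close> replaces a polynomial: as the base is at least two,
  constants, sums and products are absorbed by the exponent alone.\<close>

definition pbn :: "(nat \<Rightarrow> nat) \<Rightarrow> bool" where
  "pbn f \<longleftrightarrow> (\<exists>k. \<forall>n. f n \<le> (n + 2) ^ k)"

lemma pbnI: "(\<And>n. f n \<le> (n + 2) ^ k) \<Longrightarrow> pbn f"
  unfolding pbn_def by blast

lemma le_two_pow: "(c::nat) \<le> (n + 2) ^ c"
  by (meson less_exp less_imp_le_nat order_trans power_mono le_add2 zero_le)

lemma pow_mono: "(n::nat) + 2 \<le> m \<Longrightarrow> j \<le> k \<Longrightarrow> (n + 2) ^ j \<le> m ^ k"
  by (rule order_trans[OF power_mono power_increasing]) auto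

lemma pbn_const [intro, simp]: "pbn (\<lambda>_. c)"
  by (rule pbnI[of _ c]) (rule le_two_pow)

lemma pbn_id [intro, simp]: "pbn (\<lambda>n. n)"
  by (rule pbnI[of _ 1]) simp

lemma pbn_mult [intro]: "pbn f \<Longrightarrow> pbn g \<Longrightarrow> pbn (\<lambda>n. f n * g n)"
  unfolding pbn_def by (metis mult_le_mono power_add)

lemma pbn_add [intro]: "pbn f \<Longrightarrow> pbn g \<Longrightarrow> pbn (\<lambda>n. f n + g n)"
proof -
  assume "pbn f" "pbn g"
  then obtain j k where *: "\<And>n. f n \<le> (n + 2) ^ j" "\<And>n. g n \<le> (n + 2) ^ k" unfolding pbn_def by blast
  have "f n + g n \<le> (n + 2) ^ Suc (max j k)" for n
  proof -
    have "f n + g n \<le> 2 * (n + 2) ^ max j k"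
      using *[of n] pow_mono[of n "n + 2" j "max j k"] pow_mono[of n "n + 2" k "max j k"] by linarith
    also have "\<dots> \<le> (n + 2) * (n + 2) ^ max j k" by (intro mult_le_mono1) simp
    finally show ?thesis by simp
  qed
  then show ?thesis by (rule pbnI)
qed

lemma pbn_Suc [intro]: "pbn f \<Longrightarrow> pbn (\<lambda>n. Suc (f n))"
  using pbn_add[of f "\<lambda>_. 1"] by simp

lemma pbn_power [intro]: "pbn f \<Longrightarrow> pbn (\<lambda>n. f n ^ k)"
  by (induction k) (auto intro: pbn_mult)

lemmas pbn_intros = pbn_add pbn_mult pbn_power pbn_const pbn_id pbn_Suc

subsection \<open>Programs on the word in stack \<open>0\<close>\<close>

definition ld :: "bool list \<Rightarrow> store" where
  "ld w = (\<lambda>r. if r = 0 then w else [])"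

text \<open>All stacks except \<open>0\<close> are empty before and after the run. This convention
  is what allows programs to be composed freely.\<close>

definition runs :: "com \<Rightarrow> bool list \<Rightarrow> nat \<Rightarrow> bool list \<Rightarrow> bool" where
  "runs c w t w' \<longleftrightarrow> (\<exists>t'\<le>t. exec c (ld w) t' (ld w'))"

lemma runs_mono: "runs c w t w' \<Longrightarrow> t \<le> t2 \<Longrightarrow> runs c w t2 w'"
  unfolding runs_def by (meson order_trans)

lemma runs_Seq: "runs c1 w t1 w1 \<Longrightarrow> runs c2 w1 t2 w2 \<Longrightarrow> runs (Seq c1 c2) w (Suc (t1 + t2)) w2"
  unfolding runs_def
  by (elim exE conjE, intro exI conjI[rotated], erule (1) exec.Seq) simp

lemma exec_length: "exec c s t s' \<Longrightarrow> length (s' r) \<le> length (s r) + t"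
  by (induction rule: exec.induct) (auto split: if_splits)

lemma runs_length: "runs c w t w' \<Longrightarrow> length w' \<le> length w + t"
  unfolding runs_def ld_def using exec_length[where r=0] by fastforce

lemma exec_eq: "exec c s t s1 \<Longrightarrow> s1 = s2 \<Longrightarrow> t = t2 \<Longrightarrow> exec c s t2 s2"
  by simp

lemma runs_frame:
  assumes "runs c w t w'" "regs c \<le> m" "0 < m" "\<And>r. r < m \<Longrightarrow> u r = []"
  shows "\<exists>t'\<le>t. exec c (u(0 := w)) t' (u(0 := w'))"
proof -
  obtain t' where t': "t' \<le> t" "exec c (ld w) t' (ld w')" using assms(1) unfolding runs_def by blast
  have "(\<lambda>r. if r < m then ld x r else u r) = u(0 := x)" for x
    using assms(3,4) by (auto simp: ld_def fun_eq_iff)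
  then show ?thesis using exec_frame[OF t'(2) assms(2), of u] t'(1) by auto
qed

lemma ld_upd: "0 < m \<Longrightarrow> ((\<lambda>_. [])(m := x))(0 := w) = (ld w)(m := x)"
  by (auto simp: ld_def fun_eq_iff)

lemma ld_simps:
  "ld x 0 = x" "((ld x)(Suc n := v)) 0 = x" "((ld x)(Suc n := v))(0 := y) = (ld y)(Suc n := v)"
  by (auto simp: ld_def fun_eq_iff)

definition mv :: "nat \<Rightarrow> nat \<Rightarrow> com" where
  "mv a b = Loop a (Push b False) (Push b True)"

definition mv2 :: "nat \<Rightarrow> nat \<Rightarrow> nat \<Rightarrow> com" where
  "mv2 a b d = Loop a (Seq (Push b False) (Push d False)) (Seq (Push b True) (Push d True))"

definition clear :: "nat \<Rightarrow> com" where
  "clear a = Loop a Skip Skip"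

lemma exec_mv:
  "a \<noteq> b \<Longrightarrow> exec (mv a b) s (2 * length (s a) + 1) (s(a := [], b := rev (s a) @ s b))"
proof (induction "s a" arbitrary: s)
  case Nil
  have "s a = []" using Nil(1) by (rule sym)
  then show ?case unfolding mv_def by (intro exec_eq[OF exec.LoopE]) (auto simp: fun_eq_iff)
next
  case (Cons x w)
  let ?s = "s(a := w, b := x # s b)"
  have e: "exec (mv a b) ?s (2 * length w + 1) (?s(a := [], b := rev w @ ?s b))"
    using Cons(1)[of ?s] Cons(3) by simp
  have p: "exec (Push b x) (s(a := w)) (Suc 0) ?s"
    using exec.Push[of b x "s(a := w)"] Cons(3) by simp
  show ?case
  proof (cases x)
    case True
    then have x: "x = True" by simp
    show ?thesis unfolding mv_def
      by (rule exec_eq[OF exec.LoopT[OF Cons(2)[symmetric, unfolded x] p[unfolded x] e[unfolded mv_def x]]])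
        (use Cons(2)[symmetric] Cons(3) in \<open>auto simp: fun_eq_iff x\<close>)
  next
    case False
    then have x: "x = False" by simp
    show ?thesis unfolding mv_def
      by (rule exec_eq[OF exec.LoopF[OF Cons(2)[symmetric, unfolded x] p[unfolded x] e[unfolded mv_def x]]])
        (use Cons(2)[symmetric] Cons(3) in \<open>auto simp: fun_eq_iff x\<close>)
  qed
qed

lemma exec_mv2:
  "a \<noteq> b \<Longrightarrow> a \<noteq> d \<Longrightarrow> b \<noteq> d \<Longrightarrow>
   exec (mv2 a b d) s (4 * length (s a) + 1) (s(a := [], b := rev (s a) @ s b, d := rev (s a) @ s d))"
proof (induction "s a" arbitrary: s)
  case Nil
  have "s a = []" using Nil(1) by (rule sym)
  then show ?case unfolding mv2_def by (intro exec_eq[OF exec.LoopE]) (auto simp: fun_eq_iff)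
next
  case (Cons x w)
  let ?s = "s(a := w, b := x # s b, d := x # s d)"
  have e: "exec (mv2 a b d) ?s (4 * length w + 1) (?s(a := [], b := rev w @ ?s b, d := rev w @ ?s d))"
    using Cons(1)[of ?s] Cons(3-) by simp
  have p: "exec (Seq (Push b x) (Push d x)) (s(a := w)) 3 ?s"
    using exec.Seq[OF exec.Push[of b x "s(a := w)"] exec.Push[of d x]] Cons(3-) by (simp add: numeral_3_eq_3)
  show ?case
  proof (cases x)
    case True
    then have x: "x = True" by simp
    show ?thesis unfolding mv2_def
      by (rule exec_eq[OF exec.LoopT[OF Cons(2)[symmetric, unfolded x] p[unfolded x] e[unfolded mv2_def x]]])
        (use Cons(2)[symmetric] Cons(3-) in \<open>auto simp: fun_eq_iff x\<close>)
  next
    case False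
    then have x: "x = False" by simp
    show ?thesis unfolding mv2_def
      by (rule exec_eq[OF exec.LoopF[OF Cons(2)[symmetric, unfolded x] p[unfolded x] e[unfolded mv2_def x]]])
        (use Cons(2)[symmetric] Cons(3-) in \<open>auto simp: fun_eq_iff x\<close>)
  qed
qed

lemma exec_clear: "exec (clear a) s (2 * length (s a) + 1) (s(a := []))"
proof (induction "s a" arbitrary: s)
  case Nil
  have "s a = []" using Nil(1) by (rule sym)
  then show ?case unfolding clear_def by (intro exec_eq[OF exec.LoopE]) (auto simp: fun_eq_iff)
next
  case (Cons x w)
  have e: "exec (clear a) (s(a := w)) (2 * length w + 1) (s(a := []))"
    using Cons(1)[of "s(a := w)"] by simp
  show ?case
  proof (cases x)
    case True
    then have x: "x = True" by simp
    show ?thesis unfolding clear_def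
      by (rule exec_eq[OF exec.LoopT[OF Cons(2)[symmetric, unfolded x] exec.Skip e[unfolded clear_def x]]])
        (use Cons(2)[symmetric] Cons(2) in \<open>auto simp: fun_eq_iff x\<close>)
  next
    case False
    then have x: "x = False" by simp
    show ?thesis unfolding clear_def
      by (rule exec_eq[OF exec.LoopF[OF Cons(2)[symmetric, unfolded x] exec.Skip e[unfolded clear_def x]]])
        (use Cons(2)[symmetric] Cons(2) in \<open>auto simp: fun_eq_iff x\<close>)
  qed
qed

text \<open>Each move reverses, so two moves restore the order, and stack \<open>m\<close> is free
  again afterwards.\<close>

definition dup :: "nat \<Rightarrow> com" where
  "dup m = Seq (mv 0 m) (mv2 m 0 (Suc m))"

lemma exec_dup:
  assumes "0 < m"
  shows "exec (dup m) (ld w) (6 * length w + 3) ((ld w)(Suc m := w))"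
proof -
  have 1: "exec (mv 0 m) (ld w) (2 * length w + 1) ((ld [])(m := rev w))"
    using assms by (intro exec_eq[OF exec_mv]) (auto simp: ld_def fun_eq_iff)
  have 2: "exec (mv2 m 0 (Suc m)) ((ld [])(m := rev w)) (4 * length w + 1) ((ld w)(Suc m := w))"
    using assms by (intro exec_eq[OF exec_mv2]) (auto simp: ld_def fun_eq_iff)
  show ?thesis unfolding dup_def by (rule exec_eq[OF exec.Seq[OF 1 2]]) auto
qed

definition restore :: "nat \<Rightarrow> com" where
  "restore m = Seq (mv (Suc m) (m + 2)) (mv (m + 2) 0)"

lemma exec_restore:
  assumes "s 0 = []" "s (m + 2) = []"
  shows "exec (restore m) s (4 * length (s (Suc m)) + 3) (s(0 := s (Suc m), Suc m := []))"
proof -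
  have 1: "exec (mv (Suc m) (m + 2)) s (2 * length (s (Suc m)) + 1) (s(Suc m := [], m + 2 := rev (s (Suc m))))"
    using assms by (intro exec_eq[OF exec_mv]) (auto simp: fun_eq_iff)
  have 2: "exec (mv (m + 2) 0) (s(Suc m := [], m + 2 := rev (s (Suc m)))) (2 * length (s (Suc m)) + 1)
      (s(0 := s (Suc m), Suc m := []))"
    using assms by (intro exec_eq[OF exec_mv]) (auto simp: fun_eq_iff)
  show ?thesis unfolding restore_def by (rule exec_eq[OF exec.Seq[OF 1 2]]) auto
qed

text \<open>The first result waits in reverse on stack \<open>m\<close> while the second is
  computed, so moving it back puts it in front in the right order. The final \<open>True\<close>
  will be the tag of an inner node of a tree.\<close>

definition pairc :: "com \<Rightarrow> com \<Rightarrow> com" where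
  "pairc f g = (let m = Suc (max (regs f) (regs g)) in
     Seq (dup m) (Seq f (Seq (mv 0 m) (Seq (restore m) (Seq g (Seq (mv m 0) (Push 0 True)))))))"

lemma runs_pair:
  assumes "runs f w tf u" "runs g w tg v"
  shows "runs (pairc f g) w (14 * length w + 5 * tf + tg + 20) (True # u @ v)"
proof -
  define m where "m = Suc (max (regs f) (regs g))"
  have m: "regs f \<le> m" "regs g \<le> m" "0 < m" by (auto simp: m_def)
  obtain t1 where 1: "t1 \<le> tf" "exec f ((ld w)(Suc m := w)) t1 ((ld u)(Suc m := w))"
    using runs_frame[OF assms(1) m(1,3), of "(\<lambda>_. [])(Suc m := w)"] by (auto simp: ld_upd)
  have 2: "exec (mv 0 m) ((ld u)(Suc m := w)) (2 * length u + 1) ((ld [])(Suc m := w, m := rev u))"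
    using m by (intro exec_eq[OF exec_mv]) (auto simp: ld_def fun_eq_iff)
  have 3: "exec (restore m) ((ld [])(Suc m := w, m := rev u)) (4 * length w + 3) ((ld w)(m := rev u))"
    using m by (intro exec_eq[OF exec_restore]) (auto simp: ld_def fun_eq_iff)
  obtain t2 where 4: "t2 \<le> tg" "exec g ((ld w)(m := rev u)) t2 ((ld v)(m := rev u))"
    using runs_frame[OF assms(2) m(2,3), of "(\<lambda>_. [])(m := rev u)"] m(3) by (auto simp: ld_upd)
  have 5: "exec (mv m 0) ((ld v)(m := rev u)) (2 * length u + 1) (ld (u @ v))"
    using m by (intro exec_eq[OF exec_mv]) (auto simp: ld_def fun_eq_iff)
  have 6: "exec (Push 0 True) (ld (u @ v)) 1 (ld (True # u @ v))"
    by (intro exec_eq[OF exec.Push]) (auto simp: ld_def fun_eq_iff)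
  have l: "length u \<le> length w + tf" using runs_length[OF assms(1)] .
  show ?thesis
    unfolding runs_def pairc_def Let_def m_def[symmetric]
    by (intro exI conjI[rotated], rule exec.Seq[OF exec_dup[OF m(3)] exec.Seq[OF 1(2) exec.Seq[OF 2 exec.Seq[OF 3
      exec.Seq[OF 4(2) exec.Seq[OF 5 6]]]]]]) (use 1(1) 4(1) l in simp)
qed

subsection \<open>Trees\<close>

datatype tree = Lf | Nd tree tree

text \<open>Preorder notation is self-delimiting, so codes can be concatenated without
  separators.\<close>

fun tcode :: "tree \<Rightarrow> bool list" where
  "tcode Lf = [False]"
| "tcode (Nd a b) = True # tcode a @ tcode b"

definition tsz :: "tree \<Rightarrow> nat" where "tsz x = length (tcode x)"

lemma tsz_simps [simp]: "tsz Lf = 1" "tsz (Nd a b) = Suc (tsz a + tsz b)"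
  by (simp_all add: tsz_def)

lemma tsz_pos [simp]: "0 < tsz x"
  by (cases x) auto

fun lsub :: "tree \<Rightarrow> tree" where "lsub Lf = Lf" | "lsub (Nd a b) = a"
fun rsub :: "tree \<Rightarrow> tree" where "rsub Lf = Lf" | "rsub (Nd a b) = b"

definition parse_body :: com where
  "parse_body = Case 0 Skip (Push 2 False) (Seq (Push 2 True) (Seq (Push 1 False) (Push 1 False)))"

definition parse :: com where
  "parse = Loop 1 parse_body parse_body"

text \<open>Stack \<open>1\<close> counts in unary the subtrees that are still to be read.\<close>

lemma exec_parse:
  "exec parse (s(0 := rest, 1 := cs, 2 := rev (tcode x) @ s 2)) t s' \<Longrightarrow>
   \<exists>t'\<le>t + 8 * tsz x. exec parse (s(0 := tcode x @ rest, 1 := False # cs)) t' s'"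
proof (induction x arbitrary: s rest cs t)
  case Lf
  let ?s = "s(0 := tcode Lf @ rest, 1 := False # cs)"
  have "exec (Push 2 False) (?s(1 := cs, 0 := rest)) (Suc 0) (s(0 := rest, 1 := cs, 2 := rev (tcode Lf) @ s 2))"
    by (rule exec_eq[OF exec.Push]) (auto simp: fun_eq_iff)
  then have "exec parse_body (?s(1 := cs)) (Suc (Suc 0)) (s(0 := rest, 1 := cs, 2 := rev (tcode Lf) @ s 2))"
    unfolding parse_body_def by (intro exec.CaseF[where w=rest]) auto
  from exec.LoopF[OF _ this Lf[unfolded parse_def]] have "exec parse ?s (Suc (Suc (Suc 0) + t)) s'"
    unfolding parse_def by simp
  then show ?case by (intro exI conjI[rotated]) (auto simp del: fun_upd_apply)
next
  case (Nd a b)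
  let ?s = "s(0 := tcode (Nd a b) @ rest, 1 := False # cs)"
  let ?s1 = "s(0 := tcode a @ tcode b @ rest, 1 := False # False # cs, 2 := True # s 2)"
  have 0: "exec (Push 2 True) (?s(1 := cs, 0 := tcode a @ tcode b @ rest)) (Suc 0)
     (s(0 := tcode a @ tcode b @ rest, 1 := cs, 2 := True # s 2))"
    by (rule exec_eq[OF exec.Push]) (auto simp: fun_eq_iff)
  have 1: "exec (Push 1 False) (s(0 := tcode a @ tcode b @ rest, 1 := cs, 2 := True # s 2)) (Suc 0)
     (s(0 := tcode a @ tcode b @ rest, 1 := False # cs, 2 := True # s 2))"
    by (rule exec_eq[OF exec.Push]) (auto simp: fun_eq_iff)
  have 2: "exec (Push 1 False) (s(0 := tcode a @ tcode b @ rest, 1 := False # cs, 2 := True # s 2)) (Suc 0) ?s1"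
    by (rule exec_eq[OF exec.Push]) (auto simp: fun_eq_iff)
  have e: "exec parse_body (?s(1 := cs)) 6 ?s1"
    unfolding parse_body_def
    by (rule exec_eq[OF exec.CaseT[OF _ exec.Seq[OF 0 exec.Seq[OF 1 2]]]]) auto
  let ?s2 = "s(2 := rev (tcode a) @ True # s 2)"
  have "s(0 := rest, 1 := cs, 2 := rev (tcode (Nd a b)) @ s 2) = ?s2(0 := rest, 1 := cs, 2 := rev (tcode b) @ ?s2 2)"
    by auto
  from Nd.IH(2)[OF Nd.prems[unfolded this]]
  obtain t1 where 3: "t1 \<le> t + 8 * tsz b" "exec parse (?s2(0 := tcode b @ rest, 1 := False # cs)) t1 s'"
    by blast
  have "?s2(0 := tcode b @ rest, 1 := False # cs) =
    (s(2 := True # s 2))(0 := tcode b @ rest, 1 := False # cs, 2 := rev (tcode a) @ (s(2 := True # s 2)) 2)"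
    by auto
  from Nd.IH(1)[OF 3(2)[unfolded this]] obtain t2 where 4: "t2 \<le> t1 + 8 * tsz a"
    "exec parse ((s(2 := True # s 2))(0 := tcode a @ tcode b @ rest, 1 := False # False # cs)) t2 s'"
    by blast
  moreover have "(s(2 := True # s 2))(0 := tcode a @ tcode b @ rest, 1 := False # False # cs) = ?s1" by auto
  ultimately have "exec parse ?s1 t2 s'" by simp
  from exec.LoopF[of ?s 1, OF _ e this[unfolded parse_def]] show ?case
    using 3(1) 4(1) unfolding parse_def
    by (intro exI[of _ "Suc (6 + t2)"]) (simp add: fun_upd_same del: fun_upd_apply One_nat_def)
qed

lemma exec_parse1:
  "\<exists>t\<le>1 + 8 * tsz x. exec parse ((ld (tcode x @ rest))(1 := [False])) t ((ld rest)(2 := rev (tcode x)))"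
proof -
  have "exec parse ((ld rest)(0 := rest, 1 := [], 2 := rev (tcode x) @ ld rest 2)) 1 ((ld rest)(2 := rev (tcode x)))"
    unfolding parse_def by (rule exec_eq[OF exec.LoopE]) (auto simp: ld_def fun_eq_iff)
  from exec_parse[OF this] obtain t where
    "t \<le> 1 + 8 * tsz x" "exec parse ((ld rest)(0 := tcode x @ rest, 1 := [False])) t ((ld rest)(2 := rev (tcode x)))"
    by blast
  moreover have "(ld rest)(0 := tcode x @ rest, 1 := [False]) = (ld (tcode x @ rest))(1 := [False])"
    by (auto simp: ld_def fun_eq_iff)
  ultimately show ?thesis by auto
qed

definition lsubc :: com where
  "lsubc = Case 0 Skip (Push 0 False) (Seq (Push 1 False) (Seq parse (Seq (clear 0) (mv 2 0))))"

definition rsubc :: com where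
  "rsubc = Case 0 Skip (Push 0 False) (Seq (Push 1 False) (Seq parse (clear 2)))"

lemma runs_lsub: "runs lsubc (tcode x) (12 * tsz x + 10) (tcode (lsub x))"
proof (cases x)
  case Lf
  have "exec (Push 0 False) ((ld (tcode x))(0 := [])) 1 (ld (tcode x))"
    by (rule exec_eq[OF exec.Push]) (auto simp: Lf ld_def)
  then have "exec lsubc (ld (tcode x)) (Suc 1) (ld (tcode x))" unfolding lsubc_def
    by (intro exec.CaseF[where w="[]"]) (auto simp: Lf ld_def)
  then show ?thesis unfolding runs_def by (intro exI[of _ "Suc 1"]) (simp add: Lf)
next
  case (Nd a b)
  have 1: "exec (Push 1 False) ((ld (tcode x))(0 := tcode a @ tcode b)) 1 ((ld (tcode a @ tcode b))(1 := [False]))"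
    by (rule exec_eq[OF exec.Push]) (auto simp: Nd ld_def)
  obtain t where 2: "t \<le> 1 + 8 * tsz a"
    "exec parse ((ld (tcode a @ tcode b))(1 := [False])) t ((ld (tcode b))(2 := rev (tcode a)))"
    using exec_parse1 by blast
  have 3: "exec (clear 0) ((ld (tcode b))(2 := rev (tcode a))) (2 * tsz b + 1) ((ld [])(2 := rev (tcode a)))"
    by (rule exec_eq[OF exec_clear]) (auto simp: ld_def tsz_def)
  have 4: "exec (mv 2 0) ((ld [])(2 := rev (tcode a))) (2 * tsz a + 1) (ld (tcode a))"
    by (rule exec_eq[OF exec_mv]) (auto simp: ld_def tsz_def)
  have "ld (tcode x) 0 = True # tcode a @ tcode b" by (simp add: ld_def Nd)
  from exec.CaseT[OF this exec.Seq[OF 1 exec.Seq[OF 2(2) exec.Seq[OF 3 4]]]]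
  show ?thesis unfolding runs_def lsubc_def
    using 2(1) by (intro exI conjI[rotated]) (auto simp: Nd)
qed

lemma runs_rsub: "runs rsubc (tcode x) (12 * tsz x + 10) (tcode (rsub x))"
proof (cases x)
  case Lf
  have "exec (Push 0 False) ((ld (tcode x))(0 := [])) 1 (ld (tcode x))"
    by (rule exec_eq[OF exec.Push]) (auto simp: Lf ld_def)
  then have "exec rsubc (ld (tcode x)) (Suc 1) (ld (tcode x))" unfolding rsubc_def
    by (intro exec.CaseF[where w="[]"]) (auto simp: Lf ld_def)
  then show ?thesis unfolding runs_def by (intro exI[of _ "Suc 1"]) (simp add: Lf)
next
  case (Nd a b)
  have 1: "exec (Push 1 False) ((ld (tcode x))(0 := tcode a @ tcode b)) 1 ((ld (tcode a @ tcode b))(1 := [False]))"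
    by (rule exec_eq[OF exec.Push]) (auto simp: Nd ld_def)
  obtain t where 2: "t \<le> 1 + 8 * tsz a"
    "exec parse ((ld (tcode a @ tcode b))(1 := [False])) t ((ld (tcode b))(2 := rev (tcode a)))"
    using exec_parse1 by blast
  have 3: "exec (clear 2) ((ld (tcode b))(2 := rev (tcode a))) (2 * tsz a + 1) (ld (tcode b))"
    by (rule exec_eq[OF exec_clear]) (auto simp: ld_def tsz_def)
  have "ld (tcode x) 0 = True # tcode a @ tcode b" by (simp add: ld_def Nd)
  from exec.CaseT[OF this exec.Seq[OF 1 exec.Seq[OF 2(2) 3]]]
  show ?thesis unfolding runs_def rsubc_def
    using 2(1) by (intro exI conjI[rotated]) (auto simp: Nd)
qed

definition constc :: "tree \<Rightarrow> com" where
  "constc a = Seq (clear 0) (foldr (\<lambda>b c. Seq c (Push 0 b)) (tcode a) Skip)"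

lemma runs_const: "runs (constc a) w (2 * length w + 3 + 2 * length (tcode a)) (tcode a)"
proof -
  have 1: "exec (foldr (\<lambda>b c. Seq c (Push 0 b)) u Skip) (ld []) (Suc (2 * length u)) (ld u)" for u
  proof (induction u)
    case (Cons b u)
    have "exec (Push 0 b) (ld u) 1 (ld (b # u))" by (rule exec_eq[OF exec.Push]) (auto simp: ld_def)
    from exec_eq[OF exec.Seq[OF Cons this] refl] show ?case by simp
  qed (auto intro: exec.Skip)
  have "exec (clear 0) (ld w) (2 * length w + 1) (ld [])"
    by (rule exec_eq[OF exec_clear]) (auto simp: ld_def)
  from exec.Seq[OF this 1] show ?thesis unfolding runs_def constc_def
    by (intro exI conjI[rotated]) auto
qed

definition ifc :: "com \<Rightarrow> com \<Rightarrow> com \<Rightarrow> com" where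
  "ifc c f g = (let m = Suc (max (regs c) (max (regs f) (regs g))) in
     Seq (dup m) (Seq c (Case 0 Skip (Seq (clear 0) (Seq (restore m) f)) (Seq (clear 0) (Seq (restore m) g)))))"

text \<open>Each branch has to be correct only when it is taken. The case distinction on lists uses
  this: its second branch makes no sense on the empty list.\<close>

lemma runs_if:
  assumes "runs c w tc (tcode u)" "u = Lf \<Longrightarrow> runs f w tf v" "u \<noteq> Lf \<Longrightarrow> runs g w tf v"
  shows "runs (ifc c f g) w (12 * length w + 3 * tc + tf + 20) v"
proof -
  define m where "m = Suc (max (regs c) (max (regs f) (regs g)))"
  have m: "regs c \<le> m" "regs f \<le> m" "regs g \<le> m" "0 < m" by (auto simp: m_def)
  obtain t1 where 1: "t1 \<le> tc" "exec c ((ld w)(Suc m := w)) t1 ((ld (tcode u))(Suc m := w))"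
    using runs_frame[OF assms(1) m(1,4), of "(\<lambda>_. [])(Suc m := w)"] by (auto simp: ld_upd)
  define w' where "w' = tl (tcode u)"
  have w': "length w' \<le> length w + tc" using runs_length[OF assms(1)] by (simp add: w'_def)
  have 2: "exec (clear 0) ((ld w')(Suc m := w)) (2 * length w' + 1) ((ld [])(Suc m := w))"
    by (rule exec_eq[OF exec_clear]) (auto simp: ld_def)
  have 3: "exec (restore m) ((ld [])(Suc m := w)) (4 * length w + 3) (ld w)"
    by (rule exec_eq[OF exec_restore]) (auto simp: ld_def)
  have *: ?thesis if h: "runs h w tf v" and c: "\<And>t s'. exec (Seq (clear 0) (Seq (restore m) h)) ((ld w')(Suc m := w)) t s' \<Longrightarrow>
      exec (Case 0 Skip (Seq (clear 0) (Seq (restore m) f)) (Seq (clear 0) (Seq (restore m) g)))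
       ((ld (tcode u))(Suc m := w)) (Suc t) s'" for h
  proof -
    obtain t2 where 4: "t2 \<le> tf" "exec h (ld w) t2 (ld v)" using h unfolding runs_def by blast
    from exec.Seq[OF exec_dup[OF m(4), of w] exec.Seq[OF 1(2) c[OF exec.Seq[OF 2 exec.Seq[OF 3 4(2)]]]]]
    show ?thesis unfolding runs_def ifc_def Let_def m_def[symmetric]
      using 1(1) 4(1) w' by (intro exI conjI[rotated]) auto
  qed
  show ?thesis
  proof (cases "u = Lf")
    case True
    show ?thesis
      by (rule *[OF assms(2)[OF True]], rule exec.CaseF[where w=w'])
        (auto simp: ld_def True w'_def fun_upd_twist elim!: back_subst[where P="\<lambda>s. exec _ s _ _"])
  next
    case False
    then obtain a b where u: "u = Nd a b" by (cases u) auto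
    show ?thesis
      by (rule *[OF assms(3)[OF False]], rule exec.CaseT[where w=w'])
        (auto simp: ld_def u w'_def fun_upd_twist elim!: back_subst[where P="\<lambda>s. exec _ s _ _"])
  qed
qed

definition nodes :: "tree \<Rightarrow> nat" where "nodes x = length (filter id (tcode x))"

text \<open>The code of the counter tree drives the loop itself: a \<open>True\<close> runs
  \<open>f\<close>, a \<open>False\<close> does nothing, so the number of rounds is the number of
  inner nodes and no arithmetic is involved.\<close>

definition iterc :: "com \<Rightarrow> com \<Rightarrow> com" where
  "iterc c f = (let m = Suc (max (regs c) (regs f)) in
     Seq (dup m) (Seq c (Seq (mv 0 m) (Seq (restore m) (Loop m Skip f)))))"

lemma exec_iter:
  assumes "regs f \<le> m" "0 < m"
    "\<And>i. i < length (filter id ks) \<Longrightarrow> runs f (tcode (X i)) B (tcode (X (Suc i)))"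
  shows "\<exists>t\<le>1 + length ks * (B + 2). exec (Loop m Skip f) ((ld (tcode (X 0)))(m := ks)) t
     (ld (tcode (X (length (filter id ks)))))"
  using assms(3)
proof (induction ks arbitrary: X)
  case Nil
  have "exec (Loop m Skip f) ((ld (tcode (X 0)))(m := [])) 1 (ld (tcode (X 0)))"
    using assms(2) by (intro exec_eq[OF exec.LoopE]) (auto simp: ld_def fun_eq_iff)
  then show ?case by (intro exI[of _ 1]) (simp del: fun_upd_apply)
next
  case (Cons k ks)
  let ?s = "(ld (tcode (X 0)))(m := k # ks)"
  show ?case
  proof (cases k)
    case True
    have "runs f (tcode (X 0)) B (tcode (X 1))" using Cons.prems[of 0] True by simp
    then obtain t1 where 1: "t1 \<le> B" "exec f ((ld (tcode (X 0)))(m := ks)) t1 ((ld (tcode (X 1)))(m := ks))"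
      using runs_frame[of f "tcode (X 0)" B "tcode (X 1)" m "(\<lambda>_. [])(m := ks)"] assms(1,2) by (auto simp: ld_upd)
    have "runs f (tcode (X (Suc i))) B (tcode (X (Suc (Suc i))))" if "i < length (filter id ks)" for i
      using Cons.prems[of "Suc i"] that True by (simp add: id_def)
    from Cons.IH[of "\<lambda>i. X (Suc i)", OF this] obtain t2 where 2: "t2 \<le> 1 + length ks * (B + 2)"
      "exec (Loop m Skip f) ((ld (tcode (X 1)))(m := ks)) t2 (ld (tcode (X (Suc (length (filter id ks))))))"
      by (metis One_nat_def)
    have "exec f (?s(m := ks)) t1 ((ld (tcode (X 1)))(m := ks))" using 1(2) by simp
    from exec.LoopT[of ?s m, OF _ this 2(2)] show ?thesis
      using 1(1) 2(1) True
      by (intro exI[of _ "Suc (t1 + t2)"]) (simp add: id_def fun_upd_same del: fun_upd_apply)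
  next
    case False
    obtain t2 where 2: "t2 \<le> 1 + length ks * (B + 2)"
      "exec (Loop m Skip f) ((ld (tcode (X 0)))(m := ks)) t2 (ld (tcode (X (length (filter id ks)))))"
      using Cons.IH[of X] Cons.prems False by (auto simp: id_def simp del: fun_upd_apply)
    have "exec Skip (?s(m := ks)) 1 ((ld (tcode (X 0)))(m := ks))" by (rule exec_eq[OF exec.Skip]) auto
    from exec.LoopF[of ?s m, OF _ this 2(2)] show ?thesis
      using 2(1) False by (intro exI[of _ "Suc (1 + t2)"]) (simp add: id_def fun_upd_same del: fun_upd_apply One_nat_def)
  qed
qed

lemma runs_iter:
  assumes "runs c (tcode (X 0)) tc (tcode k)"
    "\<And>i. i < nodes k \<Longrightarrow> runs f (tcode (X i)) B (tcode (X (Suc i)))"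
  shows "runs (iterc c f) (tcode (X 0)) (20 + 12 * tsz (X 0) + 3 * tc + (tsz (X 0) + tc) * (B + 2)) (tcode (X (nodes k)))"
proof -
  let ?w = "tcode (X 0)"
  define m where "m = Suc (max (regs c) (regs f))"
  have m: "regs c \<le> m" "regs f \<le> m" "0 < m" by (auto simp: m_def)
  obtain t1 where 1: "t1 \<le> tc" "exec c ((ld ?w)(Suc m := ?w)) t1 ((ld (tcode k))(Suc m := ?w))"
    using runs_frame[OF assms(1) m(1,3), of "(\<lambda>_. [])(Suc m := ?w)"] by (auto simp: ld_upd)
  have 2: "exec (mv 0 m) ((ld (tcode k))(Suc m := ?w)) (2 * tsz k + 1) ((ld [])(Suc m := ?w, m := rev (tcode k)))"
    using m by (intro exec_eq[OF exec_mv]) (auto simp: ld_def fun_eq_iff tsz_def)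
  have 3: "exec (restore m) ((ld [])(Suc m := ?w, m := rev (tcode k))) (4 * tsz (X 0) + 3) ((ld ?w)(m := rev (tcode k)))"
    using m by (intro exec_eq[OF exec_restore]) (auto simp: ld_def fun_eq_iff tsz_def)
  have n: "length (filter id (rev (tcode k))) = nodes k" by (simp add: nodes_def rev_filter[symmetric])
  obtain t2 where 4: "t2 \<le> 1 + tsz k * (B + 2)" "exec (Loop m Skip f) ((ld ?w)(m := rev (tcode k))) t2
     (ld (tcode (X (nodes k))))"
    using exec_iter[OF m(2,3), of "rev (tcode k)" X B] assms(2) unfolding n by (auto simp: tsz_def)
  have k: "tsz k \<le> tsz (X 0) + tc" using runs_length[OF assms(1)] by (simp add: tsz_def)
  then have "t2 \<le> 1 + (tsz (X 0) + tc) * (B + 2)"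
    using 4(1) by (meson add_left_mono le_trans mult_le_mono1)
  then show ?thesis
    using exec.Seq[OF exec_dup[OF m(3), of ?w] exec.Seq[OF 1(2) exec.Seq[OF 2 exec.Seq[OF 3 4(2)]]]] 1(1) k
    unfolding runs_def iterc_def Let_def m_def[symmetric]
    by (intro exI conjI[rotated]) (auto simp: tsz_def)
qed

subsection \<open>The closure properties\<close>

text \<open>\<open>tfp a f\<close>: the tree \<open>f x\<close> is computed from the tree \<open>a x\<close>. Only trees in the range of \<open>a\<close> occur as
  arguments, so that bounds need not hold for trees that encode nothing.\<close>

definition tfp :: "('a \<Rightarrow> tree) \<Rightarrow> ('a \<Rightarrow> tree) \<Rightarrow> bool" where
  "tfp a f \<longleftrightarrow> (\<exists>c T. pbn T \<and> (\<forall>x. runs c (tcode (a x)) (T (tsz (a x))) (tcode (f x))))"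

lemma tfpI: "pbn T \<Longrightarrow> (\<And>x. runs c (tcode (a x)) (T (tsz (a x))) (tcode (f x))) \<Longrightarrow> tfp a f"
  unfolding tfp_def by blast

lemma tfp_runs:
  assumes "tfp a f"
  shows "\<exists>c k. \<forall>x n. tsz (a x) \<le> n \<longrightarrow>
    runs c (tcode (a x)) ((n + 2) ^ k) (tcode (f x)) \<and> tsz (f x) \<le> n + (n + 2) ^ k"
proof -
  obtain c T k where *: "\<And>x. runs c (tcode (a x)) (T (tsz (a x))) (tcode (f x))" "\<And>n. T n \<le> (n + 2) ^ k"
    using assms unfolding tfp_def pbn_def by blast
  have 1: "runs c (tcode (a x)) ((n + 2) ^ k) (tcode (f x))" if "tsz (a x) \<le> n" for x n
    using runs_mono[OF *(1) order_trans[OF *(2) power_mono[of "tsz (a x) + 2" "n + 2"]]] that by simp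
  moreover have "tsz (f x) \<le> n + (n + 2) ^ k" if "tsz (a x) \<le> n" for x n
    using runs_length[OF 1[OF that]] that by (simp add: tsz_def)
  ultimately show ?thesis by blast
qed

lemma tfp_size: "tfp a f \<Longrightarrow> \<exists>q. pbn q \<and> mono q \<and> (\<forall>x. tsz (f x) \<le> q (tsz (a x)))"
proof -
  assume "tfp a f"
  then obtain k where *: "\<And>x n. tsz (a x) \<le> n \<Longrightarrow> tsz (f x) \<le> n + (n + 2) ^ k"
    using tfp_runs by blast
  show ?thesis
    by (intro exI[of _ "\<lambda>n. n + (n + 2) ^ k"] conjI monoI pbn_intros allI * add_mono power_mono) auto
qed

lemma tfp_id: "tfp a a"
  by (rule tfpI[of "\<lambda>_. 1" Skip]) (auto simp: runs_def intro!: exI[of _ "Suc 0"] exec.Skip)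

lemma tfp_inst: "tfp a f \<Longrightarrow> tfp (\<lambda>x. a (h x)) (\<lambda>x. f (h x))"
  unfolding tfp_def by blast

lemma tfp_comp:
  assumes "tfp b f" "tfp a b"
  shows "tfp a f"
proof -
  obtain c k where f: "\<And>x n. tsz (b x) \<le> n \<Longrightarrow> runs c (tcode (b x)) ((n + 2) ^ k) (tcode (f x))"
    using tfp_runs[OF assms(1)] by blast
  obtain d j where g: "\<And>x n. tsz (a x) \<le> n \<Longrightarrow> runs d (tcode (a x)) ((n + 2) ^ j) (tcode (b x))"
    "\<And>x n. tsz (a x) \<le> n \<Longrightarrow> tsz (b x) \<le> n + (n + 2) ^ j" using tfp_runs[OF assms(2)] by blast
  show ?thesis
    by (rule tfpI[where T="\<lambda>n. Suc ((n + 2) ^ j + (n + (n + 2) ^ j + 2) ^ k)"], intro pbn_intros)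
      (rule runs_Seq[OF g(1)[OF order_refl] f[OF g(2)[OF order_refl]]])
qed

lemma tfp_const: "tfp a (\<lambda>_. t)"
  by (rule tfpI[OF _ runs_mono[OF runs_const[of t]], of "\<lambda>n. 2 * n + 3 + 2 * length (tcode t)"], intro pbn_intros)
    (auto simp: tsz_def)

lemma tfp_lsub: "tfp a (\<lambda>x. lsub (a x))"
  by (rule tfpI[where T="\<lambda>n. 12 * n + 10"], intro pbn_intros) (rule runs_lsub)

lemma tfp_rsub: "tfp a (\<lambda>x. rsub (a x))"
  by (rule tfpI[where T="\<lambda>n. 12 * n + 10"], intro pbn_intros) (rule runs_rsub)

lemma tfp_Nd:
  assumes "tfp a f" "tfp a g"
  shows "tfp a (\<lambda>x. Nd (f x) (g x))"
proof -
  obtain c k where f: "\<And>x n. tsz (a x) \<le> n \<Longrightarrow> runs c (tcode (a x)) ((n + 2) ^ k) (tcode (f x))"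
    using tfp_runs[OF assms(1)] by blast
  obtain d j where g: "\<And>x n. tsz (a x) \<le> n \<Longrightarrow> runs d (tcode (a x)) ((n + 2) ^ j) (tcode (g x))"
    using tfp_runs[OF assms(2)] by blast
  show ?thesis unfolding tcode.simps
    by (rule tfpI[of "\<lambda>n. 14 * n + 5 * (n + 2) ^ k + (n + 2) ^ j + 20" "pairc c d"], intro pbn_intros)
      (use runs_pair[OF f[OF order_refl] g[OF order_refl]] in \<open>simp add: tsz_def\<close>)
qed

lemma tfp_if:
  assumes "tfp a c" "tfp a f" "tfp a g"
  shows "tfp a (\<lambda>x. if c x = Lf then f x else g x)"
proof -
  obtain cc i where c: "\<And>x n. tsz (a x) \<le> n \<Longrightarrow> runs cc (tcode (a x)) ((n + 2) ^ i) (tcode (c x))"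
    using tfp_runs[OF assms(1)] by blast
  obtain cf k where f: "\<And>x n. tsz (a x) \<le> n \<Longrightarrow> runs cf (tcode (a x)) ((n + 2) ^ k) (tcode (f x))"
    using tfp_runs[OF assms(2)] by blast
  obtain cg j where g: "\<And>x n. tsz (a x) \<le> n \<Longrightarrow> runs cg (tcode (a x)) ((n + 2) ^ j) (tcode (g x))"
    using tfp_runs[OF assms(3)] by blast
  have "runs (ifc cc cf cg) (tcode (a x))
     (12 * length (tcode (a x)) + 3 * (tsz (a x) + 2) ^ i + ((tsz (a x) + 2) ^ k + (tsz (a x) + 2) ^ j) + 20)
     (tcode (if c x = Lf then f x else g x))" for x
    by (rule runs_if[OF c[OF order_refl]])
      (auto intro: runs_mono[OF f[OF order_refl]] runs_mono[OF g[OF order_refl]])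
  then show ?thesis
    by (intro tfpI[of "\<lambda>n. 12 * n + 3 * (n + 2) ^ i + ((n + 2) ^ k + (n + 2) ^ j) + 20" "ifc cc cf cg"])
     (intro pbn_intros, simp add: tsz_def)
qed

text \<open>Time is measured by a bound \<open>n\<close> on all intermediate trees and not by the
  input, because in the conversion to unary notation these trees are exponentially larger than the
  input. \<open>tfp_iter\<close> is the case of a polynomial \<open>n\<close>.\<close>

lemma runs_iterate:
  assumes "tfp a (\<lambda>y. a (F y))" "tfp a g"
  shows "\<exists>c T. pbn T \<and> (\<forall>y n. (\<forall>i \<le> nodes (g y). tsz (a ((F ^^ i) y)) \<le> n) \<longrightarrow>
     runs c (tcode (a y)) (T n) (tcode (a ((F ^^ nodes (g y)) y))))"
proof -
  obtain cf k where f: "\<And>x n. tsz (a x) \<le> n \<Longrightarrow> runs cf (tcode (a x)) ((n + 2) ^ k) (tcode (a (F x)))"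
    using tfp_runs[OF assms(1)] by blast
  obtain cg j where g: "\<And>x n. tsz (a x) \<le> n \<Longrightarrow> runs cg (tcode (a x)) ((n + 2) ^ j) (tcode (g x))"
    using tfp_runs[OF assms(2)] by blast
  let ?T = "\<lambda>n. 20 + 12 * n + 3 * (n + 2) ^ j + (n + (n + 2) ^ j) * ((n + 2) ^ k + 2)"
  have "runs (iterc cg cf) (tcode (a y)) (?T n) (tcode (a ((F ^^ nodes (g y)) y)))"
    if *: "\<forall>i \<le> nodes (g y). tsz (a ((F ^^ i) y)) \<le> n" for y n
  proof -
    have 0: "tsz (a y) \<le> n" using *[rule_format, of 0] by simp
    have "runs cf (tcode (a ((F ^^ i) y))) ((n + 2) ^ k) (tcode (a ((F ^^ Suc i) y)))" if "i < nodes (g y)" for i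
      using f[of "(F ^^ i) y" n] * that by simp
    then show ?thesis
      using runs_mono[OF runs_iter[of cg "\<lambda>i. a ((F ^^ i) y)" "(n + 2) ^ j" "g y" cf "(n + 2) ^ k"], of "?T n"]
        g[OF 0] 0 by (simp add: mult_le_mono add_mono)
  qed
  moreover have "pbn ?T" by (intro pbn_intros)
  ultimately show ?thesis by blast
qed

lemma tfp_iter:
  assumes "tfp a (\<lambda>y. a (F y))" "tfp a g" "tfp b (\<lambda>x. a (h x))" "pbn q"
    "\<And>x i. i \<le> nodes (g (h x)) \<Longrightarrow> tsz (a ((F ^^ i) (h x))) \<le> q (tsz (b x))"
  shows "tfp b (\<lambda>x. a ((F ^^ nodes (g (h x))) (h x)))"
proof -
  obtain c T where c: "pbn T" "\<And>y n. (\<And>i. i \<le> nodes (g y) \<Longrightarrow> tsz (a ((F ^^ i) y)) \<le> n) \<Longrightarrow>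
     runs c (tcode (a y)) (T n) (tcode (a ((F ^^ nodes (g y)) y)))"
    using runs_iterate[OF assms(1,2)] by blast
  obtain k where k: "\<And>n. T n \<le> (n + 2) ^ k" using c(1) unfolding pbn_def by blast
  obtain ch l where h: "\<And>x n. tsz (b x) \<le> n \<Longrightarrow> runs ch (tcode (b x)) ((n + 2) ^ l) (tcode (a (h x)))"
    using tfp_runs[OF assms(3)] by blast
  show ?thesis
    by (rule tfpI[where T="\<lambda>n. Suc ((n + 2) ^ l + (q n + 2) ^ k)"], intro pbn_intros assms(4))
      (rule runs_Seq[OF h[OF order_refl] runs_mono[OF c(2)[OF assms(5)] k]])
qed

lemma nodes_simps [simp]: "nodes Lf = 0" "nodes (Nd a b) = Suc (nodes a + nodes b)"
  by (simp_all add: nodes_def)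

subsection \<open>Words and trees\<close>

definition btree :: "bool \<Rightarrow> tree" where "btree b = (if b then Nd Lf Lf else Lf)"

fun wtree :: "bool list \<Rightarrow> tree" where
  "wtree [] = Lf"
| "wtree (b # w) = Nd (btree b) (wtree w)"

text \<open>The compiled machine delivers its input reversed, so the code of the tree is built from
  its end: each digit contributes the tag of a list cell and the code of a truth value, pushed back
  to front.\<close>

definition inputc :: com where
  "inputc = Seq (Push 1 False) (Seq
     (Loop 0 (Seq (Push 1 False) (Push 1 True))
             (Seq (Push 1 False) (Seq (Push 1 False) (Seq (Push 1 True) (Push 1 True)))))
     (Seq (mv 1 2) (mv 2 0)))"

definition outputc :: com where
  "outputc = Seq
     (Loop 0 Skip (Case 0 Skip (Push 1 False)
       (Case 0 Skip (Case 0 Skip (Push 1 True) Skip) Skip)))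
     (mv 1 0)"

lemma length_wtree: "length (tcode (wtree w)) \<le> 4 * length w + 1"
  by (induction w) (auto simp: btree_def)

lemma runs_input: "runs inputc (rev w) (30 * length w + 30) (tcode (wtree w))"
proof -
  let ?l = "Loop 0 (Seq (Push 1 False) (Push 1 True))
             (Seq (Push 1 False) (Seq (Push 1 False) (Seq (Push 1 True) (Push 1 True))))"
  have l: "\<exists>t\<le>8 * length u + 1. exec ?l ((ld u)(1 := tcode (wtree v))) t ((ld [])(1 := tcode (wtree (rev u @ v))))" for u v
  proof (induction u arbitrary: v)
    case Nil
    have "exec ?l ((ld [])(1 := tcode (wtree v))) 1 ((ld [])(1 := tcode (wtree v)))"
      by (rule exec_eq[OF exec.LoopE]) (auto simp: ld_def)
    then show ?case by (intro exI[of _ 1]) (simp del: fun_upd_apply)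
  next
    case (Cons b u)
    obtain t where t: "t \<le> 8 * length u + 1"
      "exec ?l ((ld u)(1 := tcode (wtree (b # v)))) t ((ld [])(1 := tcode (wtree (rev (b # u) @ v))))"
      using Cons[of "b # v"] by (auto simp del: fun_upd_apply)
    let ?s = "(ld (b # u))(1 := tcode (wtree v))"
    have e: "exec (Push 1 x) ((ld u)(1 := y)) 1 ((ld u)(1 := x # y))" for x y
      by (rule exec_eq[OF exec.Push]) auto
    have s: "?s(0 := u) = (ld u)(1 := tcode (wtree v))" by (auto simp: ld_def)
    show ?case
    proof (cases b)
      case True
      have "exec (Seq (Push 1 False) (Seq (Push 1 False) (Seq (Push 1 True) (Push 1 True)))) (?s(0 := u)) 7
        ((ld u)(1 := tcode (wtree (b # v))))"
        unfolding s by (rule exec_eq[OF exec.Seq[OF e exec.Seq[OF e exec.Seq[OF e e]]]]) (auto simp: True btree_def)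
      from exec.LoopT[of ?s 0, OF _ this t(2)] show ?thesis
        using t(1) True by (intro exI[of _ "Suc (7 + t)"]) (auto simp: ld_simps simp del: fun_upd_apply)
    next
      case False
      have "exec (Seq (Push 1 False) (Push 1 True)) (?s(0 := u)) 3 ((ld u)(1 := tcode (wtree (b # v))))"
        unfolding s by (rule exec_eq[OF exec.Seq[OF e e]]) (auto simp: False btree_def)
      from exec.LoopF[of ?s 0, OF _ this t(2)] show ?thesis
        using t(1) False by (intro exI[of _ "Suc (3 + t)"]) (auto simp: ld_simps simp del: fun_upd_apply)
    qed
  qed
  have 1: "exec (Push 1 False) (ld (rev w)) 1 ((ld (rev w))(1 := tcode (wtree [])))"
    by (rule exec_eq[OF exec.Push]) (auto simp: ld_def)
  obtain t where 2: "t \<le> 8 * length w + 1"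
    "exec ?l ((ld (rev w))(1 := tcode (wtree []))) t ((ld [])(1 := tcode (wtree w)))"
    using l[of "rev w" "[]"] by auto
  let ?n = "length (tcode (wtree w))"
  have 3: "exec (mv 1 2) ((ld [])(1 := tcode (wtree w))) (2 * ?n + 1) ((ld [])(2 := rev (tcode (wtree w))))"
    by (rule exec_eq[OF exec_mv]) (auto simp: ld_def)
  have 4: "exec (mv 2 0) ((ld [])(2 := rev (tcode (wtree w)))) (2 * ?n + 1) (ld (tcode (wtree w)))"
    by (rule exec_eq[OF exec_mv]) (auto simp: ld_def)
  show ?thesis unfolding runs_def inputc_def
    by (intro exI conjI[rotated], rule exec.Seq[OF 1 exec.Seq[OF 2(2) exec.Seq[OF 3 4]]])
      (use 2(1) length_wtree[of w] in simp)
qed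

lemma runs_output: "runs outputc (tcode (wtree w)) (10 * length w + 10) w"
proof -
  let ?b = "Case 0 Skip (Push 1 False) (Case 0 Skip (Case 0 Skip (Push 1 True) Skip) Skip)"
  have l: "\<exists>t\<le>8 * length w + 3. exec (Loop 0 Skip ?b) ((ld (tcode (wtree w)))(1 := v)) t ((ld [])(1 := rev w @ v))" for w v
  proof (induction w arbitrary: v)
    case Nil
    have "exec (Loop 0 Skip ?b) ((ld [])(1 := v)) 1 ((ld [])(1 := v))"
      by (rule exec_eq[OF exec.LoopE]) (auto simp: ld_def)
    moreover have "exec Skip (((ld [False])(1 := v))(0 := [])) 1 ((ld [])(1 := v))"
      by (rule exec_eq[OF exec.Skip]) (auto simp: ld_def)
    ultimately have "exec (Loop 0 Skip ?b) ((ld [False])(1 := v)) (Suc (1 + 1)) ((ld [])(1 := v))"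
      by (intro exec.LoopF[where w="[]"]) (auto simp: ld_def)
    then show ?case by (intro exI[of _ "Suc (1 + 1)"]) (simp del: fun_upd_apply)
  next
    case (Cons b w)
    obtain t where t: "t \<le> 8 * length w + 3"
      "exec (Loop 0 Skip ?b) ((ld (tcode (wtree w)))(1 := b # v)) t ((ld [])(1 := rev (b # w) @ v))"
      using Cons[of "b # v"] by (auto simp del: fun_upd_apply)
    let ?s = "(ld (tcode (wtree (b # w))))(1 := v)"
    let ?u = "tcode (btree b) @ tcode (wtree w)"
    have s: "((ld x)(1 := v))(0 := y) = (ld y)(1 := v)" for x y by (auto simp: ld_def)
    have e: "exec (Push 1 b) ((ld (tcode (wtree w)))(1 := v)) 1 ((ld (tcode (wtree w)))(1 := b # v))"
      by (rule exec_eq[OF exec.Push]) auto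
    have "\<exists>t\<le>4. exec ?b (?s(0 := ?u)) t ((ld (tcode (wtree w)))(1 := b # v))"
    proof (cases b)
      case True
      have "exec (Case 0 Skip (Push 1 True) Skip) ((ld (False # tcode (wtree w)))(1 := v)) (Suc 1)
        ((ld (tcode (wtree w)))(1 := b # v))"
        by (rule exec.CaseF[where w="tcode (wtree w)"]) (use e True in \<open>simp_all add: ld_simps del: fun_upd_apply\<close>)
      note e2 = this
      have "exec (Case 0 Skip (Case 0 Skip (Push 1 True) Skip) Skip) ((ld (False # False # tcode (wtree w)))(1 := v)) (Suc (Suc 1))
        ((ld (tcode (wtree w)))(1 := b # v))"
        by (rule exec.CaseF[where w="False # tcode (wtree w)"]) (use e2 in \<open>simp_all add: ld_simps del: fun_upd_apply\<close>)
      note e3 = this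
      have "exec ?b ((ld ?u)(1 := v)) (Suc (Suc (Suc 1))) ((ld (tcode (wtree w)))(1 := b # v))"
        by (rule exec.CaseT[where w="False # False # tcode (wtree w)"])
          (use e3 in \<open>simp_all add: ld_simps True btree_def del: fun_upd_apply\<close>)
      then show ?thesis unfolding s by (intro exI conjI[rotated]) auto
    next
      case False
      have "exec ?b ((ld ?u)(1 := v)) (Suc 1) ((ld (tcode (wtree w)))(1 := b # v))"
        by (rule exec.CaseF[where w="tcode (wtree w)"])
          (use e False in \<open>simp_all add: ld_simps btree_def del: fun_upd_apply\<close>)
      then show ?thesis unfolding s by (intro exI conjI[rotated]) auto
    qed
    then obtain t1 where "t1 \<le> 4" "exec ?b (?s(0 := ?u)) t1 ((ld (tcode (wtree w)))(1 := b # v))" by blast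
    then show ?case using exec.LoopT[of ?s 0 ?u ?b t1 _ Skip, OF _ _ t(2)] t(1)
      by (intro exI[of _ "Suc (t1 + t)"]) (auto simp: ld_simps simp del: fun_upd_apply)
  qed
  have ld1: "(ld (tcode (wtree w)))(1 := []) = ld (tcode (wtree w))" by (auto simp: ld_def)
  obtain t where 1: "t \<le> 8 * length w + 3"
    "exec (Loop 0 Skip ?b) (ld (tcode (wtree w))) t ((ld [])(1 := rev w))"
    using l[of w "[]"] unfolding ld1 append_Nil2 by blast
  have 2: "exec (mv 1 0) ((ld [])(1 := rev w)) (2 * length w + 1) (ld w)"
    by (rule exec_eq[OF exec_mv]) (auto simp: ld_def)
  show ?thesis unfolding runs_def outputc_def
    by (intro exI conjI[rotated], rule exec.Seq[OF 1(2) 2]) (use 1(1) in simp)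
qed

text \<open>The running time is measured by an arbitrary function of the argument, so that the lemma serves
  both for polynomial time and for time polynomial in the value.\<close>

lemma machine_of_runs:
  assumes "\<And>n. runs c (tcode (wtree (bits n))) (T n) (tcode (wtree (bits (F n))))"
  shows "\<exists>M. turing_machine M \<and> (\<forall>t. (\<forall>n. 1000 * (length (bits n) + T n) + 1000 \<le> t n) \<longrightarrow> computes_within M F t)"
proof -
  obtain M where M: "turing_machine M" "\<And>w t s' t'. exec (Seq inputc (Seq c outputc)) (\<lambda>r. if r = 0 then rev w else []) t s' \<Longrightarrow>
     3 * length w + 2 * t + length (s' 0) + 4 \<le> t' \<Longrightarrow> halts_with ((step M ^^ t') (init_config M w)) (s' 0)"
    using machine_exists[of "Seq inputc (Seq c outputc)"] by blast
  have "computes_within M F t" if t: "\<forall>n. 1000 * (length (bits n) + T n) + 1000 \<le> t n" for t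
    unfolding computes_within_def
  proof
    fix n
    let ?w = "bits n" and ?v = "bits (F n)"
    \<comment> \<open>The time of \<open>outputc\<close> depends on the length of the output, which
      is here bounded through the running time of \<open>c\<close>.\<close>
    have "length v \<le> length (tcode (wtree v))" for v by (induction v) (auto simp: btree_def)
    then have "length ?v \<le> length (tcode (wtree ?v))" .
    also have "\<dots> \<le> 4 * length ?w + 1 + T n"
      using runs_length[OF assms[of n]] length_wtree[of ?w] by simp
    finally have v: "length ?v \<le> 4 * length ?w + 1 + T n" .
    obtain t1 where 1: "t1 \<le> Suc (30 * length ?w + 30 + Suc (T n + (10 * length ?v + 10)))"
      "exec (Seq inputc (Seq c outputc)) (ld (rev ?w)) t1 (ld ?v)"
      using runs_Seq[OF runs_input[of ?w] runs_Seq[OF assms[of n] runs_output[of ?v]]] unfolding runs_def by blast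
    have "halts_with ((step M ^^ t n) (init_config M ?w)) (ld ?v 0)"
    proof (rule M(2)[of ?w t1])
      show "exec (Seq inputc (Seq c outputc)) (\<lambda>r. if r = 0 then rev ?w else []) t1 (ld ?v)"
        using 1(2) by (simp add: ld_def)
      show "3 * length ?w + 2 * t1 + length (ld ?v 0) + 4 \<le> t n"
        using spec[OF t, of n] 1(1) v by (simp add: ld_def)
    qed
    then show "halts_with ((step M ^^ t n) (init_config M ?w)) ?v" by (simp add: ld_def)
  qed
  with M(1) show ?thesis by blast
qed

section \<open>Polynomial-time functions on data types\<close>

text \<open>Injectivity reduces equality tests on data to equality of trees.\<close>

class enc =
  fixes enc :: "'a \<Rightarrow> tree"
  assumes enc_inject: "enc x = enc y \<longleftrightarrow> x = y"

text \<open>Frees \<open>blen\<close> from real logarithms; the recursion and the bounds for it are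
  derived from this equivalence.\<close>

lemma blen_le_iff: "blen n \<le> k \<longleftrightarrow> n < 2 ^ k"
proof -
  have "blen n \<le> k \<longleftrightarrow> log 2 (real n + 1) \<le> real k"
    unfolding blen_def by (simp add: nat_le_iff ceiling_le_iff)
  also have "\<dots> \<longleftrightarrow> real n + 1 \<le> 2 powr real k"
    by (rule log_le_iff) auto
  also have "\<dots> \<longleftrightarrow> real (n + 1) \<le> real (2 ^ k)"
    by (simp add: powr_realpow add.commute)
  also have "\<dots> \<longleftrightarrow> n < 2 ^ k" by (subst of_nat_le_iff) auto
  finally show ?thesis .
qed

lemma blen_0 [simp]: "blen 0 = 0"
  using blen_le_iff[of 0 0] by simp

lemma blen_rec: "0 < n \<Longrightarrow> blen n = Suc (blen (n div 2))"
proof -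
  assume n: "0 < n"
  have "blen n \<le> k \<longleftrightarrow> Suc (blen (n div 2)) \<le> k" for k
  proof (cases k)
    case 0
    then show ?thesis using n blen_le_iff[of n 0] by auto
  next
    case (Suc j)
    show ?thesis unfolding Suc Suc_le_mono blen_le_iff by (simp add: div_less_iff_less_mult mult.commute)
  qed
  then show ?thesis by (meson order_antisym order_refl)
qed

lemma length_bits [simp]: "length (bits n) = blen n"
  by (simp add: bits_def)

lemma bits_0 [simp]: "bits 0 = []"
  by (simp add: bits_def)

lemma bits_rec: "0 < n \<Longrightarrow> bits n = odd n # bits (n div 2)"
  unfolding bits_def by (subst blen_rec, assumption, subst upt_rec)
    (auto simp: map_Suc_upt[symmetric] bit_Suc bit_0 simp del: upt_Suc)

lemma horner_bits [simp]: "horner_sum of_bool 2 (bits n) = (n::nat)"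
proof (induction n rule: less_induct)
  case (less n)
  then show ?case by (cases "n = 0") (auto simp: bits_rec horner_sum_simps)
qed

lemma bits_inject: "bits m = bits n \<longleftrightarrow> m = n"
  by (metis horner_bits)

lemma btree_inject [simp]: "btree a = btree b \<longleftrightarrow> a = b"
  by (auto simp: btree_def)

lemma wtree_inject [simp]: "wtree v = wtree w \<longleftrightarrow> v = w"
proof (induction v arbitrary: w)
  case Nil
  then show ?case by (cases w) auto
next
  case (Cons a v)
  then show ?case by (cases w) auto
qed

instantiation tree :: enc begin
definition "enc (t::tree) = t"
instance by standard (simp add: enc_tree_def)
end

instantiation bool :: enc begin
definition "enc b = btree b"
instance by standard (simp add: enc_bool_def)
end

instantiation unit :: enc begin
definition "enc (u::unit) = Lf"
instance by standard simp
end

instantiation nat :: enc begin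
definition "enc n = wtree (bits n)"
instance by standard (simp add: enc_nat_def bits_inject)
end

instantiation prod :: (enc, enc) enc begin
definition "enc p = Nd (enc (fst p)) (enc (snd p))"
instance by standard (auto simp: enc_prod_def enc_inject prod_eq_iff)
end

instantiation list :: (enc) enc begin
primrec enc_list :: "'a list \<Rightarrow> tree" where
  "enc_list [] = Lf"
| "enc_list (a # as) = Nd (enc a) (enc_list as)"
instance
proof
  show "enc x = enc y \<longleftrightarrow> x = y" for x y :: "'a list"
  proof (induction x arbitrary: y)
    case Nil
    then show ?case by (cases y) auto
  next
    case (Cons a x)
    then show ?case by (cases y) (auto simp: enc_inject)
  qed
qed
end

lemma enc_wtree: "enc w = wtree w"
  by (induction w) (auto simp: enc_bool_def)

lemma enc_bits: "enc (bits n) = enc n"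
  by (simp add: enc_wtree enc_nat_def)

definition sz :: "'a::enc \<Rightarrow> nat" where "sz x = tsz (enc x)"

lemma sz_pos: "0 < sz x" by (simp add: sz_def)

lemma sz_simps [simp]:
  "sz (a, b) = Suc (sz a + sz b)" "sz ([]::'a::enc list) = 1" "sz (a # as) = Suc (sz a + sz as)" "sz u = 1"
  for a :: "'a::enc" and b :: "'b::enc" and as :: "'a list" and u :: unit
  by (simp_all add: sz_def enc_prod_def enc_unit_def)

lemma sz_fst_snd: "sz (fst p) \<le> sz p" "sz (snd p) \<le> sz p"
  by (cases p; simp)+

text \<open>The closure rules follow the shape of the term and are collected in
  \<open>fp_intro\<close>, so that most polynomial-time claims about explicit definitions are proved
  by introduction rules alone.\<close>

definition fp :: "('a::enc \<Rightarrow> 'b::enc) \<Rightarrow> bool" where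
  "fp f \<longleftrightarrow> tfp enc (\<lambda>x. enc (f x))"

named_theorems fp_intro

lemma fp_id [fp_intro]: "fp (\<lambda>x. x)"
  unfolding fp_def by (rule tfp_id)

lemma fp_const [fp_intro]: "fp (\<lambda>_. c)"
  unfolding fp_def by (rule tfp_const)

lemma fp_comp: "fp f \<Longrightarrow> fp g \<Longrightarrow> fp (\<lambda>x. f (g x))"
  unfolding fp_def by (rule tfp_comp[OF tfp_inst])

lemma fp_Pair [fp_intro]: "fp f \<Longrightarrow> fp g \<Longrightarrow> fp (\<lambda>x. (f x, g x))"
  unfolding fp_def by (simp add: enc_prod_def tfp_Nd)

lemma fp_fst [fp_intro]: "fp f \<Longrightarrow> fp (\<lambda>x. fst (f x :: 'a::enc \<times> 'b::enc))"
proof -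
  have "fp (fst :: 'a \<times> 'b \<Rightarrow> 'a)"
    using tfp_lsub[of "enc :: 'a \<times> 'b \<Rightarrow> tree"] by (simp add: fp_def enc_prod_def)
  moreover assume "fp f"
  ultimately show ?thesis by (rule fp_comp)
qed

lemma fp_snd [fp_intro]: "fp f \<Longrightarrow> fp (\<lambda>x. snd (f x :: 'a::enc \<times> 'b::enc))"
proof -
  have "fp (snd :: 'a \<times> 'b \<Rightarrow> 'b)"
    using tfp_rsub[of "enc :: 'a \<times> 'b \<Rightarrow> tree"] by (simp add: fp_def enc_prod_def)
  moreover assume "fp f"
  ultimately show ?thesis by (rule fp_comp)
qed

lemma fp_comp2: "fp (\<lambda>p. F (fst p) (snd p)) \<Longrightarrow> fp f \<Longrightarrow> fp g \<Longrightarrow> fp (\<lambda>x. F (f x) (g x))"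
  using fp_comp[of "\<lambda>p. F (fst p) (snd p)" "\<lambda>x. (f x, g x)"] fp_Pair[of f g] by simp

lemma fp_comp3: "fp (\<lambda>p. F (fst p) (fst (snd p)) (snd (snd p))) \<Longrightarrow> fp f \<Longrightarrow> fp g \<Longrightarrow> fp h \<Longrightarrow>
  fp (\<lambda>x. F (f x) (g x) (h x))"
  using fp_comp[of "\<lambda>p. F (fst p) (fst (snd p)) (snd (snd p))" "\<lambda>x. (f x, g x, h x)"]
    fp_Pair[of f "\<lambda>x. (g x, h x)"] fp_Pair[of g h] by simp

lemma fp_if [fp_intro]:
  assumes "fp P" "fp f" "fp g"
  shows "fp (\<lambda>x. if P x then f x else g x)"
proof -
  have "enc (if P x then f x else g x) = (if enc (P x) = Lf then enc (g x) else enc (f x))" for x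
    by (simp add: enc_bool_def btree_def)
  then show ?thesis using assms unfolding fp_def by (simp add: tfp_if)
qed

lemma fp_Cons [fp_intro]: "fp f \<Longrightarrow> fp g \<Longrightarrow> fp (\<lambda>x. f x # g x)"
  unfolding fp_def by (simp add: tfp_Nd)

lemma fp_list_case [fp_intro]:
  assumes "fp l" "fp a" "fp (\<lambda>p. b (fst p) (fst (snd p)) (snd (snd p)))"
  shows "fp (\<lambda>x. case l x of [] \<Rightarrow> a x | h # t \<Rightarrow> b x h t)"
proof -
  text \<open>On the empty list the program for \<open>b\<close> must not be run.\<close>
  obtain cl i where l: "\<And>x n. sz x \<le> n \<Longrightarrow> runs cl (tcode (enc x)) ((n + 2) ^ i) (tcode (enc (l x)))"
    "\<And>x n. sz x \<le> n \<Longrightarrow> sz (l x) \<le> n + (n + 2) ^ i"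
    using tfp_runs[OF assms(1)[unfolded fp_def]] unfolding sz_def by blast
  obtain ca j where a: "\<And>x n. sz x \<le> n \<Longrightarrow> runs ca (tcode (enc x)) ((n + 2) ^ j) (tcode (enc (a x)))"
    using tfp_runs[OF assms(2)[unfolded fp_def]] unfolding sz_def by blast
  obtain cb k where b: "\<And>p n. sz p \<le> n \<Longrightarrow> runs cb (tcode (enc p)) ((n + 2) ^ k)
     (tcode (enc (b (fst p) (fst (snd p)) (snd (snd p)))))"
    using tfp_runs[OF assms(3)[unfolded fp_def]] unfolding sz_def by blast
  let ?n = "\<lambda>n. n + n + (n + 2) ^ i + 2"
  let ?u = "\<lambda>n. 14 * n + 5 * 1 + (n + 2) ^ i + 20"
  let ?T = "\<lambda>n. 12 * n + 3 * (n + 2) ^ i + ((n + 2) ^ j + Suc (?u n + (?n n + 2) ^ k)) + 20"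
  have "runs (ifc cl ca (Seq (pairc Skip cl) cb)) (tcode (enc x)) (?T (sz x))
     (tcode (enc (case l x of [] \<Rightarrow> a x | h # t \<Rightarrow> b x h t)))" for x
  proof -
    have "length (tcode (enc x)) = sz x" by (simp add: sz_def tsz_def)
    moreover have "runs (ifc cl ca (Seq (pairc Skip cl) cb)) (tcode (enc x))
      (12 * length (tcode (enc x)) + 3 * (sz x + 2) ^ i + ((sz x + 2) ^ j + Suc (?u (sz x) + (?n (sz x) + 2) ^ k)) + 20)
     (tcode (enc (case l x of [] \<Rightarrow> a x | h # t \<Rightarrow> b x h t)))"
    proof (rule runs_if[OF l(1)[OF order_refl]])
      assume "enc (l x) = Lf"
      then have "l x = []" by (cases "l x") auto
      then show "runs ca (tcode (enc x)) ((sz x + 2) ^ j + Suc (?u (sz x) + (?n (sz x) + 2) ^ k))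
          (tcode (enc (case l x of [] \<Rightarrow> a x | h # t \<Rightarrow> b x h t)))"
        using runs_mono[OF a[of x, OF order_refl]] by simp
    next
      assume "enc (l x) \<noteq> Lf"
      then obtain h t where ht: "l x = h # t" by (cases "l x") auto
      have 1: "runs Skip w 1 w" for w unfolding runs_def by (auto intro!: exec.Skip)
      have 2: "runs (pairc Skip cl) (tcode (enc x)) (?u (sz x)) (tcode (enc (x, h, t)))"
        using runs_pair[OF 1[of "tcode (enc x)"] l(1)[of x, OF order_refl]] ht
        by (simp add: enc_prod_def sz_def tsz_def)
      have n: "sz (x, h, t) \<le> ?n (sz x)" using l(2)[of x, OF order_refl] ht by simp
      show "runs (Seq (pairc Skip cl) cb) (tcode (enc x)) ((sz x + 2) ^ j + Suc (?u (sz x) + (?n (sz x) + 2) ^ k))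
          (tcode (enc (case l x of [] \<Rightarrow> a x | h # t \<Rightarrow> b x h t)))"
        using runs_mono[OF runs_Seq[OF 2 b[OF n]], of "(sz x + 2) ^ j + Suc (?u (sz x) + (?n (sz x) + 2) ^ k)"]
        by (simp add: ht)
    qed
    ultimately show ?thesis by simp
  qed
  then show ?thesis unfolding fp_def sz_def
    by (rule tfpI[rotated]) (intro pbn_intros)
qed

lemma fp_Not [fp_intro]: "fp P \<Longrightarrow> fp (\<lambda>x. \<not> P x)"
proof -
  assume "fp P"
  moreover have "(\<lambda>x. \<not> P x) = (\<lambda>x. if P x then False else True)" by auto
  ultimately show ?thesis by (simp only: fp_if fp_const)
qed

lemma fp_conj [fp_intro]: "fp P \<Longrightarrow> fp Q \<Longrightarrow> fp (\<lambda>x. P x \<and> Q x)"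
proof -
  assume "fp P" "fp Q"
  moreover have "(\<lambda>x. P x \<and> Q x) = (\<lambda>x. if P x then Q x else False)" by auto
  ultimately show ?thesis by (simp only: fp_if fp_const)
qed

lemma fp_disj [fp_intro]: "fp P \<Longrightarrow> fp Q \<Longrightarrow> fp (\<lambda>x. P x \<or> Q x)"
proof -
  assume "fp P" "fp Q"
  moreover have "(\<lambda>x. P x \<or> Q x) = (\<lambda>x. if P x then True else Q x)" by auto
  ultimately show ?thesis by (simp only: fp_if fp_const)
qed

lemma fp_imp [fp_intro]: "fp P \<Longrightarrow> fp Q \<Longrightarrow> fp (\<lambda>x. P x \<longrightarrow> Q x)"
proof -
  assume "fp P" "fp Q"
  moreover have "(\<lambda>x. P x \<longrightarrow> Q x) = (\<lambda>x. if P x then Q x else True)" by auto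
  ultimately show ?thesis by (simp only: fp_if fp_const)
qed

lemma fp_null [fp_intro]: "fp l \<Longrightarrow> fp (\<lambda>x. l x = [])"
proof -
  assume "fp l"
  moreover have "(\<lambda>x. l x = []) = (\<lambda>x. case l x of [] \<Rightarrow> True | h # t \<Rightarrow> False)"
    by (rule ext) (simp split: list.split)
  ultimately show ?thesis by (simp only: fp_list_case fp_const)
qed

lemma fp_tl [fp_intro]: "fp (l :: 'b::enc \<Rightarrow> 'a::enc list) \<Longrightarrow> fp (\<lambda>x. tl (l x))"
proof -
  have "enc (tl xs) = rsub (enc xs)" for xs :: "'a list" by (cases xs) auto
  then have "fp (tl :: 'a list \<Rightarrow> 'a list)" using tfp_rsub[of "enc :: 'a list \<Rightarrow> tree"] by (simp add: fp_def)
  moreover assume "fp l"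
  ultimately show ?thesis by (rule fp_comp)
qed

subsection \<open>Polynomial bounds on sizes\<close>

definition pb :: "('a::enc \<Rightarrow> nat) \<Rightarrow> bool" where
  "pb B \<longleftrightarrow> (\<exists>q. pbn q \<and> mono q \<and> (\<forall>x. B x \<le> q (sz x)))"

lemma pbI: "pbn q \<Longrightarrow> mono q \<Longrightarrow> (\<And>x. B x \<le> q (sz x)) \<Longrightarrow> pb B"
  unfolding pb_def by blast

lemma pb_const [fp_intro]: "pb (\<lambda>_. c)"
  by (rule pbI[of "\<lambda>_. c"]) (auto simp: mono_def)

lemma pb_sz: "fp f \<Longrightarrow> pb (\<lambda>x. sz (f x))"
  unfolding fp_def pb_def sz_def using tfp_size by metis

lemma pb_self: "pb sz"
  by (rule pbI[of "\<lambda>n. n"]) (auto simp: mono_def)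

lemma pb_add [fp_intro]: "pb B \<Longrightarrow> pb C \<Longrightarrow> pb (\<lambda>x. B x + C x)"
  unfolding pb_def
  by (elim exE conjE, rule_tac x="\<lambda>n. q n + qa n" in exI)
    (auto intro!: pbn_add add_mono simp: mono_def)

lemma pb_mult [fp_intro]: "pb B \<Longrightarrow> pb C \<Longrightarrow> pb (\<lambda>x. B x * C x)"
  unfolding pb_def
  by (elim exE conjE, rule_tac x="\<lambda>n. q n * qa n" in exI)
    (auto intro!: pbn_mult mult_le_mono simp: mono_def)

lemma pb_Suc [fp_intro]: "pb B \<Longrightarrow> pb (\<lambda>x. Suc (B x))"
  using pb_add[OF _ pb_const, of B 1] by simp

lemma pb_power [fp_intro]: "pb B \<Longrightarrow> pb (\<lambda>x. B x ^ k)"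
  by (induction k) (auto intro: fp_intro)

subsection \<open>Bounded iteration\<close>

lemma fp_iter:
  fixes f :: "'a::enc \<Rightarrow> 'a"
  assumes "fp f" "fp g" "fp h" "pb B"
    "\<And>x i. i \<le> nodes (enc (g (h x))) \<Longrightarrow> sz ((f ^^ i) (h x)) \<le> B x"
  shows "fp (\<lambda>x. (f ^^ nodes (enc (g (h x)))) (h x))"
proof -
  obtain q where q: "pbn q" "\<And>x. B x \<le> q (sz x)" using assms(4) unfolding pb_def by blast
  show ?thesis unfolding fp_def
    by (rule tfp_iter[where a=enc and F=f and g="\<lambda>x. enc (g x)" and q=q])
      (use assms(1-3,5) q in \<open>auto simp: fp_def sz_def intro: order_trans\<close>)
qed

lemma length_le_nodes: "length xs \<le> nodes (enc xs)"
  by (induction xs) auto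

lemma nodes_le: "nodes t \<le> tsz t"
  by (simp add: nodes_def tsz_def)

lemma length_le_sz: "length xs \<le> sz xs"
  using length_le_nodes[of xs] nodes_le[of "enc xs"] by (simp add: sz_def)

lemma sz_append: "sz (xs @ ys) + 1 = sz xs + sz ys"
  by (induction xs) auto

lemma sz_rev [simp]: "sz (rev xs) = sz xs"
proof (induction xs)
  case (Cons a xs)
  then show ?case using sz_append[of "rev xs" "[a]"] by simp
qed simp

lemma sz_mem: "a \<in> set xs \<Longrightarrow> sz a \<le> sz xs"
  by (induction xs) auto

lemma sz_list_bound:
  assumes "\<And>a. a \<in> set xs \<Longrightarrow> sz a \<le> b"
  shows "sz xs \<le> Suc (length xs * Suc b)"
  using assms by (induction xs) (fastforce simp: add_le_mono)+

text \<open>Bounded recursion. A polynomial-time step does not suffice, since iterated doubling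
  grows exponentially; hence the intermediate results on all prefixes must obey a polynomial
  bound.\<close>

lemma fp_foldl:
  assumes "fp (\<lambda>p. f (fst p) (fst (snd p)) (snd (snd p)))" "fp i" "fp l" "pb B"
    "\<And>x ys zs. l x = ys @ zs \<Longrightarrow> sz (foldl (f x) (i x) ys) \<le> B x"
  shows "fp (\<lambda>x. foldl (f x) (i x) (l x))"
proof -
  \<comment> \<open>The state carries the parameter, the accumulator and the rest of the list, and
    idles once the list is used up. So it does no harm that the encoded list has more inner nodes
    than elements.\<close>
  define st where "st = (\<lambda>p. case snd (snd p) of [] \<Rightarrow> (fst p, fst (snd p), [])
     | h # t \<Rightarrow> (fst p, f (fst p) (fst (snd p)) h, t))"
  have st: "fp st" unfolding st_def
  proof (intro fp_list_case)
    show "fp (\<lambda>p. (fst (fst p), f (fst (fst p)) (fst (snd (fst p))) (fst (snd p)), snd (snd p)))"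
      by (intro fp_intro fp_comp3[OF assms(1)])
  qed (intro fp_intro)+
  have it: "(st ^^ n) (x, s, l) = (x, foldl (f x) s (take n l), drop n l)" for n x s l
    by (induction n arbitrary: s l) (auto simp: funpow_Suc_right st_def split: list.split simp del: funpow.simps)
  define h where "h x = (x, i x, l x)" for x
  have "fp (\<lambda>x. (st ^^ nodes (enc (snd (snd (h x))))) (h x))"
  proof (rule fp_iter[OF st])
    show "fp h" unfolding h_def by (intro fp_intro assms)
    show "pb (\<lambda>x. Suc (Suc (sz x + (B x + sz (l x)))))" by (intro fp_intro pb_sz pb_self assms)
    show "sz ((st ^^ n) (h x)) \<le> Suc (Suc (sz x + (B x + sz (l x))))" for n x
      using assms(5)[of x "take n (l x)" "drop n (l x)"] sz_append[of "take n (l x)" "drop n (l x)"]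
        sz_pos[of "take n (l x)"]
      unfolding h_def it by (simp del: sz_pos)
  qed (intro fp_intro)
  then have "fp (\<lambda>x. fst (snd ((st ^^ nodes (enc (snd (snd (h x))))) (h x))))" by (intro fp_intro)
  moreover have "fst (snd ((st ^^ nodes (enc (snd (snd (h x))))) (h x))) = foldl (f x) (i x) (l x)" for x
    unfolding h_def it using length_le_nodes[of "l x"] by simp
  ultimately show ?thesis by simp
qed

subsection \<open>Lists\<close>

lemma fp_rev [fp_intro]:
  assumes "fp l"
  shows "fp (\<lambda>x. rev (l x :: 'a::enc list))"
proof (rule fp_comp[OF _ assms])
  have 1: "foldl (\<lambda>s a. a # s) [] ys = rev ys" for ys :: "'a list" by (induction ys rule: rev_induct) auto
  have "fp (\<lambda>x. foldl (\<lambda>s a. a # s) [] (x :: 'a list))"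
  proof (rule fp_foldl[where f="\<lambda>_ s a. a # s"])
    show "pb (sz :: 'a list \<Rightarrow> nat)" by (rule pb_self)
    show "x = ys @ zs \<Longrightarrow> sz (foldl (\<lambda>s a. a # s) [] ys) \<le> sz x" for x ys zs :: "'a list"
      using sz_append[of ys zs] sz_pos[of zs] unfolding 1 by (simp del: sz_pos)
  qed (intro fp_intro)+
  then show "fp (rev :: 'a list \<Rightarrow> 'a list)" unfolding 1 .
qed

lemma fp_append [fp_intro]:
  assumes "fp l" "fp m"
  shows "fp (\<lambda>x. l x @ (m x :: 'a::enc list))"
proof -
  have 1: "foldl (\<lambda>s a. a # s) w ys = rev ys @ w" for ys w :: "'a list"
    by (induction ys arbitrary: w) auto
  have "fp (\<lambda>p. foldl (\<lambda>s a. a # s) (snd p) (rev (fst p) :: 'a list))"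
  proof (rule fp_foldl[where f="\<lambda>_ s a. a # s"])
    show "pb (\<lambda>p::'a list \<times> 'a list. sz (fst p) + sz (snd p))" by (intro fp_intro pb_sz)
    show "rev (fst p) = ys @ zs \<Longrightarrow> sz (foldl (\<lambda>s a. a # s) (snd p) ys) \<le> sz (fst p) + sz (snd p)"
      for p :: "'a list \<times> 'a list" and ys zs
      using sz_append[of ys zs] sz_pos[of zs] sz_append[of "rev ys" "snd p"] sz_rev[of "fst p"]
      unfolding 1 by (simp del: sz_pos)
  qed (intro fp_intro)+
  then have "fp (\<lambda>p. fst p @ (snd p :: 'a list))" unfolding 1 by simp
  then show ?thesis by (rule fp_comp2[where F="(@)"]) (rule assms)+
qed

lemma fp2_bound:
  assumes "fp (\<lambda>p. g (fst p) (snd p))"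
  shows "\<exists>k. \<forall>x a. sz (g x a) \<le> (sz x + sz a + 3) ^ k"
proof -
  obtain q where q: "pbn q" "\<And>p. sz (g (fst p) (snd p)) \<le> q (sz p)" 
    using pb_sz[OF assms] unfolding pb_def by blast
  obtain k where k: "\<And>n. q n \<le> (n + 2) ^ k" using q(1) unfolding pbn_def by blast
  have "sz (g x a) \<le> (sz x + sz a + 3) ^ k" for x a
    using order_trans[OF q(2)[of "(x, a)"] k] by (simp add: eval_nat_numeral)
  then show ?thesis by blast
qed

lemma sz_concat_map:
  assumes "\<And>a. a \<in> set ys \<Longrightarrow> sz (g a) \<le> b"
  shows "sz (concat (map g ys)) \<le> Suc (length ys * b)"
  using assms
proof (induction ys)
  case (Cons a ys)
  have "sz (g a) \<le> b" "sz (concat (map g ys)) \<le> Suc (length ys * b)" using Cons by auto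
  then show ?case using sz_append[of "g a" "concat (map g ys)"] by simp
qed simp

lemma fp_concat_map [fp_intro]:
  assumes "fp (\<lambda>p. g (fst p) (snd p))" "fp l"
  shows "fp (\<lambda>x. concat (map (g x) (l x)))"
proof -
  obtain k where k: "\<And>x a. sz (g x a) \<le> (sz x + sz a + 3) ^ k" using fp2_bound[OF assms(1)] by blast
  have 1: "foldl (\<lambda>s a. s @ g x a) [] ys = concat (map (g x) ys)" for x ys
    by (induction ys rule: rev_induct) auto
  have "fp (\<lambda>x. foldl (\<lambda>s a. s @ g x a) [] (l x))"
  proof (rule fp_foldl[where f="\<lambda>x s a. s @ g x a"])
    show "fp (\<lambda>p. fst (snd p) @ g (fst p) (snd (snd p)))"
      by (intro fp_intro fp_comp2[OF assms(1)])
    show "pb (\<lambda>x. Suc (sz (l x) * (sz x + sz (l x) + 3) ^ k))"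
      by (intro fp_intro pb_sz pb_self assms)
    show "sz (foldl (\<lambda>s a. s @ g x a) [] ys) \<le> Suc (sz (l x) * (sz x + sz (l x) + 3) ^ k)"
      if "l x = ys @ zs" for x ys zs
    proof -
      have "sz (g x a) \<le> (sz x + sz (l x) + 3) ^ k" if "a \<in> set ys" for a
        using sz_mem[of a "l x"] that \<open>l x = ys @ zs\<close> by (intro order_trans[OF k] power_mono) auto
      from sz_concat_map[OF this]
      have "sz (concat (map (g x) ys)) \<le> Suc (length ys * (sz x + sz (l x) + 3) ^ k)" .
      also have "length ys \<le> sz (l x)" using that length_le_sz[of "l x"] by simp
      finally show ?thesis unfolding 1 by simp
    qed
  qed (intro fp_intro assms)+
  then show ?thesis unfolding 1 .
qed

lemma fp_map [fp_intro]:
  assumes "fp (\<lambda>p. g (fst p) (snd p))" "fp l"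
  shows "fp (\<lambda>x. map (g x) (l x))"
proof -
  have "fp (\<lambda>x. concat (map (\<lambda>a. [g x a]) (l x)))" by (intro fp_intro assms)
  moreover have "concat (map (\<lambda>a. [h a]) ys) = map h ys" for h :: "'c \<Rightarrow> 'b" and ys by (induction ys) auto
  ultimately show ?thesis by simp
qed

text \<open>As the list is constant, the program may depend on its elements in an arbitrary way; no
  uniformity in \<open>a\<close> is asked for.\<close>

lemma fp_concat_const:
  "(\<And>a. a \<in> set as \<Longrightarrow> fp (\<lambda>x. g x a)) \<Longrightarrow> fp (\<lambda>x. concat (map (g x) as))"
proof (induction as)
  case Nil
  then show ?case by (simp add: fp_const)
next
  case (Cons a as)
  then show ?case by (simp add: fp_append)
qed

lemma fp_ball [fp_intro]:
  assumes "fp (\<lambda>p. P (fst p) (snd p))" "fp l"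
  shows "fp (\<lambda>x. \<forall>a\<in>set (l x). P x a)"
proof -
  have "fp (\<lambda>x. concat (map (\<lambda>a. if P x a then [] else [()]) (l x)) = [])" by (intro fp_intro assms)
  moreover have "(concat (map (\<lambda>a. if P x a then [] else [()]) (l x)) = []) \<longleftrightarrow> (\<forall>a\<in>set (l x). P x a)" for x
    by auto
  ultimately show ?thesis by simp
qed

lemma fp_bex [fp_intro]:
  assumes "fp (\<lambda>p. P (fst p) (snd p))" "fp l"
  shows "fp (\<lambda>x. \<exists>a\<in>set (l x). P x a)"
proof -
  have "fp (\<lambda>x. \<not> (\<forall>a\<in>set (l x). \<not> P x a))" by (intro fp_intro assms)
  then show ?thesis by simp
qed

text \<open>A default is supplied because the value of \<open>hd []\<close> is unspecified.\<close>

definition hdd :: "'a \<Rightarrow> 'a list \<Rightarrow> 'a" where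
  "hdd d l = (case l of [] \<Rightarrow> d | a # as \<Rightarrow> a)"

lemma hdd_simps [simp]: "hdd d [] = d" "hdd d (a # as) = a"
  by (simp_all add: hdd_def)

lemma fp_hdd [fp_intro]: "fp d \<Longrightarrow> fp l \<Longrightarrow> fp (\<lambda>x. hdd (d x) (l x))"
  unfolding hdd_def by (intro fp_intro)

lemma fp_drop [fp_intro]:
  assumes "fp u" "fp l"
  shows "fp (\<lambda>x. drop (length (u x)) (l x :: 'a::enc list))"
proof -
  have 1: "foldl (\<lambda>s a. tl s) w ys = drop (length ys) w" for ys :: "'c list" and w :: "'a list"
    by (induction ys arbitrary: w) (auto simp: drop_Suc)
  have "fp (\<lambda>x. foldl (\<lambda>s a. tl s) (l x) (u x))"
  proof (rule fp_foldl[where f="\<lambda>_ s a. tl s"])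
    show "pb (\<lambda>x. sz (l x))" by (intro pb_sz assms)
    show "sz (foldl (\<lambda>s a. tl s) (l x) ys) \<le> sz (l x)" for x and ys :: "'c list"
      using sz_append[of "take (length ys) (l x)" "drop (length ys) (l x)"] sz_pos[of "take (length ys) (l x)"]
      unfolding 1 by (simp del: sz_pos)
  qed (intro fp_intro assms)+
  then show ?thesis unfolding 1 .
qed

lemma fp_butlast [fp_intro]:
  assumes "fp l"
  shows "fp (\<lambda>x. butlast (l x :: 'c::enc list))"
proof -
  have "fp (\<lambda>x. rev (tl (rev (l x))))" by (intro fp_intro assms)
  moreover have "rev (tl (rev l)) = butlast l" for l :: "'c list" by (metis butlast_rev rev_rev_ident)
  ultimately show ?thesis by simp
qed

lemma fp_iff [fp_intro]: "fp P \<Longrightarrow> fp Q \<Longrightarrow> fp (\<lambda>x. P x = (Q x :: bool))"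
proof -
  assume "fp P" "fp Q"
  moreover have "(\<lambda>x. P x = Q x) = (\<lambda>x. if P x then Q x else \<not> Q x)" by auto
  ultimately show ?thesis by (simp only: fp_if fp_Not)
qed

subsection \<open>Natural numbers\<close>

lemma sz_nat: "sz (n::nat) = sz (bits n)"
  by (simp add: sz_def enc_bits)

lemma sz_bool [simp]: "sz True = 3" "sz False = 1"
  by (simp_all add: sz_def enc_bool_def btree_def)

lemma sz_bools: "sz (w :: bool list) \<le> Suc (4 * length w)"
proof -
  have "sz b \<le> 3" for b :: bool by (cases b) auto
  then show ?thesis using sz_list_bound[of w 3] by simp
qed

lemma sz_nat_le: "sz (n::nat) \<le> Suc (4 * blen n)"
  using sz_bools[of "bits n"] by (simp add: sz_nat)

lemma blen_le_sz: "blen n \<le> sz n"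
  using length_le_sz[of "bits n"] by (simp add: sz_nat)

lemma blen_mono: "m \<le> n \<Longrightarrow> blen m \<le> blen n"
  using blen_le_iff[of n "blen n"] blen_le_iff[of m "blen n"] by simp

lemma less_pow_blen: "n < 2 ^ blen n"
  using blen_le_iff[of n "blen n"] by simp

lemma blen_le: "blen n \<le> n"
  by (simp add: blen_le_iff)

lemma blen_add: "blen (a + b) \<le> Suc (blen a + blen b)"
proof -
  have "a + b < 2 ^ blen a + 2 ^ blen b" using less_pow_blen[of a] less_pow_blen[of b] by simp
  also have "\<dots> \<le> 2 ^ (blen a + blen b) + 2 ^ (blen a + blen b)"
    by (intro add_mono power_increasing) auto
  finally show ?thesis by (simp add: blen_le_iff)
qed

lemma blen_mult: "blen (a * b) \<le> blen a + blen b"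
  unfolding blen_le_iff power_add
  by (rule mult_strict_mono[OF less_pow_blen less_pow_blen]) auto

lemma blen_double [simp]: "0 < n \<Longrightarrow> blen (2 * n) = Suc (blen n)" "blen (Suc (2 * n)) = Suc (blen n)"
  by (simp_all add: blen_rec)

lemma fp_bits [fp_intro]: "fp f \<Longrightarrow> fp (\<lambda>x. bits (f x))"
  by (simp add: fp_def enc_bits)

lemma fp_half [fp_intro]: "fp f \<Longrightarrow> fp (\<lambda>x. f x div 2 :: nat)"
proof -
  assume "fp f"
  have "enc (n div 2) = enc (tl (bits n))" for n :: nat
    by (cases "n = 0") (auto simp: bits_rec[of n] enc_bits enc_nat_def)
  moreover have "fp (\<lambda>x. tl (bits (f x)))" by (intro fp_intro \<open>fp f\<close>)
  ultimately show ?thesis by (simp add: fp_def)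
qed

lemma fp_odd [fp_intro]: "fp f \<Longrightarrow> fp (\<lambda>x. odd (f x :: nat))"
proof -
  assume "fp f"
  have "odd n = hdd False (bits n)" for n :: nat
    by (cases "n = 0") (auto simp: bits_rec[of n])
  moreover have "fp (\<lambda>x. hdd False (bits (f x)))" by (intro fp_intro \<open>fp f\<close>)
  ultimately show ?thesis by simp
qed

lemma fp_even [fp_intro]: "fp f \<Longrightarrow> fp (\<lambda>x. even (f x :: nat))"
  using fp_Not[OF fp_odd[of f]] by simp

lemma fp_zero [fp_intro]: "fp f \<Longrightarrow> fp (\<lambda>x. f x = (0::nat))"
proof -
  assume "fp f"
  have "n = 0 \<longleftrightarrow> bits n = []" for n :: nat
    by (cases "n = 0") (auto simp: bits_rec[of n])
  moreover have "fp (\<lambda>x. bits (f x) = [])" by (intro fp_intro \<open>fp f\<close>)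
  ultimately show ?thesis by simp
qed

definition dbl :: "bool \<Rightarrow> nat \<Rightarrow> nat" where "dbl b n = 2 * n + of_bool b"

lemma bits_dbl: "bits (dbl b n) = (if b \<or> n \<noteq> 0 then b # bits n else [])"
  by (cases "dbl b n = 0") (auto simp: dbl_def bits_rec[of "dbl b n"] bits_rec[of "Suc _"] bits_rec[of "2 * _"])

lemma fp_dbl [fp_intro]: "fp b \<Longrightarrow> fp f \<Longrightarrow> fp (\<lambda>x. dbl (b x) (f x))"
proof -
  assume *: "fp b" "fp f"
  have "enc (dbl c n) = enc (if c \<or> n \<noteq> 0 then c # bits n else [])" for c n
    unfolding bits_dbl[symmetric] by (simp add: enc_bits)
  moreover have "fp (\<lambda>x. if b x \<or> f x \<noteq> 0 then b x # bits (f x) else [])" by (intro fp_intro *)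
  ultimately show ?thesis by (simp add: fp_def)
qed

definition num :: "bool list \<Rightarrow> nat" where "num w = foldr dbl w 0"

lemma num_simps [simp]: "num [] = 0" "num (b # w) = dbl b (num w)"
  by (simp_all add: num_def)

lemma num_horner: "num w = horner_sum of_bool 2 w"
  by (induction w) (auto simp: dbl_def horner_sum_simps)

lemma num_bits [simp]: "num (bits n) = n"
  by (simp add: num_horner)

text \<open>A final one is the leading binary digit and protects the zeros before it. In this way
  arbitrary words are passed as numbers later on.\<close>

lemma bits_num_app [simp]: "bits (num (w @ [True])) = w @ [True]"
proof (induction w)
  case Nil
  then show ?case by (simp add: bits_dbl)
next
  case (Cons b w)
  then have "num (w @ [True]) \<noteq> 0" by (metis bits_0 Nil_is_append_conv list.distinct(1))
  then show ?case using Cons by (simp add: bits_dbl)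
qed

lemma blen_num: "blen (num w) \<le> length w"
  unfolding blen_le_iff by (induction w) (auto simp: dbl_def of_bool_def)

lemma blen_foldl_dbl: "blen (foldl (\<lambda>n b. dbl b n) n w) \<le> blen n + length w"
proof (induction w arbitrary: n)
  case (Cons b w)
  have "blen (dbl b n) \<le> Suc (blen n)"
    using less_pow_blen[of n] by (auto simp: blen_le_iff dbl_def of_bool_def)
  then show ?case using Cons[of "dbl b n"] by simp
qed simp

lemma fp_foldl_dbl:
  assumes "fp w"
  shows "fp (\<lambda>x. foldl (\<lambda>n b. dbl b n) 0 (w x))"
proof (rule fp_foldl[where f="\<lambda>_ n b. dbl b n"])
  show "pb (\<lambda>x. Suc (4 * sz (w x)))" by (intro fp_intro pb_sz assms)
  show "sz (foldl (\<lambda>n b. dbl b n) 0 ys) \<le> Suc (4 * sz (w x))" if "w x = ys @ zs" for x ys zs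
  proof -
    have "blen (foldl (\<lambda>n b. dbl b n) 0 ys) \<le> length (w x)" using blen_foldl_dbl[of 0 ys] that by simp
    then show ?thesis using sz_nat_le[of "foldl (\<lambda>n b. dbl b n) 0 ys"] length_le_sz[of "w x"] by linarith
  qed
qed (intro fp_intro assms)+

lemma fp_num [fp_intro]: "fp w \<Longrightarrow> fp (\<lambda>x. num (w x))"
  using fp_foldl_dbl[of "\<lambda>x. rev (w x)"] by (simp add: num_def foldl_conv_foldr fp_rev)

text \<open>The adder keeps \<open>foldl dbl (a + b + c) ds\<close> constant, \<open>ds\<close> being the digits produced so far.\<close>

definition add_step :: "nat \<times> nat \<times> bool \<times> bool list \<Rightarrow> nat \<times> nat \<times> bool \<times> bool list" where
  "add_step p = (let a = fst p; b = fst (snd p); c = fst (snd (snd p)); ds = snd (snd (snd p)) in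
     (a div 2, b div 2, (odd a \<and> odd b) \<or> (c \<and> (odd a \<or> odd b)), (odd a \<longleftrightarrow> (odd b \<longleftrightarrow> c)) # ds))"

lemma add_step_sum:
  assumes "add_step (a, b, c, ds) = (a', b', c', ds')"
  shows "foldl (\<lambda>n b. dbl b n) (a' + b' + of_bool c') ds' = foldl (\<lambda>n b. dbl b n) (a + b + of_bool c) ds"
    "a' + b' + of_bool c' = (a + b + of_bool c) div 2"
proof -
  have d: "ds' = hd ds' # ds" using assms by (auto simp: add_step_def Let_def)
  have v: "dbl (hd ds') (a' + b' + of_bool c') = a + b + of_bool c"
    using assms by (cases "odd a"; cases "odd b"; cases c; auto simp: add_step_def dbl_def elim!: oddE evenE)
  show "foldl (\<lambda>n b. dbl b n) (a' + b' + of_bool c') ds' = foldl (\<lambda>n b. dbl b n) (a + b + of_bool c) ds"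
    by (subst d) (simp add: v)
  have "dbl e n div 2 = n" for e n by (simp add: dbl_def)
  then show "a' + b' + of_bool c' = (a + b + of_bool c) div 2"
    using v by metis
qed

lemma fp_add_step: "fp add_step"
  unfolding add_step_def Let_def by (intro fp_intro)

definition add_run :: "bool list \<Rightarrow> nat \<times> nat \<times> bool \<times> bool list \<Rightarrow> nat \<times> nat \<times> bool \<times> bool list" where
  "add_run w p = foldl (\<lambda>s _. add_step s) p w"

lemma add_run_sum:
  assumes "add_run w (a, b, c, ds) = (a', b', c', ds')"
  shows "foldl (\<lambda>n b. dbl b n) (a' + b' + of_bool c') ds' = foldl (\<lambda>n b. dbl b n) (a + b + of_bool c) ds \<and>
    a' + b' + of_bool c' = (a + b + of_bool c) div 2 ^ length w \<and> length ds' = length ds + length w"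
  using assms
proof (induction w arbitrary: a b c ds)
  case (Cons x w)
  obtain a1 b1 c1 ds1 where 1: "add_step (a, b, c, ds) = (a1, b1, c1, ds1)" using prod_cases4 by blast
  then have "add_run w (a1, b1, c1, ds1) = (a', b', c', ds')" using Cons.prems by (simp add: add_run_def)
  moreover have "length ds1 = Suc (length ds)" using 1 by (auto simp: add_step_def Let_def)
  ultimately show ?case
    using add_step_sum[OF 1] Cons.IH[of a1 b1 c1 ds1]
    by (metis (no_types, lifting) add_Suc add_Suc_right div_mult2_eq length_Cons power_Suc)
qed (simp add: add_run_def)

lemma fp_add [fp_intro]:
  assumes "fp f" "fp g"
  shows "fp (\<lambda>x. f x + g x :: nat)"
proof -
  \<comment> \<open>The list only counts rounds: the two binary lengths plus one suffice to shift
    out both numbers and the carry.\<close>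
  let ?l = "\<lambda>p::nat \<times> nat. bits (fst p) @ bits (snd p) @ [True]"
  let ?i = "\<lambda>p::nat \<times> nat. (fst p, snd p, False, [])"
  have run: "fp (\<lambda>p. add_run (?l p) (?i p))" unfolding add_run_def
  proof (rule fp_foldl[where f="\<lambda>_ s _. add_step s"])
    show "pb (\<lambda>p. 40 * (sz (fst p) + sz (snd p) + 1) :: nat)" by (intro fp_intro pb_sz)
    show "sz (foldl (\<lambda>s _. add_step s) (?i p) ys) \<le> 40 * (sz (fst p) + sz (snd p) + 1)"
      if l: "?l p = ys @ zs" for p ys zs
    proof -
      obtain a b c ds where r: "add_run ys (?i p) = (a, b, c, ds)" using prod_cases4 by blast
      have "length (?l p) = length ys + length zs" using l by simp
      then have y: "length ys \<le> Suc (sz (fst p) + sz (snd p))"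
        using blen_le_sz[of "fst p"] blen_le_sz[of "snd p"] by simp
      have "a + b + of_bool c \<le> fst p + snd p" "length ds = length ys"
        using add_run_sum[OF r] div_le_dividend[of "fst p + snd p" "2 ^ length ys"] by simp_all
      moreover from this have "blen a \<le> blen (fst p + snd p)" "blen b \<le> blen (fst p + snd p)"
        by (auto intro!: blen_mono)
      ultimately have l: "blen a \<le> Suc (sz (fst p) + sz (snd p))" "blen b \<le> Suc (sz (fst p) + sz (snd p))"
        "length ds \<le> Suc (sz (fst p) + sz (snd p))"
        using blen_add[of "fst p" "snd p"] blen_le_sz[of "fst p"] blen_le_sz[of "snd p"] y by simp_all
      have "sz a \<le> 4 * Suc (sz (fst p) + sz (snd p)) + 1" using sz_nat_le[of a] l(1) by simp
      moreover have "sz b \<le> 4 * Suc (sz (fst p) + sz (snd p)) + 1" using sz_nat_le[of b] l(2) by simp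
      moreover have "sz ds \<le> 4 * Suc (sz (fst p) + sz (snd p)) + 1" using sz_bools[of ds] l(3) by simp
      moreover have "sz c \<le> 3" by (cases c) auto
      ultimately show ?thesis using r by (simp add: add_run_def)
    qed
  qed (intro fp_intro fp_comp[OF fp_add_step])+
  have "foldl (\<lambda>n b. dbl b n) 0 (snd (snd (snd (add_run (?l p) (?i p))))) = fst p + snd p" for p
  proof -
    obtain a b c ds where r: "add_run (?l p) (?i p) = (a, b, c, ds)" using prod_cases4 by blast
    have "fst p + snd p < 2 ^ length (?l p)"
      using blen_add[of "fst p" "snd p"] unfolding blen_le_iff by simp
    then have "a + b + of_bool c = 0" using add_run_sum[OF r] by simp
    moreover have "foldl (\<lambda>n b. dbl b n) (a + b + of_bool c) ds = foldl (\<lambda>n b. dbl b n) (fst p + snd p + of_bool False) []"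
      using add_run_sum[OF r] by blast
    ultimately have "foldl (\<lambda>n b. dbl b n) 0 ds = fst p + snd p" by (simp only:) simp
    then show ?thesis unfolding r by simp
  qed
  moreover have "fp (\<lambda>p. foldl (\<lambda>n b. dbl b n) 0 (snd (snd (snd (add_run (?l p) (?i p))))))"
    by (intro fp_foldl_dbl fp_intro run)
  ultimately have "fp (\<lambda>p. fst p + snd p :: nat)" by simp
  then show ?thesis by (rule fp_comp2[where F="(+)"]) (rule assms)+
qed

lemma fp_Suc [fp_intro]: "fp f \<Longrightarrow> fp (\<lambda>x. Suc (f x))"
  using fp_add[OF _ fp_const[of 1], of f] by simp

lemma fp_mult [fp_intro]:
  assumes "fp f" "fp g"
  shows "fp (\<lambda>x. f x * g x :: nat)"
proof -
  \<comment> \<open>Horner's scheme over the digits of the first factor, the most significant one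
    first.\<close>
  let ?f = "\<lambda>p n b. dbl False n + (if b then snd p else (0::nat))"
  have v: "foldl (?f p) 0 (rev w) = snd p * num w" for p :: "nat \<times> nat" and w
    by (induction w) (auto simp: dbl_def algebra_simps)
  have "fp (\<lambda>p. foldl (?f p) 0 (rev (bits (fst p))))"
  proof (rule fp_foldl[where f="?f"])
    show "pb (\<lambda>p. 20 * (sz (fst p) + sz (snd p)) :: nat)" by (intro fp_intro pb_sz)
    show "sz (foldl (?f p) 0 ys) \<le> 20 * (sz (fst p) + sz (snd p))" if l: "rev (bits (fst p)) = ys @ zs"
      for p :: "nat \<times> nat" and ys zs
    proof -
      have "rev ys = drop (length zs) (bits (fst p))"
        using l by (metis append_eq_conv_conj length_rev rev_append rev_rev_ident)
      then have "length (rev ys) \<le> blen (fst p)" by simp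
      then have "blen (num (rev ys)) \<le> sz (fst p)" using blen_num[of "rev ys"] blen_le_sz[of "fst p"] by linarith
      then have "blen (snd p * num (rev ys)) \<le> sz (fst p) + sz (snd p)"
        using blen_mult[of "snd p" "num (rev ys)"] blen_le_sz[of "snd p"] by linarith
      moreover have e: "foldl (?f p) 0 ys = snd p * num (rev ys)" using v[of p "rev ys"] by simp
      moreover define X where "X = snd p * num (rev ys)"
      ultimately have "sz X \<le> Suc (4 * (sz (fst p) + sz (snd p)))"
        using sz_nat_le[of X] by (auto simp: X_def elim!: order_trans)
      moreover have "0 < sz (fst p)" by (rule sz_pos)
      ultimately show ?thesis unfolding e X_def[symmetric] by simp
    qed
  qed (intro fp_intro)+
  then have "fp (\<lambda>p. fst p * snd p :: nat)" unfolding v by (simp add: mult.commute)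
  then show ?thesis by (rule fp_comp2[where F="(*)"]) (rule assms)+
qed

text \<open>Digits are dropped from the low end. The flag records how the dropped parts compare and
  decides only when the remaining numbers are equal; \<open>cmp_inv\<close> expresses this.\<close>

definition cmp_step :: "nat \<times> nat \<times> bool \<Rightarrow> nat \<times> nat \<times> bool" where
  "cmp_step p = (fst p div 2, fst (snd p) div 2,
    if odd (fst p) then (odd (fst (snd p)) \<and> snd (snd p)) else (odd (fst (snd p)) \<or> snd (snd p)))"

definition cmp_inv :: "nat \<times> nat \<times> bool \<Rightarrow> bool" where
  "cmp_inv p \<longleftrightarrow> fst p < fst (snd p) \<or> fst p = fst (snd p) \<and> snd (snd p)"

lemma cmp_inv_step: "cmp_inv (cmp_step p) = cmp_inv p"
  unfolding cmp_inv_def cmp_step_def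
  by (cases "odd (fst p)"; cases "odd (fst (snd p))"; auto elim!: oddE evenE; presburger)

lemma fp_le [fp_intro]:
  assumes "fp f" "fp g"
  shows "fp (\<lambda>x. f x \<le> (g x :: nat))"
proof -
  let ?r = "\<lambda>w p. foldl (\<lambda>s _. cmp_step s) p w"
  have r: "cmp_inv (?r w p) = cmp_inv p \<and> fst (?r w p) = fst p div 2 ^ length w \<and> fst (snd (?r w p)) = fst (snd p) div 2 ^ length w"
    for p and w :: "bool list"
  proof (induction w arbitrary: p)
    case (Cons b w)
    have "fst (cmp_step p) = fst p div 2" "fst (snd (cmp_step p)) = fst (snd p) div 2" by (simp_all add: cmp_step_def)
    then show ?case using Cons[of "cmp_step p"] by (simp add: cmp_inv_step div_mult2_eq)
  qed simp
  let ?l = "\<lambda>p::nat \<times> nat. bits (fst p) @ bits (snd p)"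
  let ?i = "\<lambda>p::nat \<times> nat. (fst p, snd p, True)"
  have "fp (\<lambda>p. ?r (?l p) (?i p))"
  proof (rule fp_foldl[where f="\<lambda>_ s _. cmp_step s"])
    show "pb (\<lambda>p. 20 * (sz (fst p) + sz (snd p)) :: nat)" by (intro fp_intro pb_sz)
    show "sz (?r ys (?i p)) \<le> 20 * (sz (fst p) + sz (snd p))" for p and ys :: "bool list"
    proof -
      obtain a b c where abc: "?r ys (?i p) = (a, b, c)" using prod_cases3 by blast
      have "a \<le> fst p" "b \<le> snd p" using r[of "?i p" ys] unfolding abc by auto
      then have "sz a \<le> Suc (4 * sz (fst p))" "sz b \<le> Suc (4 * sz (snd p))"
        using sz_nat_le[of a] sz_nat_le[of b] blen_mono[of a "fst p"] blen_mono[of b "snd p"]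
          blen_le_sz[of "fst p"] blen_le_sz[of "snd p"] by linarith+
      moreover have "sz c \<le> 3" by (cases c) auto
      ultimately show ?thesis unfolding abc using sz_pos[of "fst p"] sz_pos[of "snd p"]
        by (simp del: sz_pos)
    qed
    show "fp (\<lambda>p. cmp_step (fst (snd p)))" unfolding cmp_step_def by (intro fp_intro)
  qed (intro fp_intro)+
  then have "fp (\<lambda>p. snd (snd (?r (?l p) (?i p))))" by (intro fp_intro)
  moreover have "snd (snd (?r (?l p) (?i p))) \<longleftrightarrow> fst p \<le> snd p" for p
  proof -
    have "fst p div 2 ^ length (?l p) = 0" "snd p div 2 ^ length (?l p) = 0"
      using blen_le_iff[of "fst p" "length (?l p)"] blen_le_iff[of "snd p" "length (?l p)"]
      by (simp_all add: div_eq_0_iff)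
    then show ?thesis using r[of "?i p" "?l p"] by (auto simp: cmp_inv_def)
  qed
  ultimately have "fp (\<lambda>p. fst p \<le> (snd p :: nat))" by simp
  then show ?thesis by (rule fp_comp2[where F="(\<le>)"]) (rule assms)+
qed

lemma fp_less [fp_intro]: "fp f \<Longrightarrow> fp g \<Longrightarrow> fp (\<lambda>x. f x < (g x :: nat))"
  unfolding Suc_le_eq[symmetric] by (intro fp_intro)

lemma fp_length [fp_intro]:
  assumes "fp l"
  shows "fp (\<lambda>x. length (l x))"
proof -
  have 1: "foldl (\<lambda>n _. Suc n) 0 ys = length ys" for ys :: "'c list" by (induction ys rule: rev_induct) auto
  have "fp (\<lambda>x. foldl (\<lambda>n _. Suc n) 0 (l x))"
  proof (rule fp_foldl[where f="\<lambda>_ n _. Suc n"])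
    show "pb (\<lambda>x. Suc (4 * sz (l x)))" by (intro fp_intro pb_sz assms)
    show "sz (foldl (\<lambda>n _. Suc n) 0 ys) \<le> Suc (4 * sz (l x))" if "l x = ys @ zs" for x ys zs
    proof -
      have "length ys \<le> sz (l x)" using length_le_sz[of "l x"] that by simp
      then show ?thesis unfolding 1 using sz_nat_le[of "length ys"] blen_le[of "length ys"] by linarith
    qed
  qed (intro fp_intro assms)+
  then show ?thesis unfolding 1 .
qed

lemma fp_blen [fp_intro]: "fp f \<Longrightarrow> fp (\<lambda>x. blen (f x))"
  unfolding length_bits[symmetric] by (intro fp_intro)

text \<open>The exponent is given in unary, so the result is only as long as the argument.\<close>

lemma fp_pow2:
  assumes "fp u"
  shows "fp (\<lambda>x. 2 ^ length (u x :: 'c::enc list) :: nat)"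
proof -
  have "num (map (\<lambda>_. False) us @ [True]) = 2 ^ length us" for us :: "'c::enc list"
    by (induction us) (auto simp: dbl_def)
  moreover have "fp (\<lambda>x. num (map (\<lambda>_. False) (u x) @ [True]))" by (intro fp_intro assms)
  ultimately show ?thesis by simp
qed

lemma fp_smash [fp_intro]:
  assumes "fp f" "fp g"
  shows "fp (\<lambda>x. 2 ^ (blen (f x) * blen (g x)) :: nat)"
proof -
  have "length (concat (map (\<lambda>_. v) w)) = length w * length v" for v w :: "bool list"
    by (induction w) auto
  moreover have "fp (\<lambda>x. 2 ^ length (concat (map (\<lambda>_. bits (g x)) (bits (f x)))) :: nat)"
    by (intro fp_pow2 fp_intro fp_comp[OF assms(2)] assms)
  ultimately show ?thesis by simp
qed

lemma fp_upt [fp_intro]: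
  assumes "fp u"
  shows "fp (\<lambda>x. [0..<length (u x)])"
proof -
  have 1: "foldl (\<lambda>s _. (Suc (fst s), snd s @ [fst s])) (0, []) ys = (length ys, [0..<length ys])" for ys :: "'c list"
    by (induction ys rule: rev_induct) auto
  have "fp (\<lambda>x. foldl (\<lambda>s _. (Suc (fst s), snd s @ [fst s])) (0, []) (u x))"
  proof (rule fp_foldl[where f="\<lambda>_ s _. (Suc (fst s), snd s @ [fst s])"])
    show "pb (\<lambda>x. Suc (Suc (4 * sz (u x)) + Suc (sz (u x) * Suc (Suc (4 * sz (u x))))))"
      by (intro fp_intro pb_sz assms)
    show "sz (foldl (\<lambda>s _. (Suc (fst s), snd s @ [fst s])) (0, []) ys) \<le>
      Suc (Suc (4 * sz (u x)) + Suc (sz (u x) * Suc (Suc (4 * sz (u x)))))" if "u x = ys @ zs" for x ys zs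
    proof -
      have l: "length ys \<le> sz (u x)" using length_le_sz[of "u x"] that by simp
      have a: "sz n \<le> Suc (4 * sz (u x))" if "n \<le> length ys" for n
        using sz_nat_le[of n] blen_le[of n] l that by linarith
      have "sz [0..<length ys] \<le> Suc (length ys * Suc (Suc (4 * sz (u x))))"
        using sz_list_bound[of "[0..<length ys]" "Suc (4 * sz (u x))"] a by simp
      also have "\<dots> \<le> Suc (sz (u x) * Suc (Suc (4 * sz (u x))))"
        using mult_le_mono1[OF l, of "Suc (Suc (4 * sz (u x)))"] by simp
      finally show ?thesis unfolding 1 using a[of "length ys"] by simp
    qed
  qed (intro fp_intro assms)+
  then have "fp (\<lambda>x. snd (foldl (\<lambda>s _. (Suc (fst s), snd s @ [fst s])) (0, []) (u x)))" by (intro fp_intro)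
  then show ?thesis unfolding 1 by simp
qed

lemma fp_zip [fp_intro]:
  assumes "fp l" "fp m"
  shows "fp (\<lambda>x. zip (l x) (m x :: 'd::enc list))"
proof -
  let ?f = "\<lambda>s a. (tl (fst s), snd s @ (case fst s of [] \<Rightarrow> [] | b # t \<Rightarrow> [(a, b)]))"
  have 1: "foldl ?f (w, as) ys = (drop (length ys) w, as @ zip ys w)"
    for ys :: "'c list" and w :: "'d list" and as
  proof (induction ys arbitrary: w as)
    case (Cons a ys)
    then show ?case by (cases w) auto
  qed simp
  have d: "sz (drop n w) \<le> sz w" for n and w :: "'e::enc list"
    using sz_append[of "take n w" "drop n w"] sz_pos[of "take n w"] by (simp del: sz_pos)
  have z: "sz (zip ys w) \<le> Suc (sz ys + sz w)" for ys :: "'c::enc list" and w :: "'d list"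
  proof (induction ys arbitrary: w)
    case (Cons a ys)
    show ?case
    proof (cases w)
      case w: (Cons b w')
      then show ?thesis using Cons.IH[of w'] by simp
    qed simp
  qed simp
  have "fp (\<lambda>x. foldl ?f (m x, []) (l x))"
  proof (rule fp_foldl[where f="\<lambda>_. ?f"])
    show "pb (\<lambda>x. Suc (sz (m x) + Suc (sz (l x) + sz (m x))))" by (intro fp_intro pb_sz assms)
    show "sz (foldl ?f (m x, []) ys) \<le> Suc (sz (m x) + Suc (sz (l x) + sz (m x)))" if "l x = ys @ zs" for x ys zs
      unfolding 1 using z[of ys "m x"] d[of "length ys" "m x"] sz_append[of ys zs] sz_pos[of zs]
      by (simp add: that del: sz_pos)
  qed (intro fp_intro assms)+
  then have "fp (\<lambda>x. snd (foldl ?f (m x, []) (l x)))" by (intro fp_intro)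
  then show ?thesis unfolding 1 by simp
qed

subsection \<open>Trees\<close>

lemma enc_tree [simp]: "enc (t::tree) = t"
  by (simp add: enc_tree_def)

lemma sz_tree: "sz (t::tree) = tsz t"
  by (simp add: sz_def)

lemma fp_enc [fp_intro]: "fp f \<Longrightarrow> fp (\<lambda>x. enc (f x))"
  by (simp add: fp_def)

lemma fp_lsub [fp_intro]: "fp f \<Longrightarrow> fp (\<lambda>x. lsub (f x))"
  by (rule fp_comp[of lsub]) (use tfp_lsub[of "enc::tree \<Rightarrow> tree"] in \<open>simp_all add: fp_def\<close>)

lemma fp_rsub [fp_intro]: "fp f \<Longrightarrow> fp (\<lambda>x. rsub (f x))"
  by (rule fp_comp[of rsub]) (use tfp_rsub[of "enc::tree \<Rightarrow> tree"] in \<open>simp_all add: fp_def\<close>)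

lemma fp_Nd [fp_intro]: "fp f \<Longrightarrow> fp g \<Longrightarrow> fp (\<lambda>x. Nd (f x) (g x))"
  by (simp add: fp_def tfp_Nd)

fun children :: "tree \<Rightarrow> tree list" where
  "children Lf = []"
| "children (Nd a b) = a # children b"

lemma enc_children [simp]: "enc (children t) = t"
  by (induction t) auto

lemma fp_children [fp_intro]: "fp f \<Longrightarrow> fp (\<lambda>x. children (f x))"
  by (simp add: fp_def)

lemma fp_is_Lf [fp_intro]: "fp f \<Longrightarrow> fp (\<lambda>x. f x = Lf)"
proof -
  have "t = Lf \<longleftrightarrow> children t = []" for t by (cases t) auto
  then show "fp f \<Longrightarrow> ?thesis" by (simp add: fp_null fp_children)
qed

lemma tsz_nodes: "tsz t = Suc (2 * nodes t)"
  by (induction t) auto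

text \<open>A worklist of pairs still to be compared, with a flag for failure. Each step lowers the
  total size of the left components until the list is empty, which limits the number of
  steps.\<close>

definition eq_step :: "bool \<times> (tree \<times> tree) list \<Rightarrow> bool \<times> (tree \<times> tree) list" where
  "eq_step s = (case snd s of [] \<Rightarrow> s | p # ps \<Rightarrow>
     if fst p = Lf then (fst s \<and> snd p = Lf, ps)
     else if snd p = Lf then (False, ps)
     else (fst s, (lsub (fst p), lsub (snd p)) # (rsub (fst p), rsub (snd p)) # ps))"

lemma eq_step_inv:
  "fst (eq_step s) \<and> (\<forall>p\<in>set (snd (eq_step s)). fst p = snd p) \<longleftrightarrow> fst s \<and> (\<forall>p\<in>set (snd s). fst p = snd p)"
proof (cases "snd s")
  case (Cons p ps)
  then show ?thesis by (cases "fst p"; cases "snd p") (auto simp: eq_step_def)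
qed (simp add: eq_step_def)

lemma eq_step_size: "sz (snd (eq_step s)) \<le> sz (snd s)"
  "sum_list (map (\<lambda>p. tsz (fst p)) (snd (eq_step s))) \<le> sum_list (map (\<lambda>p. tsz (fst p)) (snd s)) - 1"
proof -
  have "sz (snd (eq_step s)) \<le> sz (snd s) \<and>
   sum_list (map (\<lambda>p. tsz (fst p)) (snd (eq_step s))) \<le> sum_list (map (\<lambda>p. tsz (fst p)) (snd s)) - 1"
  proof (cases "snd s")
    case (Cons p ps)
    obtain a b where "p = (a, b)" by fastforce
    then show ?thesis using Cons by (cases a; cases b) (auto simp: eq_step_def sz_tree)
  qed (simp add: eq_step_def)
  then show "sz (snd (eq_step s)) \<le> sz (snd s)"
  "sum_list (map (\<lambda>p. tsz (fst p)) (snd (eq_step s))) \<le> sum_list (map (\<lambda>p. tsz (fst p)) (snd s)) - 1" by auto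
qed

lemma eq_run: "fst ((eq_step ^^ n) s) \<and> (\<forall>p\<in>set (snd ((eq_step ^^ n) s)). fst p = snd p) \<longleftrightarrow>
    fst s \<and> (\<forall>p\<in>set (snd s). fst p = snd p)"
  "sz (snd ((eq_step ^^ n) s)) \<le> sz (snd s)"
  "sum_list (map (\<lambda>p. tsz (fst p)) (snd ((eq_step ^^ n) s))) \<le> sum_list (map (\<lambda>p. tsz (fst p)) (snd s)) - n"
proof (induction n)
  case (Suc n)
  {
    case 1 then show ?case unfolding Suc(1)[symmetric] using eq_step_inv[of "(eq_step ^^ n) s"] by simp
  next
    case 2 then show ?case using Suc(2) eq_step_size(1)[of "(eq_step ^^ n) s"] by simp
  next
    case 3 then show ?case using Suc(3) eq_step_size(2)[of "(eq_step ^^ n) s"] by simp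
  }
qed auto

lemma fp_eq [fp_intro]:
  assumes "fp f" "fp g"
  shows "fp (\<lambda>x. f x = g x)"
proof -
  let ?h = "\<lambda>p::tree \<times> tree. (True, [p])"
  \<comment> \<open>The counter holds the state twice, since the size of a tree is about twice its
    number of inner nodes and the number of rounds has to reach the size.\<close>
  let ?g = "\<lambda>s::bool \<times> (tree \<times> tree) list. (s, s)"
  let ?r = "\<lambda>p. (eq_step ^^ nodes (enc (?g (?h p)))) (?h p)"
  have "fp ?r"
  proof (rule fp_iter[where f=eq_step and g="?g" and h="?h"])
    show "fp eq_step" unfolding eq_step_def by (intro fp_intro)
    show "pb (\<lambda>p::tree \<times> tree. 10 + sz p)" by (intro fp_intro pb_self)
    show "sz ((eq_step ^^ i) (?h p)) \<le> 10 + sz p" for i p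
    proof -
      obtain c ps where r: "(eq_step ^^ i) (?h p) = (c, ps)" by fastforce
      have "sz ps \<le> sz p + 2" using eq_run(2)[of i "?h p"] r by simp
      moreover have "sz c \<le> 3" by (cases c) auto
      ultimately show ?thesis unfolding r by simp
    qed
  qed (intro fp_intro)+
  then have "fp (\<lambda>p. fst (?r p))" by (intro fp_intro)
  moreover have "fst (?r p) \<longleftrightarrow> fst p = snd p" for p
  proof -
    let ?n = "nodes (enc (?g (?h p)))"
    have "tsz (fst p) \<le> ?n" by (simp add: enc_prod_def enc_bool_def tsz_nodes)
    then have "sum_list (map (\<lambda>p. tsz (fst p)) (snd (?r p))) = 0"
      using eq_run(3)[of ?n "?h p"] by simp
    moreover have "tsz t \<noteq> 0" for t using tsz_pos[of t] by simp
    ultimately have "snd (?r p) = []" by (cases "snd (?r p)") (simp_all del: funpow.simps)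
    then show ?thesis using eq_run(1)[of ?n "?h p"] by simp
  qed
  ultimately have "fp (\<lambda>p::tree \<times> tree. fst p = snd p)" by simp
  then have "fp (\<lambda>x. enc (f x) = enc (g x))"
    by (rule fp_comp2[where F="(=)"]) (intro fp_intro assms)+
  then show ?thesis by (simp add: enc_inject)
qed

lemma fp_finite_set: "finite A \<Longrightarrow> fp f \<Longrightarrow> fp (\<lambda>x. f x \<in> A)"
proof (induction A rule: finite_induct)
  case (insert a A)
  then have "fp (\<lambda>x. f x = a \<or> f x \<in> A)" by (intro fp_intro) auto
  then show ?case by simp
qed (simp add: fp_const)

text \<open>Preorder traversal with an explicit stack of subtrees. The produced word is kept
  reversed, and together with the codes on the stack it always spells the code of the original
  tree.\<close>

definition code_step :: "tree list \<times> bool list \<Rightarrow> tree list \<times> bool list" where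
  "code_step s = (case fst s of [] \<Rightarrow> s | t # ts \<Rightarrow>
     if t = Lf then (ts, False # snd s) else (lsub t # rsub t # ts, True # snd s))"

lemma code_step_inv:
  "rev (snd (code_step s)) @ concat (map tcode (fst (code_step s))) = rev (snd s) @ concat (map tcode (fst s))"
proof (cases "fst s")
  case (Cons t ts)
  then show ?thesis by (cases t) (auto simp: code_step_def)
qed (simp add: code_step_def)

lemma code_step_length:
  "length (concat (map tcode (fst (code_step s)))) = length (concat (map tcode (fst s))) - 1"
proof (cases "fst s")
  case (Cons t ts)
  then show ?thesis by (cases t) (auto simp: code_step_def)
qed (simp add: code_step_def)

lemma code_run:
  "rev (snd ((code_step ^^ n) s)) @ concat (map tcode (fst ((code_step ^^ n) s))) = rev (snd s) @ concat (map tcode (fst s))"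
  "length (concat (map tcode (fst ((code_step ^^ n) s)))) = length (concat (map tcode (fst s))) - n"
  by (induction n) (auto simp: code_step_inv code_step_length)

lemma sz_trees: "sz ts \<le> Suc (2 * length (concat (map tcode ts)))"
proof (induction ts)
  case (Cons t ts)
  then show ?case by (cases "tcode t"; cases t) (simp_all add: sz_tree tsz_def)
qed simp

lemma fp_tcode [fp_intro]:
  assumes "fp f"
  shows "fp (\<lambda>x. tcode (f x))"
proof (rule fp_comp[OF _ assms])
  let ?h = "\<lambda>t::tree. ([t], [])"
  let ?g = "\<lambda>s::tree list \<times> bool list. (s, s)"
  let ?r = "\<lambda>t. (code_step ^^ nodes (enc (?g (?h t)))) (?h t)"
  have "fp ?r"
  proof (rule fp_iter[where f=code_step and g="?g" and h="?h"])
    show "fp code_step" unfolding code_step_def by (intro fp_intro)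
    show "pb (\<lambda>p::tree. 10 + 8 * sz p)" by (intro fp_intro pb_self)
    show "sz ((code_step ^^ i) (?h p)) \<le> 10 + 8 * sz p" for i p
    proof -
      obtain ts w where r: "(code_step ^^ i) (?h p) = (ts, w)" by fastforce
      have "rev w @ concat (map tcode ts) = tcode p" using code_run(1)[of i "?h p"] r by simp
      then have "length (rev w @ concat (map tcode ts)) = length (tcode p)" by (rule arg_cong)
      then have "length w + length (concat (map tcode ts)) = sz p"
        by (simp add: sz_tree tsz_def del: length_concat)
      then show ?thesis unfolding r using sz_bools[of w] sz_trees[of ts] by simp
    qed
  qed (intro fp_intro)+
  then have "fp (\<lambda>p. rev (snd (?r p)))" by (intro fp_intro)
  moreover have "rev (snd (?r p)) = tcode p" for p
  proof -
    let ?n = "nodes (enc (?g (?h p)))"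
    have "tsz p \<le> ?n" by (simp add: enc_prod_def tsz_nodes)
    then have "concat (map tcode (fst (?r p))) = []"
      using code_run(2)[of ?n "?h p"] by (simp only: length_0_conv[symmetric]) (simp add: tsz_def)
    from code_run(1)[of ?n "?h p", unfolded this] show ?thesis by simp
  qed
  ultimately show "fp tcode" by simp
qed

text \<open>A word is read from the right with a stack of trees; whatever follows the code of a tree only ends up
  deeper in the stack.\<close>

definition dec_step :: "tree list \<Rightarrow> bool \<Rightarrow> tree list" where
  "dec_step ts b = (if b then Nd (hdd Lf ts) (hdd Lf (tl ts)) # tl (tl ts) else Lf # ts)"

definition dec :: "bool list \<Rightarrow> tree" where
  "dec w = hdd Lf (foldl dec_step [] (rev w))"

lemma dec_foldl: "foldl dec_step ts (rev (tcode t)) = t # ts"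
  by (induction t arbitrary: ts) (auto simp: dec_step_def)

lemma dec_tcode [simp]: "dec (tcode t @ w) = t"
  by (simp add: dec_def dec_foldl)

lemma fp_dec [fp_intro]:
  assumes "fp w"
  shows "fp (\<lambda>x. dec (w x))"
proof -
  have l: "sz (foldl dec_step ts ys) \<le> sz ts + 5 * length ys" for ts ys
  proof (induction ys arbitrary: ts)
    case (Cons b ys)
    have "sz (dec_step ts b) \<le> sz ts + 5"
    proof (cases ts)
      case Nil
      then show ?thesis by (auto simp: dec_step_def sz_tree)
    next
      case (Cons t us)
      then show ?thesis by (cases us) (auto simp: dec_step_def sz_tree)
    qed
    then show ?case using Cons[of "dec_step ts b"] by simp
  qed simp
  have "fp (\<lambda>x. foldl dec_step [] (rev (w x)))"
  proof (rule fp_foldl[where f="\<lambda>_. dec_step"])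
    show "pb (\<lambda>x. 1 + 5 * sz (w x))" by (intro fp_intro pb_sz assms)
    show "sz (foldl dec_step [] ys) \<le> 1 + 5 * sz (w x)" if "rev (w x) = ys @ zs" for x ys zs
    proof -
      have "length (rev (w x)) = length ys + length zs" using that by simp
      then show ?thesis using l[of "[]" ys] length_le_sz[of "w x"] by simp
    qed
    show "fp (\<lambda>p. dec_step (fst (snd p)) (snd (snd p)))" unfolding dec_step_def by (intro fp_intro)
  qed (intro fp_intro assms)+
  then show ?thesis unfolding dec_def by (intro fp_intro)
qed

fun tonat :: "tree \<Rightarrow> nat" where
  "tonat t = num (map (\<lambda>a. a \<noteq> Lf) (children t))"

lemma fp_tonat [fp_intro]: "fp f \<Longrightarrow> fp (\<lambda>x. tonat (f x))"
  unfolding tonat.simps by (intro fp_intro) (auto intro: fp_intro)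

lemma children_enc [simp]: "children (enc xs) = map enc xs"
  by (induction xs) auto

lemma tonat_enc [simp]: "tonat (enc (n::nat)) = n"
proof -
  have "map (\<lambda>a. a \<noteq> Lf) (children (enc (bits n))) = bits n"
    unfolding children_enc map_map by (rule map_idI) (auto simp: enc_bool_def btree_def)
  then have "tonat (enc (bits n)) = n" by (simp del: children_enc)
  then show ?thesis by (simp only: enc_bits)
qed

subsection \<open>Polynomial time on numbers\<close>

lemma poly_time_of_fp:
  assumes "fp f"
  shows "poly_time f"
proof -
  obtain c k where c: "\<And>n m. sz n \<le> m \<Longrightarrow> runs c (tcode (enc n)) ((m + 2) ^ k) (tcode (enc (f n)))"
    using tfp_runs[OF assms[unfolded fp_def]] unfolding sz_def by blast
  let ?T = "\<lambda>n. (Suc (4 * blen n) + 2) ^ k"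
  have "\<exists>M. turing_machine M \<and> (\<forall>t. (\<forall>n. 1000 * (length (bits n) + ?T n) + 1000 \<le> t n) \<longrightarrow> computes_within M f t)"
    by (rule machine_of_runs[of c]) (use c[OF sz_nat_le] in \<open>simp add: enc_nat_def\<close>)
  then obtain M where M: "turing_machine M"
    "\<And>t. (\<And>n. 1000 * (length (bits n) + ?T n) + 1000 \<le> t n) \<Longrightarrow> computes_within M f t" by blast
  \<comment> \<open>\<open>[:3, 4:]\<close> is the bound \<open>Suc (4 * blen n)\<close> on the size
    of the encoded argument plus two; the factor and the summand 1000 come from
    \<open>machine_of_runs\<close>.\<close>
  let ?p = "smult 1000 ([:0, 1:] + [:3, 4:] ^ k) + [:1000:] :: nat poly"
  have "computes_within M f (\<lambda>n. poly ?p (blen n))"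
  proof (rule M(2))
    fix n :: nat
    have e: "poly [:3, 4:] (blen n) = Suc (4 * blen n) + 2" by simp
    show "1000 * (length (bits n) + ?T n) + 1000 \<le> poly ?p (blen n)"
      unfolding poly_add poly_smult poly_power e by simp
  qed
  then show ?thesis unfolding poly_time_def using M(1) by blast
qed

text \<open>Doubling a list bit by bit turns a number into unary notation.\<close>

definition unary_step :: "bool list \<times> unit list \<Rightarrow> bool list \<times> unit list" where
  "unary_step s = (case fst s of [] \<Rightarrow> s | b # w \<Rightarrow> (w, if b then () # snd s @ snd s else snd s @ snd s))"

lemma unary_run: "(unary_step ^^ n) (w, u) = (drop n w,
   replicate (foldl (\<lambda>n b. dbl b n) (length u) (take n w)) ())"
proof (induction n arbitrary: w u)
  case 0
  then show ?case by (simp add: replicate_length_same)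
next
  case (Suc n)
  have *: "xs = replicate n ()" if "length xs = n" for xs :: "unit list" and n
    using that by (simp add: replicate_length_same flip: that)
  show ?case
  proof (cases w)
    case Nil
    then have "unary_step (w, u) = (w, u)" by (simp add: unary_step_def)
    then show ?thesis using Suc[of w u] Nil by (simp add: funpow_Suc_right del: funpow.simps)
  next
    case (Cons b w')
    have "unary_step (w, u) = (w', replicate (dbl b (length u)) ())"
      using Cons by (auto simp: unary_step_def dbl_def intro!: * simp flip: replicate_Suc)
    then show ?thesis using Suc[of w' "replicate (dbl b (length u)) ()"] Cons
      by (simp add: funpow_Suc_right del: funpow.simps)
  qed
qed

text \<open>The unary list is as long as the value of the argument, so polynomial time in the list
  is time polynomial in the value, and the conversion from binary fits into such time as
  well.\<close>

lemma poly_time_in_value_of_fp: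
  assumes "fp (f :: unit list \<Rightarrow> nat)"
  shows "poly_time_in_value (\<lambda>n. f (replicate n ()))"
proof -
  have "fp unary_step" unfolding unary_step_def by (intro fp_intro)
  then obtain c T where c: "pbn T" "\<And>y n. (\<And>i. i \<le> nodes (enc y) \<Longrightarrow> sz ((unary_step ^^ i) y) \<le> n) \<Longrightarrow>
     runs c (tcode (enc y)) (T n) (tcode (enc ((unary_step ^^ nodes (enc y)) y)))"
    using runs_iterate[where a=enc and F=unary_step and g=enc] tfp_id unfolding fp_def sz_def by blast
  obtain k where k: "\<And>n. T n \<le> (n + 2) ^ k" using c(1) unfolding pbn_def by blast
  have "fp (\<lambda>n. (rev (bits n), [] :: unit list))" by (intro fp_intro)
  then obtain c1 k1 where c1: "\<And>n m. sz n \<le> m \<Longrightarrow>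
      runs c1 (tcode (enc n)) ((m + 2) ^ k1) (tcode (enc (rev (bits n), [] :: unit list)))"
    using tfp_runs unfolding fp_def sz_def by blast
  have "fp (\<lambda>s::bool list \<times> unit list. f (snd s))" by (intro fp_comp[OF assms] fp_intro)
  from tfp_runs[OF this[unfolded fp_def]] obtain c2 k2 where c2: "\<And>s::bool list \<times> unit list. \<And>m. sz s \<le> m \<Longrightarrow> runs c2 (tcode (enc s)) ((m + 2) ^ k2) (tcode (enc (f (snd s))))"
    unfolding sz_def by blast
  \<comment> \<open>A generous bound for every state of the conversion: at most \<open>n\<close>
    remaining digits and a list of at most \<open>n\<close> units.\<close>
  let ?B = "\<lambda>n. 20 * n + 20"
  let ?T = "\<lambda>n. Suc ((?B n + 2) ^ k1 + Suc ((?B n + 2) ^ k + (?B n + 2) ^ k2))"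
  have runs: "runs (Seq c1 (Seq c c2)) (tcode (enc n)) (?T n) (tcode (enc (f (replicate n ()))))" for n
  proof -
    let ?y = "(rev (bits n), [] :: unit list)"
    have fl: "foldl (\<lambda>n b. dbl b n) 0 (rev (bits n)) = n"
      using num_bits[of n] by (simp add: num_def foldl_conv_foldr)
    have le: "foldl (\<lambda>n b. dbl b n) 0 (take i (rev (bits n))) \<le> n" for i
    proof -
      have "m \<le> foldl (\<lambda>n b. dbl b n) m w" for m w
      proof (induction w arbitrary: m)
        case (Cons b w)
        have "m \<le> dbl b m" by (simp add: dbl_def)
        then show ?case using order_trans[OF _ Cons[of "dbl b m"]] by simp
      qed simp
      from this[of "foldl (\<lambda>n b. dbl b n) 0 (take i (rev (bits n)))" "drop i (rev (bits n))"]
      show ?thesis by (simp add: fl flip: foldl_append)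
    qed
    have u: "sz (replicate m ()) = Suc (2 * m)" for m by (induction m) auto
    have "sz ((unary_step ^^ i) ?y) \<le> ?B n" for i
    proof -
      have "length (drop i (rev (bits n))) \<le> n" using blen_le[of n] by simp
      then show ?thesis
        unfolding unary_run using le[of i] sz_bools[of "drop i (rev (bits n))"] by (simp add: u)
    qed
    then have 2: "runs c (tcode (enc ?y)) ((?B n + 2) ^ k) (tcode (enc ((unary_step ^^ nodes (enc ?y)) ?y)))"
      and 3: "sz ((unary_step ^^ nodes (enc ?y)) ?y) \<le> ?B n"
      using c(2)[of ?y "?B n"] k[of "?B n"] runs_mono by blast+
    have "length (bits n) \<le> nodes (enc ?y)" using length_le_nodes[of "rev (bits n)"] by (simp add: enc_prod_def)
    then have 4: "snd ((unary_step ^^ nodes (enc ?y)) ?y) = replicate n ()"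
      unfolding unary_run by (simp add: fl)
    have "sz n \<le> ?B n" using sz_nat_le[of n] blen_le[of n] by simp
    from runs_Seq[OF c1[OF this] runs_Seq[OF 2 c2[OF 3]]] show ?thesis by (simp only: 4)
  qed
  have "\<exists>M. turing_machine M \<and> (\<forall>t. (\<forall>n. 1000 * (length (bits n) + ?T n) + 1000 \<le> t n) \<longrightarrow>
     computes_within M (\<lambda>n. f (replicate n ())) t)"
    by (rule machine_of_runs[of "Seq c1 (Seq c c2)"]) (use runs in \<open>simp add: enc_nat_def\<close>)
  then obtain M where M: "turing_machine M"
    "\<And>t. (\<And>n. 1000 * (length (bits n) + ?T n) + 1000 \<le> t n) \<Longrightarrow> computes_within M (\<lambda>n. f (replicate n ())) t" by blast
  let ?p = "smult 1000 ([:0, 1:] + ([:1:] + [:22, 20:] ^ k1 + ([:1:] + [:22, 20:] ^ k + [:22, 20:] ^ k2))) + [:1000:] :: nat poly"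
  have "computes_within M (\<lambda>n. f (replicate n ())) (\<lambda>n. poly ?p n)"
  proof (rule M(2))
    fix n :: nat
    have e: "poly [:22, 20:] n = ?B n + 2" by simp
    show "1000 * (length (bits n) + ?T n) + 1000 \<le> poly ?p n"
      unfolding poly_add poly_smult poly_power e using blen_le[of n] by simp
  qed
  then show ?thesis unfolding poly_time_in_value_def using M(1) by blast
qed

section \<open>Universal simulation: machines as data, and the inclusion of \<open>poly_time\<close>
  in \<open>fp\<close>\<close>

section \<open>Simulation of Turing machines\<close>

text \<open>The bound on head positions permits cutting the tapes to finite windows. The blank cells
  to the right later bound the length of an output by the running time.\<close>

lemma tm_inv:
  assumes "turing_machine M" "(step M ^^ n) (init_config M w) = (q, ts)"
  shows "q < nstates M \<and> length ts = ntapes M \<and> (\<forall>x\<in>set ts. \<bar>snd x\<bar> \<le> int n \<and>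
    (\<forall>i. fst x i < nsyms M \<and> (int n \<le> i \<longrightarrow> int (length w) \<le> i \<longrightarrow> fst x i = 0)))"
  using assms(2)
proof (induction n arbitrary: q ts)
  case 0
  then show ?case using assms(1)
    by (auto simp: init_config_def turing_machine_def word_tape_def split: if_splits)
next
  case (Suc n)
  obtain q0 ts0 where 0: "(step M ^^ n) (init_config M w) = (q0, ts0)" by fastforce
  from Suc.IH[OF 0] have IH: "q0 < nstates M" "length ts0 = ntapes M"
    "\<And>x. x \<in> set ts0 \<Longrightarrow> \<bar>snd x\<bar> \<le> int n" "\<And>x i. x \<in> set ts0 \<Longrightarrow> fst x i < nsyms M"
    "\<And>x i. x \<in> set ts0 \<Longrightarrow> int n \<le> i \<Longrightarrow> int (length w) \<le> i \<Longrightarrow> fst x i = 0" by auto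
  have s: "step M (q0, ts0) = (q, ts)" using Suc.prems 0 by simp
  show ?case
  proof (cases "q0 = 1")
    case True
    then have "q = q0" "ts = ts0" using s by auto
    then show ?thesis using IH by fastforce
  next
    case False
    let ?as = "map read ts0"
    have as: "length ?as = ntapes M" "\<forall>a\<in>set ?as. a < nsyms M" using IH by (auto simp: read_def split: prod.splits)
    obtain q' acts where d: "delta M q0 ?as = (q', acts)" by fastforce
    then have r: "q = q'" "ts = map2 act acts ts0" using s False by (auto simp: read_def)
    have "q' < nstates M" "length acts = ntapes M" "\<forall>(b, d) \<in> set acts. b < nsyms M"
      using assms(1) IH(1) as d unfolding turing_machine_def by (metis fst_conv snd_conv)+
    moreover have "\<bar>snd x\<bar> \<le> int (Suc n) \<and>
      (\<forall>i. fst x i < nsyms M \<and> (int (Suc n) \<le> i \<longrightarrow> int (length w) \<le> i \<longrightarrow> fst x i = 0))" if x: "x \<in> set ts" for x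
    proof -
      obtain a y where ay: "(a, y) \<in> set (zip acts ts0)" "x = act a y" using x r by auto
      obtain b d where a: "a = (b, d)" by fastforce
      have "b < nsyms M" using set_zip_leftD[OF ay(1)] \<open>\<forall>(b, d) \<in> set acts. b < nsyms M\<close> a by auto
      moreover have "\<bar>shift d\<bar> \<le> 1" by (cases d) auto
      ultimately show ?thesis using ay(2) IH(3-5)[OF set_zip_rightD[OF ay(1)]] a by (cases y) fastforce
    qed
    ultimately show ?thesis using r IH(2) by simp
  qed
qed

subsection \<open>A universal simulation on finite windows\<close>

text \<open>A transition table as a finite list with moves coded by numbers. Unlike
  \<open>machine\<close> it has an encoding and can be part of a certificate. In a
  \<open>utape\<close> the head position is kept in unary.\<close>

type_synonym udesc = "((nat \<times> nat list) \<times> nat \<times> (nat \<times> nat) list) list"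
type_synonym utape = "unit list \<times> nat list"

definition upd_at :: "unit list \<Rightarrow> nat \<Rightarrow> nat list \<Rightarrow> nat list" where
  "upd_at u b cs = map (\<lambda>p. if fst p = length u then b else snd p) (zip [0..<length cs] cs)"

definition uread :: "utape \<Rightarrow> nat" where
  "uread T = hdd 0 (drop (length (fst T)) (snd T))"

definition uact :: "nat \<times> nat \<Rightarrow> utape \<Rightarrow> utape" where
  "uact a T = ((if snd a = 0 then tl (fst T) else if snd a = 1 then fst T else () # fst T), upd_at (fst T) (fst a) (snd T))"

text \<open>Total on arbitrary tables: without a matching entry nothing changes. Thus a certificate
  may name any table whatsoever.\<close>

definition ustep :: "udesc \<Rightarrow> nat \<times> utape list \<Rightarrow> nat \<times> utape list" where
  "ustep D s = (if fst s = 1 then s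
     else case concat (map (\<lambda>e. if fst e = (fst s, map uread (snd s)) then [snd e] else []) D) of
       [] \<Rightarrow> s | r # rs \<Rightarrow> (fst r, map (\<lambda>p. uact (fst p) (snd p)) (zip (snd r) (snd s))))"

text \<open>\<open>u\<close> is the time bound in unary, and \<open>length u\<close> blank cells on
  both sides of the input keep the head inside the window. The additional last blank shows the end
  of an output of length \<open>length u\<close>.\<close>

definition uinit :: "unit list \<Rightarrow> unit list \<Rightarrow> bool list \<Rightarrow> nat \<times> utape list" where
  "uinit ks u w = (let z = map (\<lambda>_. 0) u in
     (0, (u, z @ map (\<lambda>b. if b then 2 else 1) w @ z @ [0]) # map (\<lambda>_. (u, z @ map (\<lambda>_. 0) w @ z @ [0])) (tl ks)))"

definition out_step :: "bool \<times> bool list \<Rightarrow> nat \<Rightarrow> bool \<times> bool list" where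
  "out_step s a = (if fst s \<or> a = 0 then (True, snd s) else (False, snd s @ [a = 2]))"

definition uout :: "unit list \<Rightarrow> nat \<times> utape list \<Rightarrow> nat" where
  "uout u s = num (snd (foldl out_step (False, []) (drop (length u) (snd (hdd ([], []) (snd s))))))"

definition usim :: "udesc \<times> unit list \<Rightarrow> unit list \<Rightarrow> bool list \<Rightarrow> nat" where
  "usim D u w = uout u (foldl (\<lambda>s _. ustep (fst D) s) (uinit (snd D) u w) u)"

definition mvcode :: "move \<Rightarrow> nat" where
  "mvcode d = (case d of Lft \<Rightarrow> 0 | Stay \<Rightarrow> 1 | Rgt \<Rightarrow> 2)"

definition desc :: "machine \<Rightarrow> udesc" where
  "desc M = concat (map (\<lambda>q. map (\<lambda>as. ((q, as), fst (delta M q as), map (\<lambda>a. (fst a, mvcode (snd a))) (snd (delta M q as))))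
     (List.n_lists (ntapes M) [0..<nsyms M])) [0..<nstates M])"

definition trel :: "nat \<Rightarrow> nat \<Rightarrow> tape \<Rightarrow> utape \<Rightarrow> bool" where
  "trel t L x y \<longleftrightarrow> length (fst y) = nat (snd x + int t) \<and> snd y = map (\<lambda>j. fst x (int j - int t)) [0..<L]"

lemma hdd_drop: "n < length l \<Longrightarrow> hdd d (drop n l) = l ! n"
  by (metis Cons_nth_drop_Suc hdd_simps(2))

lemma uread_trel:
  assumes "trel t L x y" "0 \<le> snd x + int t" "snd x + int t < int L"
  shows "uread y = read x"
proof -
  have "nat (snd x + int t) < L" using assms(2,3) by simp
  then have "uread y = fst x (int (nat (snd x + int t)) - int t)"
    using assms(1) unfolding trel_def uread_def by (simp add: hdd_drop)
  also have "int (nat (snd x + int t)) - int t = snd x" using assms(2) by simp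
  finally show ?thesis by (simp add: read_def split: prod.split)
qed

lemma uact_trel:
  assumes "trel t L x y" "\<bar>snd x\<bar> < int t" "2 * t \<le> L"
  shows "trel t L (act (b, d) x) (uact (b, mvcode d) y)"
proof -
  obtain c i where x: "x = (c, i)" by fastforce
  have "upd_at (fst y) b (snd y) = map (\<lambda>j. (c(i := b)) (int j - int t)) [0..<L]"
    using assms unfolding trel_def x upd_at_def
    by (auto simp: zip_map2 zip_same_conv_map intro!: nth_equalityI)
  moreover have "length (if mvcode d = 0 then tl (fst y) else if mvcode d = 1 then fst y else () # fst y) = nat (i + shift d + int t)"
    using assms unfolding trel_def x by (cases d) (auto simp: mvcode_def nat_diff_distrib)
  ultimately show ?thesis unfolding trel_def x uact_def act.simps fst_conv snd_conv by blast
qed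

lemma concat_if_hd:
  assumes "k \<in> fst ` set D" "\<And>e. e \<in> set D \<Longrightarrow> fst e = k \<Longrightarrow> snd e = v"
  shows "\<exists>rs. concat (map (\<lambda>e. if fst e = k then [snd e] else []) D) = v # rs"
proof (cases "concat (map (\<lambda>e. if fst e = k then [snd e] else []) D)")
  case Nil
  then show ?thesis using assms(1) by fastforce
next
  case (Cons r rs)
  then have "r \<in> set (concat (map (\<lambda>e. if fst e = k then [snd e] else []) D))" by simp
  then have "r = v" using assms(2) by (auto split: if_splits)
  then show ?thesis using Cons by blast
qed

lemma ustep_trel:
  assumes M: "turing_machine M" and "(step M ^^ n) (init_config M w) = (q, ts)" "n < t" "2 * t \<le> L"
    "list_all2 (trel t L) ts us"
  shows "\<exists>us'. ustep (desc M) (q, us) = (fst (step M (q, ts)), us') \<and> list_all2 (trel t L) (snd (step M (q, ts))) us'"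
proof (cases "q = 1")
  case True
  then show ?thesis using assms(5) by (simp add: ustep_def)
next
  case False
  have inv: "q < nstates M" "length ts = ntapes M"
    "\<And>x. x \<in> set ts \<Longrightarrow> \<bar>snd x\<bar> \<le> int n" "\<And>x i. x \<in> set ts \<Longrightarrow> fst x i < nsyms M"
    using tm_inv[OF assms(1,2)] by auto
  have rd: "map uread us = map read ts"
  proof (rule nth_equalityI)
    show "length (map uread us) = length (map read ts)" using list_all2_lengthD[OF assms(5)] by simp
    show "map uread us ! i = map read ts ! i" if "i < length (map uread us)" for i
    proof -
      have i: "i < length ts" using that list_all2_lengthD[OF assms(5)] by simp
      have "\<bar>snd (ts ! i)\<bar> \<le> int n" using inv(3) i by simp
      then show ?thesis
        using uread_trel[OF list_all2_nthD[OF assms(5) i]] assms(3,4) i that by simp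
    qed
  qed
  let ?as = "map read ts"
  obtain q' acts where d: "delta M q ?as = (q', acts)" by fastforce
  have as: "length ?as = ntapes M" "\<forall>a\<in>set ?as. a < nsyms M" using inv by (auto simp: read_def split: prod.splits)
  have st: "step M (q, ts) = (q', map2 act acts ts)" using False d by (simp add: read_def)
  have "length acts = ntapes M" using M inv(1) as d unfolding turing_machine_def by (metis snd_conv)
  have "?as \<in> set (List.n_lists (ntapes M) [0..<nsyms M])" using as by (auto simp: set_n_lists)
  then have "(q, ?as) \<in> fst ` set (desc M)" using inv(1) unfolding desc_def by (force simp: image_iff)
  moreover have "snd e = (q', map (\<lambda>a. (fst a, mvcode (snd a))) acts)" if "e \<in> set (desc M)" "fst e = (q, ?as)" for e
    using that d unfolding desc_def by auto
  ultimately obtain rs where "concat (map (\<lambda>e. if fst e = (q, ?as) then [snd e] else []) (desc M)) =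
     (q', map (\<lambda>a. (fst a, mvcode (snd a))) acts) # rs"
    using concat_if_hd[of "(q, ?as)" "desc M" "(q', map (\<lambda>a. (fst a, mvcode (snd a))) acts)"] by blast
  then have us: "ustep (desc M) (q, us) =
     (q', map (\<lambda>p. uact (fst p) (snd p)) (zip (map (\<lambda>a. (fst a, mvcode (snd a))) acts) us))"
    using False by (simp add: ustep_def rd)
  have "list_all2 (trel t L) (map2 act acts ts) (map (\<lambda>p. uact (fst p) (snd p)) (zip (map (\<lambda>a. (fst a, mvcode (snd a))) acts) us))"
  proof (rule list_all2_all_nthI)
    show "length (map2 act acts ts) = length (map (\<lambda>p. uact (fst p) (snd p)) (zip (map (\<lambda>a. (fst a, mvcode (snd a))) acts) us))"
      using list_all2_lengthD[OF assms(5)] by simp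
    fix i assume i: "i < length (map2 act acts ts)"
    then have "trel t L (ts ! i) (us ! i)" "\<bar>snd (ts ! i)\<bar> < int t"
      using list_all2_nthD[OF assms(5)] inv(3)[of "ts ! i"] assms(3) by auto
    then show "trel t L (map2 act acts ts ! i) (map (\<lambda>p. uact (fst p) (snd p)) (zip (map (\<lambda>a. (fst a, mvcode (snd a))) acts) us) ! i)"
      using uact_trel[of t L "ts ! i" "us ! i" "fst (acts ! i)" "snd (acts ! i)"] i assms(4)
        list_all2_lengthD[OF assms(5)] by simp
  qed
  then show ?thesis unfolding us st by simp
qed

lemma foldl_out:
  assumes "\<And>i. i < length w \<Longrightarrow> cs ! i = (if w ! i then 2 else 1)" "cs ! length w = (0::nat)" "length w < length cs"
  shows "snd (foldl out_step (False, []) cs) = w"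
proof -
  have t: "snd (foldl out_step (True, v) xs) = v" for v xs by (induction xs) (auto simp: out_step_def)
  have "snd (foldl out_step (False, v) cs) = v @ w" for v
    using assms
  proof (induction w arbitrary: v cs)
    case Nil
    have "out_step (False, v) 0 = (True, v)" by (simp add: out_step_def)
    then show ?case using Nil by (cases cs) (simp_all add: t)
  next
    case (Cons b w)
    then obtain c cs' where cs: "cs = c # cs'" by (cases cs) auto
    have "c = (if b then 2 else 1)" using Cons.prems(1)[of 0] cs by simp
    then have "foldl out_step (False, v) cs = foldl out_step (False, v @ [b]) cs'" by (simp add: cs out_step_def)
    then show ?case using Cons.IH[of cs' "v @ [b]"] Cons.prems cs by fastforce
  qed
  then show ?thesis by simp
qed

lemma usim_correct:
  assumes M: "turing_machine M" and h: "halts_with ((step M ^^ t) (init_config M w)) (bits v)"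
    and t: "length u = t" "blen v \<le> t" "length ks = ntapes M"
  shows "usim (desc M, ks) u w = v"
proof -
  define L where "L = 2 * t + length w + 1"
  have init: "fst (uinit ks u w) = 0 \<and> list_all2 (trel t L) (snd (init_config M w)) (snd (uinit ks u w))"
  proof -
    have z: "map (\<lambda>_. 0) u = replicate t (0::nat)" using t(1) by (simp add: map_replicate_const)
    have w1: "trel t L (word_tape w) (u, replicate t 0 @ map (\<lambda>b. if b then 2 else 1) w @ replicate t 0 @ [0])"
      unfolding trel_def L_def using t(1)
      by (auto simp: word_tape_def nth_append intro!: nth_equalityI) (auto simp: nat_diff_distrib')
    have w2: "trel t L (word_tape []) (u, replicate t 0 @ map (\<lambda>_. 0) w @ replicate t 0 @ [0])"
      unfolding trel_def L_def using t(1)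
      by (auto simp: word_tape_def nth_append intro!: nth_equalityI)
    have "length (tl ks) = ntapes M - 1" using t(3) by simp
    then have "list_all2 (trel t L) (replicate (ntapes M - 1) (word_tape []))
        (map (\<lambda>_. (u, replicate t 0 @ map (\<lambda>_. 0) w @ replicate t 0 @ [0])) (tl ks))"
      using w2 by (simp add: list_all2_conv_all_nth)
    then show ?thesis
      using w1 unfolding uinit_def init_config_def Let_def z by simp
  qed
  have run: "fst (foldl (\<lambda>s _. ustep (desc M) s) (uinit ks u w) x) = fst ((step M ^^ length x) (init_config M w)) \<and>
     list_all2 (trel t L) (snd ((step M ^^ length x) (init_config M w))) (snd (foldl (\<lambda>s _. ustep (desc M) s) (uinit ks u w) x))"
    if "length x \<le> t" for x :: "unit list"
    using that
  proof (induction x rule: rev_induct)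
    case Nil
    then show ?case using init by (simp add: init_config_def)
  next
    case (snoc a x)
    obtain q ts where 1: "(step M ^^ length x) (init_config M w) = (q, ts)" by fastforce
    obtain us where 2: "foldl (\<lambda>s _. ustep (desc M) s) (uinit ks u w) x = (q, us)" "list_all2 (trel t L) ts us"
      using snoc 1 by (cases "foldl (\<lambda>s _. ustep (desc M) s) (uinit ks u w) x") auto
    show ?case using ustep_trel[OF M 1 _ _ 2(2)] snoc.prems 1 2(1) by (fastforce simp: L_def)
  qed
  obtain q ts where 1: "(step M ^^ t) (init_config M w) = (q, ts)" by fastforce
  obtain us where 2: "foldl (\<lambda>s _. ustep (desc M) s) (uinit ks u w) u = (q, us)" "list_all2 (trel t L) ts us"
    using run[of u] t(1) 1 by (cases "foldl (\<lambda>s _. ustep (desc M) s) (uinit ks u w) u") auto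
  have "ntapes M \<noteq> 0" using M by (simp add: turing_machine_def)
  moreover have "length ts = ntapes M" using tm_inv[OF M 1] by blast
  ultimately obtain T ts' where ts: "ts = T # ts'" by (cases ts) auto
  then obtain U us' where us: "us = U # us'" "trel t L T U" using 2(2) by (cases us) auto
  have T: "fst T i = fst (word_tape (bits v)) i" if "0 \<le> i" "i \<le> int (blen v)" for i
    using h 1 ts that by (simp add: halts_with_def)
  let ?cs = "drop t (snd U)"
  have cs: "?cs ! i = fst T (int i)" if "i \<le> t" for i
  proof -
    have "t + i < L" using that by (simp add: L_def)
    then show ?thesis using us(2) unfolding trel_def by simp
  qed
  have "snd (foldl out_step (False, []) ?cs) = bits v"
  proof (rule foldl_out)
    show "?cs ! i = (if bits v ! i then 2 else 1)" if "i < length (bits v)" for i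
      using that cs[of i] t(2) T[of "int i"] by (simp add: word_tape_def)
    show "?cs ! length (bits v) = 0" using cs[of "blen v"] t(2) T[of "int (blen v)"] by (simp add: word_tape_def)
    show "length (bits v) < length ?cs" using us(2) t(2) unfolding trel_def L_def by simp
  qed
  then show ?thesis unfolding usim_def uout_def using 2(1) us(1) t(1) by simp
qed

subsection \<open>The simulation takes polynomial time\<close>

text \<open>The bounds concern the number of tapes, head positions, window lengths, and the size of
  states and symbols, in this order. Only the head positions can grow in a step.\<close>

definition uinv :: "nat \<Rightarrow> nat \<Rightarrow> nat \<Rightarrow> nat \<Rightarrow> nat \<times> utape list \<Rightarrow> bool" where
  "uinv k n m b s \<longleftrightarrow> sz (fst s) \<le> b \<and> length (snd s) \<le> k \<and>
     (\<forall>T\<in>set (snd s). length (fst T) \<le> n \<and> length (snd T) \<le> m \<and> (\<forall>a\<in>set (snd T). sz a \<le> b))"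

lemma uinv_ustep:
  assumes "uinv k n m b s" "sz D \<le> b"
  shows "uinv k (Suc n) m b (ustep D s)"
proof (cases "fst s = 1 \<or> concat (map (\<lambda>e. if fst e = (fst s, map uread (snd s)) then [snd e] else []) D) = []")
  case True
  then have "ustep D s = s" by (auto simp: ustep_def simp del: concat_eq_Nil_conv)
  then show ?thesis using assms(1) unfolding uinv_def by fastforce
next
  case False
  then obtain r rs where r: "concat (map (\<lambda>e. if fst e = (fst s, map uread (snd s)) then [snd e] else []) D) = r # rs"
    by (cases "concat (map (\<lambda>e. if fst e = (fst s, map uread (snd s)) then [snd e] else []) D)") auto
  then have "r \<in> set (concat (map (\<lambda>e. if fst e = (fst s, map uread (snd s)) then [snd e] else []) D))" by simp
  then obtain e where e: "e \<in> set D" "r = snd e" by (auto split: if_splits)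
  have rb: "sz r \<le> b" using sz_mem[OF e(1)] sz_fst_snd(2)[of e] e(2) assms(2) by simp
  have "uinv k (Suc n) m b (fst r, map (\<lambda>p. uact (fst p) (snd p)) (zip (snd r) (snd s)))"
    unfolding uinv_def
  proof (intro conjI ballI)
    show "sz (fst (fst r, map (\<lambda>p. uact (fst p) (snd p)) (zip (snd r) (snd s)))) \<le> b"
      using sz_fst_snd(1)[of r] rb by simp
    show "length (snd (fst r, map (\<lambda>p. uact (fst p) (snd p)) (zip (snd r) (snd s)))) \<le> k"
      using assms(1) by (auto simp: uinv_def min_def)
    fix T assume "T \<in> set (snd (fst r, map (\<lambda>p. uact (fst p) (snd p)) (zip (snd r) (snd s))))"
    then obtain a x where ax: "(a, x) \<in> set (zip (snd r) (snd s))" "T = uact a x" by auto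
    have a: "sz (fst a) \<le> b"
      using sz_mem[OF set_zip_leftD[OF ax(1)]] sz_fst_snd(2)[of r] sz_fst_snd(1)[of a] rb by simp
    have x: "length (fst x) \<le> n" "length (snd x) \<le> m" "\<And>c. c \<in> set (snd x) \<Longrightarrow> sz c \<le> b"
      using assms(1) set_zip_rightD[OF ax(1)] by (auto simp: uinv_def)
    show "length (fst T) \<le> Suc n" using x(1) ax(2) by (auto simp: uact_def)
    show "length (snd T) \<le> m" using x(2) ax(2) by (auto simp: uact_def upd_at_def)
    show "sz c \<le> b" if "c \<in> set (snd T)" for c
      using that x(3) a ax(2) by (auto simp: uact_def upd_at_def dest!: set_zip_rightD split: if_splits)
  qed
  then show ?thesis using False r by (simp add: ustep_def)
qed

lemma uinv_size:
  assumes "uinv k n m b s"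
  shows "sz s \<le> Suc (b + Suc (k * Suc (Suc (Suc (n * 2) + Suc (m * Suc b)))))"
proof -
  have "sz T \<le> Suc (Suc (n * 2) + Suc (m * Suc b))" if "T \<in> set (snd s)" for T
  proof -
    have T: "length (fst T) \<le> n" "length (snd T) \<le> m" "\<And>c. c \<in> set (snd T) \<Longrightarrow> sz c \<le> b"
      using assms that by (auto simp: uinv_def)
    have "sz (fst T) \<le> Suc (n * 2)" using sz_list_bound[of "fst T" 1] T(1) by simp
    moreover have "sz (snd T) \<le> Suc (m * Suc b)"
      using sz_list_bound[OF T(3), of "snd T"] mult_le_mono1[OF T(2), of "Suc b"] by simp
    ultimately show ?thesis by (cases T) simp
  qed
  from sz_list_bound[OF this, of "snd s"]
  have "sz (snd s) \<le> Suc (length (snd s) * Suc (Suc (Suc (n * 2) + Suc (m * Suc b))))" by simp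
  also have "\<dots> \<le> Suc (k * Suc (Suc (Suc (n * 2) + Suc (m * Suc b))))"
    using assms unfolding uinv_def by (metis Suc_le_mono mult_le_mono1)
  finally show ?thesis using assms by (cases s) (simp add: uinv_def)
qed

lemma fp_usim [fp_intro]:
  assumes "fp D" "fp u" "fp w"
  shows "fp (\<lambda>x. usim (D x) (u x) (w x))"
proof -
  let ?u = "\<lambda>p::(udesc \<times> unit list) \<times> unit list \<times> bool list. fst (snd p)"
  let ?w = "\<lambda>p::(udesc \<times> unit list) \<times> unit list \<times> bool list. snd (snd p)"
  let ?D = "\<lambda>p::(udesc \<times> unit list) \<times> unit list \<times> bool list. fst p"
  let ?k = "\<lambda>p. Suc (sz (snd (?D p)))" and ?m = "\<lambda>p. Suc (sz (?u p) + sz (?w p) + sz (?u p))"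
    and ?b = "\<lambda>p. 10 + sz (fst (?D p))" and ?n = "\<lambda>p. sz (?u p) + sz (?u p)"
  let ?B = "\<lambda>p. Suc (?b p + Suc (?k p * Suc (Suc (Suc (?n p * 2) + Suc (?m p * Suc (?b p))))))"
  have fs: "fp (\<lambda>p. ustep (fst p) (snd p))"
    unfolding ustep_def uact_def upd_at_def uread_def by (intro fp_intro)
  have fi: "fp (\<lambda>p. uinit (fst p) (fst (snd p)) (snd (snd p)))"
    unfolding uinit_def Let_def by (intro fp_intro)
  have fl: "fp (\<lambda>p. foldl (\<lambda>s _. ustep (fst (?D p)) s) (uinit (snd (?D p)) (?u p) (?w p)) (?u p))"
  proof (rule fp_foldl[where f="\<lambda>p s _. ustep (fst (?D p)) s"])
    show "pb ?B" by (intro fp_intro pb_sz)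
    show "sz (foldl (\<lambda>s _. ustep (fst (?D p)) s) (uinit (snd (?D p)) (?u p) (?w p)) ys) \<le> ?B p" if "?u p = ys @ zs" for p ys zs
    proof -
      have "uinv (?k p) (sz (?u p) + length ys) (?m p) (?b p) (foldl (\<lambda>s _. ustep (fst (?D p)) s) (uinit (snd (?D p)) (?u p) (?w p)) ys)" for ys
      proof (induction ys rule: rev_induct)
        case Nil
        have "sz (0::nat) \<le> 5" "sz (1::nat) \<le> 5" "sz (2::nat) \<le> 9"
          using sz_nat_le[of 0] sz_nat_le[of 1] sz_nat_le[of 2] blen_le[of 1] blen_le[of 2] by simp_all
        then show ?case
          using length_le_sz[of "?u p"] length_le_sz[of "?w p"] length_le_sz[of "snd (?D p)"]
          by (auto simp: uinv_def uinit_def Let_def)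
      next
        case (snoc a ys)
        then show ?case using uinv_ustep[OF snoc, of "fst (?D p)"] by simp
      qed
      from uinv_size[OF this[of ys]] have "sz (foldl (\<lambda>s _. ustep (fst (?D p)) s) (uinit (snd (?D p)) (?u p) (?w p)) ys) \<le>
        Suc (?b p + Suc (?k p * Suc (Suc (Suc ((sz (?u p) + length ys) * 2) + Suc (?m p * Suc (?b p))))))" .
      also have "\<dots> \<le> ?B p"
        using length_le_sz[of "?u p"] that by (intro Suc_le_mono[THEN iffD2] add_left_mono mult_le_mono2 add_right_mono mult_le_mono1) simp
      finally show ?thesis .
    qed
    show "fp (\<lambda>p. ustep (fst (?D (fst p))) (fst (snd p)))" by (rule fp_comp2[OF fs]) (intro fp_intro)+
    show "fp (\<lambda>p. uinit (snd (?D p)) (?u p) (?w p))" by (rule fp_comp3[OF fi]) (intro fp_intro)+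
  qed (intro fp_intro)
  have fo: "fp (\<lambda>p::unit list \<times> nat \<times> utape list. uout (fst p) (snd p))"
  proof -
    let ?l = "\<lambda>p::unit list \<times> nat \<times> utape list. drop (length (fst p)) (snd (hdd ([], []) (snd (snd p))))"
    have "fp (\<lambda>p. foldl out_step (False, []) (?l p))"
    proof (rule fp_foldl[where f="\<lambda>_. out_step"])
      show "fp (\<lambda>p. out_step (fst (snd p)) (snd (snd p)))" unfolding out_step_def by (intro fp_intro)
      show "pb (\<lambda>p. 10 + 4 * sz (?l p))" by (intro fp_intro pb_sz)
      have o: "length (snd (foldl out_step s ys)) \<le> length (snd s) + length ys" for s ys
      proof (induction ys arbitrary: s)
        case (Cons a ys)
        have "length (snd (out_step s a)) \<le> Suc (length (snd s))" by (simp add: out_step_def)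
        then show ?case using Cons[of "out_step s a"] by simp
      qed simp
      show "sz (foldl out_step (False, []) ys) \<le> 10 + 4 * sz (?l p)" if "?l p = ys @ zs" for p ys zs
      proof -
        obtain c v where cv: "foldl out_step (False, []) ys = (c, v)" by fastforce
        have "length v \<le> length ys" using o[of "(False, [])" ys] cv by simp
        moreover have "length ys \<le> sz (?l p)" using length_le_sz[of "?l p"] that by simp
        moreover have "sz c \<le> 3" by (cases c) auto
        ultimately show ?thesis unfolding cv using sz_bools[of v] by simp
      qed
    qed (intro fp_intro)+
    then show ?thesis unfolding uout_def by (intro fp_intro)
  qed
  have "fp (\<lambda>p. usim (?D p) (?u p) (?w p))" unfolding usim_def
    by (rule fp_comp2[OF fo]) (intro fp_intro, rule fl)
  then show ?thesis by (rule fp_comp3[where F=usim]) (rule assms)+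
qed

subsection \<open>Polynomially long unary words\<close>

text \<open>Provides the clocks for simulations and the lengths of witnesses.\<close>

lemma fp_unary_power:
  assumes "fp u"
  shows "\<exists>f. fp f \<and> (\<forall>x. length (f x :: unit list) = length (u x :: 'c::enc list) ^ k)"
proof (induction k)
  case 0
  show ?case by (rule exI[of _ "\<lambda>_. [()]"]) (simp add: fp_const)
next
  case (Suc k)
  then obtain f where f: "fp f" "\<And>x. length (f x :: unit list) = length (u x) ^ k" by blast
  have "length (concat (map (\<lambda>_. v) w)) = length w * length v" for v :: "unit list" and w :: "'c list"
    by (induction w) auto
  then show ?case
    by (intro exI[of _ "\<lambda>x. concat (map (\<lambda>_. f x) (u x))"])
      (auto simp: f intro!: fp_intro fp_comp[OF f(1)] assms)
qed

lemma poly_le_power: "\<exists>k. \<forall>n. poly (p :: nat poly) n \<le> (n + 2) ^ k"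
proof -
  have "pbn (poly p)"
  proof (induction p)
    case (pCons a p)
    then show ?case unfolding poly_pCons by (intro pbn_intros)
  qed (simp add: pbn_const[of 0])
  then show ?thesis unfolding pbn_def .
qed

lemma halts_with_mono:
  assumes "halts_with ((step M ^^ t) c) v" "t \<le> t'"
  shows "halts_with ((step M ^^ t') c) v"
proof -
  obtain ts where 1: "(step M ^^ t) c = (1, ts)"
    using assms(1) by (cases "(step M ^^ t) c") (auto simp: halts_with_def)
  have "(step M ^^ n) (1, ts) = (1, ts)" for n by (induction n) auto
  moreover have "(step M ^^ t') c = (step M ^^ (t' - t)) ((step M ^^ t) c)"
    using assms(2) by (simp flip: funpow_add[THEN fun_cong, simplified])
  ultimately show ?thesis using assms(1) 1 by simp
qed

text \<open>The machine is kept explicit, since certificates contain it.\<close>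

lemma poly_time_usim:
  assumes "poly_time f"
  shows "\<exists>D k. \<forall>n t. (blen n + 2) ^ k \<le> length t \<longrightarrow> usim D t (bits n) = f n"
proof -
  obtain M p where M: "turing_machine M" "computes_within M f (\<lambda>n. poly p (blen n))"
    using assms unfolding poly_time_def by blast
  obtain k where k: "\<And>n. poly p n \<le> (n + 2) ^ k" using poly_le_power by blast
  \<comment> \<open>One factor more than the running time needs makes the clock exceed the input
    length as well.\<close>
  have "usim (desc M, replicate (ntapes M) ()) u (bits n) = f n" if "(blen n + 2) ^ Suc k \<le> length u" for n u
  proof (rule usim_correct[OF M(1) _ refl])
    have "(blen n + 2) ^ k \<le> (blen n + 2) ^ Suc k" "(blen n + 2) ^ 1 \<le> (blen n + 2) ^ Suc k"
      by (intro power_increasing; simp)+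
    then have l: "poly p (blen n) \<le> length u" "blen n \<le> length u" using k[of "blen n"] that by simp_all
    show h: "halts_with ((step M ^^ length u) (init_config M (bits n))) (bits (f n))"
      using halts_with_mono[OF _ l(1)] M(2) unfolding computes_within_def by blast
    \<comment> \<open>A longer output would have a digit in cell \<open>length u\<close>, but the
      input does not extend to this cell and the head cannot have written there in time.\<close>
    show "blen (f n) \<le> length u"
    proof (rule ccontr)
      assume "\<not> ?thesis"
      then have b: "length u < blen (f n)" by simp
      obtain q ts where 1: "(step M ^^ length u) (init_config M (bits n)) = (q, ts)" by fastforce
      have "ts \<noteq> []" using tm_inv[OF M(1) 1] M(1) by (auto simp: turing_machine_def)
      then have "fst (hd ts) (int (length u)) = 0" using tm_inv[OF M(1) 1] l(2) by simp
      moreover have "fst (hd ts) (int (length u)) = fst (word_tape (bits (f n))) (int (length u))"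
        using h 1 b by (simp add: halts_with_def)
      ultimately show False using b by (simp add: word_tape_def split: if_splits)
    qed
  qed simp
  then show ?thesis by blast
qed

text \<open>The universal simulation is run with a polynomial clock. This brings the given proof
  systems and their simulations, known only as Turing machines, into the class.\<close>

lemma fp_of_poly_time:
  assumes "poly_time f"
  shows "fp f"
proof -
  obtain D k where *: "\<And>n t. (blen n + 2) ^ k \<le> length t \<Longrightarrow> usim D t (bits n) = f n"
    using poly_time_usim[OF assms] by blast
  have "fp (\<lambda>n. True # True # bits n)" by (intro fp_intro)
  then obtain u where u: "fp u" "\<And>n. length (u n :: unit list) = length (True # True # bits n) ^ k"
    using fp_unary_power by blast
  have "fp (\<lambda>n. usim D (u n) (bits n))" by (intro fp_intro u)
  moreover have "usim D (u n) (bits n) = f n" for n by (rule *) (simp add: u)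
  ultimately show ?thesis by simp
qed

section \<open>The Cook-Levin theorem\<close>

section \<open>Propositional encoding of computations\<close>

subsection \<open>Clauses\<close>

definition lit_pf :: "bool \<times> nat \<Rightarrow> pform" where
  "lit_pf l = (if fst l then PVar (snd l) else PNot (PVar (snd l)))"

definition clause_pf :: "(bool \<times> nat) list \<Rightarrow> pform" where
  "clause_pf c = foldr (\<lambda>l F. POr (lit_pf l) F) c (PAnd (PVar 0) (PNot (PVar 0)))"

definition cnf_pf :: "(bool \<times> nat) list list \<Rightarrow> pform" where
  "cnf_pf cs = foldr (\<lambda>c F. PAnd (clause_pf c) F) cs (POr (PVar 0) (PNot (PVar 0)))"

definition sat_clause :: "(nat \<Rightarrow> bool) \<Rightarrow> (bool \<times> nat) list \<Rightarrow> bool" where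
  "sat_clause v c \<longleftrightarrow> (\<exists>l\<in>set c. v (snd l) = fst l)"

lemma psat_lit: "psat v (lit_pf l) \<longleftrightarrow> v (snd l) = fst l"
  by (simp add: lit_pf_def)

lemma psat_clause: "psat v (clause_pf c) \<longleftrightarrow> sat_clause v c"
  unfolding clause_pf_def sat_clause_def by (induction c) (auto simp: psat_lit)

lemma psat_cnf: "psat v (cnf_pf cs) \<longleftrightarrow> (\<forall>c\<in>set cs. sat_clause v c)"
  unfolding cnf_pf_def by (induction cs) (auto simp: psat_clause)

lemma ptokens_clause: "ptokens (clause_pf c) =
  concat (map (\<lambda>l. if fst l then [3, 0, snd l] else [3, 1, 0, snd l]) c) @ [2, 0, 0, 1, 0, 0]"
  unfolding clause_pf_def by (induction c) (auto simp: lit_pf_def)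

lemma ptokens_cnf: "ptokens (cnf_pf cs) = concat (map (\<lambda>c. 2 # ptokens (clause_pf c)) cs) @ [3, 0, 0, 1, 0, 0]"
  unfolding cnf_pf_def by (induction cs) auto

lemma fp_ptokens_cnf [fp_intro]: "fp f \<Longrightarrow> fp (\<lambda>x. ptokens (cnf_pf (f x)))"
  unfolding ptokens_cnf ptokens_clause by (intro fp_intro)

text \<open>The machine is deterministic, so its transitions can be written as implications that
  force the variables of the actual configuration step by step.\<close>

definition horn :: "nat list \<Rightarrow> nat \<Rightarrow> (bool \<times> nat) list" where
  "horn ps q = map (\<lambda>x. (False, x)) ps @ [(True, q)]"

lemma sat_horn: "sat_clause v (horn ps q) \<longleftrightarrow> ((\<forall>x\<in>set ps. v x) \<longrightarrow> v q)"
  by (auto simp: sat_clause_def horn_def)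

lemma fp_horn [fp_intro]: "fp f \<Longrightarrow> fp g \<Longrightarrow> fp (\<lambda>x. horn (f x) (g x))"
  unfolding horn_def by (intro fp_intro)

subsection \<open>Numbering of the variables\<close>

text \<open>A pairing by a polynomial without division: the same expression is later a term of the
  language of arithmetic.\<close>

definition pr2 :: "nat \<Rightarrow> nat \<Rightarrow> nat" where "pr2 a b = (a + b) * (a + b) + a"

text \<open>The value lies between the squares of \<open>a + b\<close> and of
  \<open>a + b + 1\<close>, so it determines \<open>a + b\<close> and then \<open>a\<close>.\<close>

lemma pr2_inject [simp]: "pr2 a b = pr2 c d \<longleftrightarrow> a = c \<and> b = d"
proof -
  have "a + b \<le> c + d" if "pr2 a b = pr2 c d" for a b c d
  proof (rule ccontr)
    assume "\<not> a + b \<le> c + d"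
    then have "Suc (c + d) \<le> a + b" by simp
    from mult_le_mono[OF this this] have "Suc (c + d) * Suc (c + d) \<le> (a + b) * (a + b)" .
    then show False using that by (simp add: pr2_def)
  qed
  from this[of a b c d] this[of c d a b] have "a + b = c + d" if "pr2 a b = pr2 c d" using that by simp
  then show ?thesis by (auto simp: pr2_def)
qed

definition pr5 :: "nat \<Rightarrow> nat \<Rightarrow> nat \<Rightarrow> nat \<Rightarrow> nat \<Rightarrow> nat" where
  "pr5 t s a b c = pr2 t (pr2 s (pr2 a (pr2 b c)))"

lemma pr5_inject [simp]: "pr5 t s a b c = pr5 t' s' a' b' c' \<longleftrightarrow> t = t' \<and> s = s' \<and> a = a' \<and> b = b' \<and> c = c'"
  by (auto simp: pr5_def)

lemma fp_pr5 [fp_intro]: "fp t \<Longrightarrow> fp s \<Longrightarrow> fp a \<Longrightarrow> fp b \<Longrightarrow> fp c \<Longrightarrow> fp (\<lambda>x. pr5 (t x) (s x) (a x) (b x) (c x))"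
  unfolding pr5_def pr2_def by (intro fp_intro)

text \<open>Variables: state, symbol read, transition, head position, cell content, free input bit. Positions are
  shifted by the time bound \<open>T\<close> so as to be nonnegative.\<close>

abbreviation "vQ s q \<equiv> pr5 0 s q 0 0"
abbreviation "vR s \<tau> a \<equiv> pr5 6 s \<tau> a 0"
abbreviation "vK s j \<equiv> pr5 2 s j 0 0"
abbreviation "vH s \<tau> c \<equiv> pr5 3 s \<tau> c 0"
abbreviation "vC s \<tau> c a \<equiv> pr5 4 s \<tau> c a"
abbreviation "vI i \<equiv> pr5 5 i 0 0 0"

subsection \<open>The clauses\<close>

definition combos :: "machine \<Rightarrow> (nat \<times> nat list) list" where
  "combos M = concat (map (\<lambda>q. map (\<lambda>as. (q, as)) (List.n_lists (ntapes M) [0..<nsyms M])) [0..<nstates M])"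

text \<open>The halting state is made to idle, as in \<open>step\<close>, so that the configuration
  at the time bound still shows the result.\<close>

definition trans :: "machine \<Rightarrow> nat \<Rightarrow> nat \<times> (nat \<times> move) list" where
  "trans M j = (let (q, as) = combos M ! j in if q = 1 then (1, map (\<lambda>a. (a, Stay)) as) else delta M q as)"

definition cl_read :: "machine \<Rightarrow> nat list \<Rightarrow> nat list \<Rightarrow> (bool \<times> nat) list list" where
  "cl_read M ss cs = concat (map (\<lambda>s. concat (map (\<lambda>c. concat (map (\<lambda>\<tau>. concat (map (\<lambda>a.
     [horn [vH s \<tau> c, vC s \<tau> c a] (vR s \<tau> a)]) [0..<nsyms M])) [0..<ntapes M])) cs)) ss)"

lemma mem_concat_map: "x \<in> set xs \<Longrightarrow> y \<in> set (f x) \<Longrightarrow> y \<in> set (concat (map f xs))"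
  by auto

lemma mem_cl_read:
  "s \<in> set ss \<Longrightarrow> c \<in> set cs \<Longrightarrow> \<tau> < ntapes M \<Longrightarrow> a < nsyms M \<Longrightarrow>
   horn [vH s \<tau> c, vC s \<tau> c a] (vR s \<tau> a) \<in> set (cl_read M ss cs)"
  unfolding cl_read_def by (simp add: image_iff, intro bexI, rule refl) auto

definition cl_trans :: "machine \<Rightarrow> nat list \<Rightarrow> (bool \<times> nat) list list" where
  "cl_trans M ss = concat (map (\<lambda>s. concat (map (\<lambda>j.
     [horn (vQ s (fst (combos M ! j)) # concat (map (\<lambda>\<tau>. [vR s \<tau> (snd (combos M ! j) ! \<tau>)]) [0..<ntapes M])) (vK s j),
      horn [vK s j] (vQ (Suc s) (fst (trans M j)))]) [0..<length (combos M)])) ss)"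

definition cl_write :: "machine \<Rightarrow> nat list \<Rightarrow> nat list \<Rightarrow> (bool \<times> nat) list list" where
  "cl_write M ss cs = concat (map (\<lambda>s. concat (map (\<lambda>c. concat (map (\<lambda>j. concat (map (\<lambda>\<tau>.
     [horn [vK s j, vH s \<tau> c] (vC (Suc s) \<tau> c (fst (snd (trans M j) ! \<tau>))),
      (case snd (snd (trans M j) ! \<tau>) of
         Lft \<Rightarrow> horn [vK s j, vH s \<tau> (Suc c)] (vH (Suc s) \<tau> c)
       | Stay \<Rightarrow> horn [vK s j, vH s \<tau> c] (vH (Suc s) \<tau> c)
       | Rgt \<Rightarrow> horn [vK s j, vH s \<tau> c] (vH (Suc s) \<tau> (Suc c)))])
     [0..<ntapes M])) [0..<length (combos M)])) cs)) ss)"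

definition cl_keep :: "machine \<Rightarrow> nat list \<Rightarrow> nat list \<Rightarrow> (bool \<times> nat) list list" where
  "cl_keep M ss cs = concat (map (\<lambda>s. concat (map (\<lambda>c. concat (map (\<lambda>d. if c = d then [] else
     concat (map (\<lambda>\<tau>. concat (map (\<lambda>a.
     [horn [vH s \<tau> c, vC s \<tau> d a] (vC (Suc s) \<tau> d a)]) [0..<nsyms M])) [0..<ntapes M])) cs)) cs)) ss)"

definition cl_init :: "machine \<Rightarrow> nat \<Rightarrow> nat list \<Rightarrow> (bool \<times> nat) list list" where
  "cl_init M T cs = [(True, vQ 0 0)] # concat (map (\<lambda>\<tau>. [[(True, vH 0 \<tau> T)]]) [0..<ntapes M]) @
     concat (map (\<lambda>c. concat (map (\<lambda>\<tau>. [[(True, vC 0 \<tau> c 0)]]) [1..<ntapes M])) cs)"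

definition cl_input :: "nat \<Rightarrow> nat list \<Rightarrow> bool list \<Rightarrow> unit list \<Rightarrow> (bool \<times> nat) list list" where
  "cl_input T cs p l =
     concat (map (\<lambda>c. if c < T \<or> T + length p + length l < c then [[(True, vC 0 0 c 0)]] else []) cs) @
     map (\<lambda>z. [(True, vC 0 0 (T + fst z) (if snd z then 2 else 1))]) (zip [0..<length p] p) @
     concat (map (\<lambda>i. [[(False, vI i), (True, vC 0 0 (T + length p + i) 2)], [(True, vI i), (True, vC 0 0 (T + length p + i) 1)]])
       [0..<length l]) @
     [[(True, vC 0 0 (T + length p + length l) 2)]]"

text \<open>The last clause denies acceptance: that the machine has halted with digit one in cell
  \<open>0\<close>, which has position \<open>T\<close> after the shift. Satisfying assignments
  therefore correspond to rejected inputs.\<close>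

definition clauses :: "machine \<Rightarrow> unit list \<Rightarrow> bool list \<Rightarrow> unit list \<Rightarrow> (bool \<times> nat) list list" where
  "clauses M u p l = (let T = length u; ss = [0..<length u];
       cs = [0..<length (u @ u @ map (\<lambda>_. ()) p @ l @ [(), ()])] in
     cl_read M ss cs @ cl_trans M ss @ cl_write M ss cs @ cl_keep M ss cs @ cl_init M T cs @ cl_input T cs p l @
     [[(False, vQ T 1), (False, vC T 0 T 2)]])"

text \<open>The machine is fixed, so concatenations over its tapes, symbols and transitions fall
  under \<open>fp_concat_const\<close>; times and positions range over lists computed from the
  arguments.\<close>

lemma fp_clauses:
  assumes "fp u" "fp p" "fp l"
  shows "fp (\<lambda>x. clauses M (u x) (p x) (l x))"
proof -
  have r: "fp (\<lambda>y. cl_read M (fst y) (snd y))" unfolding cl_read_def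
    by (rule fp_concat_map, rule fp_concat_map, rule fp_concat_const, rule fp_concat_const) (intro fp_intro)+
  have t: "fp (\<lambda>y. cl_trans M y)" unfolding cl_trans_def
    by (rule fp_concat_map, rule fp_concat_const, intro fp_Cons fp_horn fp_concat_const) (intro fp_intro)+
  have w: "fp (\<lambda>y. cl_write M (fst y) (snd y))" unfolding cl_write_def
  proof (rule fp_concat_map, rule fp_concat_map, rule fp_concat_const, rule fp_concat_const)
    fix j \<tau>
    let ?s = "\<lambda>x::((nat list \<times> nat list) \<times> nat) \<times> nat. snd (fst x)"
    let ?c = "\<lambda>x::((nat list \<times> nat list) \<times> nat) \<times> nat. snd x"
    let ?d = "snd (snd (trans M j) ! \<tau>)"
    have "fp (\<lambda>x. case ?d of
         Lft \<Rightarrow> horn [vK (?s x) j, vH (?s x) \<tau> (Suc (?c x))] (vH (Suc (?s x)) \<tau> (?c x))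
       | Stay \<Rightarrow> horn [vK (?s x) j, vH (?s x) \<tau> (?c x)] (vH (Suc (?s x)) \<tau> (?c x))
       | Rgt \<Rightarrow> horn [vK (?s x) j, vH (?s x) \<tau> (?c x)] (vH (Suc (?s x)) \<tau> (Suc (?c x))))"
      by (cases ?d; simp only: move.case) (intro fp_intro)+
    then show "fp (\<lambda>x. [horn [vK (?s x) j, vH (?s x) \<tau> (?c x)] (vC (Suc (?s x)) \<tau> (?c x) (fst (snd (trans M j) ! \<tau>))),
      case ?d of
         Lft \<Rightarrow> horn [vK (?s x) j, vH (?s x) \<tau> (Suc (?c x))] (vH (Suc (?s x)) \<tau> (?c x))
       | Stay \<Rightarrow> horn [vK (?s x) j, vH (?s x) \<tau> (?c x)] (vH (Suc (?s x)) \<tau> (?c x))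
       | Rgt \<Rightarrow> horn [vK (?s x) j, vH (?s x) \<tau> (?c x)] (vH (Suc (?s x)) \<tau> (Suc (?c x)))])"
      by (intro fp_Cons fp_const) (intro fp_intro)+
  qed (intro fp_intro)+
  have k: "fp (\<lambda>y. cl_keep M (fst y) (snd y))" unfolding cl_keep_def
    apply (rule fp_concat_map, rule fp_concat_map, rule fp_concat_map, rule fp_if)
    apply (rule fp_eq)
    apply ((intro fp_intro)[1])
    apply ((intro fp_intro)[1])
    apply (rule fp_const)
    apply (rule fp_concat_const)
    apply (rule fp_concat_const)
    apply ((intro fp_intro)[1])
    apply ((intro fp_intro)[1])
    apply ((intro fp_intro)[1])
    apply ((intro fp_intro)[1])
    done
  have i: "fp (\<lambda>y. cl_init M (fst y) (snd y))" unfolding cl_init_def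
    by (rule fp_Cons, rule fp_const, rule fp_append, rule fp_concat_const, (intro fp_intro)[1],
      rule fp_concat_map, rule fp_concat_const) (intro fp_intro)+
  have n: "fp (\<lambda>y. cl_input (fst y) (fst (snd y)) (fst (snd (snd y))) (snd (snd (snd y))))"
    unfolding cl_input_def by (intro fp_append fp_Cons) (intro fp_intro)+
  let ?u = "\<lambda>y::unit list \<times> bool list \<times> unit list. fst y"
  let ?c = "\<lambda>y::unit list \<times> bool list \<times> unit list. [0..<length (fst y @ fst y @ map (\<lambda>_. ()) (fst (snd y)) @ snd (snd y) @ [(), ()])]"
  have c: "fp ?c" and s: "fp (\<lambda>y. [0..<length (?u y)])" and l: "fp (\<lambda>y. length (?u y))" by (intro fp_intro)+
  have "fp (\<lambda>y. clauses M (fst y) (fst (snd y)) (snd (snd y)))"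
    unfolding clauses_def Let_def
  proof (intro fp_append)
    show "fp (\<lambda>y. cl_read M [0..<length (?u y)] (?c y))" by (rule fp_comp2[OF r s c])
    show "fp (\<lambda>y. cl_trans M [0..<length (?u y)])" by (rule fp_comp[OF t s])
    show "fp (\<lambda>y. cl_write M [0..<length (?u y)] (?c y))" by (rule fp_comp2[OF w s c])
    show "fp (\<lambda>y. cl_keep M [0..<length (?u y)] (?c y))" by (rule fp_comp2[OF k s c])
    show "fp (\<lambda>y. cl_init M (length (?u y)) (?c y))" by (rule fp_comp2[OF i l c])
    show "fp (\<lambda>y. cl_input (length (?u y)) (?c y) (fst (snd y)) (snd (snd y)))"
    proof -
      have "fp (\<lambda>y. (length (?u y), ?c y, fst (snd y), snd (snd y)))" by (intro fp_Pair l c) (intro fp_intro)+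
      from fp_comp[OF n this] show ?thesis by (simp only: fst_conv snd_conv)
    qed
    show "fp (\<lambda>y. [[(False, vQ (length (?u y)) 1), (False, vC (length (?u y)) 0 (length (?u y)) 2)]])"
      by (intro fp_intro)
  qed
  then show ?thesis by (rule fp_comp3[where F="clauses M"]) (rule assms)+
qed

subsection \<open>Computations satisfy the clauses\<close>

lemma step_trans:
  assumes M: "turing_machine M" and c: "(step M ^^ n) (init_config M w) = (q, ts)"
  shows "\<exists>j<length (combos M). combos M ! j = (q, map read ts) \<and> length (snd (trans M j)) = ntapes M \<and>
    step M (q, ts) = (fst (trans M j), map2 act (snd (trans M j)) ts)"
proof -
  have inv: "q < nstates M" "length ts = ntapes M" "\<And>x i. x \<in> set ts \<Longrightarrow> fst x i < nsyms M"
    using tm_inv[OF assms] by auto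
  have as: "length (map read ts) = ntapes M" "\<forall>a\<in>set (map read ts). a < nsyms M"
    using inv by (auto simp: read_def split: prod.splits)
  then have "map read ts \<in> set (List.n_lists (ntapes M) [0..<nsyms M])" by (auto simp: set_n_lists)
  then have "(q, map read ts) \<in> set (combos M)" using inv(1) unfolding combos_def by auto
  then obtain j where j: "j < length (combos M)" "combos M ! j = (q, map read ts)" by (auto simp: in_set_conv_nth)
  have "length (snd (delta M q (map read ts))) = ntapes M"
    using M inv(1) as unfolding turing_machine_def by blast
  moreover have "map2 act (map (\<lambda>a. (a, Stay)) (map read ts)) ts = ts"
    using map2_act_keep[of ts] by (simp add: keep_def)
  ultimately have "length (snd (trans M j)) = ntapes M \<and> step M (q, ts) = (fst (trans M j), map2 act (snd (trans M j)) ts)"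
    using j(2) inv(2) unfolding read_def by (auto simp: trans_def split: prod.splits simp del: map_map)
  then show ?thesis using j by blast
qed

locale run =
  fixes M :: machine and w :: "bool list"
  assumes tm: "turing_machine M"
begin

definition conf :: "nat \<Rightarrow> config" where "conf n = (step M ^^ n) (init_config M w)"
definition state :: "nat \<Rightarrow> nat" where "state n = fst (conf n)"
definition head :: "nat \<Rightarrow> nat \<Rightarrow> int" where "head n \<tau> = snd (snd (conf n) ! \<tau>)"
definition cell :: "nat \<Rightarrow> nat \<Rightarrow> int \<Rightarrow> nat" where "cell n \<tau> i = fst (snd (conf n) ! \<tau>) i"

lemma conf_inv:
  "length (snd (conf n)) = ntapes M"
  "\<tau> < ntapes M \<Longrightarrow> \<bar>head n \<tau>\<bar> \<le> int n"
  "\<tau> < ntapes M \<Longrightarrow> cell n \<tau> i < nsyms M"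
proof -
  have "conf n = (fst (conf n), snd (conf n))" by simp
  from tm_inv[OF tm this[unfolded conf_def]]
  have *: "length (snd (conf n)) = ntapes M" "\<forall>x\<in>set (snd (conf n)). \<bar>snd x\<bar> \<le> int n \<and> (\<forall>i. fst x i < nsyms M)"
    unfolding conf_def by auto
  then show "length (snd (conf n)) = ntapes M" by simp
  show "\<tau> < ntapes M \<Longrightarrow> \<bar>head n \<tau>\<bar> \<le> int n" "\<tau> < ntapes M \<Longrightarrow> cell n \<tau> i < nsyms M"
    using * unfolding head_def cell_def by simp_all
qed

definition jj :: "nat \<Rightarrow> nat" where
  "jj n = (SOME j. j < length (combos M) \<and> combos M ! j = (state n, map read (snd (conf n))) \<and>
    length (snd (trans M j)) = ntapes M \<and> conf (Suc n) = (fst (trans M j), map2 act (snd (trans M j)) (snd (conf n))))"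

lemma jj: "jj n < length (combos M)" "combos M ! jj n = (state n, map read (snd (conf n)))"
  "length (snd (trans M (jj n))) = ntapes M"
  "conf (Suc n) = (fst (trans M (jj n)), map2 act (snd (trans M (jj n))) (snd (conf n)))"
proof -
  have e: "conf n = (state n, snd (conf n))" by (simp add: state_def)
  have "conf (Suc n) = step M (state n, snd (conf n))" using e by (simp add: conf_def)
  then have "\<exists>j<length (combos M). combos M ! j = (state n, map read (snd (conf n))) \<and> length (snd (trans M j)) = ntapes M \<and>
    conf (Suc n) = (fst (trans M j), map2 act (snd (trans M j)) (snd (conf n)))"
    using step_trans[OF tm e[unfolded conf_def]] unfolding conf_def by simp
  then have "jj n < length (combos M) \<and> combos M ! jj n = (state n, map read (snd (conf n))) \<and>
    length (snd (trans M (jj n))) = ntapes M \<and> conf (Suc n) = (fst (trans M (jj n)), map2 act (snd (trans M (jj n))) (snd (conf n)))"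
    unfolding jj_def by (rule someI_ex)
  then show "jj n < length (combos M)" "combos M ! jj n = (state n, map read (snd (conf n)))"
  "length (snd (trans M (jj n))) = ntapes M"
  "conf (Suc n) = (fst (trans M (jj n)), map2 act (snd (trans M (jj n))) (snd (conf n)))" by auto
qed

lemma read_nth: "\<tau> < ntapes M \<Longrightarrow> map read (snd (conf n)) ! \<tau> = cell n \<tau> (head n \<tau>)"
  using conf_inv(1)[of n] by (simp add: read_def cell_def head_def split: prod.split)

lemma step_facts:
  "state (Suc n) = fst (trans M (jj n))"
  "\<tau> < ntapes M \<Longrightarrow> head (Suc n) \<tau> = head n \<tau> + shift (snd (snd (trans M (jj n)) ! \<tau>))"
  "\<tau> < ntapes M \<Longrightarrow> cell (Suc n) \<tau> i = (if i = head n \<tau> then fst (snd (trans M (jj n)) ! \<tau>) else cell n \<tau> i)"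
proof -
  show "state (Suc n) = fst (trans M (jj n))" by (simp add: state_def jj(4))
  assume t: "\<tau> < ntapes M"
  then have "snd (conf (Suc n)) ! \<tau> = act (snd (trans M (jj n)) ! \<tau>) (snd (conf n) ! \<tau>)"
    using conf_inv(1)[of n] jj(3)[of n] by (simp add: jj(4))
  then show "head (Suc n) \<tau> = head n \<tau> + shift (snd (snd (trans M (jj n)) ! \<tau>))"
    "cell (Suc n) \<tau> i = (if i = head n \<tau> then fst (snd (trans M (jj n)) ! \<tau>) else cell n \<tau> i)"
    unfolding head_def cell_def
    by (cases "snd (trans M (jj n)) ! \<tau>"; cases "snd (conf n) ! \<tau>"; simp)+
qed

lemma init_facts:
  "state 0 = 0" "\<tau> < ntapes M \<Longrightarrow> head 0 \<tau> = 0"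
  "\<tau> < ntapes M \<Longrightarrow> cell 0 \<tau> i = (if \<tau> = 0 then fst (word_tape w) i else 0)"
  unfolding state_def head_def cell_def conf_def init_config_def
  by (auto simp: nth_Cons' word_tape_def)

definition tv :: "nat \<Rightarrow> bool list \<Rightarrow> nat \<Rightarrow> bool" where
  "tv T \<beta> x \<longleftrightarrow> (\<exists>t s a b c. x = pr5 t s a b c \<and>
     (t = 0 \<and> a = state s \<or> t = 6 \<and> b = cell s a (head s a) \<or> t = 2 \<and> combos M ! a = (state s, map read (snd (conf s))) \<or>
      t = 3 \<and> int b = head s a + int T \<or> t = 4 \<and> c = cell s a (int b - int T) \<or> t = 5 \<and> \<beta> ! s))"

lemma tv_simps [simp]:
  "tv T \<beta> (vQ s q) \<longleftrightarrow> q = state s"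
  "tv T \<beta> (vR s \<tau> a) \<longleftrightarrow> a = cell s \<tau> (head s \<tau>)"
  "tv T \<beta> (vK s j) \<longleftrightarrow> combos M ! j = (state s, map read (snd (conf s)))"
  "tv T \<beta> (vH s \<tau> c) \<longleftrightarrow> int c = head s \<tau> + int T"
  "tv T \<beta> (vC s \<tau> c a) \<longleftrightarrow> a = cell s \<tau> (int c - int T)"
  "tv T \<beta> (vI i) \<longleftrightarrow> \<beta> ! i"
  by (auto simp: tv_def)

lemma trans_eq:
  "combos M ! j = (state s, map read (snd (conf s))) \<Longrightarrow> trans M j = trans M (jj s)"
  unfolding trans_def by (simp add: jj(2))

lemma length_n: "as \<in> set (List.n_lists n xs) \<Longrightarrow> length as = n"
  by (simp add: set_n_lists)

lemma combos_length: "j < length (combos M) \<Longrightarrow> length (snd (combos M ! j)) = ntapes M"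
proof -
  assume "j < length (combos M)"
  then have "combos M ! j \<in> set (combos M)" by simp
  then show ?thesis unfolding combos_def by (auto dest: length_n)
qed

lemma tv_satisfies:
  assumes w: "w = p @ \<beta> @ [True]" "length l = length \<beta>" "length u = T"
    and rej: "\<not> (state T = 1 \<and> cell T 0 0 = 2)"
    and c: "c \<in> set (clauses M u p l)"
  shows "sat_clause (tv T \<beta>) c"
proof -
  have nt: "0 < ntapes M" using tm by (simp add: turing_machine_def)
  have cl: "c \<in> set (cl_read M ss cs) \<Longrightarrow> sat_clause (tv T \<beta>) c"
    "c \<in> set (cl_trans M ss) \<Longrightarrow> sat_clause (tv T \<beta>) c"
    "c \<in> set (cl_write M ss cs) \<Longrightarrow> sat_clause (tv T \<beta>) c"
    "c \<in> set (cl_keep M ss cs) \<Longrightarrow> sat_clause (tv T \<beta>) c"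
    "c \<in> set (cl_init M T cs) \<Longrightarrow> sat_clause (tv T \<beta>) c"
    "c \<in> set (cl_input T cs p l) \<Longrightarrow> sat_clause (tv T \<beta>) c" for ss cs
  proof -
    assume "c \<in> set (cl_read M ss cs)"
    then show "sat_clause (tv T \<beta>) c" unfolding cl_read_def by (auto simp: sat_horn)
  next
    assume "c \<in> set (cl_trans M ss)"
    then obtain s j where j: "j < length (combos M)" and
      "c = horn (vQ s (fst (combos M ! j)) # map (\<lambda>\<tau>. vR s \<tau> (snd (combos M ! j) ! \<tau>)) [0..<ntapes M]) (vK s j) \<or>
       c = horn [vK s j] (vQ (Suc s) (fst (trans M j)))"
      unfolding cl_trans_def by (auto; blast)
    moreover have "combos M ! j = (state s, map read (snd (conf s)))"
      if "fst (combos M ! j) = state s" "\<forall>\<tau><ntapes M. snd (combos M ! j) ! \<tau> = cell s \<tau> (head s \<tau>)"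
    proof -
      have "snd (combos M ! j) = map read (snd (conf s))"
        by (rule nth_equalityI) (use that(2) combos_length[OF j] conf_inv(1)[of s] in \<open>auto simp: read_nth[symmetric]\<close>)
      then show ?thesis using that(1) by (metis prod.collapse)
    qed
    ultimately show "sat_clause (tv T \<beta>) c" by (auto simp: sat_horn step_facts(1)) (metis trans_eq)
  next
    assume "c \<in> set (cl_write M ss cs)"
    then obtain s d j \<tau> where t: "\<tau> < ntapes M" and
      "c = horn [vK s j, vH s \<tau> d] (vC (Suc s) \<tau> d (fst (snd (trans M j) ! \<tau>))) \<or>
       c = (case snd (snd (trans M j) ! \<tau>) of
         Lft \<Rightarrow> horn [vK s j, vH s \<tau> (Suc d)] (vH (Suc s) \<tau> d)
       | Stay \<Rightarrow> horn [vK s j, vH s \<tau> d] (vH (Suc s) \<tau> d)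
       | Rgt \<Rightarrow> horn [vK s j, vH s \<tau> d] (vH (Suc s) \<tau> (Suc d)))"
      unfolding cl_write_def by (auto; blast)
    then show "sat_clause (tv T \<beta>) c"
    proof (cases "combos M ! j = (state s, map read (snd (conf s)))")
      case True
      then show ?thesis
        using \<open>c = _ \<or> c = _\<close> unfolding trans_eq[OF True]
        by (cases "snd (snd (trans M (jj s)) ! \<tau>)") (auto simp: sat_horn step_facts(2,3)[OF t])
    qed (cases "snd (snd (trans M j) ! \<tau>)"; auto simp: sat_horn)
  next
    assume "c \<in> set (cl_keep M ss cs)"
    then show "sat_clause (tv T \<beta>) c" unfolding cl_keep_def
      by (auto simp: sat_horn step_facts(3) split: if_splits)
  next
    assume "c \<in> set (cl_init M T cs)"
    then show "sat_clause (tv T \<beta>) c" unfolding cl_init_def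
      by (auto simp: sat_clause_def init_facts)
  next
    have c0: "cell 0 0 i = fst (word_tape (p @ \<beta> @ [True])) i" for i
      using init_facts(3)[OF nt] w(1) by simp
    assume "c \<in> set (cl_input T cs p l)"
    then show "sat_clause (tv T \<beta>) c" unfolding cl_input_def
      using w(2) by (auto simp: sat_clause_def c0 word_tape_def nth_append in_set_zip nat_int_add split: if_splits)
  qed
  have "int T - int T = 0" by simp
  then have "sat_clause (tv T \<beta>) [(False, vQ T 1), (False, vC T 0 T 2)]"
    using rej by (auto simp: sat_clause_def)
  then show ?thesis using c cl w(3) unfolding clauses_def Let_def by auto
qed

text \<open>The clauses force the variables that describe the actual run to be true. Nothing is
  claimed about the other variables; positive facts are enough to contradict the negative last
  clause.\<close>

lemma satisfied_facts:
  assumes w: "w = p @ \<beta> @ [True]" "length l = length \<beta>" "length u = T" "\<And>i. i < length \<beta> \<Longrightarrow> \<beta> ! i \<longleftrightarrow> v (vI i)"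
    and v: "\<And>c. c \<in> set (clauses M u p l) \<Longrightarrow> sat_clause v c"
    and s: "s \<le> T"
  shows "v (vQ s (state s)) \<and> (\<forall>\<tau><ntapes M. v (vH s \<tau> (nat (head s \<tau> + int T))) \<and>
     (\<forall>c < T + T + length p + length l + 2. v (vC s \<tau> c (cell s \<tau> (int c - int T)))))"
  using s
proof (induction s)
  case 0
  let ?W = "T + T + length p + length l + 2"
  define cs where "cs = [0..<length (u @ u @ map (\<lambda>_. ()) p @ l @ [(), ()])]"
  have cs: "set cs = {..<?W}" using w(3) by (auto simp: cs_def)
  have i: "sat_clause v c" if "c \<in> set (cl_init M T cs)" for c
    using v[of c] that w(3) unfolding clauses_def Let_def cs_def by auto
  have n: "sat_clause v c" if "c \<in> set (cl_input T cs p l)" for c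
    using v[of c] that w(3) unfolding clauses_def Let_def cs_def by auto
  have q: "v (vQ 0 0)" using i[of "[(True, vQ 0 0)]"] by (simp add: cl_init_def sat_clause_def)
  have h: "v (vH 0 \<tau> T)" if "\<tau> < ntapes M" for \<tau>
    using i[of "[(True, vH 0 \<tau> T)]"] that by (auto simp: cl_init_def sat_clause_def)
  have c1: "v (vC 0 \<tau> c 0)" if "\<tau> < ntapes M" "0 < \<tau>" "c < ?W" for \<tau> c
  proof -
    have "[(True, vC 0 \<tau> c 0)] \<in> set (cl_init M T cs)"
    proof -
      have "[(True, vC 0 \<tau> c 0)] \<in> set (concat (map (\<lambda>\<tau>. [[(True, vC 0 \<tau> c 0)]]) [1..<ntapes M]))"
        using that by (auto simp: image_iff)
      then show ?thesis using that(3) unfolding cl_init_def by (auto simp: cs)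
    qed
    from i[OF this] show ?thesis by (simp add: sat_clause_def)
  qed
  have c0: "v (vC 0 0 c (fst (word_tape (p @ \<beta> @ [True])) (int c - int T)))" if "c < ?W" for c
  proof -
    have "c < T \<or> T + length p + length l < c \<or> (c = T + (c - T) \<and> c - T < length p) \<or>
      (c = T + length p + (c - T - length p) \<and> c - T - length p < length l) \<or> c = T + length p + length l"
      by linarith
    then consider "c < T \<or> T + length p + length l < c" | i where "c = T + i" "i < length p"
      | i where "c = T + length p + i" "i < length l" | "c = T + length p + length l"
      by blast
    then show ?thesis
    proof cases
      case 1
      then have "[(True, vC 0 0 c 0)] \<in> set (cl_input T cs p l)"
        using that unfolding cl_input_def by (auto simp: cs)
      from n[OF this] have "v (vC 0 0 c 0)" by (simp add: sat_clause_def)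
      moreover have "fst (word_tape (p @ \<beta> @ [True])) (int c - int T) = 0"
        using 1 w(2) by (auto simp: word_tape_def)
      ultimately show ?thesis by simp
    next
      case (2 i)
      have "(i, p ! i) \<in> set (zip [0..<length p] p)" using 2(2) by (force simp: in_set_zip)
      then have "[(True, vC 0 0 (T + i) (if p ! i then 2 else 1))] \<in>
          set (cl_input T cs p l)"
        unfolding cl_input_def by force
      from n[OF this] have "v (vC 0 0 (T + i) (if p ! i then 2 else 1))" by (simp add: sat_clause_def)
      moreover have "fst (word_tape (p @ \<beta> @ [True])) (int c - int T) = (if p ! i then 2 else 1)"
        using 2 by (auto simp: word_tape_def nth_append)
      ultimately show ?thesis using 2(1) by simp
    next
      case (3 i)
      have "[(False, vI i), (True, vC 0 0 (T + length p + i) 2)] \<in>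
          set (cl_input T cs p l)"
        "[(True, vI i), (True, vC 0 0 (T + length p + i) 1)] \<in>
          set (cl_input T cs p l)"
        using 3(2) unfolding cl_input_def by auto
      from n[OF this(1)] n[OF this(2)] have "v (vC 0 0 (T + length p + i) (if v (vI i) then 2 else 1))"
        by (auto simp: sat_clause_def)
      moreover have "fst (word_tape (p @ \<beta> @ [True])) (int c - int T) = (if v (vI i) then 2 else 1)"
        using 3 w(2,4) by (auto simp: word_tape_def nth_append nat_int_add)
      ultimately show ?thesis using 3(1) by simp
    next
      case 4
      have "[(True, vC 0 0 (T + length p + length l) 2)] \<in>
          set (cl_input T cs p l)"
        unfolding cl_input_def by auto
      from n[OF this] have "v (vC 0 0 c 2)" using 4 by (simp add: sat_clause_def)
      moreover have "fst (word_tape (p @ \<beta> @ [True])) (int c - int T) = 2"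
        using 4 w(2) by (auto simp: word_tape_def nth_append)
      ultimately show ?thesis by simp
    qed
  qed
  show ?case using q h c1 c0[folded w(1)] by (auto simp: init_facts)
next
  case (Suc s)
  let ?W = "T + T + length p + length l + 2"
  have IH: "v (vQ s (state s))" "\<And>\<tau>. \<tau> < ntapes M \<Longrightarrow> v (vH s \<tau> (nat (head s \<tau> + int T)))"
    "\<And>\<tau> c. \<tau> < ntapes M \<Longrightarrow> c < ?W \<Longrightarrow> v (vC s \<tau> c (cell s \<tau> (int c - int T)))"
    using Suc by auto
  define ss where "ss = [0..<length u]"
  define cs where "cs = [0..<length (u @ u @ map (\<lambda>_. ()) p @ l @ [(), ()])]"
  have cs: "set cs = {..<?W}" using w(3) by (auto simp: cs_def)
  have ss: "s \<in> set ss" using Suc.prems w(3) by (simp add: ss_def)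
  have cl: "sat_clause v c" if "c \<in> set (cl_read M ss cs) \<union> set (cl_trans M ss) \<union> set (cl_write M ss cs) \<union> set (cl_keep M ss cs)" for c
    using v[of c] that unfolding clauses_def Let_def ss_def cs_def by auto
  have pos: "0 \<le> head s \<tau> + int T" "nat (head s \<tau> + int T) < ?W" "Suc (nat (head s \<tau> + int T)) < ?W"
      "int (nat (head s \<tau> + int T)) - int T = head s \<tau>" if "\<tau> < ntapes M" for \<tau>
    using conf_inv(2)[OF that, of s] Suc.prems by linarith+
  have r: "v (vR s \<tau> (cell s \<tau> (head s \<tau>)))" if t: "\<tau> < ntapes M" for \<tau>
  proof -
    let ?c = "nat (head s \<tau> + int T)"
    have "horn [vH s \<tau> ?c, vC s \<tau> ?c (cell s \<tau> (head s \<tau>))] (vR s \<tau> (cell s \<tau> (head s \<tau>))) \<in> set (cl_read M ss cs)"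
      using ss cs pos(2)[OF t] t conf_inv(3)[OF t] by (intro mem_cl_read) auto
    then show ?thesis using cl IH(2)[OF t] IH(3)[OF t pos(2)[OF t]] pos(4)[OF t] by (fastforce simp: sat_horn)
  qed
  let ?j = "jj s"
  have k: "v (vK s ?j)"
  proof -
    have "horn (vQ s (fst (combos M ! ?j)) # concat (map (\<lambda>\<tau>. [vR s \<tau> (snd (combos M ! ?j) ! \<tau>)]) [0..<ntapes M])) (vK s ?j)
       \<in> set (cl_trans M ss)" unfolding cl_trans_def
      by (rule mem_concat_map[OF ss], rule mem_concat_map[of ?j]) (use jj(1)[of s] in simp_all)
    from cl[OF UnI1[OF UnI1[OF UnI2[OF this]]]] show ?thesis
      using IH(1) r by (auto simp: sat_horn jj(2) read_nth)
  qed
  have "horn [vK s ?j] (vQ (Suc s) (fst (trans M ?j))) \<in> set (cl_trans M ss)"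
    unfolding cl_trans_def
    by (rule mem_concat_map[OF ss], rule mem_concat_map[of ?j]) (use jj(1)[of s] in simp_all)
  from cl[OF UnI1[OF UnI1[OF UnI2[OF this]]]] have q: "v (vQ (Suc s) (state (Suc s)))"
    using k by (simp add: sat_horn step_facts(1))
  have "v (vH (Suc s) \<tau> (nat (head (Suc s) \<tau> + int T))) \<and> (\<forall>c<?W. v (vC (Suc s) \<tau> c (cell (Suc s) \<tau> (int c - int T))))"
    if t: "\<tau> < ntapes M" for \<tau>
  proof
    let ?c = "nat (head s \<tau> + int T)" and ?c' = "nat (head (Suc s) \<tau> + int T)"
    let ?a = "snd (trans M ?j) ! \<tau>"
    have wr: "c \<in> set (cl_write M ss cs)" if "d < ?W" "c = horn [vK s ?j, vH s \<tau> d] (vC (Suc s) \<tau> d (fst ?a)) \<or> 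
      c = (case snd ?a of
         Lft \<Rightarrow> horn [vK s ?j, vH s \<tau> (Suc d)] (vH (Suc s) \<tau> d)
       | Stay \<Rightarrow> horn [vK s ?j, vH s \<tau> d] (vH (Suc s) \<tau> d)
       | Rgt \<Rightarrow> horn [vK s ?j, vH s \<tau> d] (vH (Suc s) \<tau> (Suc d)))" for c d
      unfolding cl_write_def
      by (rule mem_concat_map[OF ss], rule mem_concat_map[of d], use that(1) cs in simp,
        rule mem_concat_map[of ?j], use jj(1)[of s] in simp, rule mem_concat_map[of \<tau>])
        (use that t in auto)
    have hd: "head (Suc s) \<tau> = head s \<tau> + shift (snd ?a)" using step_facts(2)[OF t] .
    have p': "0 \<le> head (Suc s) \<tau> + int T" using conf_inv(2)[OF t, of "Suc s"] Suc.prems by linarith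
    show "v (vH (Suc s) \<tau> ?c')"
    proof (cases "snd ?a")
      case Lft
      have "?c = Suc ?c'" using hd Lft p' by simp
      moreover have "?c' < ?W" using calculation pos(2)[OF t] by simp
      ultimately show ?thesis
        using cl[OF UnI1[OF UnI2[OF wr[of ?c' "horn [vK s ?j, vH s \<tau> (Suc ?c')] (vH (Suc s) \<tau> ?c')"]]]] Lft k IH(2)[OF t]
        by (simp add: sat_horn)
    next
      case Stay
      have "?c = ?c'" using hd Stay by simp
      then show ?thesis
        using cl[OF UnI1[OF UnI2[OF wr[of ?c "horn [vK s ?j, vH s \<tau> ?c] (vH (Suc s) \<tau> ?c)"]]]] Stay k IH(2)[OF t] pos(2)[OF t]
        by (simp add: sat_horn)
    next
      case Rgt
      have "?c' = Suc ?c" using hd Rgt pos(1)[OF t] by (simp add: nat_add_distrib algebra_simps)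
      then show ?thesis
        using cl[OF UnI1[OF UnI2[OF wr[of ?c "horn [vK s ?j, vH s \<tau> ?c] (vH (Suc s) \<tau> (Suc ?c))"]]]] Rgt k IH(2)[OF t] pos(2)[OF t]
        by (simp add: sat_horn)
    qed
    show "\<forall>d<?W. v (vC (Suc s) \<tau> d (cell (Suc s) \<tau> (int d - int T)))"
    proof (intro allI impI)
      fix d assume d: "d < ?W"
      show "v (vC (Suc s) \<tau> d (cell (Suc s) \<tau> (int d - int T)))"
      proof (cases "d = ?c")
        case True
        then have "int d - int T = head s \<tau>" using pos(4)[OF t] by simp
        then show ?thesis
          using cl[OF UnI1[OF UnI2[OF wr[of d "horn [vK s ?j, vH s \<tau> d] (vC (Suc s) \<tau> d (fst ?a))"]]]] d k IH(2)[OF t] True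
          by (simp add: sat_horn step_facts(3)[OF t])
      next
        case False
        then have ne: "int d - int T \<noteq> head s \<tau>" using pos(1)[OF t] by auto
        have "horn [vH s \<tau> ?c, vC s \<tau> d (cell s \<tau> (int d - int T))] (vC (Suc s) \<tau> d (cell s \<tau> (int d - int T)))
          \<in> set (cl_keep M ss cs)"
          unfolding cl_keep_def
          by (rule mem_concat_map[OF ss], rule mem_concat_map[of ?c], use pos(2)[OF t] cs in simp,
            rule mem_concat_map[of d], use d cs in simp, subst if_not_P, use False in simp,
            rule mem_concat_map[of \<tau>], use t in simp,
            rule mem_concat_map[of "cell s \<tau> (int d - int T)"])
            (use conf_inv(3)[OF t] in auto)
        from cl[OF UnI2[OF this]] show ?thesis
          using IH(2)[OF t] IH(3)[OF t d] ne by (simp add: sat_horn step_facts(3)[OF t])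
      qed
    qed
  qed
  then show ?case using q by blast
qed

theorem clauses_satisfiable:
  assumes "w = p @ \<beta> @ [True]" "length l = length \<beta>"
    and "\<And>i. i < length \<beta> \<Longrightarrow> \<beta> ! i \<longleftrightarrow> v (vI i)"
    and "\<And>c. c \<in> set (clauses M u p l) \<Longrightarrow> sat_clause v c"
  shows "\<not> (state (length u) = 1 \<and> cell (length u) 0 0 = 2)"
proof
  let ?T = "length u"
  assume a: "state ?T = 1 \<and> cell ?T 0 0 = 2"
  have nt: "0 < ntapes M" using tm by (simp add: turing_machine_def)
  have f: "v (vQ ?T (state ?T))" "\<And>\<tau> c. \<tau> < ntapes M \<Longrightarrow> c < ?T + ?T + length p + length l + 2 \<Longrightarrow> v (vC ?T \<tau> c (cell ?T \<tau> (int c - int ?T)))"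
    using satisfied_facts[OF assms(1,2) refl assms(3,4) order_refl] by auto
  have "v (vC ?T 0 ?T 2)" using f(2)[OF nt, of ?T] a by simp
  moreover have "sat_clause v [(False, vQ ?T 1), (False, vC ?T 0 ?T 2)]"
    by (rule assms(4)) (simp add: clauses_def Let_def)
  ultimately show False using f(1) a by (simp add: sat_clause_def)
qed

end

subsection \<open>Unique readability\<close>

lemma bits_tokens_code: "bits (tokens_code ks) = concat (map token_bits ks) @ [True]"
  by (simp add: tokens_code_def flip: num_horner)

lemma fp_token_bits [fp_intro]: "fp f \<Longrightarrow> fp (\<lambda>x. token_bits (f x))"
  unfolding token_bits_def by (intro fp_intro)

lemma fp_tokens_code [fp_intro]: "fp f \<Longrightarrow> fp (\<lambda>x. tokens_code (f x))"
  unfolding tokens_code_def num_horner[symmetric] by (intro fp_intro)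

lemma marked_inject: "concat (map (\<lambda>b. [True, b]) u) @ False # x = concat (map (\<lambda>b. [True, b]) v) @ False # y \<longleftrightarrow>
  u = v \<and> x = y"
proof (induction u arbitrary: v)
  case Nil
  then show ?case by (cases v) auto
next
  case (Cons a u)
  then show ?case by (cases v) auto
qed

lemma token_bits_inject: "token_bits m @ x = token_bits n @ y \<longleftrightarrow> m = n \<and> x = y"
  by (simp add: token_bits_def marked_inject bits_inject)

lemma concat_token_bits_inject: "concat (map token_bits ks) = concat (map token_bits ls) \<longleftrightarrow> ks = ls"
proof (induction ks arbitrary: ls)
  case Nil
  then show ?case by (cases ls) (auto simp: token_bits_def)
next
  case (Cons k ks)
  then show ?case by (cases ls) (auto simp: token_bits_inject, auto simp: token_bits_def)
qed

lemma tokens_code_inject: "tokens_code ks = tokens_code ls \<longleftrightarrow> ks = ls"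
  using bits_inject[of "tokens_code ks" "tokens_code ls"] by (simp add: bits_tokens_code concat_token_bits_inject)

lemma ptokens_prefix: "ptokens A @ x = ptokens B @ y \<longleftrightarrow> A = B \<and> x = y"
proof (induction A arbitrary: B x y)
  case (PVar i)
  then show ?case by (cases B) auto
next
  case (PNot A)
  then show ?case by (cases B) auto
next
  case (PAnd A1 A2)
  then show ?case by (cases B) auto
next
  case (POr A1 A2)
  then show ?case by (cases B) auto
qed

lemma ptokens_inject: "ptokens A = ptokens B \<longleftrightarrow> A = B"
  using ptokens_prefix[of A "[]" B "[]"] by simp

lemma SAT_iff: "tokens_code (ptokens A) \<in> SAT \<longleftrightarrow> (\<exists>v. psat v A)"
  by (auto simp: SAT_def tokens_code_inject ptokens_inject)

lemma TAUT_iff: "tokens_code (ptokens A) \<in> TAUT \<longleftrightarrow> (\<forall>v. psat v A)"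
  by (auto simp: TAUT_def tokens_code_inject ptokens_inject)

subsection \<open>Hardness of SAT and TAUT\<close>

text \<open>Stated for the failure of \<open>R\<close>, so that the formula serves
  \<open>SAT\<close> with the complement of \<open>R\<close> and, negated, \<open>TAUT\<close> with
  \<open>R\<close> itself.\<close>

lemma cook_levin:
  fixes R :: "tree \<times> bool list \<Rightarrow> bool"
  assumes "fp R"
  shows "\<exists>F. fp F \<and> (\<forall>x (l :: unit list). \<exists>A. F (x, l) = ptokens A \<and>
    ((\<exists>v. psat v A) \<longleftrightarrow> (\<exists>\<beta>. length \<beta> = length l \<and> \<not> R (x, \<beta>))))"
proof -
  \<comment> \<open>The pair is handed to a machine on numbers as
    \<open>tcode x @ \<beta> @ [True]\<close>: the code of \<open>x\<close> delimits itself, and the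
    last symbol is the leading digit. The bits of \<open>\<beta>\<close> become the variables
    \<open>vI\<close>.\<close>
  define h where "h N = (if R (dec (bits N), butlast (drop (length (tcode (dec (bits N)))) (bits N))) then 1 else 0 :: nat)" for N
  have "fp h" unfolding h_def by (intro fp_if fp_comp[OF assms]) (intro fp_intro)+
  then obtain M p where M: "turing_machine M" "computes_within M h (\<lambda>n. poly p (blen n))"
    using poly_time_of_fp unfolding poly_time_def by blast
  obtain k where k: "\<And>n. poly p n \<le> (n + 2) ^ k" using poly_le_power by blast
  have "fp (\<lambda>y::tree \<times> unit list. map (\<lambda>_. ()) (tcode (fst y)) @ snd y @ [(), (), ()])" by (intro fp_intro)
  from fp_unary_power[OF this, of k] obtain u where u: "fp u"
    "\<And>y. length (u y :: unit list) = length (map (\<lambda>_. ()) (tcode (fst y)) @ snd y @ [(), (), ()]) ^ k" by blast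
  let ?cl = "\<lambda>y. clauses M (u y) (tcode (fst y)) (snd y)"
  define F where "F y = ptokens (cnf_pf (?cl y))" for y
  have "fp ?cl" by (intro fp_clauses u fp_intro)
  then have "fp F" unfolding F_def by (intro fp_intro)
  moreover have "(\<exists>v. psat v (cnf_pf (?cl (x, l)))) \<longleftrightarrow> (\<exists>\<beta>. length \<beta> = length l \<and> \<not> R (x, \<beta>))" for x l
  proof -
    have b1: "bits (Suc 0) = [True]" "blen (Suc 0) = 1" using bits_rec[of 1] blen_rec[of 1] by simp_all
    have key: "run.state M (tcode x @ \<beta> @ [True]) (length (u (x, l))) = 1 \<and>
       (run.cell M (tcode x @ \<beta> @ [True]) (length (u (x, l))) 0 0 = 2 \<longleftrightarrow> R (x, \<beta>))" if b: "length \<beta> = length l" for \<beta>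
    proof -
      let ?w = "tcode x @ \<beta> @ [True]"
      let ?N = "num ?w"
      have bits: "bits ?N = ?w" using bits_num_app[of "tcode x @ \<beta>"] by simp
      then have "blen ?N = length ?w" using length_bits[of ?N] by simp
      then have "poly p (blen ?N) \<le> length (u (x, l))" using k[of "blen ?N"] b by (simp add: u(2))
      then have "halts_with ((step M ^^ length (u (x, l))) (init_config M ?w)) (bits (h ?N))"
        using M(2) bits halts_with_mono unfolding computes_within_def by metis
      moreover have "h ?N = (if R (x, \<beta>) then 1 else 0)" by (simp add: h_def bits butlast_append)
      moreover obtain ts where ts: "(step M ^^ length (u (x, l))) (init_config M ?w) =
          (run.state M ?w (length (u (x, l))), ts)"
        unfolding run.state_def[OF run.intro[OF M(1)]] run.conf_def[OF run.intro[OF M(1)]] by (metis prod.collapse)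
      moreover have "ts \<noteq> []" using tm_inv[OF M(1) ts] M(1) by (auto simp: turing_machine_def)
      then have "run.cell M ?w (length (u (x, l))) 0 0 = fst (hd ts) 0"
        using ts by (simp add: run.cell_def[OF run.intro[OF M(1)]] run.conf_def[OF run.intro[OF M(1)]] hd_conv_nth)
      ultimately show ?thesis by (auto simp: halts_with_def word_tape_def b1 split: if_splits)
    qed
    show ?thesis
    proof
      assume "\<exists>v. psat v (cnf_pf (?cl (x, l)))"
      then obtain v where v: "\<And>c. c \<in> set (?cl (x, l)) \<Longrightarrow> sat_clause v c" by (auto simp: psat_cnf)
      let ?b = "map (\<lambda>i. v (vI i)) [0..<length l]"
      have "\<not> (run.state M (tcode x @ ?b @ [True]) (length (u (x, l))) = 1 \<and>
          run.cell M (tcode x @ ?b @ [True]) (length (u (x, l))) 0 0 = 2)"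
        by (rule run.clauses_satisfiable[OF run.intro[OF M(1)] refl, of l _ v]) (use v in auto)
      then have "\<not> R (x, ?b)" using key[of ?b] by simp
      then show "\<exists>\<beta>. length \<beta> = length l \<and> \<not> R (x, \<beta>)" by (intro exI[of _ ?b]) simp
    next
      assume "\<exists>\<beta>. length \<beta> = length l \<and> \<not> R (x, \<beta>)"
      then obtain \<beta> where b: "length \<beta> = length l" "\<not> R (x, \<beta>)" by blast
      have "sat_clause (run.tv M (tcode x @ \<beta> @ [True]) (length (u (x, l))) \<beta>) c" if "c \<in> set (?cl (x, l))" for c
        by (rule run.tv_satisfies[OF run.intro[OF M(1)] refl b(1)[symmetric] refl]) (use key[OF b(1)] b(2) that in auto)
      then show "\<exists>v. psat v (cnf_pf (?cl (x, l)))" by (auto simp: psat_cnf)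
    qed
  qed
  ultimately show ?thesis
    by (intro exI[of _ F] conjI allI exI[of _ "cnf_pf (?cl (_, _))"]) (simp_all add: F_def)
qed

lemma SAT_hard:
  fixes R :: "tree \<times> bool list \<Rightarrow> bool"
  assumes "fp R"
  shows "\<exists>F. fp F \<and> (\<forall>x (l :: unit list). F (x, l) \<in> SAT \<longleftrightarrow> (\<exists>\<beta>. length \<beta> = length l \<and> R (x, \<beta>)))"
proof -
  have "fp (\<lambda>p. \<not> R p)" by (intro fp_intro assms)
  from cook_levin[OF this] obtain F where F: "fp F" "\<And>x (l :: unit list). \<exists>A. F (x, l) = ptokens A \<and>
    ((\<exists>v. psat v A) \<longleftrightarrow> (\<exists>\<beta>. length \<beta> = length l \<and> R (x, \<beta>)))" by auto
  have "tokens_code (F (x, l)) \<in> SAT \<longleftrightarrow> (\<exists>\<beta>. length \<beta> = length l \<and> R (x, \<beta>))" for x l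
    using F(2)[of x l] by (auto simp: SAT_iff)
  then show ?thesis by (intro exI[of _ "\<lambda>p. tokens_code (F p)"]) (auto intro: fp_intro F(1))
qed

lemma TAUT_hard:
  fixes R :: "tree \<times> bool list \<Rightarrow> bool"
  assumes "fp R"
  shows "\<exists>F. fp F \<and> (\<forall>x (l :: unit list). F (x, l) \<in> TAUT \<longleftrightarrow> (\<forall>\<beta>. length \<beta> = length l \<longrightarrow> R (x, \<beta>)))"
proof -
  from cook_levin[OF assms] obtain F where F: "fp F" "\<And>x (l :: unit list). \<exists>A. F (x, l) = ptokens A \<and>
    ((\<exists>v. psat v A) \<longleftrightarrow> (\<exists>\<beta>. length \<beta> = length l \<and> \<not> R (x, \<beta>)))" by blast
  \<comment> \<open>The token \<open>1\<close> is that of \<open>PNot\<close>.\<close>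
  have "tokens_code (1 # F (x, l)) \<in> TAUT \<longleftrightarrow> (\<forall>\<beta>. length \<beta> = length l \<longrightarrow> R (x, \<beta>))" for x l
  proof -
    obtain A where A: "F (x, l) = ptokens A" "(\<exists>v. psat v A) \<longleftrightarrow> (\<exists>\<beta>. length \<beta> = length l \<and> \<not> R (x, \<beta>))"
      using F(2) by blast
    have "tokens_code (1 # F (x, l)) \<in> TAUT \<longleftrightarrow> (\<forall>v. \<not> psat v A)"
      using TAUT_iff[of "PNot A"] by (simp add: A(1))
    then show ?thesis using A(2) by blast
  qed
  then show ?thesis by (intro exI[of _ "\<lambda>p. tokens_code (1 # F p)"] conjI fp_tokens_code fp_Cons fp_const F(1)) blast
qed

section \<open>Certificates for universal satisfiability claims\<close>

section \<open>Certificates from p-optimal proof systems\<close>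

text \<open>Every tree is read as some description of a machine, so the certificate checker is
  total.\<close>

definition udec :: "tree \<Rightarrow> udesc \<times> unit list" where
  "udec t = (map (\<lambda>e. ((tonat (lsub (lsub e)), map tonat (children (rsub (lsub e)))),
      (tonat (lsub (rsub e)), map (\<lambda>a. (tonat (lsub a), tonat (rsub a))) (children (rsub (rsub e))))))
    (children (lsub t)), map (\<lambda>_. ()) (children (rsub t)))"

lemma udec_enc [simp]: "udec (enc D) = D"
proof -
  have "map (\<lambda>_. ()) us = us" for us :: "unit list" by (induction us) auto
  then show ?thesis
    by (cases D) (auto simp: udec_def enc_prod_def o_def simp del: tonat.simps intro!: map_idI)
qed

lemma fp_udec [fp_intro]: "fp f \<Longrightarrow> fp (\<lambda>x. udec (f x))"
  unfolding udec_def by (intro fp_intro)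

text \<open>A certificate consists of a machine, a clock and a \<open>P'\<close>-proof that, for all
  words of the given length, \<open>P\<close> applied to the output of the clocked machine is the
  value of \<open>G\<close>. Soundness only uses the ranges of \<open>P\<close> and
  \<open>P'\<close>; p-optimality supplies the certificates.\<close>

lemma certification:
  fixes G :: "tree \<times> bool list \<Rightarrow> nat"
  assumes P: "p_optimal SAT P" and P': "p_optimal TAUT P'" and G: "fp G"
  shows "\<exists>Cert :: tree \<times> tree \<times> unit list \<Rightarrow> bool. fp Cert \<and>
    (\<forall>c a u \<pi>. Cert (c, a, u) \<longrightarrow> length \<pi> = length u \<longrightarrow> G (a, \<pi>) \<in> SAT) \<and>
    (\<forall>a. (\<forall>\<pi>. G (a, \<pi>) \<in> SAT) \<longrightarrow> (\<exists>cf. fp cf \<and> (\<forall>u. Cert (cf u, a, u))))"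
proof -
  have fP: "fp P" "range P = SAT" and fP': "fp P'" "range P' = TAUT"
    using P P' by (auto simp: p_optimal_def proof_system_def intro: fp_of_poly_time)
  \<comment> \<open>The argument is \<open>a\<close>, the machine and the clock. The leading
    \<open>False\<close> makes the number even, which selects the values of \<open>G\<close> in the
    system \<open>Q\<close> below, and the final \<open>True\<close> preserves the word.\<close>
  define R where "R p = (P (usim (udec (lsub (rsub (fst p)))) (map (\<lambda>_. ()) (children (rsub (rsub (fst p)))))
      (False # snd p @ [True])) = G (lsub (fst p), snd p))" for p :: "tree \<times> bool list"
  have "fp R" unfolding R_def by (intro fp_eq fp_comp[OF fP(1)] fp_comp[OF G]) (intro fp_intro)+
  from TAUT_hard[OF this] obtain F where F: "fp F"
    "\<And>x (l :: unit list). F (x, l) \<in> TAUT \<longleftrightarrow> (\<forall>\<beta>. length \<beta> = length l \<longrightarrow> R (x, \<beta>))" by blast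
  define Cert where "Cert p = (P' (tonat (rsub (rsub (fst p)))) =
     F (Nd (fst (snd p)) (Nd (lsub (fst p)) (lsub (rsub (fst p)))), snd (snd p)))" for p
  show ?thesis
  proof (intro exI[of _ Cert] conjI allI impI)
    show "fp Cert" unfolding Cert_def
      by (intro fp_eq fp_comp[OF fP'(1)] fp_comp[OF F(1)] fp_tonat) (intro fp_intro)+
  next
    fix c a u and \<pi> :: "bool list"
    assume c: "Cert (c, a, u)" "length \<pi> = length u"
    have "F (Nd a (Nd (lsub c) (lsub (rsub c))), u) \<in> TAUT"
      using c(1) fP'(2) unfolding Cert_def by (metis fst_conv rangeI snd_conv)
    then have "R (Nd a (Nd (lsub c) (lsub (rsub c))), \<pi>)" using F(2) c(2) by blast
    then show "G (a, \<pi>) \<in> SAT" unfolding R_def using fP(2) by (metis fst_conv lsub.simps(2) rangeI snd_conv)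
  next
    fix a
    assume a: "\<forall>\<pi>. G (a, \<pi>) \<in> SAT"
    \<comment> \<open>Odd numbers copy \<open>P\<close>, so that the range is all of
      \<open>SAT\<close>; even numbers enumerate the values of \<open>G\<close>, which lie in
      \<open>SAT\<close> by assumption.\<close>
    define Q where "Q n = (if odd n then P (n div 2) else G (a, butlast (bits (n div 2))))" for n
    have "fp Q" unfolding Q_def by (intro fp_if fp_comp[OF fP(1)] fp_comp[OF G]) (intro fp_intro)+
    moreover have "range Q = SAT"
    proof
      show "range Q \<subseteq> SAT" using a fP(2) by (auto simp: Q_def)
      show "SAT \<subseteq> range Q"
      proof
        fix y assume "y \<in> SAT"
        then obtain m where "y = P m" using fP(2) by blast
        then have "y = Q (Suc (2 * m))" by (simp add: Q_def)
        then show "y \<in> range Q" by blast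
      qed
    qed
    ultimately have "proof_system SAT Q" by (simp add: proof_system_def poly_time_of_fp)
    then obtain f where f: "poly_time f" "\<And>w. P (f w) = Q w" using P unfolding p_optimal_def by blast
    obtain D k where D: "\<And>n t. (blen n + 2) ^ k \<le> length t \<Longrightarrow> usim D t (bits n) = f n"
      using poly_time_usim[OF f(1)] by blast
    \<comment> \<open>Two units for the digits added to the word, two for the base
      \<open>blen n + 2\<close> of the clock.\<close>
    have "fp (\<lambda>u::unit list. u @ [(), (), (), ()])" by (intro fp_intro)
    from fp_unary_power[OF this, of k] obtain tt where tt: "fp tt"
      "\<And>u. length (tt u :: unit list) = length (u @ [(), (), (), ()]) ^ k" by blast
    define X where "X u = Nd a (Nd (enc D) (enc (tt u)))" for u
    have X: "F (X u, u) \<in> TAUT" for u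
      unfolding F(2)
    proof (intro allI impI)
      fix \<beta> :: "bool list" assume b: "length \<beta> = length u"
      have bn: "bits (num (False # \<beta> @ [True])) = False # \<beta> @ [True]" using bits_num_app[of "False # \<beta>"] by simp
      then have "blen (num (False # \<beta> @ [True])) = length \<beta> + 2"
        using length_bits[of "num (False # \<beta> @ [True])"] by simp
      then have "usim D (map (\<lambda>_. ()) (tt u)) (bits (num (False # \<beta> @ [True]))) = f (num (False # \<beta> @ [True]))"
        by (intro D) (simp add: tt(2) b)
      then have "P (usim D (map (\<lambda>_. ()) (tt u)) (False # \<beta> @ [True])) = Q (num (False # \<beta> @ [True]))"
        by (simp only: bn f(2))
      also have "\<dots> = G (a, \<beta>)" by (simp add: Q_def dbl_def)
      finally show "R (X u, \<beta>)" by (simp add: R_def X_def o_def)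
    qed
    \<comment> \<open>Lengths are coded as numbers with only ones, doubled so as to be even. Here it
      is essential that the length can be recovered from a number of about the same binary
      length.\<close>
    define ub where "ub n = map (\<lambda>_. ()) (bits (n div 2))" for n
    \<comment> \<open>The analogue of \<open>Q\<close> for \<open>TAUT\<close>: the tautologies
      about the machine found above get their own lengths as proofs, and \<open>P'\<close> simulates
      this.\<close>
    define Q' where "Q' n = (if odd n then P' (n div 2) else F (X (ub n), ub n))" for n
    have fX: "fp X" unfolding X_def by (intro fp_Nd fp_const fp_enc tt(1))
    have fub: "fp ub" unfolding ub_def by (intro fp_intro)
    have "fp Q'" unfolding Q'_def
      by (intro fp_if fp_comp[OF fP'(1)] fp_comp[OF F(1)] fp_Pair fp_comp[OF fX] fub) (intro fp_intro)+
    moreover have "range Q' = TAUT"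
    proof
      show "range Q' \<subseteq> TAUT" using X fP'(2) by (auto simp: Q'_def)
      show "TAUT \<subseteq> range Q'"
      proof
        fix y assume "y \<in> TAUT"
        then obtain m where "y = P' m" using fP'(2) by blast
        then have "y = Q' (Suc (2 * m))" by (simp add: Q'_def)
        then show "y \<in> range Q'" by blast
      qed
    qed
    ultimately have "proof_system TAUT Q'" by (simp add: proof_system_def poly_time_of_fp)
    then obtain f' where f': "poly_time f'" "\<And>w. P' (f' w) = Q' w" using P' unfolding p_optimal_def by blast
    define N where "N u = dbl False (num (map (\<lambda>_. True) u))" for u :: "unit list"
    have "bits (num (map (\<lambda>_. True) u)) = map (\<lambda>_. True) u" for u :: "unit list"
      by (induction u) (auto simp: bits_dbl)
    moreover have "map (\<lambda>_. ()) u = u" for u :: "unit list" by (induction u) auto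
    ultimately have N: "ub (N u) = u" "even (N u)" for u by (simp_all add: ub_def N_def dbl_def o_def)
    define cf where "cf u = Nd (enc D) (Nd (enc (tt u)) (enc (f' (N u))))" for u
    have "fp N" unfolding N_def by (intro fp_intro)
    then have "fp cf" unfolding cf_def
      by (intro fp_Nd fp_const fp_enc tt(1) fp_comp[OF fp_of_poly_time[OF f'(1)]])
    moreover have "Cert (cf u, a, u)" for u
      unfolding Cert_def cf_def by (simp add: f'(2) Q'_def N X_def del: tonat.simps)
    ultimately show "\<exists>cf. fp cf \<and> (\<forall>u. Cert (cf u, a, u))" by blast
  qed
qed

section \<open>Bounded formulas as NP predicates\<close>

section \<open>Bounded formulas and NP\<close>

text \<open>The size bound is demanded only of some witness of a true instance; an accepted witness
  of any size proves \<open>F x\<close>. This makes padding and truncation harmless.\<close>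

definition npp :: "('a::enc \<Rightarrow> bool) \<Rightarrow> bool" where
  "npp F \<longleftrightarrow> (\<exists>C k. fp C \<and> (\<forall>x w. C (x, w) \<longrightarrow> F x) \<and>
     (\<forall>x. F x \<longrightarrow> (\<exists>w. tsz w \<le> (sz x + 2) ^ k \<and> C (x, w))))"

lemma nppI:
  assumes "fp C" "pb B" "\<And>x w. C (x, w) \<Longrightarrow> F x" "\<And>x. F x \<Longrightarrow> \<exists>w. tsz w \<le> B x \<and> C (x, w)"
  shows "npp F"
proof -
  obtain q where q: "pbn q" "\<And>x. B x \<le> q (sz x)" using assms(2) unfolding pb_def by blast
  obtain k where k: "\<And>n. q n \<le> (n + 2) ^ k" using q(1) unfolding pbn_def by blast
  have "B x \<le> (sz x + 2) ^ k" for x using order_trans[OF q(2) k] .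
  then have "\<exists>w. tsz w \<le> (sz x + 2) ^ k \<and> C (x, w)" if "F x" for x
    using assms(4)[OF that] order_trans by blast
  with assms(1,3) show ?thesis unfolding npp_def by blast
qed

lemma nppE:
  assumes "npp F"
  obtains C k where "fp C" "\<And>x w. C (x, w) \<Longrightarrow> F x" "\<And>x. F x \<Longrightarrow> \<exists>w. tsz w \<le> (sz x + 2) ^ k \<and> C (x, w)"
  using assms unfolding npp_def by blast

lemma npp_fp:
  assumes "fp F"
  shows "npp F"
proof (rule nppI[of "\<lambda>p. F (fst p)" "\<lambda>_. 1"])
  show "fp (\<lambda>p. F (fst p))" by (rule fp_comp[OF assms fp_fst[OF fp_id]])
  show "\<exists>w. tsz w \<le> 1 \<and> F (fst (x, w))" if "F x" for x using that by (intro exI[of _ Lf]) simp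
qed (simp_all add: pb_const)

lemma npp_comp:
  assumes "npp F" "fp f"
  shows "npp (\<lambda>x. F (f x))"
proof -
  obtain C k where C: "fp C" "\<And>x w. C (x, w) \<Longrightarrow> F x" "\<And>x. F x \<Longrightarrow> \<exists>w. tsz w \<le> (sz x + 2) ^ k \<and> C (x, w)"
    using nppE[OF assms(1)] by metis
  show ?thesis
  proof (rule nppI[of "\<lambda>p. C (f (fst p), snd p)" "\<lambda>x. (sz (f x) + 2) ^ k"])
    show "fp (\<lambda>p. C (f (fst p), snd p))"
      by (intro fp_comp[OF C(1)] fp_Pair fp_comp[OF assms(2)] fp_fst fp_snd fp_id)
    show "pb (\<lambda>x. (sz (f x) + 2) ^ k)" by (intro pb_power pb_add pb_const pb_sz assms(2))
  qed (use C(2,3) in auto)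
qed

lemma npp_conj:
  assumes "npp F" "npp G"
  shows "npp (\<lambda>x. F x \<and> G x)"
proof -
  obtain C k where C: "fp C" "\<And>x w. C (x, w) \<Longrightarrow> F x" "\<And>x. F x \<Longrightarrow> \<exists>w. tsz w \<le> (sz x + 2) ^ k \<and> C (x, w)"
    using nppE[OF assms(1)] by metis
  obtain D j where D: "fp D" "\<And>x w. D (x, w) \<Longrightarrow> G x" "\<And>x. G x \<Longrightarrow> \<exists>w. tsz w \<le> (sz x + 2) ^ j \<and> D (x, w)"
    using nppE[OF assms(2)] by metis
  show ?thesis
  proof (rule nppI[of "\<lambda>p. C (fst p, lsub (snd p)) \<and> D (fst p, rsub (snd p))" "\<lambda>x. Suc ((sz x + 2) ^ k + (sz x + 2) ^ j)"])
    show "fp (\<lambda>p. C (fst p, lsub (snd p)) \<and> D (fst p, rsub (snd p)))"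
      by (intro fp_conj fp_comp[OF C(1)] fp_comp[OF D(1)] fp_intro)
    show "pb (\<lambda>x. Suc ((sz x + 2) ^ k + (sz x + 2) ^ j))" by (intro fp_intro pb_self)
    fix x assume "F x \<and> G x"
    then obtain w v where "tsz w \<le> (sz x + 2) ^ k" "C (x, w)" "tsz v \<le> (sz x + 2) ^ j" "D (x, v)"
      using C(3) D(3) by blast
    then show "\<exists>w. tsz w \<le> Suc ((sz x + 2) ^ k + (sz x + 2) ^ j) \<and> C (fst (x, w), lsub (snd (x, w))) \<and> D (fst (x, w), rsub (snd (x, w)))"
      by (intro exI[of _ "Nd w v"]) simp
  qed (use C(2) D(2) in auto)
qed

lemma npp_disj:
  assumes "npp F" "npp G"
  shows "npp (\<lambda>x. F x \<or> G x)"
proof -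
  obtain C k where C: "fp C" "\<And>x w. C (x, w) \<Longrightarrow> F x" "\<And>x. F x \<Longrightarrow> \<exists>w. tsz w \<le> (sz x + 2) ^ k \<and> C (x, w)"
    using nppE[OF assms(1)] by metis
  obtain D j where D: "fp D" "\<And>x w. D (x, w) \<Longrightarrow> G x" "\<And>x. G x \<Longrightarrow> \<exists>w. tsz w \<le> (sz x + 2) ^ j \<and> D (x, w)"
    using nppE[OF assms(2)] by metis
  show ?thesis
  proof (rule nppI[of "\<lambda>p. C p \<or> D p" "\<lambda>x. (sz x + 2) ^ k + (sz x + 2) ^ j"])
    show "fp (\<lambda>p. C p \<or> D p)" by (intro fp_disj C(1) D(1))
    show "pb (\<lambda>x. (sz x + 2) ^ k + (sz x + 2) ^ j)" by (intro fp_intro pb_self)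
    show "\<exists>w. tsz w \<le> (sz x + 2) ^ k + (sz x + 2) ^ j \<and> (C (x, w) \<or> D (x, w))" if "F x \<or> G x" for x
      using that C(3) D(3) by (meson trans_le_add1 trans_le_add2)
  qed (use C(2) D(2) in auto)
qed

lemma npp_exle:
  assumes "npp F" "fp t"
  shows "npp (\<lambda>x. \<exists>a\<le>t x. F (x, a :: nat))"
proof -
  obtain C k where C: "fp C" "\<And>x w. C (x, w) \<Longrightarrow> F x" "\<And>x. F x \<Longrightarrow> \<exists>w. tsz w \<le> (sz x + 2) ^ k \<and> C (x, w)"
    using nppE[OF assms(1)] by metis
  let ?s = "\<lambda>x. Suc (4 * sz (t x))"
  let ?C = "\<lambda>p. tonat (lsub (snd p)) \<le> t (fst p) \<and> C ((fst p, tonat (lsub (snd p))), rsub (snd p))"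
  show ?thesis
  proof (rule nppI[of ?C "\<lambda>x. Suc (?s x + (Suc (sz x + ?s x) + 2) ^ k)"])
    show "fp ?C" by (intro fp_conj fp_le fp_tonat fp_comp[OF assms(2)] fp_comp[OF C(1)] fp_intro)
    show "pb (\<lambda>x. Suc (?s x + (Suc (sz x + ?s x) + 2) ^ k))" by (intro fp_intro pb_self pb_sz assms(2))
    show "\<exists>a\<le>t x. F (x, a)" if "?C (x, w)" for x w
      using that C(2) by (auto simp del: tonat.simps)
    fix x assume "\<exists>a\<le>t x. F (x, a)"
    then obtain a w where a: "a \<le> t x" "tsz w \<le> (sz (x, a) + 2) ^ k" "C ((x, a), w)" using C(3) by blast
    have "sz a \<le> ?s x" using sz_nat_le[of a] blen_mono[OF a(1)] blen_le_sz[of "t x"] by simp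
    moreover from this have "(sz (x, a) + 2) ^ k \<le> (Suc (sz x + ?s x) + 2) ^ k" by (intro power_mono) auto
    ultimately have "tsz (Nd (enc a) w) \<le> Suc (?s x + (Suc (sz x + ?s x) + 2) ^ k)"
      using a(2) by (simp add: sz_def[symmetric])
    then show "\<exists>w. tsz w \<le> Suc (?s x + (Suc (sz x + ?s x) + 2) ^ k) \<and> ?C (x, w)"
      using a by (intro exI[of _ "Nd (enc a) w"]) (simp del: tonat.simps)
  qed
qed

lemma npp_ball:
  assumes "npp F" "fp l"
  shows "npp (\<lambda>x. \<forall>a\<in>set (l x). F (x, a))"
proof -
  obtain C k where C: "fp C" "\<And>x w. C (x, w) \<Longrightarrow> F x" "\<And>x. F x \<Longrightarrow> \<exists>w. tsz w \<le> (sz x + 2) ^ k \<and> C (x, w)"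
    using nppE[OF assms(1)] by metis
  \<comment> \<open>\<open>zip\<close> truncates, so the list of witnesses is required to be long
    enough to cover every element.\<close>
  let ?C = "\<lambda>p. length (l (fst p)) \<le> length (children (snd p)) \<and>
     (\<forall>q\<in>set (zip (l (fst p)) (children (snd p))). C ((fst p, fst q), snd q))"
  let ?b = "\<lambda>x. (Suc (sz x + sz (l x)) + 2) ^ k"
  show ?thesis
  proof (rule nppI[of ?C "\<lambda>x. Suc (sz (l x) * Suc (?b x))"])
    have "fp (\<lambda>y. C ((fst (fst y), fst (snd y)), snd (snd y)))" by (intro fp_comp[OF C(1)] fp_intro)
    then show "fp ?C" by (intro fp_conj fp_le fp_length fp_comp[OF assms(2)] fp_ball fp_zip fp_children fp_fst fp_snd fp_id)
    show "pb (\<lambda>x. Suc (sz (l x) * Suc (?b x)))" by (intro fp_intro pb_self pb_sz assms(2))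
    show "\<forall>a\<in>set (l x). F (x, a)" if c: "?C (x, w)" for x w
    proof
      fix a assume "a \<in> set (l x)"
      then obtain i where i: "i < length (l x)" "a = l x ! i" by (auto simp: in_set_conv_nth)
      then have "(a, children w ! i) \<in> set (zip (l x) (children w))" using c by (auto simp: in_set_zip)
      then show "F (x, a)" using c C(2) by fastforce
    qed
    fix x assume F: "\<forall>a\<in>set (l x). F (x, a)"
    define g where "g a = (SOME w. tsz w \<le> (sz (x, a) + 2) ^ k \<and> C ((x, a), w))" for a
    have g: "tsz (g a) \<le> (sz (x, a) + 2) ^ k \<and> C ((x, a), g a)" if "a \<in> set (l x)" for a
      unfolding g_def by (rule someI_ex) (use C(3) F that in blast)
    let ?ws = "map g (l x)"
    have "sz w \<le> ?b x" if w: "w \<in> set ?ws" for w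
    proof -
      obtain a where a: "a \<in> set (l x)" "w = g a" using w by auto
      have "(sz (x, a) + 2) ^ k \<le> ?b x" using sz_mem[OF a(1)] by (intro power_mono) auto
      then show ?thesis using g[OF a(1)] a(2) by (simp add: sz_tree)
    qed
    from sz_list_bound[OF this, of ?ws] have "sz ?ws \<le> Suc (length (l x) * Suc (?b x))" by simp
    also have "\<dots> \<le> Suc (sz (l x) * Suc (?b x))"
      using length_le_sz[of "l x"] by (intro Suc_le_mono[THEN iffD2] mult_le_mono1)
    finally have "tsz (enc ?ws) \<le> Suc (sz (l x) * Suc (?b x))" by (simp add: sz_def)
    moreover have "?C (x, enc ?ws)"
      using g by (auto simp: zip_map2 zip_same_conv_map o_def)
    ultimately show "\<exists>w. tsz w \<le> Suc (sz (l x) * Suc (?b x)) \<and> ?C (x, w)" by blast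
  qed
qed

subsection \<open>Evaluation of formulas\<close>

text \<open>Environments are association lists; variables that are not assigned have the value \<open>0\<close>.\<close>

definition env :: "(nat \<times> nat) list \<Rightarrow> nat \<Rightarrow> nat" where
  "env al i = hdd 0 (concat (map (\<lambda>p. if fst p = i then [snd p] else []) al))"

lemma env_Cons [simp]: "env ((x, a) # al) = (env al)(x := a)"
  by (auto simp: env_def fun_eq_iff)

lemma env_Nil [simp]: "env [] i = 0"
  by (simp add: env_def)

lemma tm_val_cong: "(\<And>i. i \<in> tm_vars t \<Longrightarrow> v i = v' i) \<Longrightarrow> tm_val v t = tm_val v' t"
  by (induction t) auto

lemma tm_val_upd [simp]: "x \<notin> tm_vars t \<Longrightarrow> tm_val (v(x := a)) t = tm_val v t"
  by (rule tm_val_cong) auto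

lemma fp_tm_val [fp_intro]: "fp al \<Longrightarrow> fp (\<lambda>y. tm_val (env (al y)) t)"
proof (induction t)
  case (Var i)
  then show ?case unfolding tm_val.simps env_def by (intro fp_intro)
qed (simp_all add: fp_intro)

lemma holds_AllLe: "x \<notin> tm_vars t \<Longrightarrow> holds v (AllLe x t A) \<longleftrightarrow> (\<forall>a\<le>tm_val v t. holds (v(x := a)) A)"
  by auto

lemma holds_ExLe: "x \<notin> tm_vars t \<Longrightarrow> holds v (ExLe x t A) \<longleftrightarrow> (\<exists>a\<le>tm_val v t. holds (v(x := a)) A)"
  by auto

text \<open>Turns a sharply bounded quantifier into one over a list; the extra element makes the
  bound inclusive.\<close>

lemma le_blen: "a \<le> blen n \<longleftrightarrow> a \<in> set [0..<length (True # bits n)]"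
  by auto

lemma holds_AllLe_Len: "x \<notin> tm_vars t \<Longrightarrow> holds (env al) (AllLe x (Len t) A) \<longleftrightarrow>
   (\<forall>a\<in>set [0..<length (True # bits (tm_val (env al) t))]. holds (env ((x, a) # al)) A)"
  by (subst holds_AllLe) (simp_all add: le_blen del: upt_Suc, auto)

lemma holds_ExLe_Len: "x \<notin> tm_vars t \<Longrightarrow> holds (env al) (ExLe x (Len t) A) \<longleftrightarrow>
   (\<exists>a\<in>set [0..<length (True # bits (tm_val (env al) t))]. holds (env ((x, a) # al)) A)"
  by (subst holds_ExLe) (simp_all add: le_blen del: upt_Suc, auto)

lemma fp_sharply_bounded: "sharply_bounded A \<Longrightarrow> fp (\<lambda>al. holds (env al) A)"
proof (induction rule: sharply_bounded.induct)
  case (7 A x t)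
  have "fp (\<lambda>p. holds (env ((x, snd p) # fst p)) A)" by (rule fp_comp[OF 7(3)]) (intro fp_intro)
  then show ?case unfolding holds_AllLe_Len[OF 7(2)] by (intro fp_ball fp_intro)
next
  case (8 A x t)
  have "fp (\<lambda>p. holds (env ((x, snd p) # fst p)) A)" by (rule fp_comp[OF 8(3)]) (intro fp_intro)
  then show ?case unfolding holds_ExLe_Len[OF 8(2)] by (intro fp_bex fp_intro)
qed (simp_all add: fp_intro)

text \<open>The joint induction is forced by \<open>Neg\<close> and \<open>Imp\<close>, which
  exchange the two classes. Sharply bounded quantifiers cost one witness per value.\<close>

lemma npp_Sigma1b:
  "Sigma1b A \<Longrightarrow> npp (\<lambda>al. holds (env al) A)"
  "Pi1b A \<Longrightarrow> npp (\<lambda>al. \<not> holds (env al) A)"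
proof (induction rule: Sigma1b_Pi1b.inducts)
  case (1 A)
  then show ?case by (intro npp_fp fp_sharply_bounded)
next
  case (2 A x t)
  have "npp (\<lambda>p. holds (env ((x, snd p) # fst p)) A)" by (rule npp_comp[OF "2.IH"]) (intro fp_intro)
  from npp_exle[OF this fp_tm_val[OF fp_id, of t]] show ?case unfolding holds_ExLe[OF "2.hyps"(2)] by simp
next
  case (3 A x t)
  have "npp (\<lambda>p. holds (env ((x, snd p) # fst p)) A)" by (rule npp_comp[OF "3.IH"]) (intro fp_intro)
  from npp_ball[OF this, of "\<lambda>al. [0..<length (True # bits (tm_val (env al) t))]"]
  show ?case unfolding holds_AllLe_Len[OF "3.hyps"(2)] fst_conv snd_conv
    by (elim meta_mp) (intro fp_intro)
next
  case (4 A B)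
  then show ?case by (simp add: npp_conj)
next
  case (5 A B)
  then show ?case by (simp add: npp_disj)
next
  case (6 A)
  then show ?case by simp
next
  case (7 A B)
  have "(\<lambda>al. holds (env al) (Imp A B)) = (\<lambda>al. \<not> holds (env al) A \<or> holds (env al) B)" by auto
  then show ?case using npp_disj[OF "7.IH"] by simp
next
  case (8 A)
  then show ?case by (intro npp_fp fp_Not fp_sharply_bounded)
next
  case (9 A x t)
  have "npp (\<lambda>p. \<not> holds (env ((x, snd p) # fst p)) A)" by (rule npp_comp[OF "9.IH"]) (intro fp_intro)
  from npp_exle[OF this fp_tm_val[OF fp_id, of t]] show ?case unfolding holds_AllLe[OF "9.hyps"(2)] by simp
next
  case (10 A x t)
  have e: "(\<not> (\<exists>a\<in>S. P a)) = (\<forall>a\<in>S. \<not> P a)" for S and P :: "nat \<Rightarrow> bool" by blast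
  have "npp (\<lambda>p. \<not> holds (env ((x, snd p) # fst p)) A)" by (rule npp_comp[OF "10.IH"]) (intro fp_intro)
  from npp_ball[OF this, of "\<lambda>al. [0..<length (True # bits (tm_val (env al) t))]"]
  show ?case unfolding e holds_ExLe_Len[OF "10.hyps"(2)] fst_conv snd_conv
    by (elim meta_mp) (intro fp_intro)
next
  case (11 A B)
  have "(\<lambda>al. \<not> holds (env al) (And A B)) = (\<lambda>al. \<not> holds (env al) A \<or> \<not> holds (env al) B)" by auto
  then show ?case using npp_disj[OF "11.IH"] by simp
next
  case (12 A B)
  have "(\<lambda>al. \<not> holds (env al) (Or A B)) = (\<lambda>al. \<not> holds (env al) A \<and> \<not> holds (env al) B)" by auto
  then show ?case using npp_conj[OF "12.IH"] by simp
next
  case (13 A)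
  then show ?case by simp
next
  case (14 A B)
  have "(\<lambda>al. \<not> holds (env al) (Imp A B)) = (\<lambda>al. holds (env al) A \<and> \<not> holds (env al) B)" by auto
  then show ?case using npp_conj[OF "14.IH"] by simp
qed

section \<open>Metalogic: soundness, provability through valuations, equality\<close>

section \<open>Logic\<close>

subsection \<open>Soundness\<close>

lemma tm_val_subst [simp]: "tm_val v (tm_subst x r s) = tm_val (v(x := tm_val v r)) s"
  by (induction s) auto

lemma holds_cong: "(\<And>i. i \<in> free_vars A \<Longrightarrow> v i = v' i) \<Longrightarrow> holds v A = holds v' A"
proof (induction A arbitrary: v v')
  case (Eq s t)
  then show ?case using tm_val_cong[of s v v'] tm_val_cong[of t v v'] by auto
next
  case (Le s t)
  then show ?case using tm_val_cong[of s v v'] tm_val_cong[of t v v'] by auto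
next
  case (All x A)
  have "holds (v(x := a)) A = holds (v'(x := a)) A" for a by (rule All.IH) (use All.prems in auto)
  then show ?case by simp
next
  case (Ex x A)
  have "holds (v(x := a)) A = holds (v'(x := a)) A" for a by (rule Ex.IH) (use Ex.prems in auto)
  then show ?case by simp
next
  case (Neg A)
  have "holds v A = holds v' A" by (rule Neg.IH) (use Neg.prems in auto)
  then show ?case by simp
next
  case (And A B)
  have "holds v A = holds v' A" "holds v B = holds v' B" by (rule And.IH; use And.prems in auto)+
  then show ?case by simp
next
  case (Or A B)
  have "holds v A = holds v' A" "holds v B = holds v' B" by (rule Or.IH; use Or.prems in auto)+
  then show ?case by simp
next
  case (Imp A B)
  have "holds v A = holds v' A" "holds v B = holds v' B" by (rule Imp.IH; use Imp.prems in auto)+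
  then show ?case by simp
qed

lemma holds_upd: "x \<notin> free_vars A \<Longrightarrow> holds (v(x := a)) A = holds v A"
  by (rule holds_cong) auto

lemma tm_subst_id [simp]: "x \<notin> tm_vars s \<Longrightarrow> tm_subst x r s = s"
  by (induction s) auto

lemma subst_id [simp]: "x \<notin> free_vars A \<Longrightarrow> subst x r A = A"
  by (induction A) auto

lemma tm_subst_Var [simp]: "tm_subst x (Var x) s = s"
  by (induction s) auto

lemma subst_Var [simp]: "subst x (Var x) A = A"
  by (induction A) auto

lemma free_for_self: "tm_vars r \<subseteq> {x} \<Longrightarrow> free_for r x A"
  by (induction A) auto

lemma tm_vars_subst: "tm_vars (tm_subst x r s) \<subseteq> (tm_vars s - {x}) \<union> tm_vars r"
  by (induction s) auto

lemma free_vars_subst: "free_vars (subst x r A) \<subseteq> (free_vars A - {x}) \<union> tm_vars r"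
proof (induction A)
  case (Eq s t)
  then show ?case using tm_vars_subst[of x r s] tm_vars_subst[of x r t] by auto
next
  case (Le s t)
  then show ?case using tm_vars_subst[of x r s] tm_vars_subst[of x r t] by auto
qed auto

lemma holds_subst: "free_for r x A \<Longrightarrow> holds v (subst x r A) = holds (v(x := tm_val v r)) A"
proof (induction A arbitrary: v)
  case (All y A)
  show ?case
  proof (cases "x \<in> free_vars (All y A)")
    case True
    then have y: "y \<noteq> x" "y \<notin> tm_vars r" "free_for r x A" using All.prems by auto
    have "holds (v(y := a)) (subst x r A) = holds ((v(x := tm_val v r))(y := a)) A" for a
      unfolding All.IH[OF y(3)] tm_val_upd[OF y(2)] fun_upd_twist[OF y(1)[symmetric], of v] ..
    then show ?thesis by (simp only: subst.simps holds.simps y(1) if_False)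
  next
    case False
    show ?thesis unfolding subst_id[OF False] by (rule holds_upd[OF False, symmetric])
  qed
next
  case (Ex y A)
  show ?case
  proof (cases "x \<in> free_vars (Ex y A)")
    case True
    then have y: "y \<noteq> x" "y \<notin> tm_vars r" "free_for r x A" using Ex.prems by auto
    have "holds (v(y := a)) (subst x r A) = holds ((v(x := tm_val v r))(y := a)) A" for a
      unfolding Ex.IH[OF y(3)] tm_val_upd[OF y(2)] fun_upd_twist[OF y(1)[symmetric], of v] ..
    then show ?thesis by (simp only: subst.simps holds.simps y(1) if_False)
  next
    case False
    show ?thesis unfolding subst_id[OF False] by (rule holds_upd[OF False, symmetric])
  qed
qed auto

lemma logical_axiom_holds: "logical_axiom A \<Longrightarrow> holds v A"
proof (induction rule: logical_axiom.induct)
  case (11 t x A)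
  then show ?case by (simp add: holds_subst)
next
  case (12 t x A)
  then show ?case by (auto simp: holds_subst)
next
  case (13 x C A)
  then show ?case by (simp add: holds_upd)
next
  case (14 x C A)
  then show ?case by (auto simp: holds_upd)
qed auto

subsection \<open>Provability\<close>

lemma is_proof_single: "logical_axiom A \<or> A \<in> T \<Longrightarrow> is_proof T [A] A"
  by (auto simp: is_proof_def)

lemma provable_ax: "logical_axiom A \<Longrightarrow> T \<turnstile> A" "A \<in> T \<Longrightarrow> T \<turnstile> A"
  using is_proof_single unfolding provable_def by blast+

definition lines :: "fm set \<Rightarrow> fm list \<Rightarrow> bool" where
  "lines T As \<longleftrightarrow> (\<forall>i < length As. logical_axiom (As ! i) \<or> As ! i \<in> T \<or>
        (\<exists>j < i. \<exists>k < i. As ! k = Imp (As ! j) (As ! i)) \<or>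
        (\<exists>j < i. \<exists>x. As ! i = All x (As ! j)))"

lemma is_proof_lines: "is_proof T As A \<longleftrightarrow> As \<noteq> [] \<and> last As = A \<and> lines T As"
  by (simp add: is_proof_def lines_def)

lemma lines_append:
  assumes "lines T As" "lines T Bs"
  shows "lines T (As @ Bs)"
  unfolding lines_def
proof (intro allI impI)
  fix i assume i: "i < length (As @ Bs)"
  show "logical_axiom ((As @ Bs) ! i) \<or> (As @ Bs) ! i \<in> T \<or>
        (\<exists>j < i. \<exists>k < i. (As @ Bs) ! k = Imp ((As @ Bs) ! j) ((As @ Bs) ! i)) \<or>
        (\<exists>j < i. \<exists>x. (As @ Bs) ! i = All x ((As @ Bs) ! j))"
  proof (cases "i < length As")
    case True
    then have e: "(As @ Bs) ! j = As ! j" if "j \<le> i" for j using that by (simp add: nth_append)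
    show ?thesis using assms(1) True e unfolding lines_def by (metis less_imp_le order_refl)
  next
    case False
    let ?i = "i - length As"
    have e: "(As @ Bs) ! (length As + j) = Bs ! j" "j < ?i \<Longrightarrow> length As + j < i" for j by auto
    have ei: "(As @ Bs) ! i = Bs ! ?i" using False by (simp add: nth_append)
    from assms(2) i False have "logical_axiom (Bs ! ?i) \<or> Bs ! ?i \<in> T \<or>
        (\<exists>j < ?i. \<exists>k < ?i. Bs ! k = Imp (Bs ! j) (Bs ! ?i)) \<or> (\<exists>j < ?i. \<exists>x. Bs ! ?i = All x (Bs ! j))"
      unfolding lines_def by auto
    then show ?thesis unfolding ei using e by metis
  qed
qed

lemma lines_snoc:
  assumes "lines T As" "logical_axiom B \<or> B \<in> T \<or> (\<exists>A\<in>set As. Imp A B \<in> set As) \<or> (\<exists>A\<in>set As. \<exists>x. B = All x A)"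
  shows "lines T (As @ [B])"
  unfolding lines_def
proof (intro allI impI)
  fix i assume i: "i < length (As @ [B])"
  show "logical_axiom ((As @ [B]) ! i) \<or> (As @ [B]) ! i \<in> T \<or>
        (\<exists>j < i. \<exists>k < i. (As @ [B]) ! k = Imp ((As @ [B]) ! j) ((As @ [B]) ! i)) \<or>
        (\<exists>j < i. \<exists>x. (As @ [B]) ! i = All x ((As @ [B]) ! j))"
  proof (cases "i < length As")
    case True
    then have e: "(As @ [B]) ! j = As ! j" if "j \<le> i" for j using that by (simp add: nth_append)
    show ?thesis using assms(1) True e unfolding lines_def by (metis less_imp_le order_refl)
  next
    case False
    then have "i = length As" using i by simp
    then show ?thesis using assms(2) by (auto simp: in_set_conv_nth nth_append) blast+
  qed
qed

lemma provable_mp: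
  assumes "T \<turnstile> Imp A B" "T \<turnstile> A"
  shows "T \<turnstile> B"
proof -
  obtain As Bs where "is_proof T As (Imp A B)" "is_proof T Bs A" using assms unfolding provable_def by blast
  then have l: "lines T (As @ Bs)" and "Imp A B \<in> set (As @ Bs)" "A \<in> set (As @ Bs)"
    using last_in_set[of As] last_in_set[of Bs] by (auto simp: is_proof_lines lines_append)
  then have "lines T ((As @ Bs) @ [B])" by (intro lines_snoc[OF l]) blast
  then have "is_proof T ((As @ Bs) @ [B]) B" by (simp add: is_proof_lines)
  then show ?thesis unfolding provable_def by blast
qed

lemma provable_gen:
  assumes "T \<turnstile> A"
  shows "T \<turnstile> All x A"
proof -
  obtain As where "is_proof T As A" using assms unfolding provable_def by blast
  then have "lines T (As @ [All x A])" by (intro lines_snoc) (auto simp: is_proof_lines)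
  then have "is_proof T (As @ [All x A]) (All x A)" by (simp add: is_proof_lines)
  then show ?thesis unfolding provable_def by blast
qed

lemma provable_induct [consumes 1, case_names logical axiom mp gen]:
  assumes "T \<turnstile> A"
    and "\<And>A. logical_axiom A \<Longrightarrow> P A" "\<And>A. A \<in> T \<Longrightarrow> P A"
    and "\<And>A B. P (Imp A B) \<Longrightarrow> P A \<Longrightarrow> P B" "\<And>A x. P A \<Longrightarrow> P (All x A)"
  shows "P A"
proof -
  obtain As where As: "is_proof T As A" using assms(1) unfolding provable_def by blast
  have "P (As ! i)" if "i < length As" for i
    using that
  proof (induction i rule: less_induct)
    case (less i)
    have "logical_axiom (As ! i) \<or> As ! i \<in> T \<or> (\<exists>j < i. \<exists>k < i. As ! k = Imp (As ! j) (As ! i)) \<or>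
        (\<exists>j < i. \<exists>x. As ! i = All x (As ! j))" using As less.prems unfolding is_proof_def by blast
    then show ?case
      using assms(2-5) less.IH less.prems by (metis order.strict_trans)
  qed
  then show ?thesis using As unfolding is_proof_def by (metis diff_less last_conv_nth length_greater_0_conv zero_less_one)
qed

lemma soundness: "T \<turnstile> A \<Longrightarrow> (\<And>B v. B \<in> T \<Longrightarrow> holds v B) \<Longrightarrow> holds v A"
proof (induction arbitrary: v rule: provable_induct)
  case (mp A B)
  then show ?case by simp
qed (simp_all add: logical_axiom_holds)

lemma provable_trans: "T \<turnstile> A \<Longrightarrow> (\<And>B. B \<in> T \<Longrightarrow> U \<turnstile> B) \<Longrightarrow> U \<turnstile> A"
  by (induction rule: provable_induct) (auto intro: provable_ax provable_mp provable_gen)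

subsection \<open>Valuations\<close>

text \<open>
  A valuation is a propositional model containing all theorems. Since a formula is a theorem as
  soon as it holds in all valuations, derivations are replaced by reasoning in the metalogic.
\<close>

definition valuation :: "fm set \<Rightarrow> (fm \<Rightarrow> bool) \<Rightarrow> bool" where
  "valuation T w \<longleftrightarrow> (\<forall>A. T \<turnstile> A \<longrightarrow> w A) \<and> (\<forall>A. w (Neg A) = (\<not> w A)) \<and>
     (\<forall>A B. w (And A B) = (w A \<and> w B) \<and> w (Or A B) = (w A \<or> w B) \<and> w (Imp A B) = (w A \<longrightarrow> w B))"

text \<open>Hypotheses are used with modus ponens only and generalization is confined to theorems,
  so the deduction theorem holds without conditions on variables.\<close>

inductive ded :: "fm set \<Rightarrow> fm set \<Rightarrow> fm \<Rightarrow> bool" for T \<Gamma> where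
  hyp: "A \<in> \<Gamma> \<Longrightarrow> ded T \<Gamma> A"
| theo: "T \<turnstile> A \<Longrightarrow> ded T \<Gamma> A"
| mp: "ded T \<Gamma> (Imp A B) \<Longrightarrow> ded T \<Gamma> A \<Longrightarrow> ded T \<Gamma> B"

lemma ded_ax: "logical_axiom A \<Longrightarrow> ded T \<Gamma> A"
  by (intro ded.theo provable_ax)

lemma ded_imp: "ded T (insert B \<Gamma>) A \<Longrightarrow> ded T \<Gamma> (Imp B A)"
proof (induction rule: ded.induct)
  case (hyp A)
  have "ded T \<Gamma> (Imp B B)"
    using ded.mp[OF ded.mp[OF ded_ax[OF logical_axiom.intros(2)[of B "Imp B B" B]] ded_ax[OF logical_axiom.intros(1)]]
        ded_ax[OF logical_axiom.intros(1)]] .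
  then show ?case using hyp by (metis ded.hyp ded.mp ded_ax insert_iff logical_axiom.intros(1))
next
  case (theo A)
  then show ?case by (metis ded.mp ded.theo ded_ax logical_axiom.intros(1))
next
  case (mp A C)
  then show ?case by (metis ded.mp ded_ax logical_axiom.intros(2))
qed

lemma ded_mono: "ded T \<Gamma> A \<Longrightarrow> \<Gamma> \<subseteq> \<Delta> \<Longrightarrow> ded T \<Delta> A"
  by (induction rule: ded.induct) (auto intro: ded.intros)

definition incon :: "fm set \<Rightarrow> fm set \<Rightarrow> bool" where
  "incon T \<Gamma> \<longleftrightarrow> (\<exists>B. ded T \<Gamma> B \<and> ded T \<Gamma> (Neg B))"

lemma incon_neg: "incon T (insert B \<Gamma>) \<Longrightarrow> ded T \<Gamma> (Neg B)"
  unfolding incon_def by (metis ded.mp ded_ax ded_imp logical_axiom.intros(9))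

lemma incon_all: "incon T \<Gamma> \<Longrightarrow> ded T \<Gamma> A"
  unfolding incon_def by (metis ded.mp ded_ax logical_axiom.intros(1,9,10))

text \<open>Finite character of derivations, in the form that Zorn's lemma asks for.\<close>

lemma ded_chain:
  assumes "ded T (\<Union>C) A" "C \<noteq> {}" "\<And>X Y. X \<in> C \<Longrightarrow> Y \<in> C \<Longrightarrow> X \<subseteq> Y \<or> Y \<subseteq> X"
  shows "\<exists>\<Gamma>\<in>C. ded T \<Gamma> A"
  using assms
proof (induction rule: ded.induct)
  case (mp A B)
  then obtain X Y where "X \<in> C" "Y \<in> C" "ded T X (Imp A B)" "ded T Y A" by blast
  then show ?case using mp.prems(2)[of X Y] ded_mono ded.mp by meson
qed (auto intro: ded.intros)

text \<open>Lindenbaum's lemma: membership in a maximal set that is not inconsistent commutes with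
  the connectives.\<close>

lemma valuation_exists:
  assumes "\<not> incon T \<Gamma>"
  shows "\<exists>w. valuation T w \<and> (\<forall>A\<in>\<Gamma>. w A)"
proof -
  let ?S = "{\<Delta>. \<Gamma> \<subseteq> \<Delta> \<and> \<not> incon T \<Delta>}"
  have "\<exists>M\<in>?S. \<forall>X\<in>?S. M \<subseteq> X \<longrightarrow> X = M"
  proof (rule subset_Zorn_nonempty)
    show "?S \<noteq> {}" using assms by blast
    fix C assume C: "C \<noteq> {}" "subset.chain ?S C"
    then have ch: "X \<subseteq> Y \<or> Y \<subseteq> X" if "X \<in> C" "Y \<in> C" for X Y
      using that C(2) unfolding subset_chain_def by blast
    have "\<not> incon T (\<Union>C)"
    proof
      assume "incon T (\<Union>C)"
      then obtain B X Y where "X \<in> C" "Y \<in> C" "ded T X B" "ded T Y (Neg B)"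
        unfolding incon_def using ded_chain[OF _ C(1) ch] by blast
      then obtain Z where "Z \<in> C" "incon T Z" using ch[of X Y] ded_mono unfolding incon_def by meson
      then show False using C(2) unfolding subset_chain_def by blast
    qed
    then show "\<Union>C \<in> ?S" using C unfolding subset_chain_def by blast
  qed
  then obtain M where M: "\<Gamma> \<subseteq> M" "\<not> incon T M" "\<And>X. M \<subseteq> X \<Longrightarrow> \<not> incon T X \<Longrightarrow> X = M" by auto
  have cl: "A \<in> M" if "ded T M A" for A
  proof (rule ccontr)
    assume "A \<notin> M"
    then have "incon T (insert A M)" using M(3)[of "insert A M"] by blast
    then show False using that incon_neg M(2) unfolding incon_def by blast
  qed
  have ng: "Neg A \<in> M \<longleftrightarrow> A \<notin> M" for A
    using M(2) M(3)[of "insert A M"] incon_neg[of T A M] cl ded.hyp unfolding incon_def by blast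
  have ex: "Neg A \<in> M \<Longrightarrow> Imp A B \<in> M" for A B
    by (intro cl ded_imp incon_all) (auto simp: incon_def intro: ded.hyp)
  have mpM: "Imp A B \<in> M \<Longrightarrow> A \<in> M \<Longrightarrow> B \<in> M" for A B by (intro cl) (meson ded.hyp ded.mp)
  have axM: "logical_axiom A \<Longrightarrow> A \<in> M" for A by (intro cl ded_ax)
  have im: "Imp A B \<in> M \<longleftrightarrow> (A \<in> M \<longrightarrow> B \<in> M)" for A B
    using ex[of A B] mpM[of A B] ng[of A] mpM[of B "Imp A B"] axM[OF logical_axiom.intros(1)[of B A]] by blast
  have an: "And A B \<in> M \<longleftrightarrow> A \<in> M \<and> B \<in> M" for A B
    using axM[OF logical_axiom.intros(3)[of A B]] axM[OF logical_axiom.intros(4)[of A B]]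
      axM[OF logical_axiom.intros(5)[of A B]] by (auto simp: im)
  have orr: "Or A B \<in> M \<longleftrightarrow> A \<in> M \<or> B \<in> M" for A B
    using axM[OF logical_axiom.intros(6)[of A B]] axM[OF logical_axiom.intros(7)[of B A]]
      axM[OF logical_axiom.intros(8)[where A = A and B = B and C = A]] by (auto simp: im)
  have "valuation T (\<lambda>A. A \<in> M)" unfolding valuation_def by (simp add: im an orr ng cl ded.theo)
  then show ?thesis using M(1) by blast
qed

lemma provable_if_valuations: "(\<And>w. valuation T w \<Longrightarrow> w A) \<Longrightarrow> T \<turnstile> A"
proof (rule ccontr)
  assume a: "\<And>w. valuation T w \<Longrightarrow> w A" "\<not> T \<turnstile> A"
  have e: "ded T {} B \<Longrightarrow> T \<turnstile> B" for B by (induction rule: ded.induct) (auto intro: provable_mp)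
  have "\<not> incon T {Neg A}"
    using incon_neg[of T "Neg A" "{}"] e a(2) by (metis provable_ax(1) provable_mp logical_axiom.intros(10))
  then obtain w where "valuation T w" "w (Neg A)" using valuation_exists by blast
  then show False using a(1) unfolding valuation_def by blast
qed

lemma consistent_valuation:
  assumes "consistent T"
  shows "\<exists>w. valuation T w"
proof -
  have e: "ded T {} B \<Longrightarrow> T \<turnstile> B" for B by (induction rule: ded.induct) (auto intro: provable_mp)
  then have "\<not> incon T {}" using assms unfolding incon_def consistent_def by blast
  then show ?thesis using valuation_exists by blast
qed

lemma valuation_simps:
  assumes "valuation T w"
  shows "w (Neg A) \<longleftrightarrow> \<not> w A" "w (And A B) \<longleftrightarrow> w A \<and> w B" "w (Or A B) \<longleftrightarrow> w A \<or> w B" "w (Imp A B) \<longleftrightarrow> (w A \<longrightarrow> w B)"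
  using assms unfolding valuation_def by auto

lemma valuation_thm: "valuation T w \<Longrightarrow> T \<turnstile> A \<Longrightarrow> w A"
  unfolding valuation_def by blast

lemma valuation_ax: "valuation T w \<Longrightarrow> logical_axiom A \<Longrightarrow> w A"
  using valuation_thm provable_ax by blast

lemma val_mp: "valuation T w \<Longrightarrow> logical_axiom (Imp A B) \<Longrightarrow> w A \<Longrightarrow> w B"
  using valuation_ax[of T w "Imp A B"] valuation_simps(4)[of T w A B] by simp

lemma val_allD: "valuation T w \<Longrightarrow> w (All x A) \<Longrightarrow> free_for t x A \<Longrightarrow> w (subst x t A)"
  by (rule val_mp[OF _ logical_axiom.intros(11)])

lemma val_allD': "valuation T w \<Longrightarrow> w (All x A) \<Longrightarrow> w A"
  using val_allD[of T w x A "Var x"] by (simp add: free_for_self)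

text \<open>A single valuation does not respect generalization. The assumptions in use are bundled
  into one formula \<open>C\<close> without \<open>x\<close>, and the argument is made in all
  valuations satisfying \<open>C\<close>.\<close>

lemma val_allI:
  assumes "\<And>w. valuation T w \<Longrightarrow> w C \<Longrightarrow> w A" "x \<notin> free_vars C" "valuation T w" "w C"
  shows "w (All x A)"
proof -
  have "T \<turnstile> Imp C A" by (rule provable_if_valuations) (simp add: valuation_simps assms(1))
  then have "w (All x (Imp C A))" using provable_gen valuation_thm assms(3) by blast
  then show ?thesis using valuation_ax[OF assms(3) logical_axiom.intros(13)[OF assms(2)], of A] assms(4)
    by (simp add: valuation_simps[OF assms(3)])
qed

lemma val_exI: "valuation T w \<Longrightarrow> free_for t x A \<Longrightarrow> w (subst x t A) \<Longrightarrow> w (Ex x A)"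
  by (rule val_mp[OF _ logical_axiom.intros(12)])

lemma val_exE:
  assumes "\<And>w. valuation T w \<Longrightarrow> w C \<Longrightarrow> w A \<Longrightarrow> w B" "x \<notin> free_vars C" "x \<notin> free_vars B"
    "valuation T w" "w C" "w (Ex x A)"
  shows "w B"
proof -
  have "w (All x (Imp A B))"
    by (rule val_allI[of T C, OF _ assms(2,4,5)]) (simp add: valuation_simps assms(1))
  then show ?thesis using valuation_ax[OF assms(4) logical_axiom.intros(14)[OF assms(3)], of A] assms(6)
    by (simp add: valuation_simps[OF assms(4)])
qed

lemma val_subst:
  assumes "\<And>w. valuation T w \<Longrightarrow> w C \<Longrightarrow> w A" "x \<notin> free_vars C" "free_for t x A" "valuation T w" "w C"
  shows "w (subst x t A)"
proof -
  have "w (All x A)" by (rule val_allI[of T C]) (use assms in auto)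
  then show ?thesis by (rule val_allD[OF assms(4) _ assms(3)])
qed

lemma provable_subst: "T \<turnstile> A \<Longrightarrow> free_for t x A \<Longrightarrow> T \<turnstile> subst x t A"
  using provable_gen provable_mp provable_ax(1) logical_axiom.intros(11) by blast

subsection \<open>Equality\<close>

context
  fixes T w
  assumes w: "valuation T w"
begin

lemma eq_refl: "w (Eq t t)"
  by (rule valuation_ax[OF w logical_axiom.intros(15)])

lemma imp2: "logical_axiom (Imp A (Imp B C)) \<Longrightarrow> w A \<Longrightarrow> w B \<Longrightarrow> w C"
  using val_mp[OF w, of A "Imp B C"] valuation_simps(4)[OF w, of B C] by simp

lemma eq_cong: "w (Eq s t) \<Longrightarrow> w (Eq s' t') \<Longrightarrow> w (Eq s s') \<Longrightarrow> w (Eq t t')"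
  using imp2[OF logical_axiom.intros(22), of s t s' t'] valuation_simps(4)[OF w] by simp

lemma eq_sym: "w (Eq s t) \<Longrightarrow> w (Eq t s)"
  using eq_cong eq_refl by blast

lemma eq_trans: "w (Eq r s) \<Longrightarrow> w (Eq s t) \<Longrightarrow> w (Eq r t)"
  using eq_cong eq_refl eq_sym by blast

lemma eq_iff: "w (Eq s t) \<Longrightarrow> w (Eq s' t') \<Longrightarrow> w (Eq s s') = w (Eq t t')"
  using eq_cong eq_sym by blast

lemma le_cong: "w (Eq s t) \<Longrightarrow> w (Eq s' t') \<Longrightarrow> w (Le s s') \<Longrightarrow> w (Le t t')"
  using imp2[OF logical_axiom.intros(23), of s t s' t'] valuation_simps(4)[OF w] by simp

lemma le_iff: "w (Eq s t) \<Longrightarrow> w (Eq s' t') \<Longrightarrow> w (Le s s') = w (Le t t')"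
  using le_cong eq_sym by blast

lemma eq_Sc: "w (Eq s t) \<Longrightarrow> w (Eq (Sc s) (Sc t))"
  by (rule val_mp[OF w logical_axiom.intros(16)])

lemma eq_Len: "w (Eq s t) \<Longrightarrow> w (Eq (Len s) (Len t))"
  by (rule val_mp[OF w logical_axiom.intros(17)])

lemma eq_Half: "w (Eq s t) \<Longrightarrow> w (Eq (Half s) (Half t))"
  by (rule val_mp[OF w logical_axiom.intros(18)])

lemma eq_Add: "w (Eq s t) \<Longrightarrow> w (Eq s' t') \<Longrightarrow> w (Eq (Add s s') (Add t t'))"
  by (rule imp2[OF logical_axiom.intros(19)])

lemma eq_Mul: "w (Eq s t) \<Longrightarrow> w (Eq s' t') \<Longrightarrow> w (Eq (Mul s s') (Mul t t'))"
  by (rule imp2[OF logical_axiom.intros(20)])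

lemma eq_Smash: "w (Eq s t) \<Longrightarrow> w (Eq s' t') \<Longrightarrow> w (Eq (Smash s s') (Smash t t'))"
  by (rule imp2[OF logical_axiom.intros(21)])

lemma eq_tm_subst: "w (Eq s r) \<Longrightarrow> w (Eq (tm_subst x s t) (tm_subst x r t))"
  by (induction t) (auto intro: eq_refl eq_Sc eq_Len eq_Half eq_Add eq_Mul eq_Smash)

end

lemma eq_subst:
  assumes "valuation T w" "w (Eq s r)" "free_for s x A" "free_for r x A"
  shows "w (subst x s A) = w (subst x r A)"
  using assms
proof (induction A arbitrary: w)
  case (Eq a b)
  then show ?case using eq_tm_subst[OF Eq.prems(1,2)] by (simp add: eq_iff)
next
  case (Le a b)
  then show ?case using eq_tm_subst[OF Le.prems(1,2)] by (simp add: le_iff)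
next
  case (All y A)
  show ?case
  proof (cases "x \<in> free_vars (All y A)")
    case True
    then have y: "y \<noteq> x" "y \<notin> tm_vars s" "y \<notin> tm_vars r" "free_for s x A" "free_for r x A" using All.prems by auto
    have st: "w' (subst x s A) = w' (subst x r A)" if "valuation T w'" "w' (Eq s r)" for w'
      using All.IH[OF that y(4,5)] .
    \<comment> \<open>The equation together with the quantified formula is the side formula;
      \<open>y\<close> is not free in it because it occurs neither in \<open>s\<close> nor in
      \<open>r\<close>.\<close>
    have 1: "w (All y (subst x r A))" if "w (All y (subst x s A))"
      by (rule val_allI[of T "And (Eq s r) (All y (subst x s A))"])
        (use st y that All.prems in \<open>auto simp: valuation_simps dest: val_allD'\<close>)
    have 2: "w (All y (subst x s A))" if "w (All y (subst x r A))"
      by (rule val_allI[of T "And (Eq s r) (All y (subst x r A))"])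
        (use st y that All.prems in \<open>auto simp: valuation_simps dest: val_allD'\<close>)
    show ?thesis using 1 2 y by auto
  next
    case False
    then show ?thesis by (simp only: subst_id[OF False])
  qed
next
  case (Ex y A)
  show ?case
  proof (cases "x \<in> free_vars (Ex y A)")
    case True
    then have y: "y \<noteq> x" "y \<notin> tm_vars s" "y \<notin> tm_vars r" "free_for s x A" "free_for r x A" using Ex.prems by auto
    have st: "w' (subst x s A) = w' (subst x r A)" if "valuation T w'" "w' (Eq s r)" for w'
      using Ex.IH[OF that y(4,5)] .
    have ex: "w' (Ex y C)" if "valuation T w'" "w' C" for w' C
      using val_exI[OF that(1), of "Var y" y C] that(2) by (simp add: free_for_self)
    have 1: "w (Ex y (subst x r A))" if "w (Ex y (subst x s A))"
      by (rule val_exE[of T "Eq s r" "subst x s A"])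
        (use st y that Ex.prems ex in \<open>auto simp: valuation_simps\<close>)
    have 2: "w (Ex y (subst x s A))" if "w (Ex y (subst x r A))"
      by (rule val_exE[of T "Eq s r" "subst x r A"])
        (use st y that Ex.prems ex in \<open>auto simp: valuation_simps\<close>)
    show ?thesis using 1 2 y by auto
  next
    case False
    then show ?thesis by (simp only: subst_id[OF False])
  qed
qed (auto simp: valuation_simps)

subsection \<open>Deciding bounded formulas\<close>

primrec unum :: "nat \<Rightarrow> trm" where
  "unum 0 = Zero"
| "unum (Suc n) = Sc (unum n)"

lemma tm_vars_unum [simp]: "tm_vars (unum n) = {}"
  by (induction n) auto

fun qfree :: "fm \<Rightarrow> bool" where
  "qfree (Neg A) = qfree A"
| "qfree (And A B) = (qfree A \<and> qfree B)"
| "qfree (Or A B) = (qfree A \<and> qfree B)"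
| "qfree (Imp A B) = (qfree A \<and> qfree B)"
| "qfree (All x A) = False"
| "qfree (Ex x A) = False"
| "qfree A = True"

lemma qfree_free_for: "qfree A \<Longrightarrow> free_for r x A"
  by (induction A rule: qfree.induct) auto

lemma qfree_subst [simp]: "qfree (subst x r A) = qfree A"
  by (induction A rule: qfree.induct) auto

lemma qfree_BASIC: "\<forall>A\<in>BASIC. qfree A"
  by (simp add: BASIC_def Let_def)

locale basic =
  fixes T :: "fm set"
  assumes basic: "A \<in> BASIC \<Longrightarrow> T \<turnstile> A"
begin

lemma BASIC_inst:
  assumes "A \<in> BASIC"
  shows "T \<turnstile> subst 0 a (subst 1 b (subst 2 c (subst 3 d A)))"
  using assms qfree_BASIC by (intro provable_subst basic qfree_free_for) simp_all

text \<open>The terms avoid the variables of the axioms, so that the four successive substitutions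
  act like a simultaneous one.\<close>

lemma BASIC_val:
  assumes w: "valuation T w"
    and "tm_vars a \<inter> {0, 1, 2, 3} = {}" "tm_vars b \<inter> {0, 1, 2, 3} = {}"
    "tm_vars c \<inter> {0, 1, 2, 3} = {}" "tm_vars d \<inter> {0, 1, 2, 3} = {}"
  shows "w (Le Zero a)" "(w (Le a b) \<and> \<not> w (Eq a b)) = w (Le (Sc a) b)" "w (Le a b) \<or> w (Le b a)"
    "w (Le a b) \<and> w (Le b a) \<longrightarrow> w (Eq a b)" "w (Le a b) \<and> w (Le b c) \<longrightarrow> w (Le a c)"
    "w (Eq (Len Zero) Zero)" "w (Eq (Len (Smash a b)) (Sc (Mul (Len a) (Len b))))"
    "w (Eq (Smash Zero a) One)"
    "\<not> w (Eq a Zero) \<longrightarrow> w (Eq (Smash One (Mul Two a)) (Mul Two (Smash One a))) \<and>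
       w (Eq (Smash One (Sc (Mul Two a))) (Mul Two (Smash One a)))"
    "w (Eq (Smash a b) (Smash b a))"
    "w (Eq (Len a) (Add (Len b) (Len c))) \<longrightarrow> w (Eq (Smash a d) (Mul (Smash b d) (Smash c d)))"
    "w (Le a (Add a b))" "w (Eq (Add a Zero) a)" "w (Eq (Add a (Sc b)) (Sc (Add a b)))"
    "w (Eq (Mul a Zero) Zero)" "w (Eq (Mul a (Sc b)) (Add (Mul a b) a))"
    "w (Le One a) \<longrightarrow> w (Le (Mul a b) (Mul a c)) = w (Le b c)"
    "\<not> w (Eq a Zero) \<longrightarrow> w (Eq (Len a) (Sc (Len (Half a))))"
    "w (Eq a (Half b)) = (w (Eq (Mul Two a) b) \<or> w (Eq (Sc (Mul Two a)) b))"
    "w (Eq (Mul a b) (Mul b a))"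
proof -
  note vs = valuation_simps[OF w]
  have "\<forall>A\<in>BASIC. w (subst 0 a (subst 1 b (subst 2 c (subst 3 d A))))"
    using BASIC_inst valuation_thm[OF w] by blast
  then have F: "\<forall>A\<in>BASIC. w (subst 0 a (subst 1 b (subst 2 c (subst 3 d A))))" .
  have cl: "\<And>r. tm_subst 0 r b = b" "\<And>r. tm_subst 0 r c = c" "\<And>r. tm_subst 1 r c = c"
    "\<And>r. tm_subst 0 r d = d" "\<And>r. tm_subst 1 r d = d" "\<And>r. tm_subst 2 r d = d"
    using assms(2-) by simp_all
  have ne: "Suc 0 \<noteq> 0" "(2::nat) \<noteq> 0" "(2::nat) \<noteq> 1" "(3::nat) \<noteq> 0" "(3::nat) \<noteq> 1" "(3::nat) \<noteq> 2"
    "0 \<noteq> (1::nat)" "0 \<noteq> (2::nat)" "0 \<noteq> (3::nat)" "1 \<noteq> (2::nat)" "1 \<noteq> (3::nat)" "2 \<noteq> (3::nat)" "1 \<noteq> (0::nat)" by simp_all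
  note F' = F[unfolded BASIC_def Let_def, simplified subst.simps tm_subst.simps ball_simps vs cl ne if_True if_False simp_thms]
  show "w (Le Zero a)" "(w (Le a b) \<and> \<not> w (Eq a b)) = w (Le (Sc a) b)" "w (Le a b) \<or> w (Le b a)"
    "w (Le a b) \<and> w (Le b a) \<longrightarrow> w (Eq a b)" "w (Le a b) \<and> w (Le b c) \<longrightarrow> w (Le a c)"
    "w (Eq (Len Zero) Zero)" "w (Eq (Len (Smash a b)) (Sc (Mul (Len a) (Len b))))"
    "w (Eq (Smash Zero a) One)"
    "\<not> w (Eq a Zero) \<longrightarrow> w (Eq (Smash One (Mul Two a)) (Mul Two (Smash One a))) \<and>
       w (Eq (Smash One (Sc (Mul Two a))) (Mul Two (Smash One a)))"
    "w (Eq (Smash a b) (Smash b a))"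
    "w (Eq (Len a) (Add (Len b) (Len c))) \<longrightarrow> w (Eq (Smash a d) (Mul (Smash b d) (Smash c d)))"
    "w (Le a (Add a b))" "w (Eq (Add a Zero) a)" "w (Eq (Add a (Sc b)) (Sc (Add a b)))"
    "w (Eq (Mul a Zero) Zero)" "w (Eq (Mul a (Sc b)) (Add (Mul a b) a))"
    "w (Le One a) \<longrightarrow> w (Le (Mul a b) (Mul a c)) = w (Le b c)"
    "\<not> w (Eq a Zero) \<longrightarrow> w (Eq (Len a) (Sc (Len (Half a))))"
    "w (Eq a (Half b)) = (w (Eq (Mul Two a) b) \<or> w (Eq (Sc (Mul Two a)) b))"
    "w (Eq (Mul a b) (Mul b a))"
    using F' by satx+
qed

end

locale basic_val = basic T for T +
  fixes w assumes w: "valuation T w"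
begin

lemmas vs = valuation_simps[OF w]
lemmas erefl = eq_refl[OF w]
lemmas esym = eq_sym[OF w]
lemmas etrans = eq_trans[OF w]
lemmas eqI = eq_Sc[OF w] eq_Len[OF w] eq_Half[OF w] eq_Add[OF w] eq_Mul[OF w] eq_Smash[OF w]

lemma u_Le: "w (Le (unum a) (unum b)) \<longleftrightarrow> a \<le> b"
  and u_Eq: "w (Eq (unum a) (unum b)) \<longleftrightarrow> a = b"
  and u_Add: "w (Eq (Add (unum a) (unum b)) (unum (a + b)))"
proof -
  have add: "w (Eq (Add (unum a) (unum b)) (unum (a + b)))" for a b
  proof (induction b)
    case 0
    then show ?case using BASIC_val(13)[OF w, of "unum a" Zero Zero Zero] by simp
  next
    case (Suc b)
    then show ?case using BASIC_val(14)[OF w, of "unum a" "unum b" Zero Zero] by (auto intro: etrans eqI)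
  qed
  have le: "w (Le (unum a) (unum b))" if "a \<le> b" for a b
    using BASIC_val(12)[OF w, of "unum a" "unum (b - a)" Zero Zero] le_iff[OF w erefl add[of a "b - a"]] that by simp
  have lt: "w (Le (unum a) (unum b))" "\<not> w (Eq (unum a) (unum b))" if "a < b" for a b
    using BASIC_val(2)[OF w, of "unum a" "unum b" Zero Zero] le[of "Suc a" b] that by simp_all
  show "w (Le (unum a) (unum b)) \<longleftrightarrow> a \<le> b"
    using le[of a b] lt[of b a] BASIC_val(4)[OF w, of "unum b" "unum a" Zero Zero] by (cases "a \<le> b") auto
  show "w (Eq (unum a) (unum b)) \<longleftrightarrow> a = b"
    using lt(2)[of a b] lt(2)[of b a] esym[of "unum a" "unum b"] erefl[of "unum a"] by (cases a b rule: linorder_cases) auto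
  show "w (Eq (Add (unum a) (unum b)) (unum (a + b)))" by (rule add)
qed

lemma u_Mul: "w (Eq (Mul (unum a) (unum b)) (unum (a * b)))"
proof (induction b)
  case 0
  then show ?case using BASIC_val(15)[OF w, of "unum a" Zero Zero Zero] by simp
next
  case (Suc b)
  have "w (Eq (Add (Mul (unum a) (unum b)) (unum a)) (unum (a * b + a)))"
    by (rule etrans[OF eqI(4)[OF Suc erefl] u_Add])
  then show ?case using BASIC_val(16)[OF w, of "unum a" "unum b" Zero Zero] etrans by (simp add: add.commute)
qed

lemma u_Half: "w (Eq (Half (unum b)) (unum (b div 2)))"
proof -
  let ?a = "unum (b div 2)"
  have m: "w (Eq (Mul Two ?a) (unum (2 * (b div 2))))" using u_Mul[of 2 "b div 2"] by (simp add: numeral_2_eq_2)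
  then have "w (Eq (Mul Two ?a) (unum b)) \<or> w (Eq (Sc (Mul Two ?a)) (unum b))"
  proof (cases "even b")
    case True
    then show ?thesis using m by simp
  next
    case False
    then have "Suc (2 * (b div 2)) = b" by simp
    then show ?thesis using eqI(1)[OF m] by (metis unum.simps(2))
  qed
  then show ?thesis using BASIC_val(19)[OF w, of ?a "unum b" Zero Zero] esym by simp
qed

lemma u_Len: "w (Eq (Len (unum n)) (unum (blen n)))"
proof (induction n rule: less_induct)
  case (less n)
  show ?case
  proof (cases "n = 0")
    case True
    then show ?thesis using BASIC_val(6)[OF w, of Zero Zero Zero Zero] by simp
  next
    case False
    then have "w (Eq (Len (unum n)) (Sc (Len (Half (unum n)))))"
      using BASIC_val(18)[OF w, of "unum n" Zero Zero Zero] u_Eq[of n 0] by simp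
    moreover have "w (Eq (Len (Half (unum n))) (unum (blen (n div 2))))"
      using etrans[OF eqI(2)[OF u_Half] less.IH] False by simp
    ultimately have "w (Eq (Len (unum n)) (Sc (unum (blen (n div 2)))))" by (blast intro: etrans eqI)
    then show ?thesis using False by (simp add: blen_rec)
  qed
qed

text \<open>BASIC offers a recursion for \<open>Smash One\<close> at \<open>2a\<close> and
  \<open>2a + 1\<close> only if \<open>a\<close> is not zero, so the value at one has to be found
  separately.\<close>

lemma u_Smash1: "w (Eq (Smash One (unum d)) (unum (2 ^ blen d)))"
proof (induction d rule: less_induct)
  case (less d)
  consider "d = 0" | "d = 1" | "2 \<le> d" by linarith
  then show ?case
  proof cases
    case 1
    then show ?thesis
      using etrans[OF BASIC_val(10)[OF w, of One Zero Zero Zero] BASIC_val(8)[OF w, of One Zero Zero Zero]] by simp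
  next
    case 2
    \<comment> \<open>Its length is two, hence it is not zero. Splitting the length of two as one
      plus one shows that two smash one is the square of \<open>?s\<close>, while the recursion
      shows that it is twice \<open>?s\<close>; cancelling the factor \<open>?s\<close> leaves
      two.\<close>
    let ?s = "Smash One One"
    have one: "w (Eq One (unum 1))" "w (Eq Two (unum 2))" using erefl by (simp_all add: numeral_2_eq_2)
    have "w (Eq (Len ?s) (Sc (Mul (Len One) (Len One))))"
      using BASIC_val(7)[OF w, of One One Zero Zero] by simp
    moreover have "w (Eq (Sc (Mul (Len One) (Len One))) (unum 2))"
    proof -
      have b1: "blen 1 = 1" by (simp add: blen_rec)
      have l: "w (Eq (Len One) (unum 1))" using u_Len[of 1] b1 by simp
      have "w (Eq (Mul (Len One) (Len One)) (unum 1))" using etrans[OF eqI(5)[OF l l] u_Mul] by simp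
      from eqI(1)[OF this] show ?thesis by (simp add: numeral_2_eq_2)
    qed
    ultimately have len: "w (Eq (Len ?s) (unum 2))" using etrans by blast
    have ns: "\<not> w (Eq ?s Zero)"
    proof
      assume "w (Eq ?s Zero)"
      then have "w (Eq (Len ?s) (unum 0))" using etrans[OF eqI(2) BASIC_val(6)[OF w, of Zero Zero Zero Zero]] by simp
      then have "w (Eq (unum 2) (unum 0))" using len etrans esym by blast
      then show False using u_Eq[of 2 0] by simp
    qed
    then have ge: "w (Le One ?s)"
      using BASIC_val(1)[OF w, of ?s Zero Zero Zero] BASIC_val(2)[OF w, of Zero ?s Zero Zero] esym by auto
    have m: "w (Eq (Mul Two One) Two)" using u_Mul[of 2 1] by (simp add: numeral_2_eq_2)
    have t1: "w (Eq (Smash Two One) (Mul ?s ?s))"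
    proof -
      have b: "blen (Suc (Suc 0)) = Suc (Suc 0)" "blen (Suc 0) = Suc 0" by (simp_all add: blen_rec)
      have l: "w (Eq (Len One) (unum 1))" "w (Eq (Len Two) (unum 2))"
        using u_Len[of 1] u_Len[of 2] by (simp_all add: b numeral_2_eq_2)
      have "w (Eq (Add (Len One) (Len One)) (unum 2))"
        using etrans[OF eqI(4)[OF l(1) l(1)] u_Add] by (simp add: numeral_2_eq_2)
      from etrans[OF l(2) esym[OF this]] have "w (Eq (Len Two) (Add (Len One) (Len One)))" .
      then show ?thesis using BASIC_val(11)[OF w, of Two One One One] by simp
    qed
    have "\<not> w (Eq One Zero)" using u_Eq[of 1 0] by simp
    then have "w (Eq (Smash One (Mul Two One)) (Mul Two ?s))" using BASIC_val(9)[OF w, of One Zero Zero Zero] by simp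
    then have t2: "w (Eq (Smash Two One) (Mul Two ?s))"
      using etrans[OF etrans[OF BASIC_val(10)[OF w, of Two One Zero Zero] esym[OF eqI(6)[OF erefl m]]]] by simp
    have e: "w (Eq (Mul ?s ?s) (Mul ?s Two))"
      using etrans[OF etrans[OF esym[OF t1] t2]] BASIC_val(20)[OF w, of Two ?s Zero Zero] by simp
    have r: "w (Le t t)" if "tm_vars t = {}" for t
      using BASIC_val(3)[OF w, of t t Zero Zero] that by simp
    have "w (Le ?s Two)"
      using BASIC_val(17)[OF w, of ?s ?s Two Zero] ge le_iff[OF w erefl e, of "Mul ?s ?s"] r[of "Mul ?s ?s"] by simp
    moreover have "w (Le Two ?s)"
      using BASIC_val(17)[OF w, of ?s Two ?s Zero] ge le_iff[OF w e erefl, of "Mul ?s ?s"] r[of "Mul ?s ?s"] by simp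
    ultimately have "w (Eq ?s Two)" using BASIC_val(4)[OF w, of ?s Two Zero Zero] by simp
    then show ?thesis using 2 by (simp add: blen_rec numeral_2_eq_2)
  next
    case 3
    let ?a = "unum (d div 2)"
    have h: "0 < d div 2" "d div 2 < d" using 3 by auto
    have m: "w (Eq (Mul Two ?a) (unum (2 * (d div 2))))" using u_Mul[of 2 "d div 2"] by (simp add: numeral_2_eq_2)
    have "\<not> w (Eq ?a Zero)" using u_Eq[of "d div 2" 0] h by simp
    then have n: "w (Eq (Smash One (Mul Two ?a)) (Mul Two (Smash One ?a)))"
      "w (Eq (Smash One (Sc (Mul Two ?a))) (Mul Two (Smash One ?a)))"
      using BASIC_val(9)[OF w, of ?a Zero Zero Zero] by simp_all
    have "w (Eq (Mul Two (Smash One ?a)) (Mul (unum 2) (unum (2 ^ blen (d div 2)))))"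
      using eqI(5)[OF erefl[of Two] less.IH[OF h(2)]] by (simp add: numeral_2_eq_2)
    from etrans[OF this u_Mul] have k: "w (Eq (Mul Two (Smash One ?a)) (unum (2 ^ blen d)))"
      using h 3 by (simp add: blen_rec[of d])
    show ?thesis
    proof (cases "even d")
      case True
      then have "w (Eq (Mul Two ?a) (unum d))" using m by simp
      then show ?thesis using etrans[OF etrans[OF eqI(6)[OF erefl esym] n(1)] k] by blast
    next
      case False
      then have "Suc (2 * (d div 2)) = d" by simp
      then have "w (Eq (Sc (Mul Two ?a)) (unum d))" using eqI(1)[OF m] by (metis unum.simps(2))
      then show ?thesis using etrans[OF etrans[OF eqI(6)[OF erefl esym] n(2)] k] by blast
    qed
  qed
qed

text \<open>The length of \<open>a\<close> is that of \<open>a div 2\<close> plus that of one, which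
  splits the smash function into a product.\<close>

lemma u_Smash: "w (Eq (Smash (unum a) (unum d)) (unum (2 ^ (blen a * blen d))))"
proof (induction a rule: less_induct)
  case (less a)
  show ?case
  proof (cases "a = 0")
    case True
    then show ?thesis using BASIC_val(8)[OF w, of "unum d" Zero Zero Zero] by simp
  next
    case False
    let ?h = "unum (a div 2)"
    have b: "blen a = Suc (blen (a div 2))" "blen 1 = 1" using False by (simp_all add: blen_rec)
    have o: "w (Eq (Len One) (unum 1))" using u_Len[of 1] b(2) by simp
    have "w (Eq (Add (Len ?h) (Len One)) (unum (blen a)))"
      using etrans[OF eqI(4)[OF u_Len o] u_Add] b(1) by simp
    then have "w (Eq (Len (unum a)) (Add (Len ?h) (Len One)))" by (rule etrans[OF u_Len esym])
    then have 1: "w (Eq (Smash (unum a) (unum d)) (Mul (Smash ?h (unum d)) (Smash One (unum d))))"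
      using BASIC_val(11)[OF w, of "unum a" ?h One "unum d"] by simp
    have 2: "w (Eq (Mul (Smash ?h (unum d)) (Smash One (unum d))) (unum (2 ^ (blen (a div 2) * blen d) * 2 ^ blen d)))"
      using etrans[OF eqI(5)[OF less.IH u_Smash1] u_Mul] False by simp
    show ?thesis using etrans[OF 1 2] b(1) by (simp add: power_add mult.commute)
  qed
qed

lemma eval_tm: "(\<And>i. i \<in> tm_vars t \<Longrightarrow> w (Eq (Var i) (unum (v i)))) \<Longrightarrow> w (Eq t (unum (tm_val v t)))"
proof (induction t)
  case Zero
  then show ?case using erefl[of Zero] by simp
next
  case (Sc t)
  then show ?case using eqI(1) by simp
next
  case (Add s t)
  then have "w (Eq s (unum (tm_val v s)))" "w (Eq t (unum (tm_val v t)))" by auto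
  from etrans[OF eqI(4)[OF this] u_Add] show ?case by simp
next
  case (Mul s t)
  then have "w (Eq s (unum (tm_val v s)))" "w (Eq t (unum (tm_val v t)))" by auto
  from etrans[OF eqI(5)[OF this] u_Mul] show ?case by simp
next
  case (Len t)
  then have "w (Eq t (unum (tm_val v t)))" by auto
  from etrans[OF eqI(2)[OF this] u_Len] show ?case by simp
next
  case (Half t)
  then have "w (Eq t (unum (tm_val v t)))" by auto
  from etrans[OF eqI(3)[OF this] u_Half] show ?case by simp
next
  case (Smash s t)
  then have "w (Eq s (unum (tm_val v s)))" "w (Eq t (unum (tm_val v t)))" by auto
  from etrans[OF eqI(6)[OF this] u_Smash] show ?case by simp
qed simp

text \<open>First for variable \<open>4\<close>, which does not occur in BASIC, as
  \<open>BASIC_val\<close> requires; the general case follows by substitution.\<close>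

lemma Le_unum4: "w (Le (Var 4) (unum n)) \<Longrightarrow> \<exists>a\<le>n. w (Eq (Var 4) (unum a))"
proof (induction n)
  case 0
  then show ?case using BASIC_val(1,4)[OF w, of "Var 4" Zero Zero Zero] by auto
next
  case (Suc n)
  show ?case
  proof (cases "w (Eq (Var 4) (unum (Suc n)))")
    case False
    have "w (Le (Var 4) (unum n))"
    proof (rule ccontr)
      assume n: "\<not> w (Le (Var 4) (unum n))"
      then have "w (Le (unum n) (Var 4))" using BASIC_val(3)[OF w, of "unum n" "Var 4" Zero Zero] by auto
      moreover have "\<not> w (Eq (unum n) (Var 4))"
        using n le_iff[OF w _ erefl, of "unum n" "Var 4" "unum n"] u_Le[of n n] by auto
      ultimately have "w (Le (unum (Suc n)) (Var 4))" using BASIC_val(2)[OF w, of "unum n" "Var 4" Zero Zero] by auto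
      then show False using Suc.prems False BASIC_val(4)[OF w, of "Var 4" "unum (Suc n)" Zero Zero] by auto
    qed
    then show ?thesis using Suc.IH le_SucI by blast
  qed auto
qed

end

lemma (in basic) Le_unum:
  assumes "valuation T w" "w (Le (Var x) (unum n))"
  shows "\<exists>a\<le>n. w (Eq (Var x) (unum a))"
proof -
  \<comment> \<open>The finite disjunction is written as a formula, so that the claim becomes a
    theorem in which the variable can be replaced.\<close>
  define E where "E y = foldr (\<lambda>a. Or (Eq (Var y) (unum a))) [0..<Suc n] (Neg (Eq Zero Zero))" for y
  have val: "w (foldr (\<lambda>a. Or (Eq (Var y) (unum a))) l (Neg (Eq Zero Zero))) \<longleftrightarrow> (\<exists>a\<in>set l. w (Eq (Var y) (unum a)))"
    if "valuation T w" for w y l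
    by (induction l) (auto simp: valuation_simps[OF that] eq_refl[OF that])
  have E: "w (E y) \<longleftrightarrow> (\<exists>a\<le>n. w (Eq (Var y) (unum a)))" if "valuation T w" for w y
    unfolding E_def val[OF that] by (simp add: Bex_def less_Suc_eq_le del: upt_Suc)
  have qf: "qfree (foldr (\<lambda>a. Or (Eq (Var y) (unum a))) l (Neg (Eq Zero Zero)))" for y l by (induction l) auto
  have sb: "subst 4 (Var x) (foldr (\<lambda>a. Or (Eq (Var 4) (unum a))) l (Neg (Eq Zero Zero))) =
      foldr (\<lambda>a. Or (Eq (Var x) (unum a))) l (Neg (Eq Zero Zero))" for l by (induction l) auto
  have "T \<turnstile> Imp (Le (Var 4) (unum n)) (E 4)"
  proof (rule provable_if_valuations)
    fix w assume w: "valuation T w"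
    then interpret basic_val T w by unfold_locales
    show "w (Imp (Le (Var 4) (unum n)) (E 4))" using Le_unum4 by (simp add: vs E[OF w])
  qed
  then have "T \<turnstile> subst 4 (Var x) (Imp (Le (Var 4) (unum n)) (E 4))"
    by (rule provable_subst) (simp add: E_def qf qfree_free_for del: upt_Suc)
  then have "w (Imp (Le (Var x) (unum n)) (E x))"
    using valuation_thm[OF assms(1)] by (simp add: E_def sb del: upt_Suc)
  then show ?thesis using assms E by (simp add: valuation_simps[OF assms(1)])
qed

lemma finite_tm_vars [simp]: "finite (tm_vars t)"
  by (induction t) auto

lemma finite_free_vars [simp]: "finite (free_vars A)"
  by (induction A) auto

definition var_eqs :: "(nat \<Rightarrow> nat) \<Rightarrow> nat list \<Rightarrow> fm" where
  "var_eqs v xs = foldr (\<lambda>i. And (Eq (Var i) (unum (v i)))) xs (Eq Zero Zero)"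

lemma val_var_eqs: "valuation T w \<Longrightarrow> w (var_eqs v xs) \<longleftrightarrow> (\<forall>i\<in>set xs. w (Eq (Var i) (unum (v i))))"
  unfolding var_eqs_def by (induction xs) (auto simp: valuation_simps eq_refl)

lemma free_vars_var_eqs: "free_vars (var_eqs v xs) = set xs"
  unfolding var_eqs_def by (induction xs) auto

context basic
begin

text \<open>The theory settles \<open>A\<close> under equations that fix its free variables.
  Equations are used in place of substituted numerals, so that nothing is substituted under
  quantifiers during the induction.\<close>

definition decided :: "fm \<Rightarrow> bool" where
  "decided A \<longleftrightarrow> (\<forall>v w. valuation T w \<longrightarrow> (\<forall>i\<in>free_vars A. w (Eq (Var i) (unum (v i)))) \<longrightarrow> w A = holds v A)"

lemma decidedD: "decided A \<Longrightarrow> valuation T w \<Longrightarrow> (\<And>i. i \<in> free_vars A \<Longrightarrow> w (Eq (Var i) (unum (v i)))) \<Longrightarrow> w A = holds v A"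
  unfolding decided_def by blast

text \<open>The bound is provably equal to a numeral, and a variable below a numeral provably takes
  one of finitely many values.\<close>

lemma decided_bounded:
  assumes A: "decided A" and x: "x \<notin> tm_vars t"
  shows "decided (AllLe x t A)" "decided (ExLe x t A)"
proof -
  have main: "w (AllLe x t A) = holds v (AllLe x t A) \<and> w (ExLe x t A) = holds v (ExLe x t A)"
    if w: "valuation T w" and e: "\<And>i. i \<in> (tm_vars t \<union> free_vars A) - {x} \<Longrightarrow> w (Eq (Var i) (unum (v i)))" for v w
  proof -
    obtain xs where xs: "set xs = (tm_vars t \<union> free_vars A) - {x}"
      using finite_list[of "(tm_vars t \<union> free_vars A) - {x}"] by auto
    \<comment> \<open>All that is known about the valuation, in one formula without
      \<open>x\<close>, as generalization and elimination of \<open>Ex\<close> require.\<close>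
    define C where "C = var_eqs v xs"
    have C: "x \<notin> free_vars C" "w C" using xs e by (auto simp: C_def free_vars_var_eqs val_var_eqs[OF w])
    let ?n = "tm_val v t"
    have t: "w' (Eq t (unum ?n))" if "valuation T w'" "w' C" for w'
    proof -
      interpret basic_val T w' using that(1) by unfold_locales
      show ?thesis
        using that x by (intro eval_tm) (auto simp: C_def val_var_eqs[OF that(1)] xs)
    qed
    have le: "w' (Le (Var x) t) = w' (Le (Var x) (unum ?n))" if "valuation T w'" "w' C" for w'
      using le_iff[OF that(1) eq_refl[OF that(1)] t[OF that]] .
    have wA: "w' A = holds (v(x := a)) A" if "valuation T w'" "w' C" "w' (Eq (Var x) (unum a))" for w' a
    proof (rule decidedD[OF A that(1)])
      fix i assume i: "i \<in> free_vars A"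
      show "w' (Eq (Var i) (unum ((v(x := a)) i)))"
        using that i by (cases "i = x") (auto simp: C_def val_var_eqs[OF that(1)] xs)
    qed
    have a_le: "w' (Le (Var x) t)" if "valuation T w'" "w' C" "w' (Eq (Var x) (unum a))" "a \<le> ?n" for w' a
    proof -
      interpret basic_val T w' using that(1) by unfold_locales
      show ?thesis using le[OF that(1,2)] le_iff[OF that(1) that(3) erefl[of "unum ?n"]] u_Le[of a ?n] that(4) by simp
    qed
    have ff: "free_for (unum a) x F" for a F by (rule free_for_self) simp
    have er: "w (Eq (unum a) (unum a))" for a by (rule eq_refl[OF w])
    have "w (AllLe x t A)" if h: "\<forall>a\<le>?n. holds (v(x := a)) A"
    proof (rule val_allI[OF _ C(1) w C(2)])
      fix w' assume w': "valuation T w'" "w' C"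
      have "w' A" if "w' (Le (Var x) t)"
        using Le_unum[OF w'(1), of x ?n] that le[OF w'] wA[OF w'] h by blast
      then show "w' (Imp (Le (Var x) t) A)" by (simp add: valuation_simps[OF w'(1)])
    qed
    moreover have "holds (v(x := a)) A" if h: "w (AllLe x t A)" "a \<le> ?n" for a
    proof (rule ccontr)
      assume n: "\<not> holds (v(x := a)) A"
      have "w (subst x (unum a) (Imp (Eq (Var x) (unum a)) (Neg (Imp (Le (Var x) t) A))))"
      proof (rule val_subst[OF _ C(1) ff w C(2)])
        fix w' assume w': "valuation T w'" "w' C"
        show "w' (Imp (Eq (Var x) (unum a)) (Neg (Imp (Le (Var x) t) A)))"
          using wA[OF w'] a_le[OF w' _ h(2)] n by (simp add: valuation_simps[OF w'(1)])
      qed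
      then show False using val_allD[OF w h(1) ff, of a] er[of a] by (simp add: valuation_simps[OF w])
    qed
    moreover have "w (ExLe x t A)" if h: "a \<le> ?n" "holds (v(x := a)) A" for a
    proof (rule val_exI[OF w ff[of a]])
      have "w (subst x (unum a) (Imp (Eq (Var x) (unum a)) (And (Le (Var x) t) A)))"
      proof (rule val_subst[OF _ C(1) ff w C(2)])
        fix w' assume w': "valuation T w'" "w' C"
        show "w' (Imp (Eq (Var x) (unum a)) (And (Le (Var x) t) A))"
          using wA[OF w'] a_le[OF w' _ h(1)] h(2) by (simp add: valuation_simps[OF w'(1)])
      qed
      then show "w (subst x (unum a) (And (Le (Var x) t) A))"
        using er[of a] by (simp add: valuation_simps[OF w])
    qed
    moreover have "\<exists>a\<le>?n. holds (v(x := a)) A" if h: "w (ExLe x t A)"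
    proof (rule ccontr)
      assume n: "\<not> (\<exists>a\<le>?n. holds (v(x := a)) A)"
      have "w (Neg (Eq Zero Zero))"
      proof (rule val_exE[OF _ C(1) _ w C(2) h])
        fix w' assume w': "valuation T w'" "w' C" "w' (And (Le (Var x) t) A)"
        then have "w' (Le (Var x) t)" "w' A" by (simp_all add: valuation_simps[OF w'(1)])
        then have False using Le_unum[OF w'(1), of x ?n] le[OF w'(1,2)] wA[OF w'(1,2)] n by blast
        then show "w' (Neg (Eq Zero Zero))" ..
      qed simp
      then show False using eq_refl[OF w] by (simp add: valuation_simps[OF w])
    qed
    ultimately show ?thesis unfolding holds_AllLe[OF x] holds_ExLe[OF x] by blast
  qed
  have fv: "free_vars (AllLe x t A) = (tm_vars t \<union> free_vars A) - {x}" "free_vars (ExLe x t A) = (tm_vars t \<union> free_vars A) - {x}"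
    by auto
  show "decided (AllLe x t A)" "decided (ExLe x t A)" unfolding decided_def fv using main by blast+
qed

lemma decided_conn:
  assumes "decided A"
  shows "decided (Neg A)" and "decided B \<Longrightarrow> decided (And A B)" and "decided B \<Longrightarrow> decided (Or A B)"
    and "decided B \<Longrightarrow> decided (Imp A B)"
  using assms unfolding decided_def by (simp_all add: valuation_simps)

lemma decided_atom: "decided (Eq s t)" "decided (Le s t)"
proof -
  have "w (Eq s t) = holds v (Eq s t) \<and> w (Le s t) = holds v (Le s t)"
    if w: "valuation T w" and e: "\<And>i. i \<in> tm_vars s \<union> tm_vars t \<Longrightarrow> w (Eq (Var i) (unum (v i)))" for v w
  proof -
    interpret basic_val T w using w by unfold_locales
    have h: "w (Eq s (unum (tm_val v s)))" "w (Eq t (unum (tm_val v t)))" by (rule eval_tm, rule e, simp)+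
    show ?thesis unfolding eq_iff[OF w h] le_iff[OF w h] u_Eq u_Le by simp
  qed
  then show "decided (Eq s t)" "decided (Le s t)" unfolding decided_def by simp_all
qed

lemma decided_sharply: "sharply_bounded A \<Longrightarrow> decided A"
  by (induction rule: sharply_bounded.induct) (auto intro: decided_atom decided_conn decided_bounded)

lemma decided_Sigma1b: "Sigma1b A \<Longrightarrow> decided A" "Pi1b A \<Longrightarrow> decided A"
  by (induction rule: Sigma1b_Pi1b.inducts) (auto intro: decided_sharply decided_conn decided_bounded)

end

lemma tm_vars_numeral [simp]: "tm_vars (numeral_tm n) = {}"
  by (induction n rule: less_induct) (subst numeral_tm.simps, simp)

lemma tm_val_numeral [simp]: "tm_val v (numeral_tm n) = n"
proof (induction n rule: less_induct)
  case (less n)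
  then show ?case
    by (subst numeral_tm.simps) (auto elim: oddE)
qed

lemma S12_basic: "A \<in> BASIC \<Longrightarrow> S12 \<turnstile> A"
  by (intro provable_ax) (simp add: S12_def)

text \<open>A false instance would be refuted by \<open>S\<close>. Here consistency of
  \<open>S\<close> turns into truth of the \<open>\<Sigma>\<^sup>b\<^sub>1\<close> instances that
  \<open>S\<close> proves.\<close>

lemma numeral_inst_holds:
  assumes "consistent S" "\<And>A. S12 \<turnstile> A \<Longrightarrow> S \<turnstile> A" "Sigma1b A" "free_vars A \<subseteq> {0, 1, 2}"
    "S \<turnstile> numeral_inst A (v 0) (v 1) (v 2)"
  shows "holds v A"
proof (rule ccontr)
  assume n: "\<not> holds v A"
  interpret basic S using assms(2) S12_basic by unfold_locales blast
  obtain w where w: "valuation S w" using consistent_valuation[OF assms(1)] by blast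
  let ?F = "Imp (Eq (Var 0) (numeral_tm (v 0))) (Imp (Eq (Var 1) (numeral_tm (v 1))) (Imp (Eq (Var 2) (numeral_tm (v 2))) (Neg A)))"
  have "S \<turnstile> ?F"
  proof (rule provable_if_valuations)
    fix w assume w: "valuation S w"
    interpret basic_val S w using w by unfold_locales
    have nu: "w (Eq (numeral_tm k) (unum k))" for k using eval_tm[of "numeral_tm k" v] by simp
    have "\<not> w A" if h: "w (Eq (Var 0) (numeral_tm (v 0)))" "w (Eq (Var 1) (numeral_tm (v 1)))" "w (Eq (Var 2) (numeral_tm (v 2)))"
    proof -
      have "w (Eq (Var i) (unum (v i)))" if "i \<in> free_vars A" for i
        using that assms(4) etrans[OF h(1) nu] etrans[OF h(2) nu] etrans[OF h(3) nu] by auto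
      then show ?thesis using decidedD[OF decided_Sigma1b(1)[OF assms(3)] w] n by blast
    qed
    then show "w ?F" by (simp add: vs)
  qed
  then have "S \<turnstile> subst 0 (numeral_tm (v 0)) (subst 1 (numeral_tm (v 1)) (subst 2 (numeral_tm (v 2)) ?F))"
    by (intro provable_subst free_for_self) simp_all
  from valuation_thm[OF w this] valuation_thm[OF w assms(5)] show False
    by (simp add: valuation_simps[OF w] eq_refl[OF w] numeral_inst_def)
qed

subsection \<open>Induction axioms without substitution\<close>

text \<open>Zero and successor enter through equations, and \<open>y\<close> carries the successor
  past the rebinding of \<open>x\<close>. Thus the tokens of the axiom arise from those of
  \<open>A\<close> by concatenation, and no substitution into a varying formula has to be
  programmed.\<close>

definition IND :: "nat \<Rightarrow> nat \<Rightarrow> fm \<Rightarrow> fm" where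
  "IND x y A = Imp (And (All x (Imp (Eq (Var x) Zero) A))
       (All x (Imp A (All y (Imp (Eq (Var y) (Sc (Var x))) (All x (Imp (Eq (Var x) (Var y)) A)))))))
     (All x A)"

lemma holds_IND:
  assumes "x \<noteq> y" "y \<notin> free_vars A"
  shows "holds v (IND x y A)"
proof -
  have e: "holds (v(y := b, x := c)) A = holds (v(x := c)) A" for b c
    by (rule holds_cong) (use assms in auto)
  have "holds (v(x := n)) A"
    if "holds (v(x := 0)) A" "\<And>n. holds (v(x := n)) A \<Longrightarrow> holds (v(x := Suc n)) A" for n
  proof (induction n)
    case 0
    show ?case by (rule that(1))
  next
    case (Suc n)
    then show ?case by (rule that(2))
  qed
  then show ?thesis using assms(1) by (simp add: IND_def e)
qed

lemma free_vars_tokens: "free_vars A \<subseteq> set (fm_tokens A)"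
proof -
  have "tm_vars t \<subseteq> set (tm_tokens t)" for t by (induction t) auto
  then show ?thesis by (induction A) auto
qed

lemma free_for_fresh: "y \<notin> set (fm_tokens A) \<Longrightarrow> free_for (Var y) x A"
  by (induction A) auto

text \<open>Full induction yields \<open>A\<close> everywhere, in particular at all lengths. The
  equations of \<open>IND\<close> are exchanged for substitutions by the equality axioms.\<close>

lemma LIND_if_IND:
  assumes T: "T \<turnstile> IND x y A" and y: "x \<noteq> y" "y \<notin> set (fm_tokens A)"
  shows "T \<turnstile> LIND x A"
proof (rule provable_if_valuations)
  fix w assume w: "valuation T w"
  define C where "C = And (subst x Zero A) (All x (Imp A (subst x (Sc (Var x)) A)))"
  have yA: "y \<notin> free_vars A" "free_for (Var y) x A" using y(2) free_vars_tokens free_for_fresh by blast+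
  have xC: "x \<notin> free_vars C" using free_vars_subst[of x Zero A] by (auto simp: C_def)
  have yC: "y \<notin> free_vars C"
    using free_vars_subst[of x Zero A] free_vars_subst[of x "Sc (Var x)" A] yA y(1) by (auto simp: C_def)
  have ff: "free_for Zero x A" "free_for (Sc (Var x)) x A" "free_for (Len (Var x)) x A" "free_for (Var x) x A"
    by (simp_all add: free_for_self)
  have "w (All x (subst x (Len (Var x)) A))" if c: "w C"
  proof -
    have 1: "w (All x (Imp (Eq (Var x) Zero) A))"
    proof (rule val_allI[OF _ xC w c])
      fix w' assume w': "valuation T w'" "w' C"
      then show "w' (Imp (Eq (Var x) Zero) A)"
        using eq_subst[OF w'(1) _ ff(4,1)] by (simp add: valuation_simps C_def)
    qed
    have 2: "w (All x (Imp A (All y (Imp (Eq (Var y) (Sc (Var x))) (All x (Imp (Eq (Var x) (Var y)) A))))))"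
    proof (rule val_allI[OF _ xC w c])
      fix w' assume w': "valuation T w'" "w' C"
      have "w' (All y (Imp (Eq (Var y) (Sc (Var x))) (All x (Imp (Eq (Var x) (Var y)) A))))" if a: "w' A"
      proof (rule val_allI[of T "And C A"])
        show "y \<notin> free_vars (And C A)" using yC yA by simp
        show "w' (And C A)" using w' a by (simp add: valuation_simps)
        fix w'' assume w'': "valuation T w''" "w'' (And C A)"
        have "w'' (All x (Imp (Eq (Var x) (Var y)) A))" if e: "w'' (Eq (Var y) (Sc (Var x)))"
        proof (rule val_allI[of T "subst x (Var y) A"])
          show "x \<notin> free_vars (subst x (Var y) A)" using free_vars_subst[of x "Var y" A] y(1) by auto
          have "w'' (Imp A (subst x (Sc (Var x)) A))"
            using w'' val_allD'[OF w''(1), of x "Imp A (subst x (Sc (Var x)) A)"] by (simp add: valuation_simps C_def)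
          then show "w'' (subst x (Var y) A)"
            using w'' eq_subst[OF w''(1) e yA(2) ff(2)] by (simp add: valuation_simps)
          fix u assume u: "valuation T u" "u (subst x (Var y) A)"
          then show "u (Imp (Eq (Var x) (Var y)) A)"
            using eq_subst[OF u(1) _ ff(4) yA(2)] by (simp add: valuation_simps)
        qed (rule w''(1))
        then show "w'' (Imp (Eq (Var y) (Sc (Var x))) (All x (Imp (Eq (Var x) (Var y)) A)))"
          using w'' by (simp add: valuation_simps)
      qed (rule w'(1))
      then show "w' (Imp A (All y (Imp (Eq (Var y) (Sc (Var x))) (All x (Imp (Eq (Var x) (Var y)) A)))))"
        using w' by (simp add: valuation_simps)
    qed
    have 3: "w (All x A)" using valuation_thm[OF w T] 1 2 by (simp add: IND_def valuation_simps[OF w])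
    show ?thesis
      by (rule val_allI[of T "All x A"]) (use 3 w ff(3) in \<open>auto intro: val_allD\<close>)
  qed
  then show "w (LIND x A)" by (simp add: LIND_def C_def valuation_simps[OF w])
qed

section \<open>Syntax in polynomial time\<close>

section \<open>Syntax in polynomial time\<close>

lemma tm_tokens_prefix: "tm_tokens s @ x = tm_tokens t @ y \<longleftrightarrow> s = t \<and> x = y"
proof (induction s arbitrary: t x y)
  case (Var i) then show ?case by (cases t) auto
next
  case Zero then show ?case by (cases t) auto
next
  case (Sc s) then show ?case by (cases t) auto
next
  case (Add s1 s2) then show ?case by (cases t) auto
next
  case (Mul s1 s2) then show ?case by (cases t) auto
next
  case (Len s) then show ?case by (cases t) auto
next
  case (Half s) then show ?case by (cases t) auto
next
  case (Smash s1 s2) then show ?case by (cases t) auto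
qed

lemma fm_tokens_prefix: "fm_tokens A @ x = fm_tokens B @ y \<longleftrightarrow> A = B \<and> x = y"
proof (induction A arbitrary: B x y)
  case (Eq s t) then show ?case by (cases B) (auto simp: tm_tokens_prefix)
next
  case (Le s t) then show ?case by (cases B) (auto simp: tm_tokens_prefix)
next
  case (Neg A) then show ?case by (cases B) auto
next
  case (And A1 A2) then show ?case by (cases B) auto
next
  case (Or A1 A2) then show ?case by (cases B) auto
next
  case (Imp A1 A2) then show ?case by (cases B) auto
next
  case (All i A) then show ?case by (cases B) auto
next
  case (Ex i A) then show ?case by (cases B) auto
qed

lemma fm_code_inject: "fm_code A = fm_code B \<longleftrightarrow> A = B"
  using fm_tokens_prefix[of A "[]" B "[]"] by (simp add: fm_code_def tokens_code_inject)

subsection \<open>Recognizing formulas\<close>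

text \<open>
  The stack of the recognizer lists what is still to be read: \<open>0\<close> stands for a variable index,
  \<open>1\<close> for a term and \<open>2\<close> for a formula; \<open>3\<close> is the failure state.
\<close>

definition expand :: "nat \<Rightarrow> nat \<Rightarrow> nat list" where
  "expand k c = (if k = 0 then []
     else if k = 1 then
       (if c = 0 then [0] else if c = 1 then [] else if c = 2 \<or> c = 5 \<or> c = 6 then [1]
        else if c = 3 \<or> c = 4 \<or> c = 7 then [1, 1] else [3])
     else if k = 2 then
       (if c = 8 \<or> c = 9 then [1, 1] else if c = 10 then [2] else if c = 11 \<or> c = 12 \<or> c = 13 then [2, 2]
        else if c = 14 \<or> c = 15 then [0, 2] else [3])
     else [3])"

definition recog :: "nat list \<Rightarrow> nat \<Rightarrow> nat list" where
  "recog ks c = (if ks = [] then [3] else expand (hdd 3 ks) c @ tl ks)"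

definition kind :: "nat \<Rightarrow> nat list \<Rightarrow> bool" where
  "kind k l \<longleftrightarrow> k = 0 \<and> (\<exists>c. l = [c]) \<or> k = 1 \<and> (\<exists>t. l = tm_tokens t) \<or> k = 2 \<and> (\<exists>A. l = fm_tokens A)"

fun kinds :: "nat list \<Rightarrow> nat list \<Rightarrow> bool" where
  "kinds [] l = (l = [])"
| "kinds (k # ks) l = (\<exists>a b. l = a @ b \<and> kind k a \<and> kinds ks b)"

lemma kind_Nil [simp]: "\<not> kind k []"
proof -
  have "[] \<noteq> tm_tokens t" for t by (cases t) auto
  moreover have "[] \<noteq> fm_tokens A" for A by (cases A) auto
  ultimately show ?thesis unfolding kind_def by blast
qed

lemma kind_3 [simp]: "\<not> kind 3 l"
  by (simp add: kind_def)

lemma kinds_append: "kinds (ks @ ls) l \<longleftrightarrow> (\<exists>a b. l = a @ b \<and> kinds ks a \<and> kinds ls b)"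
proof (induction ks arbitrary: l)
  case (Cons k ks)
  then show ?case by simp (metis append.assoc)
qed simp

lemma kinds_single [simp]: "kinds [k] l = kind k l" by auto

lemma ex_trm: "(\<exists>t :: trm. P t) \<longleftrightarrow> (\<exists>i. P (Var i)) \<or> P Zero \<or> (\<exists>t. P (Sc t)) \<or> (\<exists>s t. P (Add s t)) \<or>
    (\<exists>s t. P (Mul s t)) \<or> (\<exists>t. P (Len t)) \<or> (\<exists>t. P (Half t)) \<or> (\<exists>s t. P (Smash s t))"
  by (rule iffI, erule exE, rename_tac t, case_tac t) blast+

lemma ex_fm: "(\<exists>A :: fm. P A) \<longleftrightarrow> (\<exists>s t. P (Eq s t)) \<or> (\<exists>s t. P (Le s t)) \<or> (\<exists>A. P (Neg A)) \<or> (\<exists>A B. P (And A B)) \<or>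
    (\<exists>A B. P (Or A B)) \<or> (\<exists>A B. P (Imp A B)) \<or> (\<exists>x A. P (All x A)) \<or> (\<exists>x A. P (Ex x A))"
  by (rule iffI, erule exE, rename_tac A, case_tac A) blast+

lemma kind_Cons: "kind k (c # l) \<longleftrightarrow> kinds (expand k c) l"
proof -
  consider "k = 0" | "k = 1" | "k = 2" | "3 \<le> k" by linarith
  then show ?thesis
  proof cases
    case 1
    then show ?thesis by (auto simp: kind_def expand_def)
  next
    case 2
    have "(\<exists>t. c # l = tm_tokens t) \<longleftrightarrow> kinds (expand 1 c) l"
      by (subst ex_trm) (auto simp: expand_def kind_def)
    then show ?thesis using 2 by (simp add: kind_def)
  next
    case 3
    have z: "(\<exists>a b. x # m = a @ b \<and> (\<exists>c. a = [c]) \<and> Q b) \<longleftrightarrow> Q m" for x :: nat and m Q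
    proof
      assume "Q m"
      then have "x # m = [x] @ m \<and> (\<exists>c. [x] = [c]) \<and> Q m" by simp
      then show "\<exists>a b. x # m = a @ b \<and> (\<exists>c. a = [c]) \<and> Q b" by blast
    qed auto
    have "(\<exists>A. c # l = fm_tokens A) \<longleftrightarrow> kinds (expand 2 c) l"
      by (subst ex_fm) (auto simp: expand_def kind_def z)
    then show ?thesis using 3 by (simp add: kind_def)
  next
    case 4
    then show ?thesis by (auto simp: kind_def expand_def)
  qed
qed

lemma kinds_recog: "foldl recog ks l = [] \<longleftrightarrow> kinds ks l"
proof (induction l arbitrary: ks)
  case Nil
  then show ?case by (cases ks) auto
next
  case (Cons c l)
  show ?case
  proof (cases ks)
    case Nil
    then show ?thesis using Cons[of "[3]"] by (simp add: recog_def)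
  next
    case (Cons k ks')
    have "kinds (k # ks') (c # l) \<longleftrightarrow> (\<exists>a b. l = a @ b \<and> kind k (c # a) \<and> kinds ks' b)"
      by (simp add: Cons_eq_append_conv) (metis kind_Nil)
    then show ?thesis using Cons.IH[of "recog ks c"] Cons by (simp add: recog_def kinds_append kind_Cons)
  qed
qed

definition fm_ok :: "nat list \<Rightarrow> bool" where
  "fm_ok l \<longleftrightarrow> foldl recog [2] l = []"

lemma fm_ok_iff: "fm_ok l \<longleftrightarrow> (\<exists>A. l = fm_tokens A)"
  unfolding fm_ok_def kinds_recog kinds_single by (simp add: kind_def)

lemma fp_fm_ok [fp_intro]:
  assumes "fp l"
  shows "fp (\<lambda>x. fm_ok (l x))"
proof -
  have m: "\<forall>k\<in>set (foldl recog ks l). k \<le> 3" "length (foldl recog ks l) \<le> length ks + 2 * length l"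
    if "\<forall>k\<in>set ks. k \<le> 3" for ks l
  proof -
    have "(\<forall>k\<in>set (foldl recog ks l). k \<le> 3) \<and> length (foldl recog ks l) \<le> length ks + 2 * length l"
      using that
    proof (induction l arbitrary: ks)
      case (Cons c l)
      have s: "set (expand k c) \<subseteq> {0, 1, 2, 3}" "length (expand k c) \<le> 2" for k by (auto simp: expand_def)
      have "\<forall>k\<in>set (recog ks c). k \<le> 3"
        using Cons.prems s(1) by (cases ks) (fastforce simp: recog_def)+
      moreover have "length (recog ks c) \<le> length ks + 2"
        using s(2) by (cases ks) (auto simp: recog_def le_SucI)
      ultimately show ?case using Cons.IH[of "recog ks c"] by fastforce
    qed simp
    then show "\<forall>k\<in>set (foldl recog ks l). k \<le> 3" "length (foldl recog ks l) \<le> length ks + 2 * length l" by auto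
  qed
  have b3: "sz (k :: nat) \<le> 13" if "k \<le> 3" for k
  proof -
    have "blen k \<le> 3" using blen_le[of k] that by simp
    then show ?thesis using sz_nat_le[of k] by simp
  qed
  have "fp (\<lambda>x. foldl recog [2] (l x))"
  proof (rule fp_foldl)
    show "fp (\<lambda>p :: 'a \<times> nat list \<times> nat. recog (fst (snd p)) (snd (snd p)))"
      unfolding recog_def expand_def by (intro fp_intro fp_eq)
    \<comment> \<open>Each token removes one stack entry and adds at most two; entries are at most
      \<open>3\<close>, hence of size at most 13.\<close>
    show "pb (\<lambda>x. Suc ((1 + 2 * sz (l x)) * Suc 13))" by (intro fp_intro pb_sz assms)
    fix x ys zs assume e: "l x = ys @ zs"
    have "sz (foldl recog [2] ys) \<le> Suc (length (foldl recog [2] ys) * Suc 13)"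
      using m(1)[of "[2]" ys] b3 by (intro sz_list_bound) auto
    also have "\<dots> \<le> Suc ((1 + 2 * sz (l x)) * Suc 13)"
    proof -
      have "length ys \<le> sz (l x)" using length_le_sz[of "l x"] e by simp
      then have "length (foldl recog [2] ys) \<le> 1 + 2 * sz (l x)" using m(2)[of "[2]" ys] by simp
      then show ?thesis by (intro Suc_le_mono[THEN iffD2] mult_le_mono1)
    qed
    finally show "sz (foldl recog [2] ys) \<le> Suc ((1 + 2 * sz (l x)) * Suc 13)" .
  qed (intro fp_intro assms)+
  then show ?thesis unfolding fm_ok_def by (intro fp_null)
qed

text \<open>No parse tree is ever computed: only the tokens of the result matter, and these are the
  given list itself or, by default, those of \<open>Eq Zero Zero\<close>.\<close>

definition fm_of :: "nat list \<Rightarrow> fm" where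
  "fm_of l = (if fm_ok l then SOME A. l = fm_tokens A else Eq Zero Zero)"

lemma fm_of_tokens [simp]: "fm_of (fm_tokens A) = A"
proof -
  have "fm_tokens A = fm_tokens B \<longleftrightarrow> A = B" for B using fm_tokens_prefix[of A "[]" B "[]"] by simp
  then have "(SOME B. fm_tokens A = fm_tokens B) = A" by simp
  then show ?thesis by (auto simp: fm_of_def fm_ok_iff)
qed

lemma tokens_fm_of: "fm_tokens (fm_of l) = (if fm_ok l then l else [8, 1, 1])"
proof (cases "fm_ok l")
  case True
  then obtain A where "l = fm_tokens A" using fm_ok_iff by blast
  then show ?thesis using True by simp
qed (simp add: fm_of_def)

subsection \<open>Functions with syntactic values\<close>

text \<open>Terms and formulas have no encoding of their own. They occur only as results, for which
  the token lists suffice; arguments are given as token lists from the start.\<close>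

definition fpt :: "('a::enc \<Rightarrow> trm) \<Rightarrow> bool" where "fpt F \<longleftrightarrow> fp (\<lambda>x. tm_tokens (F x))"
definition fpf :: "('a::enc \<Rightarrow> fm) \<Rightarrow> bool" where "fpf F \<longleftrightarrow> fp (\<lambda>x. fm_tokens (F x))"

named_theorems fpf_intro

lemma fpt_intros [fpf_intro]:
  "fp f \<Longrightarrow> fpt (\<lambda>x. Var (f x))" "fpt (\<lambda>_. t)" "fpt F \<Longrightarrow> fpt (\<lambda>x. Sc (F x))" "fpt F \<Longrightarrow> fpt (\<lambda>x. Len (F x))"
  "fpt F \<Longrightarrow> fpt (\<lambda>x. Half (F x))" "fpt F \<Longrightarrow> fpt G \<Longrightarrow> fpt (\<lambda>x. Add (F x) (G x))"
  "fpt F \<Longrightarrow> fpt G \<Longrightarrow> fpt (\<lambda>x. Mul (F x) (G x))" "fpt F \<Longrightarrow> fpt G \<Longrightarrow> fpt (\<lambda>x. Smash (F x) (G x))"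
  unfolding fpt_def tm_tokens.simps by (intro fp_intro; assumption)+

lemma fpf_intros [fpf_intro]:
  "fpt s \<Longrightarrow> fpt t \<Longrightarrow> fpf (\<lambda>x. Eq (s x) (t x))" "fpt s \<Longrightarrow> fpt t \<Longrightarrow> fpf (\<lambda>x. Le (s x) (t x))"
  "fpf (\<lambda>_. A)" "fpf F \<Longrightarrow> fpf (\<lambda>x. Neg (F x))" "fpf F \<Longrightarrow> fpf G \<Longrightarrow> fpf (\<lambda>x. And (F x) (G x))"
  "fpf F \<Longrightarrow> fpf G \<Longrightarrow> fpf (\<lambda>x. Or (F x) (G x))" "fpf F \<Longrightarrow> fpf G \<Longrightarrow> fpf (\<lambda>x. Imp (F x) (G x))"
  "fp f \<Longrightarrow> fpf F \<Longrightarrow> fpf (\<lambda>x. All (f x) (F x))" "fp f \<Longrightarrow> fpf F \<Longrightarrow> fpf (\<lambda>x. Ex (f x) (F x))"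
  unfolding fpf_def fpt_def fm_tokens.simps by (intro fp_intro; assumption)+

lemma fpf_if [fpf_intro]: "fp P \<Longrightarrow> fpf F \<Longrightarrow> fpf G \<Longrightarrow> fpf (\<lambda>x. if P x then F x else G x)"
  unfolding fpf_def if_distrib[of fm_tokens] by (rule fp_if)

lemma fpf_fm_of [fpf_intro]: "fp l \<Longrightarrow> fpf (\<lambda>x. fm_of (l x))"
  unfolding fpf_def tokens_fm_of by (intro fp_intro)

lemma tokens_numeral: "tm_tokens (numeral_tm n) =
  concat (map (\<lambda>b. if b then [2, 4, 2, 2, 1] else [4, 2, 2, 1]) (bits n)) @ [1]"
proof (induction n rule: less_induct)
  case (less n)
  show ?case
  proof (cases "n = 0")
    case True
    then show ?thesis by (simp add: numeral_tm.simps)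
  next
    case False
    then show ?thesis using less[of "n div 2"] by (subst numeral_tm.simps) (simp add: bits_rec)
  qed
qed

lemma fpt_numeral [fpf_intro]: "fp f \<Longrightarrow> fpt (\<lambda>x. numeral_tm (f x))"
  unfolding fpt_def tokens_numeral by (intro fp_append fp_concat_map fp_if fp_bits fp_snd fp_id fp_const)

lemma fpt_subst [fpf_intro]: "fpt r \<Longrightarrow> fpt (\<lambda>x. tm_subst y (r x) s)"
proof (induction s)
  case (Var i)
  then show ?case by (cases "i = y") (simp_all add: fpf_intro)
qed (auto intro: fpf_intro)

lemma fpf_subst [fpf_intro]: "fpt r \<Longrightarrow> fpf (\<lambda>x. subst y (r x) A)"
proof (induction A)
  case (All z A)
  then show ?case by (cases "z = y") (auto intro!: fpf_intro fp_const)
next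
  case (Ex z A)
  then show ?case by (cases "z = y") (auto intro!: fpf_intro fp_const)
qed (auto intro!: fpf_intro)

text \<open>\<open>poly_tm\<close> for a list of coefficients, which in contrast to a polynomial can
  be read from an index, even if it is not a normalized list.\<close>

definition list_tm :: "nat list \<Rightarrow> trm \<Rightarrow> trm" where
  "list_tm cs t = foldr (\<lambda>c s. Add (numeral_tm c) (Mul t s)) cs Zero"

lemma tokens_list_tm: "tm_tokens (list_tm cs t) =
  concat (map (\<lambda>c. [3] @ tm_tokens (numeral_tm c) @ [4] @ tm_tokens t) cs) @ [1]"
  by (induction cs) (auto simp: list_tm_def)

lemma fpt_list_tm [fpf_intro]:
  assumes "fp f"
  shows "fpt (\<lambda>x. list_tm (f x) t)"
proof -
  have "fp (\<lambda>p. tm_tokens (numeral_tm (snd p)))" by (rule fpt_numeral[unfolded fpt_def]) (intro fp_intro)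
  then show ?thesis unfolding fpt_def tokens_list_tm
    by (intro fp_append fp_concat_map fp_const assms)
qed

lemma poly_tm_list: "poly_tm p t = list_tm (coeffs p) t"
  by (simp add: poly_tm_def list_tm_def)

definition peval :: "nat list \<Rightarrow> nat \<Rightarrow> nat" where
  "peval cs n = foldl (\<lambda>s c. c + n * s) 0 (rev cs)"

lemma peval_foldr: "peval cs n = foldr (\<lambda>c s. c + n * s) cs 0"
  by (simp add: peval_def foldl_conv_foldr)

lemma peval_coeffs: "peval (coeffs p) n = poly p n"
  by (induction p) (auto simp: peval_foldr cCons_def)

lemma tm_val_list_tm [simp]: "tm_val v (list_tm cs t) = peval cs (tm_val v t)"
  by (induction cs) (auto simp: list_tm_def peval_foldr)

lemma peval_mono: "m \<le> n \<Longrightarrow> peval cs m \<le> peval cs n"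
  by (induction cs) (auto simp: peval_foldr intro: mult_le_mono)

text \<open>The coefficient list is an argument, so the degree is not fixed; still, the length of
  the value grows only by an additive amount with each coefficient.\<close>

lemma fp_peval [fp_intro]:
  assumes "fp l" "fp f"
  shows "fp (\<lambda>x. peval (l x) (f x))"
proof -
  have b: "blen (foldl (\<lambda>s c. c + n * s) s ys) \<le> blen s + length ys * Suc (B + blen n)"
    if "\<forall>c\<in>set ys. blen c \<le> B" for n s ys B
    using that
  proof (induction ys arbitrary: s)
    case (Cons c ys)
    have "blen (c + n * s) \<le> Suc (blen c + (blen n + blen s))"
      using blen_add[of c "n * s"] blen_mult[of n s] by simp
    then show ?case using Cons.IH[of "c + n * s"] Cons.prems by (auto intro: order_trans)
  qed simp
  show ?thesis unfolding peval_def
  proof (rule fp_foldl)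
    show "fp (\<lambda>p. snd (snd p) + f (fst p) * fst (snd p))" by (intro fp_add fp_mult fp_comp[OF assms(2)] fp_intro)
    show "pb (\<lambda>x. Suc (4 * (sz (l x) * Suc (sz (l x) + sz (f x)))))" by (intro fp_intro pb_sz assms)
    fix x ys zs assume e: "rev (l x) = ys @ zs"
    have "\<forall>c\<in>set ys. blen c \<le> sz (l x)"
    proof
      fix c assume "c \<in> set ys"
      then have "c \<in> set (l x)" using e by (metis Un_iff set_append set_rev)
      then show "blen c \<le> sz (l x)" using blen_le_sz[of c] sz_mem by (meson order_trans)
    qed
    from b[OF this, of "f x" 0] have "blen (foldl (\<lambda>s c. c + f x * s) 0 ys) \<le> length ys * Suc (sz (l x) + blen (f x))" by simp
    also have "\<dots> \<le> sz (l x) * Suc (sz (l x) + sz (f x))"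
    proof (rule mult_le_mono)
      show "length ys \<le> sz (l x)" using length_le_sz[of "l x"] arg_cong[OF e, of length] by simp
      show "Suc (sz (l x) + blen (f x)) \<le> Suc (sz (l x) + sz (f x))" using blen_le_sz[of "f x"] by simp
    qed
    finally show "sz (foldl (\<lambda>s c. c + f x * s) 0 ys) \<le> Suc (4 * (sz (l x) * Suc (sz (l x) + sz (f x))))"
      using sz_nat_le[of "foldl (\<lambda>s c. c + f x * s) 0 ys"] by simp
  qed (intro fp_intro assms)+
qed

subsection \<open>Axiom sets enumerated in polynomial time\<close>

text \<open>An automaton for \<open>token_bits\<close>: in state \<open>0\<close> a marker is
  expected, in state \<open>1\<close> a digit, and state \<open>2\<close> means that the token is
  complete.\<close>

definition rt_step :: "nat \<times> bool list \<Rightarrow> bool \<Rightarrow> nat \<times> bool list" where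
  "rt_step s b = (if fst s = 0 then (if b then (1, snd s) else (2, snd s))
     else if fst s = 1 then (0, snd s @ [b]) else s)"

lemma rt_step_token: "snd (foldl rt_step (0, []) (token_bits n @ w)) = bits n"
proof -
  have 1: "foldl rt_step (0, a) (concat (map (\<lambda>b. [True, b]) u)) = (0, a @ u)" for a u
    by (induction u arbitrary: a) (auto simp: rt_step_def)
  have 2: "foldl rt_step (2, a) u = (2, a)" for a u by (induction u) (auto simp: rt_step_def)
  show ?thesis by (simp add: token_bits_def 1 rt_step_def 2)
qed

lemma fp_rt:
  assumes "fp w"
  shows "fp (\<lambda>x. snd (foldl rt_step (0, []) (w x)))"
proof -
  have b: "fst (foldl rt_step s ys) \<le> fst s + 2 \<and> length (snd (foldl rt_step s ys)) \<le> length (snd s) + length ys"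
    if "fst s \<le> 2" for s ys using that
  proof -
    have "fst (foldl rt_step s ys) \<le> 2 \<and> length (snd (foldl rt_step s ys)) \<le> length (snd s) + length ys"
      using that
    proof (induction ys arbitrary: s)
      case (Cons b ys)
      have "fst (rt_step s b) \<le> 2" "length (snd (rt_step s b)) \<le> Suc (length (snd s))"
        using Cons.prems by (auto simp: rt_step_def)
      then show ?case using Cons.IH[of "rt_step s b"] by fastforce
    qed simp
    then show ?thesis by auto
  qed
  have "fp (\<lambda>x. foldl rt_step (0, []) (w x))"
  proof (rule fp_foldl)
    show "fp (\<lambda>p :: 'a \<times> (nat \<times> bool list) \<times> bool. rt_step (fst (snd p)) (snd (snd p)))"
      unfolding rt_step_def by (intro fp_intro fp_eq)
    show "pb (\<lambda>x. 20 + 4 * sz (w x))" by (intro fp_intro pb_sz assms)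
    fix x ys zs assume e: "w x = ys @ zs"
    let ?s = "foldl rt_step (0, []) ys"
    have l: "length ys \<le> sz (w x)" using length_le_sz[of "w x"] e by simp
    have s: "fst ?s \<le> 2" "length (snd ?s) \<le> length ys" using b[of "(0, [])" ys] by auto
    have "sz (fst ?s) \<le> 9" using sz_nat_le[of "fst ?s"] blen_le[of "fst ?s"] s(1) by simp
    moreover have "sz (snd ?s) \<le> Suc (4 * sz (w x))" using sz_bools[of "snd ?s"] s(2) l by simp
    moreover have "sz ?s = Suc (sz (fst ?s) + sz (snd ?s))" by (cases ?s) simp
    ultimately show "sz ?s \<le> 20 + 4 * sz (w x)" by simp
  qed (intro fp_intro assms)+
  then show ?thesis by (rule fp_snd)
qed

text \<open>The conjunct \<open>Eq (Var c) (Var c)\<close> makes the index readable from the axiom (Craig's trick).\<close>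

lemma decidable_axioms:
  assumes F: "fpf F" and A: "finite A"
  shows "poly_time_decidable (fm_code ` (A \<union> range (\<lambda>c. And (Eq (Var c) (Var c)) (F c))))"
proof -
  let ?F = "\<lambda>c. And (Eq (Var c) (Var c)) (F c)"
  \<comment> \<open>The tokens of \<open>And\<close>, \<open>Eq\<close> and \<open>Var\<close>; the
    index is the next one.\<close>
  let ?pre = "concat (map token_bits [11, 8, 0])"
  define g where "g n = num (snd (foldl rt_step (0, []) (drop (length ?pre) (bits n))))" for n
  have g: "g (fm_code (?F c)) = c" for c
  proof -
    have "bits (fm_code (?F c)) = ?pre @ token_bits c @ (concat (map token_bits ([0, c] @ fm_tokens (F c))) @ [True])"
      unfolding fm_code_def bits_tokens_code by simp
    then have "drop (length ?pre) (bits (fm_code (?F c))) =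
        token_bits c @ (concat (map token_bits ([0, c] @ fm_tokens (F c))) @ [True])"
      by (simp only: append_eq_conv_conj drop_append append_take_drop_id) simp
    then show ?thesis unfolding g_def by (simp only: rt_step_token num_bits)
  qed
  have fg: "fp g" unfolding g_def by (intro fp_num fp_rt fp_drop fp_bits fp_const fp_id)
  have "fpf ?F" by (intro fpf_intro fp_id F)
  then have "fp (\<lambda>c. fm_code (?F c))" unfolding fpf_def fm_code_def by (rule fp_tokens_code)
  \<comment> \<open>Membership is decided by extracting an index and comparing the axiom of that
    index with the input.\<close>
  then have "fp (\<lambda>n. if n \<in> fm_code ` A \<or> fm_code (?F (g n)) = n then 1 else 0 :: nat)"
    using fg by (intro fp_if fp_disj fp_finite_set fp_eq fp_const fp_id finite_imageI A) (rule fp_comp)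
  moreover have "(n \<in> fm_code ` A \<or> fm_code (?F (g n)) = n) \<longleftrightarrow> n \<in> fm_code ` (A \<union> range ?F)" for n
  proof
    assume "n \<in> fm_code ` A \<or> fm_code (?F (g n)) = n"
    then show "n \<in> fm_code ` (A \<union> range ?F)"
    proof
      assume "n \<in> fm_code ` A"
      then show ?thesis by (simp add: image_Un)
    next
      assume "fm_code (?F (g n)) = n"
      then show ?thesis by (intro image_eqI[of _ _ "?F (g n)"] UnI2 rangeI) (rule sym)
    qed
  qed (use g in auto)
  ultimately show ?thesis unfolding poly_time_decidable_def by (intro poly_time_of_fp) simp
qed

section \<open>Truth of the axioms\<close>

lemma blen_pow2 [simp]: "blen (2 ^ k) = Suc k"
  by (induction k) (simp_all add: blen_rec)

lemma blen_1 [simp]: "blen (Suc 0) = Suc 0"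
  by (simp add: blen_rec)

lemma BASIC_holds:
  assumes "A \<in> BASIC"
  shows "holds v A"
proof -
  have 2: "0 < a \<Longrightarrow> blen (a + a) = Suc (blen a)" "blen (Suc (a + a)) = Suc (blen a)" for a
    using blen_double[of a] by (simp_all add: mult_2)
  have "\<forall>A\<in>BASIC. holds v A"
    unfolding BASIC_def Let_def ball_simps holds.simps tm_val.simps numeral_2_eq_2[symmetric] One_nat_def[symmetric]
    by (intro conjI impI;
      (simp add: 2 power_add power_mult_distrib mult.commute add_mult_distrib add_mult_distrib2 blen_mono
        blen_rec[symmetric] mult_2 | linarith | presburger)+)
  then show ?thesis using assms by blast
qed

lemma LIND_holds: "holds v (LIND x A)"
proof -
  have s: "holds v (subst x Zero A) = holds (v(x := 0)) A"
    "holds v (subst x (Sc (Var x)) A) = holds (v(x := Suc (v x))) A"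
    "holds v (subst x (Len (Var x)) A) = holds (v(x := blen (v x))) A" for v
    by (subst holds_subst; simp add: free_for_self)+
  have "holds (v(x := n)) A"
    if "holds (v(x := 0)) A" "\<And>n. holds (v(x := n)) A \<Longrightarrow> holds (v(x := Suc n)) A" for n
  proof (induction n)
    case 0
    show ?case by (rule that(1))
  next
    case (Suc n)
    then show ?case by (rule that(2))
  qed
  then show ?thesis by (simp add: LIND_def s)
qed

lemma S12_sound: "S12 \<turnstile> A \<Longrightarrow> holds v A"
  by (rule soundness) (auto simp: S12_def BASIC_holds LIND_holds)

lemma finite_BASIC: "finite BASIC"
  by (simp add: BASIC_def Let_def)

section \<open>Reflection axioms and the theory built from them\<close>

section \<open>Reflection axioms\<close>

text \<open>The tree witness is replaced by a word of a length that depends on the arguments only: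
  its code is padded, and \<open>dec\<close> ignores the padding.\<close>

lemma SAT_translation:
  assumes "Sigma1b A"
  shows "\<exists>\<sigma>. fp \<sigma> \<and> (\<forall>e x z. \<sigma> (e, x, z) \<in> SAT \<longleftrightarrow> holds (env [(0, e), (1, x), (2, z)]) A)"
proof -
  obtain C k where C: "fp C" "\<And>al w. C (al, w) \<Longrightarrow> holds (env al) A"
    "\<And>al. holds (env al) A \<Longrightarrow> \<exists>w. tsz w \<le> (sz al + 2) ^ k \<and> C (al, w)"
    using nppE[OF npp_Sigma1b(1)[OF assms]] by metis
  define al where "al t = [(0::nat, tonat (lsub t)), (1, tonat (lsub (rsub t))), (2, tonat (rsub (rsub t)))]" for t
  have fal: "fp al" unfolding al_def by (intro fp_intro)
  have al: "al (enc (e, x, z)) = [(0, e), (1, x), (2, z)]" for e x z :: nat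
    by (simp add: al_def enc_prod_def del: tonat.simps)
  have "fp (\<lambda>p. C (al (fst p), dec (snd p)))" by (intro fp_comp[OF C(1)] fp_Pair fp_comp[OF fal] fp_intro)
  from SAT_hard[OF this] obtain F where F: "fp F"
    "\<And>t (l :: unit list). F (t, l) \<in> SAT \<longleftrightarrow> (\<exists>\<beta>. length \<beta> = length l \<and> C (al t, dec \<beta>))" by auto
  have "fp (\<lambda>t. tcode (enc (al t)) @ [True, True])" by (intro fp_intro fp_comp[OF fal])
  from fp_unary_power[OF this, of k] obtain l where l: "fp l"
    "\<And>t. length (l t :: unit list) = length (tcode (enc (al t)) @ [True, True]) ^ k" by blast
  have ll: "length (l t) = (sz (al t) + 2) ^ k" for t by (simp add: l(2) sz_def tsz_def)
  have main: "F (t, l t) \<in> SAT \<longleftrightarrow> holds (env (al t)) A" for t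
  proof
    assume "holds (env (al t)) A"
    then obtain w where w: "tsz w \<le> (sz (al t) + 2) ^ k" "C (al t, w)" using C(3) by blast
    then have "length (tcode w @ replicate ((sz (al t) + 2) ^ k - tsz w) True) = length (l t)" by (simp add: ll tsz_def)
    then show "F (t, l t) \<in> SAT" unfolding F(2) using w(2) dec_tcode by metis
  qed (use F(2) C(2) in blast)
  show ?thesis
  proof (intro exI[of _ "\<lambda>p. F (enc p, l (enc p))"] conjI allI)
    show "fp (\<lambda>p. F (enc p, l (enc p)))" by (intro fp_comp[OF F(1)] fp_Pair fp_comp[OF l(1)] fp_enc fp_id)
  qed (simp only: main al)
qed

definition pr4 :: "nat \<Rightarrow> nat \<Rightarrow> nat \<Rightarrow> nat \<Rightarrow> nat" where
  "pr4 a b c d = pr2 (pr2 a b) (pr2 c d)"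

definition pr2_tm :: "trm \<Rightarrow> trm \<Rightarrow> trm" where
  "pr2_tm s t = Add (Mul (Add s t) (Add s t)) s"

definition pr4_tm :: trm where
  "pr4_tm = pr2_tm (pr2_tm (Var 0) (Var 3)) (pr2_tm (Var 1) (Var 2))"

lemma tm_val_pr4 [simp]: "tm_val v pr4_tm = pr4 (v 0) (v 3) (v 1) (v 2)"
  by (simp add: pr4_tm_def pr2_tm_def pr4_def pr2_def)

lemma pr2_ge: "a \<le> pr2 a b" "b \<le> pr2 a b"
proof -
  have "a + b \<le> (a + b) * (a + b)" by (cases "a + b") simp_all
  then have "a + b \<le> pr2 a b" unfolding pr2_def by (rule trans_le_add1)
  then show "a \<le> pr2 a b" "b \<le> pr2 a b" by simp_all
qed

lemma pr4_ge: "a \<le> pr4 a b c d" "b \<le> pr4 a b c d" "c \<le> pr4 a b c d" "d \<le> pr4 a b c d"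
  unfolding pr4_def by (blast intro: order_trans[OF pr2_ge(1) pr2_ge(1)] order_trans[OF pr2_ge(2) pr2_ge(1)]
      order_trans[OF pr2_ge(1) pr2_ge(2)] order_trans[OF pr2_ge(2) pr2_ge(2)])+

lemma pr4_inject [simp]: "pr4 a b c d = pr4 a' b' c' d' \<longleftrightarrow> a = a' \<and> b = b' \<and> c = c' \<and> d = d'"
  by (auto simp: pr4_def)

lemma blen_pr2: "blen a \<le> n \<Longrightarrow> blen b \<le> n \<Longrightarrow> blen (pr2 a b) \<le> 3 + 5 * n"
  using blen_add[of "(a + b) * (a + b)" a] blen_mult[of "a + b" "a + b"] blen_add[of a b]
  unfolding pr2_def by simp

text \<open>Nesting the bound for \<open>pr2\<close> gives \<open>3 + 5 * (3 + 5 * n)\<close>; this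
  is the origin of 18 and 25 below.\<close>

lemma blen_pr4:
  assumes "blen a \<le> n" "blen b \<le> n" "blen c \<le> n" "blen d \<le> n"
  shows "blen (pr4 a b c d) \<le> 18 + 25 * n"
  using blen_pr2[OF blen_pr2[OF assms(1,2)] blen_pr2[OF assms(3,4)]] unfolding pr4_def by simp

lemma fp_pr4 [fp_intro]: "fp a \<Longrightarrow> fp b \<Longrightarrow> fp c \<Longrightarrow> fp d \<Longrightarrow> fp (\<lambda>x. pr4 (a x) (b x) (c x) (d x))"
  unfolding pr4_def pr2_def by (intro fp_intro)

text \<open>
  \<open>tuple_fm t D B\<close> says that variable \<open>1\<close> codes numbers \<open>e, u, x, z\<close> such that \<open>u\<close> is a proof, in
  the sense of \<open>B\<close>, of the instance of the universal formula at \<open>e, x, z\<close>. Outside of \<open>B\<close>, it and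
  \<open>RFN\<close> bind the same variables, hence \<open>B\<close> may be an arbitrary formula in the axioms below.
\<close>

definition tuple_fm :: "trm \<Rightarrow> fm \<Rightarrow> fm \<Rightarrow> fm" where
  "tuple_fm t D B = ExLe 4 (Var 1) (And (Eq (Var 4) (Var 1)) (ExLe 0 (Var 4) (ExLe 3 (Var 4) (ExLe 1 (Var 4)
     (ExLe 2 (Var 4) (And (Eq (Var 4) pr4_tm) (ExLe 4 t (And D B))))))))"

definition universal_ax :: "fm \<Rightarrow> trm \<Rightarrow> fm \<Rightarrow> nat \<Rightarrow> nat list \<Rightarrow> fm \<Rightarrow> fm" where
  "universal_ax \<mu> t D e cs B = All 1 (All 2 (Imp (Le (list_tm cs (Len (Var 1))) (Len (Var 2)))
     (Iff (subst 0 (numeral_tm e) \<mu>) (tuple_fm t D B))))"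

lemma fpf_universal_ax [fpf_intro]: "fp e \<Longrightarrow> fp cs \<Longrightarrow> fpf B \<Longrightarrow> fpf (\<lambda>x. universal_ax \<mu> t D (e x) (cs x) (B x))"
  unfolding universal_ax_def tuple_fm_def by (intro fpf_intro fp_const)

lemma fpf_RFN [fpf_intro]: "fpf B \<Longrightarrow> fp n \<Longrightarrow> fpf (\<lambda>x. RFN \<mu> D (B x) (n x))"
  unfolding RFN_def Let_def by (intro fpf_intro fp_const)

text \<open>The term \<open>t\<close> bounds the code of the instance. With it the unbounded
  \<open>Ex vY\<close> of \<open>RFN\<close> can be replaced by a bounded quantifier in
  \<open>tuple_fm\<close>, which has to be \<open>Sigma1b\<close>.\<close>

locale reflection =
  fixes \<mu> D :: fm and t :: trm
  assumes \<mu>: "Sigma1b \<mu>" "free_vars \<mu> \<subseteq> {0, 1, 2}"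
    and D: "Sigma1b D" "free_vars D \<subseteq> {0, 1, 2, 4}" and t: "tm_vars t \<subseteq> {0, 1, 2}"
    and D_bound: "\<And>v. holds v D \<Longrightarrow> v 4 \<le> tm_val v t"
    and D_code: "\<And>v. holds v D \<longleftrightarrow> v 4 = fm_code (numeral_inst \<mu> (v 0) (v 1) (v 2))"
begin

abbreviation "U \<equiv> universal_ax \<mu> t D"

text \<open>Variable \<open>4\<close> first takes over the tuple from variable \<open>1\<close>,
  which is then bound anew, and is finally reused for the code. The quantifier bounds are met by
  \<open>pr4_ge\<close> and \<open>D_bound\<close>.\<close>

lemma holds_tuple_fm: "holds v (tuple_fm t D B) \<longleftrightarrow>
  (\<exists>e u x z y. v 1 = pr4 e u x z \<and> holds (v(0 := e, 3 := u, 1 := x, 2 := z, 4 := y)) D \<and>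
     holds (v(0 := e, 3 := u, 1 := x, 2 := z, 4 := y)) B)"
proof
  assume "holds v (tuple_fm t D B)"
  then show "\<exists>e u x z y. v 1 = pr4 e u x z \<and> holds (v(0 := e, 3 := u, 1 := x, 2 := z, 4 := y)) D \<and>
     holds (v(0 := e, 3 := u, 1 := x, 2 := z, 4 := y)) B"
    by (simp add: tuple_fm_def) blast
next
  assume "\<exists>e u x z y. v 1 = pr4 e u x z \<and> holds (v(0 := e, 3 := u, 1 := x, 2 := z, 4 := y)) D \<and>
     holds (v(0 := e, 3 := u, 1 := x, 2 := z, 4 := y)) B"
  then obtain e u x z y where *: "v 1 = pr4 e u x z" "holds (v(0 := e, 3 := u, 1 := x, 2 := z, 4 := y)) D"
    "holds (v(0 := e, 3 := u, 1 := x, 2 := z, 4 := y)) B" by blast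
  have y: "y \<le> tm_val (v(0 := e, 3 := u, 1 := x, 2 := z, 4 := y)) t" using D_bound[OF *(2)] by simp
  note v1 = *(1)[unfolded One_nat_def]
  have le: "e \<le> v (Suc 0)" "u \<le> v (Suc 0)" "x \<le> v (Suc 0)" "z \<le> v (Suc 0)" unfolding v1 by (rule pr4_ge)+
  have "\<exists>y. y \<le> tm_val (v(0 := e, 3 := u, Suc 0 := x, 2 := z, 4 := y)) t \<and>
      holds (v(0 := e, 3 := u, Suc 0 := x, 2 := z, 4 := y)) D \<and> holds (v(0 := e, 3 := u, Suc 0 := x, 2 := z, 4 := y)) B"
    using *(2,3) y unfolding One_nat_def by blast
  with v1 le have "\<exists>e\<le>v (Suc 0). \<exists>u\<le>v (Suc 0). \<exists>x\<le>v (Suc 0). \<exists>z\<le>v (Suc 0). v (Suc 0) = pr4 e u x z \<and>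
      (\<exists>y. y \<le> tm_val (v(0 := e, 3 := u, Suc 0 := x, 2 := z, 4 := y)) t \<and>
      holds (v(0 := e, 3 := u, Suc 0 := x, 2 := z, 4 := y)) D \<and> holds (v(0 := e, 3 := u, Suc 0 := x, 2 := z, 4 := y)) B)"
    by blast
  then show "holds v (tuple_fm t D B)" by (simp add: tuple_fm_def)
qed

lemma holds_RFN: "holds v (RFN \<mu> D B n) \<longleftrightarrow>
  (\<forall>e u x z. blen e \<le> n \<and> blen u \<le> n \<and> blen x \<le> n \<and> blen z \<le> n \<and>
     (\<exists>y. holds (v(0 := e, 3 := u, 1 := x, 2 := z, 4 := y)) D \<and> holds (v(0 := e, 3 := u, 1 := x, 2 := z, 4 := y)) B) \<longrightarrow>
     holds (v(0 := e, 3 := u, 1 := x, 2 := z)) \<mu>)"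
  by (simp add: RFN_def Let_def)

lemma holds_\<mu>: "v 0 = e \<Longrightarrow> v 1 = x \<Longrightarrow> v 2 = z \<Longrightarrow> holds v \<mu> = holds (env [(0, e), (1, x), (2, z)]) \<mu>"
  by (rule holds_cong) (use \<mu>(2) in auto)

lemma holds_universal_ax: "holds v (U e cs B) \<longleftrightarrow> (\<forall>X Z. peval cs (blen X) \<le> blen Z \<longrightarrow>
   holds (env [(0, e), (1, X), (2, Z)]) \<mu> = holds (v(1 := X, 2 := Z)) (tuple_fm t D B))"
proof -
  have "holds (v(1 := X, 2 := Z)) (subst 0 (numeral_tm e) \<mu>) = holds (env [(0, e), (1, X), (2, Z)]) \<mu>" for X Z
    by (subst holds_subst[OF free_for_self]) (simp, rule holds_\<mu>, simp_all)
  then show ?thesis by (simp add: universal_ax_def) blast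
qed

text \<open>
  The search function \<open>G\<close> reads a tuple \<open>e, u, x, z, Z, b\<close> and outputs the translation of the
  instance of \<open>\<mu>\<close> at \<open>e, x, z\<close> if \<open>b\<close> witnesses the instance of \<open>\<mu>\<close> that asserts its provability.
  Thus all values of \<open>G\<close> are satisfiable iff the reflection principle holds.
\<close>

lemma search:
  "\<exists>G L. fp (G :: tree \<times> bool list \<Rightarrow> nat) \<and> fp (L :: nat \<times> unit list \<times> unit list \<Rightarrow> unit list) \<and>
   (\<forall>e' cs nu mu v B. (\<forall>\<pi>. length \<pi> = length (L (e', nu, mu)) \<longrightarrow> G (enc (e', cs), \<pi>) \<in> SAT) \<longrightarrow>
      peval cs (18 + 25 * length nu) \<le> length mu \<longrightarrow> holds v (U e' cs B) \<longrightarrow> holds v (RFN \<mu> D B (length nu))) \<and>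
   (\<forall>e' cs. (\<forall>e u x z Z. peval cs (blen (pr4 e u x z)) \<le> blen Z \<longrightarrow>
        holds (env [(0, e'), (1, pr4 e u x z), (2, Z)]) \<mu> \<longrightarrow> holds (env [(0, e), (1, x), (2, z)]) \<mu>) \<longrightarrow>
      (\<forall>\<pi>. G (enc (e', cs), \<pi>) \<in> SAT))"
proof -
  obtain C k where C: "fp C" "\<And>al w. C (al, w) \<Longrightarrow> holds (env al) \<mu>"
    "\<And>al. holds (env al) \<mu> \<Longrightarrow> \<exists>w. tsz w \<le> (sz al + 2) ^ k \<and> C (al, w)"
    using nppE[OF npp_Sigma1b(1)[OF \<mu>(1)]] by metis
  obtain \<sigma> where \<sigma>: "fp \<sigma>" "\<And>e x z. \<sigma> (e, x, z) \<in> SAT \<longleftrightarrow> holds (env [(0, e), (1, x), (2, z)]) \<mu>"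
    using SAT_translation[OF \<mu>(1)] by blast
  \<comment> \<open>The output for words that pass no test; it is satisfiable, so such words are
    harmless.\<close>
  define s0 where "s0 = tokens_code (ptokens (PVar 0))"
  have s0: "s0 \<in> SAT" unfolding s0_def SAT_iff by auto
  define te where "te s = tonat (lsub s)" for s
  define tu where "tu s = tonat (lsub (rsub s))" for s
  define tx where "tx s = tonat (lsub (rsub (rsub s)))" for s
  define tz where "tz s = tonat (lsub (rsub (rsub (rsub s))))" for s
  define tZ where "tZ s = tonat (lsub (rsub (rsub (rsub (rsub s)))))" for s
  define tb where "tb s = rsub (rsub (rsub (rsub (rsub s))))" for s
  define tX where "tX s = pr4 (te s) (tu s) (tx s) (tz s)" for s
  have ft: "fp te" "fp tx" "fp tz" "fp tZ" "fp tb" "fp tX"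
    unfolding tX_def te_def tu_def tx_def tz_def tZ_def tb_def by (intro fp_intro)+
  define ok where "ok a s \<longleftrightarrow> peval (map tonat (children (rsub a))) (blen (tX s)) \<le> blen (tZ s) \<and>
     C ([(0, tonat (lsub a)), (1, tX s), (2, tZ s)], tb s)" for a s
  define G where "G p = (if ok (fst p) (dec (snd p)) then \<sigma> (te (dec (snd p)), tx (dec (snd p)), tz (dec (snd p))) else s0)" for p
  have fG: "fp G"
    unfolding G_def ok_def
    by (intro fp_if fp_conj fp_le fp_peval fp_comp[OF \<sigma>(1)] fp_comp[OF C(1)] fp_Pair fp_Cons fp_blen fp_const
        fp_comp[OF ft(1)] fp_comp[OF ft(2)] fp_comp[OF ft(3)] fp_comp[OF ft(4)] fp_comp[OF ft(5)] fp_comp[OF ft(6)])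
      (intro fp_intro)+
  \<comment> \<open>The length exceeds the size of the environment for \<open>\<mu>\<close> by
    enough: a tuple of numbers of length at most \<open>length nu\<close> has size at most
    \<open>73 + 100 * length nu\<close>, and \<open>Z\<close> has size at most
    \<open>5 + 4 * length mu\<close>. The power in \<open>L\<close> leaves room for the
    witness.\<close>
  define W where "W p = tcode (enc (fst p)) @ concat (map (\<lambda>_. replicate 100 True) (fst (snd p))) @
     concat (map (\<lambda>_. replicate 4 True) (snd (snd p))) @ replicate 200 True" for p :: "nat \<times> unit list \<times> unit list"
  have fW: "fp W" unfolding W_def by (intro fp_append fp_tcode fp_enc fp_concat_map fp_const fp_fst fp_snd fp_id)
  have cr: "length (concat (map (\<lambda>_. replicate c True) us)) = c * length us" for c and us :: "unit list"
    by (induction us) auto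
  have lW: "length (W (e', nu, mu)) = 200 + sz e' + 100 * length nu + 4 * length mu" for e' nu mu
    by (simp add: W_def cr sz_def tsz_def)
  obtain Wk where Wk: "fp Wk" "\<And>p. length (Wk p :: unit list) = length (W p) ^ k" using fp_unary_power[OF fW] by blast
  define L where "L p = map (\<lambda>_. ()) (W p) @ Wk p" for p
  have fL: "fp L" unfolding L_def by (intro fp_append fp_map fp_const fW Wk(1))
  have 1: "holds v (RFN \<mu> D B (length nu))"
    if G: "\<And>\<pi>. length \<pi> = length (L (e', nu, mu)) \<Longrightarrow> G (enc (e', cs), \<pi>) \<in> SAT"
      and m: "peval cs (18 + 25 * length nu) \<le> length mu" and h: "holds v (U e' cs B)" for e' cs nu mu v B
    unfolding holds_RFN
  proof (intro allI impI; elim conjE exE)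
    fix e u x z y
    assume b: "blen e \<le> length nu" "blen u \<le> length nu" "blen x \<le> length nu" "blen z \<le> length nu"
      and DB: "holds (v(0 := e, 3 := u, 1 := x, 2 := z, 4 := y)) D" "holds (v(0 := e, 3 := u, 1 := x, 2 := z, 4 := y)) B"
    \<comment> \<open>\<open>Z\<close> is a power of two whose length exceeds
      \<open>length mu\<close>, so it passes the threshold from which universality guarantees the
      equivalence.\<close>
    let ?X = "pr4 e u x z" and ?Z = "2 ^ length mu :: nat"
    let ?al = "[(0 :: nat, e'), (1, ?X), (2, ?Z)]"
    have bX: "blen ?X \<le> 18 + 25 * length nu" by (rule blen_pr4[OF b])
    have le: "peval cs (blen ?X) \<le> blen ?Z" using peval_mono[OF bX, of cs] m by simp
    have "holds (v(1 := ?X, 2 := ?Z)) (tuple_fm t D B)"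
      unfolding holds_tuple_fm
    proof (intro exI conjI)
      show "(v(1 := ?X, 2 := ?Z)) 1 = ?X" by simp
      have "(v(1 := ?X, 2 := ?Z))(0 := e, 3 := u, 1 := x, 2 := z, 4 := y) = v(0 := e, 3 := u, 1 := x, 2 := z, 4 := y)"
        by (simp add: fun_eq_iff)
      then show "holds ((v(1 := ?X, 2 := ?Z))(0 := e, 3 := u, 1 := x, 2 := z, 4 := y)) D"
        "holds ((v(1 := ?X, 2 := ?Z))(0 := e, 3 := u, 1 := x, 2 := z, 4 := y)) B" using DB by (simp_all only:)
    qed
    then have "holds (env ?al) \<mu>" using h le unfolding holds_universal_ax by blast
    then obtain w where w: "tsz w \<le> (sz ?al + 2) ^ k" "C (?al, w)" using C(3) by blast
    have n: "sz (0::nat) \<le> 1" "sz (1::nat) \<le> 5" "sz (2::nat) \<le> 9"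
      using sz_nat_le[of 0] sz_nat_le[of 1] sz_nat_le[of 2] blen_le[of 1] blen_le[of 2] by simp_all
    have sXZ: "sz ?X \<le> 73 + 100 * length nu" "sz ?Z \<le> 5 + 4 * length mu"
      using sz_nat_le[of ?X] bX sz_nat_le[of ?Z] by simp_all
    have "sz ?al + 2 \<le> length (W (e', nu, mu))" using n sXZ by (simp add: lW)
    then have sw: "tsz w \<le> length (W (e', nu, mu)) ^ k" using w(1) power_mono order_trans by blast
    define s where "s = Nd (enc e) (Nd (enc u) (Nd (enc x) (Nd (enc z) (Nd (enc ?Z) w))))"
    have se: "te s = e" "tu s = u" "tx s = x" "tz s = z" "tZ s = ?Z" "tb s = w"
      by (simp_all add: s_def te_def tu_def tx_def tz_def tZ_def tb_def del: tonat.simps)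
    have sn: "sz e \<le> 1 + 4 * length nu" "sz u \<le> 1 + 4 * length nu" "sz x \<le> 1 + 4 * length nu" "sz z \<le> 1 + 4 * length nu"
      using b sz_nat_le[of e] sz_nat_le[of u] sz_nat_le[of x] sz_nat_le[of z] by simp_all
    have "tsz s = 5 + sz e + sz u + sz x + sz z + sz ?Z + tsz w" by (simp add: s_def sz_def)
    also have "\<dots> \<le> length (L (e', nu, mu))" using sn sXZ(2) sw by (simp add: L_def lW Wk(2))
    finally have "length (tcode s) \<le> length (L (e', nu, mu))" by (simp add: tsz_def)
    then have "length (tcode s @ replicate (length (L (e', nu, mu)) - length (tcode s)) True) = length (L (e', nu, mu))" by simp
    from G[OF this] have "\<sigma> (e, x, z) \<in> SAT"
      using le w(2) by (simp add: G_def ok_def se tX_def enc_prod_def o_def del: tonat.simps)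
    then show "holds (v(0 := e, 3 := u, 1 := x, 2 := z)) \<mu>"
      unfolding \<sigma>(2) by (subst holds_\<mu>[where e = e and x = x and z = z]) simp_all
  qed
  have 2: "G (enc (e', cs), \<pi>) \<in> SAT"
    if a: "\<And>e u x z Z. peval cs (blen (pr4 e u x z)) \<le> blen Z \<Longrightarrow>
        holds (env [(0, e'), (1, pr4 e u x z), (2, Z)]) \<mu> \<Longrightarrow> holds (env [(0, e), (1, x), (2, z)]) \<mu>" for e' cs \<pi>
  proof (cases "ok (enc (e', cs)) (dec \<pi>)")
    case True
    let ?s = "dec \<pi>"
    have o: "peval cs (blen (tX ?s)) \<le> blen (tZ ?s)" "C ([(0, e'), (1, tX ?s), (2, tZ ?s)], tb ?s)"
      using True by (simp_all add: ok_def enc_prod_def o_def del: tonat.simps)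
    have "holds (env [(0, te ?s), (1, tx ?s), (2, tz ?s)]) \<mu>"
      using a[OF o(1)[unfolded tX_def]] C(2)[OF o(2)[unfolded tX_def]] by blast
    then show ?thesis using True by (simp add: G_def \<sigma>(2))
  qed (simp add: G_def s0)
  show ?thesis using fG fL 1 2 by blast
qed

end

definition ind_fm :: "tree \<Rightarrow> fm" where
  "ind_fm s = (if fm_ok (map tonat (children (rsub (rsub s)))) \<and>
       (\<forall>k\<in>set (map tonat (children (rsub (rsub s)))). k < tonat (lsub (rsub s))) \<and> tonat (lsub s) < tonat (lsub (rsub s))
     then IND (tonat (lsub s)) (tonat (lsub (rsub s))) (fm_of (map tonat (children (rsub (rsub s)))))
     else Eq Zero Zero)"

lemma fpf_ind_fm [fpf_intro]:
  assumes "fp f"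
  shows "fpf (\<lambda>x. ind_fm (f x))"
proof -
  have "fp (\<lambda>x. map tonat (children (rsub (rsub (f x)))))" by (intro fp_map fp_tonat fp_intro assms)
  then show ?thesis unfolding ind_fm_def IND_def
    by (intro fpf_intro fp_conj fp_fm_ok fp_ball fp_less fp_tonat fp_lsub fp_rsub fp_snd fp_fst fp_id assms fp_comp[OF assms])
qed

lemma holds_ind_fm: "holds v (ind_fm s)"
proof -
  have "y \<notin> free_vars (fm_of l)" if "fm_ok l" "\<forall>k\<in>set l. k < y" for l y
    using that free_vars_tokens[of "fm_of l"] tokens_fm_of[of l] by auto
  then show ?thesis by (auto simp: ind_fm_def intro!: holds_IND)
qed

lemma ind_fm_IND:
  assumes "x < y" "\<forall>k\<in>set (fm_tokens A). k < y"
  shows "ind_fm (enc (x, y, fm_tokens A)) = IND x y A"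
proof -
  have "fm_ok (fm_tokens A)" unfolding fm_ok_iff by blast
  then show ?thesis using assms by (simp add: ind_fm_def enc_prod_def o_def del: tonat.simps)
qed

context reflection
begin

text \<open>One theory serves all \<open>B\<close>, \<open>e\<close> and \<open>p\<close>. The
  second premise is purely semantic: it is what makes all values of the search function satisfiable,
  so that certificates exist and can be constructed.\<close>

lemma reflection_theory:
  assumes P: "p_optimal SAT P" and P': "p_optimal TAUT P'"
  shows "\<exists>T\<in>theories. \<forall>B e p. S12 \<turnstile> U e (coeffs p) B \<longrightarrow>
    (\<forall>e' u x z Z. poly p (blen (pr4 e' u x z)) \<le> blen Z \<longrightarrow> holds (env [(0, e), (1, pr4 e' u x z), (2, Z)]) \<mu> \<longrightarrow>
       holds (env [(0, e'), (1, x), (2, z)]) \<mu>) \<longrightarrow>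
    (\<exists>h. poly_time_in_value h \<and> (\<forall>n. Pr T (h n) (fm_code (RFN \<mu> D B n))))"
proof -
  obtain G L where G: "fp (G :: tree \<times> bool list \<Rightarrow> nat)" and L: "fp (L :: nat \<times> unit list \<times> unit list \<Rightarrow> unit list)"
    and sound: "\<And>e' cs nu mu v B. (\<And>\<pi>. length \<pi> = length (L (e', nu, mu)) \<Longrightarrow> G (enc (e', cs), \<pi>) \<in> SAT) \<Longrightarrow>
      peval cs (18 + 25 * length nu) \<le> length mu \<Longrightarrow> holds v (U e' cs B) \<Longrightarrow> holds v (RFN \<mu> D B (length nu))"
    and complete: "\<And>e' cs. (\<forall>e u x z Z. peval cs (blen (pr4 e u x z)) \<le> blen Z \<longrightarrow>
        holds (env [(0, e'), (1, pr4 e u x z), (2, Z)]) \<mu> \<longrightarrow> holds (env [(0, e), (1, x), (2, z)]) \<mu>) \<Longrightarrow>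
      (\<forall>\<pi>. G (enc (e', cs), \<pi>) \<in> SAT)"
    using search by (elim exE conjE) metis
  obtain Cert :: "tree \<times> tree \<times> unit list \<Rightarrow> bool" where Cert: "fp Cert"
    "\<And>c a u \<pi>. Cert (c, a, u) \<Longrightarrow> length \<pi> = length u \<Longrightarrow> G (a, \<pi>) \<in> SAT"
    "\<And>a. (\<forall>\<pi>. G (a, \<pi>) \<in> SAT) \<Longrightarrow> (\<exists>cf. fp cf \<and> (\<forall>u. Cert (cf u, a, u)))"
    using certification[OF P P' G] by (elim exE conjE) metis
  define nus where "nus s = map (\<lambda>_. ()) (children (lsub (rsub s)))" for s
  define mus where "mus s = map (\<lambda>_. ()) (children (lsub (rsub (rsub s))))" for s
  define toks where "toks s = map tonat (children (rsub (rsub (rsub s))))" for s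
  define ei where "ei s = tonat (lsub (lsub s))" for s
  define cs where "cs s = map tonat (children (rsub (lsub s)))" for s
  have fs: "fp nus" "fp mus" "fp toks" "fp ei" "fp cs"
    unfolding nus_def mus_def toks_def ei_def cs_def by (intro fp_map fp_intro)+
  \<comment> \<open>An index with a failing test gives a trivial equation, so every number is the
    index of a true formula and the set of axioms can be enumerated without gaps.\<close>
  define rf where "rf c s = (if peval (cs s) (18 + 25 * length (nus s)) \<le> length (mus s) \<and>
      Cert (c, enc (ei s, cs s), L (ei s, nus s, mus s))
    then Imp (U (ei s) (cs s) (fm_of (toks s))) (RFN \<mu> D (fm_of (toks s)) (length (nus s))) else Eq Zero Zero)" for c s
  have rf_holds: "holds v (rf c s)" for c s v
    using sound[OF Cert(2)] by (auto simp: rf_def)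
  \<comment> \<open>The left subtree of an index selects the kind of axiom: a leaf stands for
    induction, and an inner node carries the certificate for a reflection axiom.\<close>
  define gf where "gf n = (if lsub (dec (bits n)) = Lf then ind_fm (rsub (dec (bits n)))
     else rf (rsub (lsub (dec (bits n)))) (rsub (dec (bits n))))" for n
  have bn: "dec (bits (num (tcode t @ [True]))) = t" for t by (simp only: bits_num_app dec_tcode)
  have gf_holds: "holds v (gf n)" for v n by (simp add: gf_def holds_ind_fm rf_holds)
  have d: "fp (\<lambda>n. dec (bits n))" "fp (\<lambda>n. rsub (dec (bits n)))" by (intro fp_intro)+
  note fc = fp_comp[OF fs(1) d(2)] fp_comp[OF fs(2) d(2)] fp_comp[OF fs(3) d(2)] fp_comp[OF fs(4) d(2)] fp_comp[OF fs(5) d(2)]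
  have fgf: "fpf gf"
    unfolding gf_def rf_def
    by (intro fpf_if fpf_ind_fm fp_is_Lf fp_lsub fp_rsub d fp_conj fp_le fp_peval fp_length fc fp_comp[OF Cert(1)] fp_Pair
        fp_enc fp_comp[OF L] fpf_intros fpt_intros fpf_universal_ax fpf_RFN fpf_fm_of fp_add fp_mult fp_const)
  define gx where "gx n = And (Eq (Var n) (Var n)) (gf n)" for n
  define T where "T = BASIC \<union> range gx"
  have T_holds: "T \<turnstile> A \<Longrightarrow> holds v A" for A v
    by (rule soundness) (auto simp: T_def gx_def BASIC_holds gf_holds)
  have T_gf: "T \<turnstile> gf n" for n
    by (rule provable_mp[OF provable_ax(1)[OF logical_axiom.intros(4)[of "Eq (Var n) (Var n)"]] provable_ax(2)])
      (simp add: T_def gx_def[symmetric])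
  have T_LIND: "T \<turnstile> LIND x A" for x A
  proof -
    define y where "y = Suc (x + sum_list (fm_tokens A))"
    have lt: "\<forall>k\<in>set (fm_tokens A). k < y" using member_le_sum_list by (fastforce simp: y_def)
    have xy: "x < y" by (simp add: y_def)
    let ?n = "num (tcode (Nd Lf (enc (x, y, fm_tokens A))) @ [True])"
    have "gf ?n = IND x y A" unfolding gf_def bn by (simp add: ind_fm_IND[OF xy lt])
    then show ?thesis using LIND_if_IND[of T x y A] T_gf[of ?n] xy lt by force
  qed
  have T_BASIC: "A \<in> BASIC \<Longrightarrow> T \<turnstile> A" for A by (rule provable_ax(2)) (simp add: T_def)
  have S12_T: "S12 \<turnstile> A \<Longrightarrow> T \<turnstile> A" for A
    by (erule provable_trans) (auto simp: S12_def T_LIND T_BASIC)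
  have "consistent T" unfolding consistent_def using T_holds holds.simps(3) by blast
  moreover have "poly_time_decidable (fm_code ` T)"
    unfolding T_def gx_def by (rule decidable_axioms[OF fgf finite_BASIC])
  ultimately have T: "T \<in> theories" using S12_T by (simp add: theories_def)
  have "\<exists>h. poly_time_in_value h \<and> (\<forall>n. Pr T (h n) (fm_code (RFN \<mu> D B n)))"
    if U: "S12 \<turnstile> U e (coeffs p) B" and good: "\<forall>e' u x z Z. poly p (blen (pr4 e' u x z)) \<le> blen Z \<longrightarrow>
      holds (env [(0, e), (1, pr4 e' u x z), (2, Z)]) \<mu> \<longrightarrow> holds (env [(0, e'), (1, x), (2, z)]) \<mu>" for B e p
  proof -
    \<comment> \<open>This proof does not depend on \<open>n\<close>, so it is a constant of the
      construction.\<close>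
    obtain As where As: "is_proof T As (U e (coeffs p) B)" using S12_T[OF U] unfolding provable_def by blast
    obtain cf where cf: "fp cf" "\<And>u. Cert (cf u, enc (e, coeffs p), u)"
      using Cert(3)[OF complete[of "coeffs p" e]] good by (auto simp: peval_coeffs)
    obtain k where k: "\<And>n. poly p n \<le> (n + 2) ^ k" using poly_le_power by blast
    \<comment> \<open>\<open>25 * length u + 20\<close> is the bound
      \<open>18 + 25 * length u\<close> on tuples plus the two from
      \<open>poly_le_power\<close>.\<close>
    have "fp (\<lambda>u :: unit list. concat (map (\<lambda>_. replicate 25 ()) u) @ replicate 20 ())"
      by (intro fp_append fp_concat_map fp_const fp_id)
    from fp_unary_power[OF this, of k] obtain m where m: "fp m"
      "\<And>u :: unit list. length (m u :: unit list) = length (concat (map (\<lambda>_. replicate 25 ()) u) @ replicate 20 ()) ^ k" by blast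
    have "length (concat (map (\<lambda>_. replicate 25 ()) u)) = 25 * length u" for u :: "unit list" by (induction u) auto
    then have lm: "poly p (18 + 25 * length u) \<le> length (m u)" for u
      using k[of "18 + 25 * length u"] by (simp add: m(2) add.commute)
    define c where "c u = num (tcode (Nd (Nd Lf (cf (L (e, u, m u)))) (Nd (enc (e, coeffs p)) (Nd (enc u)
      (Nd (enc (m u)) (enc (fm_tokens B)))))) @ [True])" for u
    have fcc: "fp c" unfolding c_def
      by (intro fp_num fp_append fp_tcode fp_Nd fp_const fp_comp[OF cf(1)] fp_comp[OF L] fp_Pair m(1) fp_enc fp_id)
    have un: "map (\<lambda>_. ()) u = u" for u :: "unit list" by (induction u) auto
    have gc: "gf (c u) = Imp (U e (coeffs p) B) (RFN \<mu> D B (length u))" for u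
      unfolding gf_def c_def bn
      by (simp add: rf_def ei_def cs_def nus_def mus_def toks_def enc_prod_def o_def un lm peval_coeffs
          cf(2)[unfolded enc_prod_def fst_conv snd_conv] del: tonat.simps)
    \<comment> \<open>The proof of the premise is followed by the axiom, the logical axiom that
      projects out its second conjunct, the implication, and its conclusion.\<close>
    define Bs where "Bs u = As @ [gx (c u), Imp (gx (c u)) (gf (c u)), gf (c u), RFN \<mu> D B (length u)]" for u
    have pr: "is_proof T (Bs u) (RFN \<mu> D B (length u))" for u
    proof -
      have "lines T As" "U e (coeffs p) B \<in> set As" using As last_in_set[of As] by (auto simp: is_proof_lines)
      then have "lines T ((((As @ [gx (c u)]) @ [Imp (gx (c u)) (gf (c u))]) @ [gf (c u)]) @ [RFN \<mu> D B (length u)])"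
        by (intro lines_snoc) (auto simp: gc T_def gx_def intro: logical_axiom.intros)
      then show ?thesis by (simp add: is_proof_lines Bs_def)
    qed
    have fg: "fpf (\<lambda>u. gf (c u))" unfolding fpf_def by (rule fp_comp[OF fgf[unfolded fpf_def] fcc])
    have fx: "fpf (\<lambda>u. gx (c u))" unfolding gx_def by (intro fpf_intro fcc fg)
    have fl: "fpf (\<lambda>u :: unit list. RFN \<mu> D B (length u))" by (intro fpf_intro fp_length fp_id)
    have "fp (\<lambda>u. proof_code (Bs u))"
      unfolding proof_code_def Bs_def map_append concat_append list.map concat.simps fm_tokens.simps
      by (intro fp_tokens_code fp_append fp_Cons fp_const fg[unfolded fpf_def] fx[unfolded fpf_def] fl[unfolded fpf_def])
    from poly_time_in_value_of_fp[OF this]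
    have "poly_time_in_value (\<lambda>n. proof_code (Bs (replicate n ())))" .
    moreover have "Pr T (proof_code (Bs (replicate n ()))) (fm_code (RFN \<mu> D B n))" for n
      using pr[of "replicate n ()"] unfolding Pr_def by force
    ultimately show ?thesis by blast
  qed
  then show ?thesis using T by blast
qed

end

theorem theorem3p5:
  fixes \<mu> D :: fm and B :: "fm set \<Rightarrow> fm"
  assumes "universal_Sigma1b \<mu>"
    and "defines_dot_code \<mu> D"
    and "\<And>S. S \<in> theories \<Longrightarrow> defines_Pr S (B S)"
  shows "\<not> (\<exists>P. p_optimal SAT P) \<or>
         \<not> (\<exists>P. p_optimal TAUT P) \<or>
         (\<exists>T \<in> theories. \<forall>S \<in> theories. \<exists>h. poly_time_in_value h \<and>
            (\<forall>n. Pr T (h n) (fm_code (RFN \<mu> D (B S) n))))"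
proof -
  obtain t where t: "tm_vars t \<subseteq> {0, 1, 2}" "S12 \<turnstile> ExLe 5 t (All 4 (Iff D (Eq (Var 4) (Var 5))))"
    using assms(2) unfolding defines_dot_code_def by blast
  \<comment> \<open>Since \<open>S12\<close> is sound, the provable bound on the value of the
    function defined by \<open>D\<close> is true in the standard model.\<close>
  have bound: "v 4 \<le> tm_val v t" if "holds v D" for v
  proof -
    obtain a where a: "a \<le> tm_val (v(5 := a)) t" "\<forall>y. holds (v(5 := a, 4 := y)) D \<longleftrightarrow> y = a"
      using S12_sound[OF t(2), of v] by auto
    have "holds (v(5 := a, 4 := v 4)) D = holds v D"
      by (rule holds_cong) (use assms(2) in \<open>auto simp: defines_dot_code_def\<close>)
    then have "v 4 = a" using a(2) that by blast
    moreover have "tm_val (v(5 := a)) t = tm_val v t" using t(1) by (intro tm_val_upd) auto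
    ultimately show ?thesis using a(1) by simp
  qed
  interpret reflection \<mu> D t
    using assms(1,2) t(1) bound by unfold_locales (auto simp: universal_Sigma1b_def defines_dot_code_def)
  have main: "\<exists>h. poly_time_in_value h \<and> (\<forall>n. Pr T (h n) (fm_code (RFN \<mu> D (B S) n)))"
    if T: "\<forall>B e p. S12 \<turnstile> U e (coeffs p) B \<longrightarrow>
        (\<forall>e' u x z Z. poly p (blen (pr4 e' u x z)) \<le> blen Z \<longrightarrow> holds (env [(0, e), (1, pr4 e' u x z), (2, Z)]) \<mu> \<longrightarrow>
           holds (env [(0, e'), (1, x), (2, z)]) \<mu>) \<longrightarrow>
        (\<exists>h. poly_time_in_value h \<and> (\<forall>n. Pr T (h n) (fm_code (RFN \<mu> D B n))))" and S: "S \<in> theories" for T S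
  proof -
    have B: "Sigma1b (B S)" "free_vars (B S) \<subseteq> {3, 4}" "\<And>v. holds v (B S) \<longleftrightarrow> Pr S (v 3) (v 4)"
      using assms(3)[OF S] by (auto simp: defines_Pr_def)
    have eq: "Sigma1b (Eq r s)" for r s by (intro Sigma1b_Pi1b.intros(1) sharply_bounded.intros(1))
    have "tm_vars pr4_tm = {0, 1, 2, 3}" by (auto simp: pr4_tm_def pr2_tm_def)
    \<comment> \<open>With variable \<open>1\<close> as its only free variable and in
      \<open>Sigma1b\<close>, the formula is covered by universality, which supplies the index and
      the polynomial.\<close>
    then have "free_vars (tuple_fm t D (B S)) \<subseteq> {1}" using t(1) D(2) B(2) by (auto simp: tuple_fm_def)
    moreover have "Sigma1b (tuple_fm t D (B S))"
      unfolding tuple_fm_def by (intro Sigma1b_Pi1b.intros(2,4) eq D(1) B(1)) (use t(1) in auto)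
    ultimately obtain e p where ep: "S12 \<turnstile> U e (coeffs p) (B S)"
      using assms(1) unfolding universal_Sigma1b_def universal_ax_def poly_tm_list by blast
    have "holds (env [(0, e'), (1, x), (2, z)]) \<mu>"
      if le: "poly p (blen (pr4 e' u x z)) \<le> blen Z" and h: "holds (env [(0, e), (1, pr4 e' u x z), (2, Z)]) \<mu>" for e' u x z Z
    proof -
      \<comment> \<open>Truth of the universality theorem turns the witnessed instance into an
        actual \<open>S\<close>-proof \<open>u\<close> of the instance at \<open>e'\<close>,
        \<open>x\<close>, \<open>z\<close>, and consistency of \<open>S\<close> makes that instance
        true.\<close>
      have "holds (\<lambda>_. 0) (U e (coeffs p) (B S))" by (rule S12_sound[OF ep])
      then have "holds ((\<lambda>_. 0)(1 := pr4 e' u x z, 2 := Z)) (tuple_fm t D (B S))"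
        using le h unfolding holds_universal_ax peval_coeffs by blast
      then obtain y where "holds ((\<lambda>_. 0)(1 := pr4 e' u x z, 2 := Z, 0 := e', 3 := u, 1 := x, 2 := z, 4 := y)) D"
        "holds ((\<lambda>_. 0)(1 := pr4 e' u x z, 2 := Z, 0 := e', 3 := u, 1 := x, 2 := z, 4 := y)) (B S)"
        unfolding holds_tuple_fm by auto
      then have "y = fm_code (numeral_inst \<mu> e' x z)" "Pr S u y" by (simp_all add: D_code B(3))
      then have "S \<turnstile> numeral_inst \<mu> e' x z" unfolding Pr_def provable_def using fm_code_inject by metis
      then show ?thesis
        using numeral_inst_holds[of S \<mu> "env [(0, e'), (1, x), (2, z)]"] S \<mu> by (simp add: theories_def)
    qed
    then show ?thesis using T ep by blast
  qed
  show ?thesis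
  proof (cases "(\<exists>P. p_optimal SAT P) \<and> (\<exists>P. p_optimal TAUT P)")
    case True
    then obtain P P' where "p_optimal SAT P" "p_optimal TAUT P'" by blast
    from reflection_theory[OF this] show ?thesis by (elim bexE) (use main in blast)
  qed blast
qed

end
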